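(* Consider the two-level equi-energy sampler $\{X^{(1)}_t\}_{t\ge 0}$, $\{X^{(0)}_t\}_{t\ge T}$ on the circle $\Omega=[0,1]$ with parameters $M,H,c,p_{ee}$ and level-$0$ starting time $T_b^{(0)}=T$, as defined in the context. Let $Q$ be a distribution on $\Omega$ that has a continuous density with respect to Lebesgue measure $\lambda$ and satisfies $\big\|\frac{dQ}{d\lambda}\big\|_{L_2(\Omega,\lambda)}\le 2$. Fix a function $f$ on $\Omega$ that is $1$-Lipschitz for the metric $d$ and has $\mathbb{E}_\pi[f]=0$. Fix $k\in\mathbb{N}\cup\{\infty\}$, $0<\epsilon<\min\big(\frac1{512},\frac{cM}{384}\big)$, and a burn-in time $$T_b^{(0)}=T>110592\,c^{-2}(\epsilon^{-1}+1)^2\log\big(4608(\epsilon^{-1}+1)^2\big).$$ Suppose $X^{(1)}_0\sim Q$ and $X^{(0)}_T=x\in\Omega$. Put $$A_1=\min\Big(\frac{p_{ee}(1-p_{ee})M}{32},\frac{p_{ee}}{2c}\Big),\qquad A_2=\frac{16\,e\,H}{A_1c}e^{-H}.$$ Then, with probability at least $$1-\frac{\epsilon}{12}\min\Big(k,\frac{1}{1-\epsilon^{\epsilon/2}}\Big)$$ (over the trajectory $\{X^{(1)}_s\}_{s\in\mathbb{N}}$), the inequality $$\mathbb{E}\big[f(X^{(0)}_T)f(X^{(0)}_{T+S})\,\big|\,\{X^{(1)}_s\}_{s\in\mathbb{N}}\big]\le 2e^{-A_1c\lfloor S/4\rfloor}+2\epsilon+A_2$$ holds simultaneously for all integers $0\le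 S\le T\big(1+\frac{k\epsilon}{2}\big)$.
   Context: $\Omega=[0,1]$ with $0$ and $1$ identified, with metric $d(x,y)=\min(|x-y|,1-|x-y|)$; $\lambda$ is Lebesgue measure. Parameters: an integer $M>1$, a real $H\ge0$, $0<c<\frac1{4M}$, $0<p_{ee}<1$. The target $\pi$ has density $\pi(x)=\frac{2}{1+e^H}$ for $0\le x\le\frac1{2M}$, $\pi(x)=\frac{2e^H}{1+e^H}$ for $\frac1{2M}<x<\frac1M$, extended with period $\frac1M$. The potential is $V(x)=H$ where the density equals $\frac{2}{1+e^H}$ and $V(x)=0$ where it equals $\frac{2e^H}{1+e^H}$ (so $\pi\propto e^{-V}$). The proposal kernel is $K_{\mathrm{MH}}(x,A)=\frac1{2c}\lambda(A\cap\{y:d(x,y)<c\})$. Equi-energy sampler: the level-$1$ chain $\{X^{(1)}_t\}_{t\ge0}$ is the Metropolis-Hastings chain with proposal $K_{\mathrm{MH}}$ and target $\pi_1=\lambda$ (i.e. the Markov chain with kernel $K_{\mathrm{MH}}$). The level-$0$ process $\{X_t^{(0)}\}$ starts at time $T_b^{(0)}=T$. For $v\in\{0,H\}$ the energy ring at time $t$ is $\widehat D^{(0)}_{t,v}=\{X^{(1)}_s:0\le s\le t,\ V(X^{(1)}_s)=v\}$. Given $X^{(0)}_t$ and the whole level-$1$ trajectory, independently at each step: with probability $1-p_{ee}$, $X^{(0)}_{t+1}$ is obtained by one Metropolis-Hastings step with proposal $K_{\mathrm{MH}}$ and target $\pi$ (propose $y\sim K_{\mathrm{MH}}(X_t^{(0)},\cdot)$,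 accept with probability $\min(1,\pi(y)/\pi(X^{(0)}_t))$, else stay); with probability $p_{ee}$, $X^{(0)}_{t+1}$ is drawn uniformly from $\widehat D^{(0)}_{t,V(X^{(0)}_t)}$ (such moves are always accepted, since the acceptance ratio equals $1$ here; if the ring is empty the process stays put). When $k=\infty$ the range of $S$ is all $S\ge 0$. *)

theory Defs
  imports "HOL-Probability.Probability"
begin

text \<open>The interval [0,1] with its endpoints identified is represented by the half-open
  interval, which contains exactly one representative of every point.\<close>

definition Omega :: "real set" where
  "Omega = {0..<1}"

text \<open>The outer absolute value has no effect on \<open>Omega\<close>; the locale \<open>Metric_space\<close> asks
  for nonnegativity on the whole type.\<close>

definition circ_dist :: "real \<Rightarrow> real \<Rightarrow> real" where
  "circ_dist x y = min \<bar>x - y\<bar> \<bar>1 - \<bar>x - y\<bar>\<bar>"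

definition circ_leb :: "real measure" where
  "circ_leb = restrict_space lborel Omega"

lemma space_circ_leb [simp]: "space circ_leb = Omega"
  by (simp add: circ_leb_def space_restrict_space)

lemma sets_circ_leb: "sets circ_leb = sets (restrict_space borel Omega)"
  by (simp add: circ_leb_def sets_restrict_space)

lemma Metric_space_circle: "Metric_space Omega circ_dist"
proof
  fix x y z :: real
  show "circ_dist x y = circ_dist y x"
    by (simp add: circ_dist_def abs_minus_commute)
  assume x: "x \<in> Omega" and y: "y \<in> Omega"
  show "circ_dist x y = 0 \<longleftrightarrow> x = y"
    using x y by (auto simp: circ_dist_def Omega_def min_def abs_if)
  assume z: "z \<in> Omega"
  show "circ_dist x z \<le> circ_dist x y + circ_dist y z"
    using x y z by (auto simp: circ_dist_def Omega_def min_def abs_if)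
qed (simp add: circ_dist_def)

lemma prob_space_circ_leb: "prob_space circ_leb"
  by (rule prob_spaceI) (simp add: circ_leb_def emeasure_restrict_space space_restrict_space Omega_def)

text \<open>\<open>frac (M x) \<le> 1/2\<close> is the \<open>1/M\<close>-periodic extension of \<open>0 \<le> x \<le> 1/(2M)\<close>.\<close>

definition target_dens :: "nat \<Rightarrow> real \<Rightarrow> real \<Rightarrow> real" where
  "target_dens M H x =
     (if frac (real M * x) \<le> 1 / 2 then 2 / (1 + exp H) else 2 * exp H / (1 + exp H))"

definition target :: "nat \<Rightarrow> real \<Rightarrow> real measure" where
  "target M H = density circ_leb (\<lambda>x. ennreal (target_dens M H x))"

definition potential :: "nat \<Rightarrow> real \<Rightarrow> real \<Rightarrow> real" where
  "potential M H x = (if frac (real M * x) \<le> 1 / 2 then H else 0)"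

definition proposal :: "real \<Rightarrow> real \<Rightarrow> real measure" where
  "proposal c x = density circ_leb (\<lambda>y. ennreal (1 / (2 * c)) * indicator {y. circ_dist x y < c} y)"

text \<open>One Metropolis-Hastings step from \<open>x\<close> for the (symmetric) proposal above, where \<open>w\<close> is a
  density of the target.\<close>

definition mh_kernel :: "real \<Rightarrow> (real \<Rightarrow> real) \<Rightarrow> real \<Rightarrow> real measure" where
  "mh_kernel c w x = do {
     y \<leftarrow> proposal c x;
     accept \<leftarrow> measure_pmf (bernoulli_pmf (min 1 (w y / w x)));
     return circ_leb (if accept then y else x)
   }"

definition energy_ring :: "nat \<Rightarrow> real \<Rightarrow> (nat \<Rightarrow> real) \<Rightarrow> nat \<Rightarrow> real \<Rightarrow> real set" where
  "energy_ring M H \<xi> t v = {\<xi> s |s. s \<le> t \<and> potential M H (\<xi> s) = v}"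

definition ee_jump :: "nat \<Rightarrow> real \<Rightarrow> (nat \<Rightarrow> real) \<Rightarrow> nat \<Rightarrow> real \<Rightarrow> real measure" where
  "ee_jump M H \<xi> t x =
     (let R = energy_ring M H \<xi> t (potential M H x)
      in if R = {} then return circ_leb x
         else distr (uniform_count_measure R) circ_leb (\<lambda>y. y))"

definition level0_kernel ::
  "nat \<Rightarrow> real \<Rightarrow> real \<Rightarrow> real \<Rightarrow> (nat \<Rightarrow> real) \<Rightarrow> nat \<Rightarrow> real \<Rightarrow> real measure" where
  "level0_kernel M H c p_ee \<xi> t x = do {
     jump \<leftarrow> measure_pmf (bernoulli_pmf p_ee);
     if jump then ee_jump M H \<xi> t x else mh_kernel c (target_dens M H) x
   }"

text \<open>The kernels are genuine probability kernels, so that the monadic binds above have their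
  intended meaning.\<close>

lemma circ_dist_measurable [measurable]: "circ_dist x \<in> borel_measurable borel"
  unfolding circ_dist_def[abs_def] by measurable

lemma circ_dist_measurable' [measurable]: "circ_dist x \<in> borel_measurable circ_leb"
  by (metis circ_dist_measurable circ_leb_def measurable_lborel2 measurable_restrict_space1)

lemma circ_ball_measurable: "{y \<in> Omega. circ_dist x y < c} \<in> sets circ_leb"
proof -
  have "{y \<in> space circ_leb. circ_dist x y < c} \<in> sets circ_leb"
    by measurable
  then show ?thesis by simp
qed

lemma emeasure_circ_ball:
  assumes c: "0 < c" "c \<le> 1 / 2" and x: "x \<in> Omega"
  shows "emeasure circ_leb {y \<in> Omega. circ_dist x y < c} = ennreal (2 * c)"
proof -
  let ?B = "{y \<in> Omega. circ_dist x y < c}"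
  have "emeasure circ_leb ?B = emeasure lborel ?B"
    unfolding circ_leb_def by (rule emeasure_restrict_space) (auto simp: Omega_def)
  also consider "x < c" | "c \<le> x" "x + c \<le> 1" | "1 < x + c"
    by linarith
  then have "emeasure lborel ?B = ennreal (2 * c)"
  proof cases
    case 1
    have "?B = {0..<x + c} \<union> {1 + x - c<..<1}"
      using c x 1 by (auto simp: circ_dist_def Omega_def min_def abs_if split: if_splits)
    also have "emeasure lborel \<dots> = emeasure lborel {0..<x + c} + emeasure lborel {1 + x - c<..<1}"
      using c by (intro plus_emeasure[symmetric]) auto
    also have "\<dots> = ennreal (2 * c)"
      using c x 1 by (simp add: Omega_def flip: ennreal_plus)
    finally show ?thesis .
  next
    case 2
    have "?B = {x - c<..<x + c}"
      using c x 2 by (auto simp: circ_dist_def Omega_def min_def abs_if split: if_splits)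
    then show ?thesis using c by simp
  next
    case 3
    have "?B = {0..<x + c - 1} \<union> {x - c<..<1}"
      using c x 3 by (auto simp: circ_dist_def Omega_def min_def abs_if split: if_splits)
    also have "emeasure lborel \<dots> = emeasure lborel {0..<x + c - 1} + emeasure lborel {x - c<..<1}"
      using c by (intro plus_emeasure[symmetric]) auto
    also have "\<dots> = ennreal (2 * c)"
      using c x 3 by (simp add: Omega_def flip: ennreal_plus)
    finally show ?thesis .
  qed
  finally show ?thesis .
qed

lemma sets_proposal [simp]: "sets (proposal c x) = sets circ_leb"
  by (simp add: proposal_def)

lemma space_proposal [simp]: "space (proposal c x) = Omega"
  by (simp add: proposal_def)

lemma emeasure_proposal:
  assumes A: "A \<in> sets circ_leb"
  shows "emeasure (proposal c x) A =
    ennreal (1 / (2 * c)) * emeasure circ_leb (A \<inter> {y. circ_dist x y < c})"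
proof -
  have sub: "A \<subseteq> Omega"
    using sets.sets_into_space[OF A] by simp
  then have eq: "A \<inter> {y. circ_dist x y < c} = A \<inter> {y \<in> Omega. circ_dist x y < c}"
    by auto
  have m: "A \<inter> {y. circ_dist x y < c} \<in> sets circ_leb"
    unfolding eq using A circ_ball_measurable by (rule sets.Int)
  have "emeasure (proposal c x) A =
      (\<integral>\<^sup>+y. ennreal (1 / (2 * c)) * indicator {y. circ_dist x y < c} y * indicator A y \<partial>circ_leb)"
    unfolding proposal_def by (rule emeasure_density) (use A in measurable)
  also have "\<dots> = (\<integral>\<^sup>+y. ennreal (1 / (2 * c)) * indicator (A \<inter> {y. circ_dist x y < c}) y \<partial>circ_leb)"
    by (intro nn_integral_cong) (auto simp: indicator_def)
  also have "\<dots> = ennreal (1 / (2 * c)) * emeasure circ_leb (A \<inter> {y. circ_dist x y < c})"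
    using m by (rule nn_integral_cmult_indicator)
  finally show ?thesis .
qed

lemma prob_space_proposal:
  assumes c: "0 < c" "c \<le> 1 / 2" and x: "x \<in> Omega"
  shows "prob_space (proposal c x)"
proof (rule prob_spaceI)
  have "emeasure (proposal c x) (space circ_leb) =
      ennreal (1 / (2 * c)) * emeasure circ_leb (space circ_leb \<inter> {y. circ_dist x y < c})"
    by (rule emeasure_proposal) (rule sets.top)
  also have "space circ_leb \<inter> {y. circ_dist x y < c} = {y \<in> Omega. circ_dist x y < c}"
    by auto
  also have "ennreal (1 / (2 * c)) * emeasure circ_leb \<dots> = 1"
    unfolding emeasure_circ_ball[OF assms] using c by (simp flip: ennreal_mult)
  finally show "emeasure (proposal c x) (space (proposal c x)) = 1"
    by simp
qed

lemma bernoulli_kernel: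
  assumes a [measurable]: "a \<in> borel_measurable N" and a01: "\<And>y. y \<in> space N \<Longrightarrow> a y \<in> {0..1}"
  shows "(\<lambda>y. measure_pmf (bernoulli_pmf (a y))) \<in> N \<rightarrow>\<^sub>M prob_algebra (count_space UNIV)"
proof (rule measurable_prob_algebraI)
  show "prob_space (measure_pmf (bernoulli_pmf (a y)))" for y
    by (rule measure_pmf.prob_space_axioms)
  show "(\<lambda>y. measure_pmf (bernoulli_pmf (a y))) \<in> N \<rightarrow>\<^sub>M subprob_algebra (count_space UNIV)"
  proof (rule measurable_subprob_algebra)
    fix A :: "bool set"
    have "emeasure (measure_pmf (bernoulli_pmf (a y))) A =
        ennreal (indicator A True * a y + indicator A False * (1 - a y))" if "y \<in> space N" for y
    proof -
      have "measure (measure_pmf (bernoulli_pmf (a y))) A = (\<Sum>b\<in>A. pmf (bernoulli_pmf (a y)) b)"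
        by (rule measure_measure_pmf_finite) simp
      also have "\<dots> = (\<Sum>b\<in>UNIV. indicator A b * pmf (bernoulli_pmf (a y)) b)"
        by (rule sum.mono_neutral_cong_left) (simp_all add: indicator_def)
      also have "\<dots> = indicator A True * a y + indicator A False * (1 - a y)"
        using a01[OF that] by (simp add: UNIV_bool indicator_def)
      finally show ?thesis
        by (simp add: measure_pmf.emeasure_eq_measure)
    qed
    then show "(\<lambda>y. emeasure (measure_pmf (bernoulli_pmf (a y))) A) \<in> borel_measurable N"
      by (subst measurable_cong) measurable
  qed (auto intro: measure_pmf.subprob_space_axioms)
qed

lemma bind_in_prob_algebra:
  assumes "N \<in> space (prob_algebra A)" "K \<in> A \<rightarrow>\<^sub>M prob_algebra B"
  shows "N \<bind> K \<in> space (prob_algebra B)"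
  using prob_space_bind'[OF assms] sets_bind'[OF assms] by (simp add: space_prob_algebra)

lemma mh_kernel_in_prob_algebra:
  assumes c: "0 < c" "c \<le> 1 / 2" and x: "x \<in> Omega"
    and w [measurable]: "w \<in> borel_measurable circ_leb" and w0: "\<And>y. y \<in> Omega \<Longrightarrow> 0 \<le> w y"
  shows "mh_kernel c w x \<in> space (prob_algebra circ_leb)"
proof -
  have [measurable]: "(\<lambda>y. measure_pmf (bernoulli_pmf (min 1 (w y / w x)))) \<in>
      circ_leb \<rightarrow>\<^sub>M prob_algebra (count_space UNIV)"
    by (rule bernoulli_kernel) (use w0 x in auto)
  have [measurable]: "(\<lambda>y. x) \<in> circ_leb \<Otimes>\<^sub>M count_space (UNIV :: bool set) \<rightarrow>\<^sub>M circ_leb"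
    using x by simp
  have "(\<lambda>y. do {
      accept \<leftarrow> measure_pmf (bernoulli_pmf (min 1 (w y / w x)));
      return circ_leb (if accept then y else x) }) \<in> circ_leb \<rightarrow>\<^sub>M prob_algebra circ_leb"
    by (rule measurable_bind_prob_space2[where N = "count_space UNIV"]) measurable
  moreover have "proposal c x \<in> space (prob_algebra circ_leb)"
    using prob_space_proposal[OF c x] by (simp add: space_prob_algebra)
  ultimately show ?thesis
    unfolding mh_kernel_def by (intro bind_in_prob_algebra)
qed

lemma mh_kernel_uniform:
  assumes c: "0 < c" "c \<le> 1 / 2" and x: "x \<in> Omega"
  shows "mh_kernel c (\<lambda>_. 1) x = proposal c x"
proof -
  have "bernoulli_pmf 1 = return_pmf True"
    by (rule pmf_eqI) (metis (full_types) pmf_bernoulli_True pmf_bernoulli_False diff_self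
        pmf_return le_numeral_extra(4) zero_le_one indicator_simps singletonD singletonI)
  moreover have "return (count_space UNIV) True \<bind>
      (\<lambda>b. return circ_leb (if b then y else x)) = return circ_leb y" if "y \<in> Omega" for y
    using x that
    by (subst bind_return[where N = circ_leb])
       (auto simp: space_subprob_algebra intro!: subprob_space_return)
  ultimately have "mh_kernel c (\<lambda>_. 1) x = proposal c x \<bind> return circ_leb"
    by (simp add: mh_kernel_def return_pmf.rep_eq cong: bind_cong_simp)
  also have "\<dots> = proposal c x"
    by (rule bind_return'') simp
  finally show ?thesis .
qed

lemma target_dens_measurable [measurable]: "target_dens M H \<in> borel_measurable circ_leb"
proof -
  have "target_dens M H \<in> borel_measurable borel"
    unfolding target_dens_def[abs_def] frac_def by measurable
  then show ?thesis
    unfolding circ_leb_def by (intro measurable_restrict_space1) simp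
qed

lemma ee_jump_in_prob_algebra:
  assumes x: "x \<in> Omega" and \<xi>: "\<And>s. \<xi> s \<in> Omega"
  shows "ee_jump M H \<xi> t x \<in> space (prob_algebra circ_leb)"
proof (cases "energy_ring M H \<xi> t (potential M H x) = {}")
  case True
  then show ?thesis
    using x by (simp add: ee_jump_def space_prob_algebra prob_space_return)
next
  case False
  let ?R = "energy_ring M H \<xi> t (potential M H x)"
  have "?R \<subseteq> \<xi> ` {..t}"
    by (auto simp: energy_ring_def)
  then have fin: "finite ?R"
    by (rule finite_subset) simp
  have "?R \<subseteq> Omega"
    using \<xi> by (auto simp: energy_ring_def)
  then have "(\<lambda>y. y) \<in> uniform_count_measure ?R \<rightarrow>\<^sub>M circ_leb"
    by (auto simp: measurable_def space_uniform_count_measure sets_uniform_count_measure)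
  then show ?thesis
    using False fin
    by (simp add: ee_jump_def space_prob_algebra prob_space.prob_space_distr
        prob_space_uniform_count_measure)
qed

lemma level0_kernel_in_prob_algebra:
  assumes c: "0 < c" "c \<le> 1 / 2" and x: "x \<in> Omega" and \<xi>: "\<And>s. \<xi> s \<in> Omega"
  shows "level0_kernel M H c p_ee \<xi> t x \<in> space (prob_algebra circ_leb)"
proof -
  have "mh_kernel c (target_dens M H) x \<in> space (prob_algebra circ_leb)"
    using c x by (rule mh_kernel_in_prob_algebra) (auto simp: target_dens_def add_nonneg_nonneg)
  moreover note ee_jump_in_prob_algebra[OF x \<xi>]
  ultimately have "(\<lambda>jump. if jump then ee_jump M H \<xi> t x else mh_kernel c (target_dens M H) x)
      \<in> count_space UNIV \<rightarrow>\<^sub>M prob_algebra circ_leb"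
    by auto
  moreover have "measure_pmf (bernoulli_pmf p_ee) \<in> space (prob_algebra (count_space UNIV))"
    by (simp add: space_prob_algebra measure_pmf.prob_space_axioms)
  ultimately show ?thesis
    unfolding level0_kernel_def by (intro bind_in_prob_algebra)
qed

text \<open>\<open>K \<omega>\<close> is the conditional law of \<open>Y\<close> given the sub-\<open>\<sigma>\<close>-algebra \<open>F\<close>.\<close>

definition has_cond_law ::
  "'a measure \<Rightarrow> 'a measure \<Rightarrow> 'b measure \<Rightarrow> ('a \<Rightarrow> 'b) \<Rightarrow> ('a \<Rightarrow> 'b measure) \<Rightarrow> bool" where
  "has_cond_law P F N Y K \<longleftrightarrow>
     (\<forall>A \<in> sets N. AE \<omega> in P.
        real_cond_exp P F (indicator (Y -` A \<inter> space P)) \<omega> = measure (K \<omega>) A)"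

definition history1 :: "'a measure \<Rightarrow> (nat \<Rightarrow> 'a \<Rightarrow> real) \<Rightarrow> nat \<Rightarrow> 'a measure" where
  "history1 P X1 t =
     vimage_algebra (space P) (\<lambda>\<omega>. \<lambda>s\<in>{..t}. X1 s \<omega>) (\<Pi>\<^sub>M s\<in>{..t}. circ_leb)"

definition trajectory1 :: "'a measure \<Rightarrow> (nat \<Rightarrow> 'a \<Rightarrow> real) \<Rightarrow> 'a measure" where
  "trajectory1 P X1 = vimage_algebra (space P) (\<lambda>\<omega> s. X1 s \<omega>) (\<Pi>\<^sub>M s\<in>UNIV. circ_leb)"

definition history0 ::
  "'a measure \<Rightarrow> (nat \<Rightarrow> 'a \<Rightarrow> real) \<Rightarrow> (nat \<Rightarrow> 'a \<Rightarrow> real) \<Rightarrow> nat \<Rightarrow> nat \<Rightarrow> 'a measure" where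
  "history0 P X1 X0 T t =
     vimage_algebra (space P) (\<lambda>\<omega>. ((\<lambda>s. X1 s \<omega>), (\<lambda>s\<in>{T..t}. X0 s \<omega>)))
       ((\<Pi>\<^sub>M s\<in>UNIV. circ_leb) \<Otimes>\<^sub>M (\<Pi>\<^sub>M s\<in>{T..t}. circ_leb))"

text \<open>\<open>X1\<close> is the level-1 chain with initial law \<open>Q\<close>, whose target has constant density 1;
  \<open>X0\<close> is the level-0 process, started from the point \<open>x\<close> at time \<open>T\<close> (the values of
  \<open>X0\<close> before time \<open>T\<close> play no role).\<close>

locale equi_energy_sampler = prob_space P
  for P :: "'a measure"
    and M :: nat and H c p_ee :: real
    and Q :: "real measure" and T :: nat and x :: real
    and X1 X0 :: "nat \<Rightarrow> 'a \<Rightarrow> real" +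
  assumes X1_measurable: "\<And>s. X1 s \<in> P \<rightarrow>\<^sub>M circ_leb"
    and X1_init: "distr P circ_leb (X1 0) = Q"
    and X1_step: "\<And>t. has_cond_law P (history1 P X1 t) circ_leb (X1 (Suc t))
                       (\<lambda>\<omega>. mh_kernel c (\<lambda>_. 1) (X1 t \<omega>))"
    and X0_measurable: "\<And>t. T \<le> t \<Longrightarrow> X0 t \<in> P \<rightarrow>\<^sub>M circ_leb"
    and X0_init: "AE \<omega> in P. X0 T \<omega> = x"
    and X0_step: "\<And>t. T \<le> t \<Longrightarrow> has_cond_law P (history0 P X1 X0 T t) circ_leb (X0 (Suc t))
                       (\<lambda>\<omega>. level0_kernel M H c p_ee (\<lambda>s. X1 s \<omega>) t (X0 t \<omega>))"

end

theory Submission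
  imports Defs
begin

text \<open>
  Freeze the level-1 trajectory. It almost surely visits pairwise distinct points, so an equi-energy
  jump averages over the empirical measure of the visited points of the current energy, and the
  conditional expectations \<open>m S \<phi>\<close> of \<open>\<phi> (X0 (T + S))\<close> given the trajectory satisfy the linear recursion
  \<open>m (S + 1) \<phi> = (1 - p) m S (P \<phi>) + p (m S 1\<^sub>A \<mu>\<^sub>A \<phi> + m S 1\<^sub>B \<mu>\<^sub>B \<phi>)\<close>, where \<open>A\<close> and \<open>B\<close> are the sets of high
  and low potential and \<open>\<mu>\<^sub>A\<close>, \<open>\<mu>\<^sub>B\<close> the empirical means over them.
  Suppose that these means are close to their limits on finitely many test functions. For \<open>H \<ge> 1\<close> one
  rejects the moves from \<open>B\<close> to \<open>A\<close>, at a cost of order \<open>e\<^sup>-\<^sup>H\<close>: the mass of \<open>A\<close> then decays geometrically,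
  and the rejected walk preserves Lipschitz functions on \<open>B\<close>, so Koksma's inequality controls their
  empirical means. For \<open>H < 1\<close> one accepts every move, at a cost of order \<open>H\<close>, and the mass of \<open>A\<close> solves
  a renewal inequality.
  The test functions are controlled for all times after the burn-in at once, by solving the Poisson
  equation of the proposal walk (whose solutions are bounded by a coupling) and applying Hoeffding's
  lemma and Ville's maximal inequality to the resulting martingale.
\<close>

section \<open>Averaging over an interval\<close>

text \<open>The empirical means are needed to relative, not absolute, accuracy. Let n accepted moves
  separate two ring jumps. The level then changes with probabilities \<alpha> from A to B and
  \<beta> from B to A, both of order min (M c sqrt n) 1, which for small n is only known to exceed a
  fixed multiple of \<epsilon>. The mass of B equilibrates at \<alpha> / (\<alpha> + \<beta>), so
  its bias is the imbalance \<alpha> - \<beta> divided by this possibly small flow, and the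
  imbalance has to be small compared with the flow, uniformly in n. Up to the normalisation by the
  ring sizes, the imbalance is the empirical mean of \<open>upI M\<close> minus its n-step average.
  The truncated Poisson solution for that function varies by only O(sqrt n) within one step of the
  walk, so the martingale estimate carries the same factor sqrt n as the flow. The flow itself is
  bounded below by Fourier analysis of a triangle wave. Finitely many n need a test: beyond n of
  order \<open>\<epsilon> ^ (-5)\<close> the n-step walk has mixed pointwise, whatever the
  trajectory.\<close>

definition bmeas :: "(real \<Rightarrow> real) \<Rightarrow> bool" where
  "bmeas \<phi> \<longleftrightarrow> \<phi> \<in> borel_measurable borel \<and> (\<exists>C. \<forall>x. \<bar>\<phi> x\<bar> \<le> C)"

lemma bmeasI: "\<phi> \<in> borel_measurable borel \<Longrightarrow> (\<And>x. \<bar>\<phi> x\<bar> \<le> C) \<Longrightarrow> bmeas \<phi>"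
  by (auto simp: bmeas_def)

lemma bmeas_measurable [measurable_dest]: "bmeas \<phi> \<Longrightarrow> \<phi> \<in> borel_measurable borel"
  by (auto simp: bmeas_def)

lemma bmeasE:
  assumes "bmeas \<phi>" obtains C where "\<And>x. \<bar>\<phi> x\<bar> \<le> C" "C \<ge> 0"
proof -
  obtain C where C: "\<And>x. \<bar>\<phi> x\<bar> \<le> C" using assms by (auto simp: bmeas_def)
  moreover from C[of 0] have "C \<ge> 0" by linarith
  ultimately show thesis using that by blast
qed

lemma bmeas_const [intro, simp]: "bmeas (\<lambda>_. a)"
  by (rule bmeasI[of _ "\<bar>a\<bar>"]) auto

lemma bmeas_add [intro]:
  assumes "bmeas \<phi>" "bmeas \<psi>" shows "bmeas (\<lambda>x. \<phi> x + \<psi> x)"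
proof -
  obtain C D where "\<And>x. \<bar>\<phi> x\<bar> \<le> C" "\<And>x. \<bar>\<psi> x\<bar> \<le> D" using assms by (meson bmeasE)
  then show ?thesis using assms
    by (intro bmeasI[of _ "C + D"]) (auto simp: bmeas_def intro: order_trans[OF abs_triangle_ineq add_mono])
qed

lemma bmeas_mult [intro]:
  assumes "bmeas \<phi>" "bmeas \<psi>" shows "bmeas (\<lambda>x. \<phi> x * \<psi> x)"
proof -
  obtain C D where C: "\<And>x. \<bar>\<phi> x\<bar> \<le> C" "C \<ge> 0" and D: "\<And>x. \<bar>\<psi> x\<bar> \<le> D" "D \<ge> 0"
    using assms by (meson bmeasE)
  then show ?thesis using assms
    by (intro bmeasI[of _ "C * D"]) (auto simp: bmeas_def abs_mult intro: mult_mono)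
qed

lemma bmeas_uminus [intro]: "bmeas \<phi> \<Longrightarrow> bmeas (\<lambda>x. - \<phi> x)"
  using bmeas_mult[OF bmeas_const[of "-1"], of \<phi>] by simp

lemma bmeas_diff [intro]: "bmeas \<phi> \<Longrightarrow> bmeas \<psi> \<Longrightarrow> bmeas (\<lambda>x. \<phi> x - \<psi> x)"
  using bmeas_add[OF _ bmeas_uminus, of \<phi> \<psi>] by simp

lemma bmeas_cmult [intro]: "bmeas \<phi> \<Longrightarrow> bmeas (\<lambda>x. a * \<phi> x)"
  by auto

lemma bmeas_sum [intro]: "(\<And>i. i \<in> I \<Longrightarrow> bmeas (\<phi> i)) \<Longrightarrow> bmeas (\<lambda>x. \<Sum>i\<in>I. \<phi> i x)"
  by (induction I rule: infinite_finite_induct) auto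

lemma bmeas_compose: "bmeas \<phi> \<Longrightarrow> g \<in> borel_measurable borel \<Longrightarrow> bmeas (\<lambda>x. \<phi> (g x))"
  by (auto simp: bmeas_def)

lemma bmeas_integrable_lborel:
  assumes "bmeas \<phi>"
  shows "set_integrable lborel {a..b::real} \<phi>"
proof -
  obtain C where C: "\<And>x. \<bar>\<phi> x\<bar> \<le> C" "C \<ge> 0" using assms by (meson bmeasE)
  have "set_integrable lborel {a..b} (\<lambda>_. C)"
    by (intro borel_integrable_atLeastAtMost' continuous_intros)
  then show ?thesis
  proof (rule set_integrable_bound)
    show "set_borel_measurable lborel {a..b} \<phi>"
      using assms by (auto simp: set_borel_measurable_def bmeas_def)
    show "AE x in lborel. x \<in> {a..b} \<longrightarrow> norm (\<phi> x) \<le> norm C"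
      using C by auto
  qed
qed

lemma bmeas_integrable_on [intro]:
  "bmeas \<phi> \<Longrightarrow> \<phi> integrable_on {a..b::real}"
  using bmeas_integrable_lborel set_borel_integral_eq_integral(1) by blast

lemma bmeas_integral_eq:
  "bmeas \<phi> \<Longrightarrow> integral {a..b::real} \<phi> = (LINT x:{a..b}|lborel. \<phi> x)"
  by (simp add: bmeas_integrable_lborel set_borel_integral_eq_integral(2))

text \<open>The circle is unrolled: a function on it becomes a 1-periodic function on the line, and
  a step of the proposal walk becomes an integral over translates. Shifts, reflections and changes
  of scale are then available without wrap-around; \<open>mh_op_avg\<close> makes the link with the
  circle.\<close>

definition avg :: "real \<Rightarrow> (real \<Rightarrow> real) \<Rightarrow> real \<Rightarrow> real" where
  "avg c \<phi> x = (1 / (2 * c)) * integral {-c..c} (\<lambda>u. \<phi> (x + u))"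

lemma bmeas_shift: "bmeas \<phi> \<Longrightarrow> bmeas (\<lambda>u. \<phi> (x + u))"
  by (rule bmeas_compose) auto

lemma bmeas_shift': "bmeas \<phi> \<Longrightarrow> bmeas (\<lambda>u. \<phi> (u + x))"
  by (rule bmeas_compose) auto

lemma bmeas_reflect: "bmeas \<phi> \<Longrightarrow> bmeas (\<lambda>u. \<phi> (x - u))"
  by (rule bmeas_compose) auto

lemma integral_shift_real:
  fixes \<phi> :: "real \<Rightarrow> real"
  assumes "bmeas \<phi>"
  shows "integral {a..b} (\<lambda>u. \<phi> (x + u)) = integral {x + a..x + b} \<phi>"
proof -
  have "(LINT u:{a..b}|lborel. \<phi> (x + u)) = (LINT u:{x + a..x + b}|lborel. \<phi> u)"
    unfolding set_lebesgue_integral_def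
    by (subst (2) lborel_integral_real_affine[of 1 _ x])
       (auto simp: indicator_def intro!: Bochner_Integration.integral_cong)
  then show ?thesis
    using bmeas_integral_eq[OF assms, of "x + a" "x + b"] bmeas_integral_eq[OF bmeas_shift[OF assms], of a b x]
    by simp
qed

lemma integral_reflect_shift_real:
  fixes \<phi> :: "real \<Rightarrow> real"
  assumes "bmeas \<phi>"
  shows "integral {a..b} (\<lambda>u. \<phi> (x - u)) = integral {x - b..x - a} \<phi>"
proof -
  have "(LINT u:{a..b}|lborel. \<phi> (x - u)) = (LINT u:{x - b..x - a}|lborel. \<phi> u)"
    unfolding set_lebesgue_integral_def
    by (subst (2) lborel_integral_real_affine[of "-1" _ x])
       (auto simp: indicator_def intro!: Bochner_Integration.integral_cong)
  then show ?thesis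
    using bmeas_integral_eq[OF assms, of "x - b" "x - a"] bmeas_integral_eq[OF bmeas_reflect[OF assms], of a b x]
    by simp
qed

lemma avg_alt: "bmeas \<phi> \<Longrightarrow> avg c \<phi> x = (1 / (2 * c)) * integral {x - c..x + c} \<phi>"
  by (simp add: avg_def integral_shift_real)

lemma avg_mono:
  assumes "c > 0" "bmeas \<phi>" "bmeas \<psi>" "\<And>u. \<bar>u\<bar> \<le> c \<Longrightarrow> \<phi> (x + u) \<le> \<psi> (x + u)"
  shows "avg c \<phi> x \<le> avg c \<psi> x"
  unfolding avg_def
  by (intro mult_left_mono integral_le bmeas_integrable_on bmeas_shift) (use assms in auto)

lemma avg_const [simp]: "c > 0 \<Longrightarrow> avg c (\<lambda>_. a) x = a"
  by (simp add: avg_def)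

lemma avg_cmult [simp]: "avg c (\<lambda>x. a * \<phi> x) x = a * avg c \<phi> x"
  by (simp add: avg_def)

lemma avg_add: "bmeas \<phi> \<Longrightarrow> bmeas \<psi> \<Longrightarrow> avg c (\<lambda>x. \<phi> x + \<psi> x) x = avg c \<phi> x + avg c \<psi> x"
  unfolding avg_def by (subst integral_add) (auto intro!: bmeas_integrable_on bmeas_shift simp: distrib_left right_diff_distrib)

lemma avg_diff: "bmeas \<phi> \<Longrightarrow> bmeas \<psi> \<Longrightarrow> avg c (\<lambda>x. \<phi> x - \<psi> x) x = avg c \<phi> x - avg c \<psi> x"
  unfolding avg_def by (subst integral_diff) (auto intro!: bmeas_integrable_on bmeas_shift simp: distrib_left right_diff_distrib)

lemma avg_sum: "(\<And>i. i \<in> I \<Longrightarrow> bmeas (\<phi> i)) \<Longrightarrow> finite I \<Longrightarrow>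
    avg c (\<lambda>x. \<Sum>i\<in>I. \<phi> i x) x = (\<Sum>i\<in>I. avg c (\<phi> i) x)"
proof (induction I rule: infinite_finite_induct)
  case empty
  then show ?case by (simp add: avg_def)
next
  case (insert i I)
  then have "avg c (\<lambda>x. \<phi> i x + (\<Sum>i\<in>I. \<phi> i x)) x = avg c (\<phi> i) x + avg c (\<lambda>x. \<Sum>i\<in>I. \<phi> i x) x"
    by (intro avg_add) auto
  with insert show ?case by simp
qed auto

lemma avg_le:
  assumes "c > 0" "bmeas \<phi>" "\<And>u. \<bar>u\<bar> \<le> c \<Longrightarrow> \<phi> (x + u) \<le> a"
  shows "avg c \<phi> x \<le> a"
  using avg_mono[OF assms(1,2) bmeas_const[of a], of x] assms by simp

lemma avg_ge:
  assumes "c > 0" "bmeas \<phi>" "\<And>u. \<bar>u\<bar> \<le> c \<Longrightarrow> a \<le> \<phi> (x + u)"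
  shows "a \<le> avg c \<phi> x"
  using avg_mono[OF assms(1) bmeas_const[of a] assms(2), of x] assms by simp

lemma avg_abs_le:
  assumes "c > 0" "bmeas \<phi>" "\<And>u. \<bar>u\<bar> \<le> c \<Longrightarrow> \<bar>\<phi> (x + u)\<bar> \<le> a"
  shows "\<bar>avg c \<phi> x\<bar> \<le> a"
  using avg_le[OF assms(1,2), of x a] avg_ge[OF assms(1,2), of "-a" x] assms(3) by (fastforce simp: abs_le_iff)

lemma bmeas_avg [intro]:
  assumes "c > 0" "bmeas \<phi>"
  shows "bmeas (avg c \<phi>)"
proof -
  obtain C where C: "\<And>x. \<bar>\<phi> x\<bar> \<le> C" "C \<ge> 0" using assms by (meson bmeasE)
  have [measurable]: "\<phi> \<in> borel_measurable borel" using assms by auto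
  have "avg c \<phi> = (\<lambda>x. (1 / (2 * c)) * (LINT u|lborel. indicator {-c..c} u * \<phi> (x + u)))"
    by (simp add: avg_def fun_eq_iff set_lebesgue_integral_def bmeas_integral_eq[OF bmeas_shift[OF assms(2)]])
  also have "\<dots> \<in> borel_measurable borel" by measurable
  finally show ?thesis
    using avg_abs_le[OF assms C(1)] by (intro bmeasI)
qed

lemma bmeas_avg_pow [intro]: "c > 0 \<Longrightarrow> bmeas \<phi> \<Longrightarrow> bmeas ((avg c ^^ n) \<phi>)"
  by (induction n) auto

lemma avg_periodic: "(\<And>x. \<phi> (x + p) = \<phi> x) \<Longrightarrow> avg c \<phi> (x + p) = avg c \<phi> x"
proof -
  assume "\<And>x. \<phi> (x + p) = \<phi> x"
  then have "\<phi> (x + p + u) = \<phi> (x + u)" for u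
    by (metis add.assoc add.commute)
  then show ?thesis by (simp add: avg_def)
qed

lemma avg_pow_periodic: "(\<And>x. \<phi> (x + p) = \<phi> x) \<Longrightarrow> (avg c ^^ n) \<phi> (x + p) = (avg c ^^ n) \<phi> x"
  by (induction n arbitrary: x) (auto intro: avg_periodic)

lemma avg_pow_mono:
  assumes "c > 0" "bmeas \<phi>" "bmeas \<psi>" "\<And>x. \<phi> x \<le> \<psi> x"
  shows "(avg c ^^ n) \<phi> x \<le> (avg c ^^ n) \<psi> x"
  using assms(4)
proof (induction n arbitrary: x)
  case (Suc n)
  then show ?case using assms(1-3) by (auto intro!: avg_mono)
qed auto

lemma avg_pow_bounds:
  assumes "c > 0" "bmeas \<phi>" "\<And>x. a \<le> \<phi> x" "\<And>x. \<phi> x \<le> b"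
  shows "a \<le> (avg c ^^ n) \<phi> x" "(avg c ^^ n) \<phi> x \<le> b"
proof -
  have "(avg c ^^ n) (\<lambda>_. d) x = d" for d
    using assms(1) by (induction n arbitrary: x) (auto simp: avg_def)
  then show "a \<le> (avg c ^^ n) \<phi> x" "(avg c ^^ n) \<phi> x \<le> b"
    using avg_pow_mono[OF assms(1) bmeas_const assms(2), of a n x]
      avg_pow_mono[OF assms(1,2) bmeas_const, of b n x] assms(3,4) by auto
qed

text \<open>Rescaling by M turns a 1/M-periodic function into a 1-periodic one and the step size c
  into M c. Estimates for the exchange between the levels therefore depend on M and c only through
  their product.\<close>

lemma avg_scale:
  assumes "m > 0" "bmeas \<phi>" "c > 0"
  shows "avg c (\<lambda>x. \<phi> (m * x)) x = avg (m * c) \<phi> (m * x)"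
proof -
  have "bmeas (\<lambda>u. \<phi> (m * (x + u)))"
    by (rule bmeas_compose[OF assms(2)]) simp
  then have "integral {-c..c} (\<lambda>u. \<phi> (m * (x + u))) = (LINT u:{-c..c}|lborel. \<phi> (m * x + m * u))"
    by (simp add: bmeas_integral_eq distrib_left)
  moreover have "integral {-(m*c)..m*c} (\<lambda>u. \<phi> (m * x + u)) = (LINT u:{-(m*c)..m*c}|lborel. \<phi> (m * x + u))"
    by (intro bmeas_integral_eq bmeas_shift assms)
  moreover have "(LINT u:{-(m*c)..m*c}|lborel. \<phi> (m * x + u)) = m * (LINT u:{-c..c}|lborel. \<phi> (m * x + m * u))"
  proof -
    have "u \<in> {-c..c} \<longleftrightarrow> m * u \<in> {-(m*c)..m*c}" for u
      using assms(1) mult_le_cancel_left_pos[of m "-c" u] mult_le_cancel_left_pos[of m u c] by auto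
    then have *: "indicator {-c..c} u = (indicator {-(m*c)..m*c} (m * u) :: real)" for u
      unfolding indicator_def by presburger
    show ?thesis
      unfolding set_lebesgue_integral_def *
      using assms(1) by (subst lborel_integral_real_affine[of m _ 0]) simp_all
  qed
  ultimately show ?thesis
    using assms by (simp add: avg_def)
qed

lemma avg_pow_scale:
  assumes "m > 0" "bmeas \<phi>" "c > 0"
  shows "(avg c ^^ n) (\<lambda>x. \<phi> (m * x)) x = (avg (m * c) ^^ n) \<phi> (m * x)"
proof (induction n arbitrary: x)
  case (Suc n)
  have "avg c ((avg c ^^ n) (\<lambda>x. \<phi> (m * x))) x = avg c (\<lambda>x. (avg (m * c) ^^ n) \<phi> (m * x)) x"
    using Suc by (metis (mono_tags, lifting) ext)
  also have "\<dots> = avg (m * c) ((avg (m * c) ^^ n) \<phi>) (m * x)"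
    by (rule avg_scale) (use assms in auto)
  finally show ?case by simp
qed auto

section \<open>Coupling and the Poisson equation\<close>

definition psi :: "real \<Rightarrow> real \<Rightarrow> real \<Rightarrow> real" where
  "psi c l D = 1 + 3 / (4 * c\<^sup>2) * (D * (l - D))"

text \<open>For u uniform on [-c, c] the increment -2 u has mean 0 and variance 4 c^2 / 3. A
  quadratic with leading coefficient -3 / (4 c^2) therefore drops by exactly 1 in the mean under a
  mirrored step, which explains the coefficient in \<open>psi\<close>. The upper limit e is left
  free for steps that are partly matched up.\<close>

lemma has_integral_psi:
  assumes "- c \<le> e"
  shows "((\<lambda>u. psi c l (D - 2 * u)) has_integral
    (e + c + 3 / (4 * c\<^sup>2) * (D * (l - D) * (e + c) + (2 * D - l) * (e\<^sup>2 - c\<^sup>2) - 4 / 3 * (e ^ 3 + c ^ 3)))) {-c..e}"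
proof -
  define F where "F = (\<lambda>u. u + 3 / (4 * c\<^sup>2) * (D * (l - D) * u + (2 * D - l) * u\<^sup>2 - 4 / 3 * u ^ 3))"
  have "((\<lambda>u. psi c l (D - 2 * u)) has_integral (F e - F (-c))) {-c..e}"
  proof (rule fundamental_theorem_of_calculus[OF assms])
    fix u
    have "(F has_real_derivative psi c l (D - 2 * u)) (at u within {-c..e})"
      unfolding F_def psi_def
      by (rule derivative_eq_intros refl)+ (simp add: algebra_simps power2_eq_square)
    then show "(F has_vector_derivative psi c l (D - 2 * u)) (at u within {-c..e})"
      by (simp add: has_real_derivative_iff_has_vector_derivative)
  qed
  also have "F e - F (-c) = e + c + 3 / (4 * c\<^sup>2) * (D * (l - D) * (e + c) + (2 * D - l) * (e\<^sup>2 - c\<^sup>2) - 4 / 3 * (e ^ 3 + c ^ 3))"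
    by (simp add: F_def algebra_simps)
  finally show ?thesis .
qed

text \<open>Two walkers at distance \<open>D\<close> move by mirrored steps, except that steps which can be made to
  lead to the same point are matched up; the distance becomes \<open>0\<close> or \<open>D - 2 u\<close>. The function
  \<open>psi\<close> bounds the expected time until the walkers meet.\<close>

lemma avg_coupling:
  assumes c: "c > 0" and \<phi>: "bmeas \<phi>" and a: "a \<ge> 0"
    and hyp: "\<And>x y. 0 \<le> y - x \<Longrightarrow> y - x \<le> l / 2 + 2 * c \<Longrightarrow> \<bar>\<phi> x - \<phi> y\<bar> \<le> a * psi c l (y - x)"
    and D: "0 \<le> y - x" "y - x \<le> l / 2"
  shows "\<bar>avg c \<phi> x - avg c \<phi> y\<bar> \<le> a * (psi c l (y - x) - 1)"
proof -
  define D where "D = y - x"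
  \<comment> \<open>For D < 2 c the intervals of radius c around x and y overlap, and the overlap
    cancels. What remains around x is u in [-c, D - c], paired with the reflected point y -
    u.\<close>
  define e where "e = min c (D - c)"
  have e: "- c \<le> e" "e \<le> c" "2 * e \<le> D" using D c by (auto simp: e_def D_def min_def)
  have int1: "(\<lambda>u. \<phi> (x + u)) integrable_on {a..b}" "(\<lambda>u. \<phi> (y - u)) integrable_on {a..b}" for a b
    by (intro bmeas_integrable_on bmeas_shift bmeas_reflect \<phi>)+
  have eq: "integral {-c..c} (\<lambda>u. \<phi> (x + u)) - integral {-c..c} (\<lambda>u. \<phi> (y + u)) =
      integral {-c..e} (\<lambda>u. \<phi> (x + u) - \<phi> (y - u))"
  proof (cases "D \<ge> 2 * c")
    case True
    then have "e = c" by (auto simp: e_def)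
    moreover have "integral {-c..c} (\<lambda>u. \<phi> (y - u)) = integral {-c..c} (\<lambda>u. \<phi> (y + u))"
      by (subst integral_reflect_shift_real[OF \<phi>], subst integral_shift_real[OF \<phi>]) (simp add: algebra_simps)
    ultimately show ?thesis by (simp add: integral_diff int1)
  next
    case False
    then have e': "e = D - c" by (auto simp: e_def)
    have "integral {x - c..y - c} \<phi> + integral {y - c..x + c} \<phi> = integral {x - c..x + c} \<phi>"
      using False D by (intro Henstock_Kurzweil_Integration.integral_combine) (auto simp: D_def \<phi> intro: bmeas_integrable_on)
    moreover have "integral {y - c..x + c} \<phi> + integral {x + c..y + c} \<phi> = integral {y - c..y + c} \<phi>"
      using False D by (intro Henstock_Kurzweil_Integration.integral_combine) (auto simp: D_def \<phi> intro: bmeas_integrable_on)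
    ultimately have "integral {-c..c} (\<lambda>u. \<phi> (x + u)) - integral {-c..c} (\<lambda>u. \<phi> (y + u)) =
       integral {x - c..y - c} \<phi> - integral {x + c..y + c} \<phi>"
      by (simp add: integral_shift_real \<phi>)
    also have "integral {x - c..y - c} \<phi> = integral {-c..e} (\<lambda>u. \<phi> (x + u))"
      by (simp add: integral_shift_real \<phi> e' D_def)
    also have "integral {x + c..y + c} \<phi> = integral {-c..e} (\<lambda>u. \<phi> (y - u))"
      by (simp add: integral_reflect_shift_real \<phi> e' D_def)
    finally show ?thesis by (simp add: integral_diff int1)
  qed
  note ip = has_integral_psi[OF e(1), of l D]
  define J where "J = integral {-c..e} (\<lambda>u. psi c l (D - 2 * u))"
  have "\<bar>integral {-c..e} (\<lambda>u. \<phi> (x + u) - \<phi> (y - u))\<bar> \<le> integral {-c..e} (\<lambda>u. a * psi c l (D - 2 * u))"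
    unfolding real_norm_def[symmetric]
  proof (rule integral_norm_bound_integral)
    show "(\<lambda>u. \<phi> (x + u) - \<phi> (y - u)) integrable_on {-c..e}"
      by (intro integrable_diff int1)
    show "(\<lambda>u. a * psi c l (D - 2 * u)) integrable_on {-c..e}"
      using ip by (intro integrable_on_mult_right) auto
    fix u assume u: "u \<in> {-c..e}"
    have eqD: "(y - u) - (x + u) = D - 2 * u" by (simp add: D_def)
    have "0 \<le> (y - u) - (x + u)" "(y - u) - (x + u) \<le> l / 2 + 2 * c"
      using u e D(2) unfolding eqD by (auto simp: D_def)
    from hyp[OF this] show "norm (\<phi> (x + u) - \<phi> (y - u)) \<le> a * psi c l (D - 2 * u)"
      unfolding eqD by simp
  qed
  also have "\<dots> = a * J" by (simp add: J_def)
  \<comment> \<open>Equality for D at least 2 c. Below that, matched steps contribute nothing, so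
    the mean falls by more than 1; the surplus is the explicit product that is dropped at the
    end.\<close>
  also have "J \<le> 2 * c * (psi c l D - 1)"
  proof (cases "D \<ge> 2 * c")
    case True
    then have "e = c" by (auto simp: e_def)
    then show ?thesis
      using integral_unique[OF ip] c by (simp add: J_def psi_def field_simps power2_eq_square power3_eq_cube)
  next
    case False
    then have e': "e = D - c" by (auto simp: e_def)
    have "J = D + 3 / (4 * c\<^sup>2) * (D * (2 * l * c - 4 * c\<^sup>2 - D\<^sup>2 / 3))"
      unfolding J_def integral_unique[OF ip] unfolding e' by (simp add: algebra_simps power2_eq_square power3_eq_cube)
    also have "\<dots> = 2 * c * (psi c l D - 1) - D * ((2 * c - D) * (4 * c - D)) / (4 * c\<^sup>2)"
      using c by (simp add: psi_def field_simps power2_eq_square)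
    also have "\<dots> \<le> 2 * c * (psi c l D - 1)"
      using False D c by (auto simp: D_def)
    finally show ?thesis .
  qed
  finally have *: "\<bar>integral {-c..e} (\<lambda>u. \<phi> (x + u) - \<phi> (y - u))\<bar> \<le> a * (2 * c * (psi c l D - 1))"
    using a by (simp add: mult_left_mono)
  have "\<bar>avg c \<phi> x - avg c \<phi> y\<bar> = (1 / (2 * c)) * \<bar>integral {-c..e} (\<lambda>u. \<phi> (x + u) - \<phi> (y - u))\<bar>"
    using c unfolding avg_def eq[symmetric] by (simp add: abs_mult flip: diff_divide_distrib)
  also have "\<dots> \<le> (1 / (2 * c)) * (a * (2 * c * (psi c l D - 1)))"
    using * c by (intro mult_left_mono) auto
  also have "\<dots> = a * (psi c l D - 1)" using c by simp
  finally show ?thesis by (simp add: D_def)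
qed

lemma periodic_int:
  assumes "\<And>x. \<phi> (x + 1) = \<phi> (x :: real)"
  shows "\<phi> (x + of_int k) = \<phi> x"
proof -
  have nat: "\<phi> (x + real n) = \<phi> x" for n x
  proof (induction n)
    case (Suc n)
    then show ?case using assms[of "x + real n"] by (simp add: algebra_simps)
  qed auto
  show ?thesis
  proof (cases "k \<ge> 0")
    case True
    then show ?thesis using nat[of x "nat k"] by simp
  next
    case False
    then show ?thesis using nat[of "x + of_int k" "nat (- k)"] by simp
  qed
qed

lemma periodic_frac:
  assumes "\<And>x. \<phi> (x + 1) = \<phi> (x :: real)"
  shows "\<phi> (frac x) = \<phi> x"
  using periodic_int[of \<phi>, OF assms, of "frac x" "\<lfloor>x\<rfloor>"] by (simp add: frac_def)

lemma psi_bounds: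
  assumes "c > 0" "0 \<le> D" "D \<le> 1"
  shows "1 \<le> psi c 1 D" "psi c 1 D \<le> 1 + 3 / (16 * c\<^sup>2)"
proof -
  have "0 \<le> D * (1 - D)" using assms by auto
  then show "1 \<le> psi c 1 D" by (simp add: psi_def)
  have "D * (1 - D) \<le> 1 / 4" using mult_const_minus_self_real_le[of D 1] by simp
  then have "3 / (4 * c\<^sup>2) * (D * (1 - D)) \<le> 3 / (4 * c\<^sup>2) * (1 / 4)"
    by (intro mult_left_mono) auto
  then show "psi c 1 D \<le> 1 + 3 / (16 * c\<^sup>2)" by (simp add: psi_def)
qed

text \<open>With l = 1 the profile \<open>psi\<close> is symmetric under exchanging D and 1 - D, so
  an arc longer than one half is replaced by the complementary arc by moving x to x + 1. The bound c
  \<le> 1 / 4 keeps l / 2 + 2 c within one period, where the hypothesis is available.\<close>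

lemma avg_coupling_periodic:
  assumes c: "0 < c" "c \<le> 1 / 4" and \<phi>: "bmeas \<phi>" and a: "a \<ge> 0"
    and per: "\<And>x. \<phi> (x + 1) = \<phi> x"
    and hyp: "\<And>x y. 0 \<le> y - x \<Longrightarrow> y - x \<le> 1 \<Longrightarrow> \<bar>\<phi> x - \<phi> y\<bar> \<le> a * psi c 1 (y - x)"
    and D: "0 \<le> y - x" "y - x \<le> 1"
  shows "\<bar>avg c \<phi> x - avg c \<phi> y\<bar> \<le> a * (psi c 1 (y - x) - 1)"
proof (cases "y - x \<le> 1 / 2")
  case True
  show ?thesis
    by (rule avg_coupling) (use assms True in auto)
next
  case False
  have "\<bar>avg c \<phi> y - avg c \<phi> (x + 1)\<bar> \<le> a * (psi c 1 ((x + 1) - y) - 1)"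
    by (rule avg_coupling) (use assms False in auto)
  moreover have "psi c 1 ((x + 1) - y) = psi c 1 (y - x)"
    by (simp add: psi_def algebra_simps)
  moreover have "avg c \<phi> (x + 1) = avg c \<phi> x" by (rule avg_periodic) (rule per)
  ultimately show ?thesis by (simp add: abs_minus_commute)
qed

text \<open>\<open>psi\<close> serves as a Lyapunov function: it lies between 1 and \<Psi>, so
  lowering it by 1 is at least a contraction by the factor 1 - 1 / \<Psi>.\<close>

lemma avg_pow_contract:
  assumes c: "0 < c" "c \<le> 1 / 4" and h: "bmeas h"
    and per: "\<And>x. h (x + 1) = h x" and osc: "\<And>x y. \<bar>h x - h y\<bar> \<le> 1"
    and D: "0 \<le> y - x" "y - x \<le> 1"
  defines "\<Psi> \<equiv> 1 + 3 / (16 * c\<^sup>2)"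
  shows "\<bar>(avg c ^^ n) h x - (avg c ^^ n) h y\<bar> \<le> (1 - 1 / \<Psi>) ^ n * psi c 1 (y - x)"
  using D
proof (induction n arbitrary: x y)
  case 0
  then show ?case using osc[of x y] psi_bounds(1)[of c "y - x"] c by auto
next
  case (Suc n)
  have \<Psi>: "\<Psi> \<ge> 1" by (simp add: \<Psi>_def)
  have "\<bar>avg c ((avg c ^^ n) h) x - avg c ((avg c ^^ n) h) y\<bar> \<le> (1 - 1 / \<Psi>) ^ n * (psi c 1 (y - x) - 1)"
    by (rule avg_coupling_periodic) (use assms Suc \<Psi> in \<open>auto intro!: avg_pow_periodic zero_le_power simp flip: \<Psi>_def\<close>)
  also have "\<dots> \<le> (1 - 1 / \<Psi>) ^ n * ((1 - 1 / \<Psi>) * psi c 1 (y - x))"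
  proof (rule mult_left_mono)
    have "psi c 1 (y - x) \<le> \<Psi>" using psi_bounds(2)[of c "y - x"] Suc.prems c by (simp add: \<Psi>_def)
    then have "psi c 1 (y - x) / \<Psi> \<le> 1" using \<Psi> by simp
    then show "psi c 1 (y - x) - 1 \<le> (1 - 1 / \<Psi>) * psi c 1 (y - x)" by (simp add: algebra_simps)
  qed (use \<Psi> in auto)
  finally show ?case by (simp add: algebra_simps)
qed

text \<open>The geometric rate is weakened to 1 / n through Bernoulli's inequality in the form (1 -
  t)^n (1 + n t) \<le> 1. A polynomial rate is enough, because it only decides how far potentials
  are summed and beyond which n no test is made.\<close>

lemma avg_pow_osc:
  assumes c: "0 < c" "c \<le> 1 / 4" and h: "bmeas h"
    and per: "\<And>x. h (x + 1) = h x" and osc: "\<And>x y. \<bar>h x - h y\<bar> \<le> 1" and n: "n > 0"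
  shows "\<bar>(avg c ^^ n) h x - (avg c ^^ n) h y\<bar> \<le> (1 / (4 * c\<^sup>2))\<^sup>2 / real n"
proof -
  define \<Psi> where "\<Psi> = 1 + 3 / (16 * c\<^sup>2)"
  have \<Psi>: "\<Psi> \<ge> 1" by (simp add: \<Psi>_def)
  have "1 \<le> 1 / (16 * c\<^sup>2)"
    using c power_mono[of c "1/4" 2] by (simp add: power2_eq_square)
  then have \<Psi>2: "\<Psi> \<le> 1 / (4 * c\<^sup>2)" by (simp add: \<Psi>_def field_simps)
  have "(1 - 1 / \<Psi>) ^ n * (1 + real n * (1 / \<Psi>)) \<le> (1 - 1 / \<Psi>) ^ n * (1 + 1 / \<Psi>) ^ n"
    using \<Psi> by (intro mult_left_mono Bernoulli_inequality) (auto intro: order_trans[of _ 0])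
  also have "\<dots> = (1 - 1 / \<Psi>\<^sup>2) ^ n" by (simp add: power_mult_distrib[symmetric] algebra_simps power2_eq_square)
  also have "\<dots> \<le> 1" using \<Psi> by (intro power_le_one) (auto simp: power2_eq_square mult_ge1_I)
  finally have "(1 - 1 / \<Psi>) ^ n * (1 + real n * (1 / \<Psi>)) \<le> 1" .
  moreover have "(1 - 1 / \<Psi>) ^ n * (real n * (1 / \<Psi>)) \<le> (1 - 1 / \<Psi>) ^ n * (1 + real n * (1 / \<Psi>))"
    using \<Psi> by (intro mult_left_mono) auto
  ultimately have "(1 - 1 / \<Psi>) ^ n * (real n * (1 / \<Psi>)) \<le> 1" by linarith
  then have geo: "(1 - 1 / \<Psi>) ^ n \<le> \<Psi> / real n" using n \<Psi> by (simp add: field_simps)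
  \<comment> \<open>By periodicity only y modulo 1 matters; z is its representative in [x, x +
    1).\<close>
  define z where "z = x + frac (y - x)"
  have "\<bar>(avg c ^^ n) h x - (avg c ^^ n) h z\<bar> \<le> (1 - 1 / \<Psi>) ^ n * psi c 1 (z - x)"
    unfolding \<Psi>_def by (rule avg_pow_contract) (use assms frac_lt_1[of "y - x"] in \<open>auto simp: z_def\<close>)
  also have "\<dots> \<le> \<Psi> / real n * \<Psi>"
    using geo psi_bounds(2)[of c "z - x"] psi_bounds(1)[of c "z - x"] frac_lt_1[of "y - x"] c \<Psi>
    by (intro mult_mono) (auto simp: z_def \<Psi>_def)
  also have "\<dots> = \<Psi>\<^sup>2 / real n" by (simp add: power2_eq_square)
  also have "\<dots> \<le> (1 / (4 * c\<^sup>2))\<^sup>2 / real n" using \<Psi> \<Psi>2 by (intro divide_right_mono power_mono) auto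
  also have "(avg c ^^ n) h z = (avg c ^^ n) h y"
    using periodic_int[of "(avg c ^^ n) h" y "- \<lfloor>y - x\<rfloor>"] avg_pow_periodic[of h 1 n c, OF per]
    by (simp add: z_def frac_def algebra_simps)
  finally show ?thesis .
qed

section \<open>Truncated potentials: Poisson equation and oscillation\<close>

definition potn :: "real \<Rightarrow> (real \<Rightarrow> real) \<Rightarrow> nat \<Rightarrow> real \<Rightarrow> real" where
  "potn c h n x = (\<Sum>i<n. (avg c ^^ i) h x)"

lemma bmeas_potn [intro]: "c > 0 \<Longrightarrow> bmeas h \<Longrightarrow> bmeas (potn c h n)"
  unfolding potn_def[abs_def] by (intro bmeas_sum bmeas_avg_pow)

lemma potn_periodic: "(\<And>x. h (x + p) = h x) \<Longrightarrow> potn c h n (x + p) = potn c h n x"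
  by (simp add: potn_def avg_pow_periodic)

lemma avg_potn: "c > 0 \<Longrightarrow> bmeas h \<Longrightarrow> avg c (potn c h n) x = (\<Sum>i<n. (avg c ^^ Suc i) h x)"
  unfolding potn_def[abs_def] by (subst avg_sum) auto

lemma potn_Suc: "c > 0 \<Longrightarrow> bmeas h \<Longrightarrow> potn c h (Suc n) x = h x + avg c (potn c h n) x"
  by (subst avg_potn) (simp_all add: potn_def sum.lessThan_Suc_shift del: sum.lessThan_Suc)

text \<open>A telescoping sum. Stopping at n leaves the remainder \<open>(avg c ^^ n) h\<close>, and
  in return neither convergence of the series nor centring of h is an issue.\<close>

lemma potn_poisson:
  assumes "c > 0" "bmeas h"
  shows "potn c h n x - avg c (potn c h n) x = h x - (avg c ^^ n) h x"
  using potn_Suc[OF assms, of n x] by (simp add: potn_def)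

text \<open>Two coupled walkers contribute at most 1 per step until they meet, and
  \<open>psi\<close> bounds the mean meeting time, hence a bound that is uniform in n. In the
  induction the 1 gained by the coupling pays for the new summand.\<close>

lemma potn_osc:
  assumes c: "0 < c" "c \<le> 1 / 4" and h: "bmeas h"
    and per: "\<And>x. h (x + 1) = h x" and osc: "\<And>x y. \<bar>h x - h y\<bar> \<le> 1"
    and D: "0 \<le> y - x" "y - x \<le> 1"
  shows "\<bar>potn c h n x - potn c h n y\<bar> \<le> psi c 1 (y - x)"
  using D
proof (induction n arbitrary: x y)
  case 0
  then show ?case using psi_bounds(1)[of c "y - x"] c by (auto simp: potn_def)
next
  case (Suc n)
  have "\<bar>avg c (potn c h n) x - avg c (potn c h n) y\<bar> \<le> 1 * (psi c 1 (y - x) - 1)"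
    by (rule avg_coupling_periodic) (use assms Suc in \<open>auto intro: potn_periodic\<close>)
  moreover have "potn c h (Suc n) x - potn c h (Suc n) y = (h x - h y) + (avg c (potn c h n) x - avg c (potn c h n) y)"
    using c h by (simp add: potn_Suc)
  ultimately show ?case using osc[of x y] unfolding abs_le_iff mult_1_left by (intro conjI; linarith)
qed

text \<open>For walkers at distance at most 2 c the meeting time has to be counted only up to the
  horizon n, which gives order sqrt n where the periodic bound gives order 1 / c. The coupling is
  run on a stretch of length l of order c sqrt n; outside, the oscillation is bounded by the number
  of summands.\<close>

lemma potn_local_osc:
  assumes c: "0 < c" and h: "bmeas h" and osc: "\<And>x y. \<bar>h x - h y\<bar> \<le> 1"
    and n: "n \<ge> 1" and D: "0 \<le> y - x" "y - x \<le> 2 * c"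
  shows "\<bar>potn c h n x - potn c h n y\<bar> \<le> 6 * sqrt (real n)"
proof -
  \<comment> \<open>Chosen so that \<open>psi c l\<close> takes the value n at distance l / 2 + 2 c.
    Between l / 2 and that distance it is at least n, and the trivial bound takes over.\<close>
  define s where "s = sqrt (16 * (real n + 2) / 3)"
  define l where "l = c * s"
  have s2: "s\<^sup>2 = 16 * (real n + 2) / 3" by (simp add: s_def)
  have s4: "s \<ge> 4" unfolding s_def by (rule real_le_rsqrt) (use n in auto)
  have l4: "l \<ge> 4 * c" using s4 c by (simp add: l_def)
  have triv: "\<bar>potn c h i x - potn c h i y\<bar> \<le> real i" for i x y
  proof -
    have "\<bar>(avg c ^^ j) h x - (avg c ^^ j) h y\<bar> \<le> 1" for j
    proof -
      have "\<And>z. h z \<le> (INF w. h w) + 1"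
      proof -
        fix z
        have "h z - 1 \<le> (INF w. h w)" by (rule cINF_greatest) (use osc in \<open>auto simp: abs_le_iff algebra_simps\<close>)
        then show "h z \<le> (INF w. h w) + 1" by simp
      qed
      moreover have "(INF w. h w) \<le> h z" for z
      proof (rule cINF_lower)
        show "bdd_below (range h)"
        proof -
          obtain C where "\<And>x. \<bar>h x\<bar> \<le> C" using bmeasE[OF h] by metis
          then show ?thesis by (intro bdd_belowI[of _ "-C"]) (auto simp: abs_le_iff minus_le_iff)
        qed
      qed auto
      ultimately show ?thesis
        using avg_pow_bounds[OF c h, of "INF w. h w" "(INF w. h w) + 1" j] 
        by (metis (no_types, lifting) abs_le_iff add.commute add_diff_cancel_left' diff_mono minus_diff_eq)
    qed
    then show ?thesis
      unfolding potn_def sum_subtractf[symmetric]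
      by (intro order_trans[OF sum_abs]) (use sum_mono[of "{..<i}" "\<lambda>j. \<bar>(avg c ^^ j) h x - (avg c ^^ j) h y\<bar>" "\<lambda>_. 1"] in auto)
  qed
  have *: "\<bar>potn c h i x - potn c h i y\<bar> \<le> psi c l (y - x)"
    if "i \<le> n" "0 \<le> y - x" "y - x \<le> l / 2 + 2 * c" for i x y
    using that
  proof (induction i arbitrary: x y)
    case 0
    have "0 \<le> (y - x) * (l - (y - x))" using 0 l4 c by (intro mult_nonneg_nonneg) auto
    then show ?case by (simp add: potn_def psi_def)
  next
    case (Suc i)
    show ?case
    proof (cases "y - x \<le> l / 2")
      case True
      have "\<bar>avg c (potn c h i) x - avg c (potn c h i) y\<bar> \<le> 1 * (psi c l (y - x) - 1)"
        by (rule avg_coupling) (use c h Suc True in auto)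
      moreover have "potn c h (Suc i) x - potn c h (Suc i) y = (h x - h y) + (avg c (potn c h i) x - avg c (potn c h i) y)"
        using c h by (simp add: potn_Suc)
      ultimately show ?thesis using osc[of x y] unfolding abs_le_iff mult_1_left by (intro conjI; linarith)
    next
      case False
      have "\<bar>potn c h (Suc i) x - potn c h (Suc i) y\<bar> \<le> real n" using triv[of "Suc i" x y] Suc.prems(1) by linarith
      also have "real n = 1 + 3 / (4 * c\<^sup>2) * (l\<^sup>2 / 4 - (2 * c)\<^sup>2)"
        using c by (simp add: l_def power_mult_distrib s2 field_simps)
      also have "\<dots> \<le> psi c l (y - x)"
      proof -
        have "((y - x) - l / 2)\<^sup>2 \<le> (2 * c)\<^sup>2" using False Suc.prems by (intro power_mono) auto
        then have "l\<^sup>2 / 4 - (2 * c)\<^sup>2 \<le> (y - x) * (l - (y - x))" by (simp add: power2_eq_square algebra_simps)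
        then show ?thesis unfolding psi_def by (intro add_left_mono mult_left_mono) auto
      qed
      finally show ?thesis .
    qed
  qed
  have "\<bar>potn c h n x - potn c h n y\<bar> \<le> psi c l (y - x)"
    using D l4 c by (intro *) auto
  also have "\<dots> \<le> 1 + 3 / (4 * c\<^sup>2) * (2 * c * (l - 2 * c))"
  proof -
    have "0 \<le> (2 * c - (y - x)) * (l - 2 * c - (y - x))" using D l4 by (intro mult_nonneg_nonneg) auto
    then have "(y - x) * (l - (y - x)) \<le> 2 * c * (l - 2 * c)" by (simp add: algebra_simps)
    then show ?thesis unfolding psi_def by (intro add_left_mono mult_left_mono) auto
  qed
  also have "\<dots> = 3 / 2 * s - 2" using c by (simp add: l_def field_simps power2_eq_square)
  also have "\<dots> \<le> 6 * sqrt (real n)"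
  proof -
    have "s \<le> sqrt (16 * real n)" unfolding s_def by (rule real_sqrt_le_mono) (use n in auto)
    then show ?thesis by (simp add: real_sqrt_mult)
  qed
  finally show ?thesis .
qed

section \<open>The flow between the two energy levels\<close>

lemma circ_leb_measurable:
  "\<phi> \<in> borel_measurable borel \<Longrightarrow> \<phi> \<in> borel_measurable circ_leb"
  unfolding circ_leb_def by (rule measurable_restrict_space1) simp

lemma circ_leb_integral:
  assumes "bmeas \<phi>"
  shows "(LINT x|circ_leb. \<phi> x) = integral {0..1} \<phi>"
proof -
  have "(LINT x|circ_leb. \<phi> x) = (LINT x:{0..<1}|lborel. \<phi> x)"
    unfolding circ_leb_def
    by (subst integral_restrict_space) (auto simp: Omega_def set_lebesgue_integral_def)
  also have "\<dots> = (LINT x:{0..1}|lborel. \<phi> x)"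
    unfolding set_lebesgue_integral_def
  proof (rule integral_cong_AE)
    have "AE x in lborel. x \<noteq> (1::real)" by (rule AE_lborel_singleton)
    then show "AE x in lborel. indicator {0..<1} x *\<^sub>R \<phi> x = indicator {0..1} x *\<^sub>R \<phi> x"
      by eventually_elim (auto simp: indicator_def)
  qed (use assms in \<open>auto simp: bmeas_def\<close>)
  finally show ?thesis using assms by (simp add: bmeas_integral_eq)
qed

lemma integral_periodic_mult:
  assumes H: "bmeas H" and per: "\<And>x. H (x + 1) = H x"
  shows "integral {0..real m} H = real m * integral {0..1} H"
proof (induction m)
  case (Suc m)
  have "integral {0..real m} H + integral {real m..real (Suc m)} H = integral {0..real (Suc m)} H"
    by (intro Henstock_Kurzweil_Integration.integral_combine bmeas_integrable_on H) auto
  moreover have "integral {real m..real (Suc m)} H = integral {0..1} (\<lambda>u. H (real m + u))"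
    by (subst integral_shift_real[OF H]) (simp add: add.commute)
  moreover have "(\<lambda>u. H (real m + u)) = H"
    using periodic_int[of H _ "int m", OF per] by (simp add: add.commute fun_eq_iff)
  ultimately have "integral {0..real (Suc m)} H = real m * integral {0..1} H + integral {0..1} H"
    using Suc by metis
  also have "\<dots> = real (Suc m) * integral {0..1} H" by (simp add: distrib_right)
  finally show ?case .
qed auto

lemma circ_leb_integral_scale:
  assumes H: "bmeas H" and per: "\<And>x. H (x + 1) = H x" and m: "m > 0"
  shows "(LINT x|circ_leb. H (real m * x)) = integral {0..1} H"
proof -
  have bm: "bmeas (\<lambda>x. H (real m * x))" by (rule bmeas_compose[OF H]) simp
  have ind: "indicator {0..1} u = (indicator {0..real m} (real m * u) :: real)" for u
    using m by (auto simp: indicator_def zero_le_mult_iff)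
  have "integral {0..real m} H = (LINT x|lborel. indicator {0..real m} x * H x)"
    by (simp add: bmeas_integral_eq H set_lebesgue_integral_def)
  also have "\<dots> = real m * (LINT x|lborel. indicator {0..1} x * H (real m * x))"
    unfolding ind using m by (subst lborel_integral_real_affine[of "real m" _ 0]) auto
  also have "(LINT x|lborel. indicator {0..1} x * H (real m * x)) = integral {0..1} (\<lambda>x. H (real m * x))"
    by (simp add: bmeas_integral_eq bm set_lebesgue_integral_def)
  finally have "real m * integral {0..1} (\<lambda>x. H (real m * x)) = real m * integral {0..1} H"
    using integral_periodic_mult[OF H per, of m] by linarith
  then have "integral {0..1} (\<lambda>x. H (real m * x)) = integral {0..1} H" using m by simp
  then show ?thesis using circ_leb_integral[OF bm] by simp
qed

lemma bmeas_integral_fubini: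
  fixes F :: "real \<times> real \<Rightarrow> real"
  assumes [measurable]: "F \<in> borel_measurable borel" and bound: "\<And>p. \<bar>F p\<bar> \<le> C"
  shows "integral {a..b} (\<lambda>x. integral {s..t} (\<lambda>y. F (x, y))) = integral {s..t} (\<lambda>y. integral {a..b} (\<lambda>x. F (x, y)))"
    and "bmeas (\<lambda>x. integral {s..t} (\<lambda>y. F (x, y)))"
    and "bmeas (\<lambda>y. integral {a..b} (\<lambda>x. F (x, y)))"
proof -
  have [measurable]: "F \<in> borel_measurable (borel \<Otimes>\<^sub>M borel)" by (simp add: borel_prod)
  have C: "C \<ge> 0" using bound[of undefined] by linarith
  have b1: "bmeas (\<lambda>y. F (x, y))" "bmeas (\<lambda>x. F (x, y))" for x y
    by (rule bmeasI[where C=C]; use bound in \<open>(measurable | simp)\<close>)+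
  have meas: "(\<lambda>x. integral {s..t} (\<lambda>y. F (x, y))) \<in> borel_measurable borel" for s t
    by (subst bmeas_integral_eq[OF b1(1)]) (unfold set_lebesgue_integral_def, measurable)
  have meas': "(\<lambda>y. integral {s..t} (\<lambda>x. F (x, y))) \<in> borel_measurable borel" for s t
    by (subst bmeas_integral_eq[OF b1(2)]) (unfold set_lebesgue_integral_def, measurable)
  have bd: "\<bar>integral {s..t} g\<bar> \<le> C * max 0 (t - s)" if g: "bmeas g" "\<And>y. \<bar>g y\<bar> \<le> C" for g :: "real \<Rightarrow> real" and s t
  proof (cases "s \<le> t")
    case True
    have "\<bar>integral {s..t} g\<bar> \<le> integral {s..t} (\<lambda>_. C)"
      unfolding real_norm_def[symmetric] by (rule integral_norm_bound_integral) (use g in auto)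
    with True show ?thesis by (simp add: mult.commute)
  qed auto
  show bm: "bmeas (\<lambda>x. integral {s..t} (\<lambda>y. F (x, y)))" "bmeas (\<lambda>y. integral {a..b} (\<lambda>x. F (x, y)))"
    by (rule bmeasI[OF meas bd[OF b1(1) bound]], rule bmeasI[OF meas' bd[OF b1(2) bound]])
  let ?G = "\<lambda>(x, y). indicator {a..b} x * (indicator {s..t} y * F (x, y))"
  have int: "integrable (lborel \<Otimes>\<^sub>M lborel) ?G"
  proof (rule integrableI_bounded_set[where A = "{a..b} \<times> {s..t}" and B = C])
    show "emeasure (lborel \<Otimes>\<^sub>M lborel) ({a..b} \<times> {s..t}) < \<infinity>"
      by (subst lborel.emeasure_pair_measure_Times) (auto simp: ennreal_mult_less_top emeasure_lborel_Icc_eq)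
  qed (use bound C in \<open>auto simp: indicator_def\<close>)
  have "integral {a..b} (\<lambda>x. integral {s..t} (\<lambda>y. F (x, y))) =
      (LINT x|lborel. LINT y|lborel. indicator {a..b} x * (indicator {s..t} y * F (x, y)))"
    unfolding bmeas_integral_eq[OF bm(1)] by (simp add: bmeas_integral_eq[OF b1(1)] set_lebesgue_integral_def)
  also have "\<dots> = (LINT y|lborel. LINT x|lborel. indicator {a..b} x * (indicator {s..t} y * F (x, y)))"
    using lborel_pair.Fubini_integral[of "\<lambda>x y. indicator {a..b} x * (indicator {s..t} y * F (x, y))"] int by simp
  also have "\<dots> = (LINT y|lborel. LINT x|lborel. indicator {s..t} y * (indicator {a..b} x * F (x, y)))"
    by (simp add: mult.left_commute)
  also have "\<dots> = integral {s..t} (\<lambda>y. integral {a..b} (\<lambda>x. F (x, y)))"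
    unfolding bmeas_integral_eq[OF bm(2)] by (simp add: bmeas_integral_eq[OF b1(2)] set_lebesgue_integral_def)
  finally show "integral {a..b} (\<lambda>x. integral {s..t} (\<lambda>y. F (x, y))) = integral {s..t} (\<lambda>y. integral {a..b} (\<lambda>x. F (x, y)))" .
qed

section \<open>The two-level profile and its correlation with its shifts\<close>

definition upper :: "real \<Rightarrow> real" where
  "upper y = (if frac y \<le> 1 / 2 then 0 else 1)"

lemma upper_bounds [simp]: "0 \<le> upper y" "upper y \<le> 1" "\<bar>upper y\<bar> \<le> 1"
  by (auto simp: upper_def)

lemma upper_measurable [measurable]: "upper \<in> borel_measurable borel"
  unfolding upper_def[abs_def] frac_def by measurable

lemma bmeas_upper [intro, simp]: "bmeas upper"
  by (rule bmeasI[where C=1]) auto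

lemma upper_periodic [simp]: "upper (y + 1) = upper y"
  by (simp add: upper_def frac_def)

lemma upper_periodic_int [simp]: "upper (y + of_int k) = upper y"
  by (rule periodic_int) simp

text \<open>For h = \<open>upper\<close> this is the triangle wave, the distance from z to the
  nearest integer. Being a correlation it commutes with \<open>avg\<close>, so that n steps of the
  walk can be applied to an explicit function and evaluated at shift 0.\<close>

definition corr :: "(real \<Rightarrow> real) \<Rightarrow> real \<Rightarrow> real" where
  "corr h z = integral {0..1} (\<lambda>y. (1 - upper y) * h (y + z))"

lemma corr_avg:
  assumes d: "d > 0" and h: "bmeas h"
  shows "corr (avg d h) z = avg d (corr h) z" "bmeas (corr h)"
proof -
  obtain C where C: "\<And>x. \<bar>h x\<bar> \<le> C" "C \<ge> 0" using h by (meson bmeasE)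
  have [measurable]: "h \<in> borel_measurable borel" using h by auto
  have bd: "\<bar>(1 - upper y) * h v\<bar> \<le> C" for y v
    using mult_mono[of "\<bar>1 - upper y\<bar>" 1 "\<bar>h v\<bar>" C] C by (auto simp: abs_mult upper_def)
  have m1: "(\<lambda>(y, u). (1 - upper y) * h (y + (z + u))) \<in> borel_measurable borel" for z
    by (subst borel_prod[symmetric]) measurable
  have F: "integral {0..1} (\<lambda>y. integral {-d..d} (\<lambda>u. (1 - upper y) * h (y + (z + u)))) =
      integral {-d..d} (\<lambda>u. integral {0..1} (\<lambda>y. (1 - upper y) * h (y + (z + u))))"
    "bmeas (\<lambda>u. integral {0..1} (\<lambda>y. (1 - upper y) * h (y + (0 + u))))"
    using bmeas_integral_fubini(1)[OF m1[of z], of C 0 1 "-d" d] bmeas_integral_fubini(3)[OF m1[of 0], of C 0 1] bd by auto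
  have "corr (avg d h) z = (1 / (2 * d)) * integral {0..1} (\<lambda>y. integral {-d..d} (\<lambda>u. (1 - upper y) * h (y + (z + u))))"
  proof -
    have pt: "(1 - upper y) * avg d h (y + z) = (1 / (2 * d)) * integral {-d..d} (\<lambda>u. (1 - upper y) * h (y + (z + u)))" for y
      by (simp add: avg_def add.assoc)
    show ?thesis unfolding corr_def pt by simp
  qed
  also have "\<dots> = (1 / (2 * d)) * integral {-d..d} (\<lambda>u. integral {0..1} (\<lambda>y. (1 - upper y) * h (y + (z + u))))"
    unfolding F(1) ..
  also have "\<dots> = avg d (corr h) z"
    by (simp add: corr_def avg_def)
  finally show "corr (avg d h) z = avg d (corr h) z" .
  show "bmeas (corr h)"
    using F(2) by (simp add: corr_def[abs_def])
qed

lemma corr_avg_pow: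
  assumes d: "d > 0" and h: "bmeas h"
  shows "corr ((avg d ^^ n) h) = (avg d ^^ n) (corr h)"
proof (induction n)
  case (Suc n)
  have "corr (avg d ((avg d ^^ n) h)) = avg d (corr ((avg d ^^ n) h))"
    by (rule ext, rule corr_avg) (use d h in auto)
  then show ?case using Suc by simp
qed auto

lemma integral_upper: "integral {0..1} upper = 1 / 2" "integral {0..1} (\<lambda>y. 1 - upper y) = 1 / 2"
proof -
  have "((\<lambda>y::real. 1::real) has_integral (1 - 1 / 2)) {1/2..1}"
    using has_integral_const_real[of "1::real" "1/2" 1] by simp
  then have "(upper has_integral (1 - 1 / 2)) {1/2..1}"
    by (rule has_integral_spike_finite[of "{1/2, 1}", rotated 2])
       (auto simp: upper_def frac_unique_iff frac_eq[symmetric])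
  moreover have "((\<lambda>y::real. 0::real) has_integral 0) {0..1/2}" by simp
  then have "(upper has_integral 0) {0..1/2}"
    by (rule has_integral_eq[rotated]) (auto simp: upper_def frac_eq[THEN iffD2])
  ultimately have "(upper has_integral (0 + (1 - 1 / 2))) {0..1}"
    by (intro has_integral_combine[where c="1/2"]) auto
  then show 1: "integral {0..1} upper = 1 / 2" by (simp add: integral_unique)
  then show "integral {0..1} (\<lambda>y. 1 - upper y) = 1 / 2"
    by (subst integral_diff) auto
qed

lemma corr_upper_ge:
  "min (frac z) (1 - frac z) \<le> corr upper z"
proof -
  define w where "w = frac z"
  have w: "0 \<le> w" "w < 1" by (auto simp: w_def frac_lt_1)
  have eq: "upper (y + z) = upper (y + w)" for y
    using upper_periodic_int[of "y + w" "\<lfloor>z\<rfloor>"] by (simp add: w_def frac_def)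
  have bm: "bmeas (\<lambda>y. (1 - upper y) * upper (y + z))"
    by (intro bmeas_mult bmeas_diff bmeas_const bmeas_shift' bmeas_upper)
  have sub: "integral {a..b} (\<lambda>y. (1 - upper y) * upper (y + z)) \<le> corr upper z" if "0 \<le> a" "b \<le> 1" for a b
    unfolding corr_def
    by (rule integral_subset_le) (use that bm in \<open>auto intro: bmeas_integrable_on\<close>)
  show ?thesis
  proof (cases "w \<le> 1 / 2")
    case True
    have i: "((\<lambda>y::real. 1::real) has_integral w) {1/2-w..1/2}"
      using has_integral_const_real[of "1::real" "1/2-w" "1/2"] w by simp
    have "((\<lambda>y. (1 - upper y) * upper (y + z)) has_integral w) {1/2-w..1/2}"
      unfolding eq
      by (rule has_integral_spike_finite[OF _ _ i, of "{1/2-w, 1/2}"])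
         (use True in \<open>auto simp: upper_def frac_eq[THEN iffD2]\<close>)
    then show ?thesis using sub[of "1/2-w" "1/2"] True w by (simp add: integral_unique w_def[symmetric])
  next
    case False
    have i: "((\<lambda>y::real. 1::real) has_integral (1 - w)) {0..1-w}"
      using has_integral_const_real[of "1::real" 0 "1-w"] w by simp
    have "((\<lambda>y. (1 - upper y) * upper (y + z)) has_integral (1 - w)) {0..1-w}"
      unfolding eq
      by (rule has_integral_spike_finite[OF _ _ i, of "{1-w}"])
         (use False w in \<open>auto simp: upper_def frac_eq[THEN iffD2]\<close>)
    then show ?thesis using sub[of 0 "1-w"] False w by (simp add: integral_unique w_def[symmetric])
  qed
qed

lemma one_minus_cos_le: "1 - cos (2 * t) \<le> 2 * \<bar>t\<bar>" for t :: real
proof -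
  have "1 - cos (2 * t) = 2 * (sin t)\<^sup>2" by (simp add: cos_double_sin)
  also have "\<dots> \<le> 2 * \<bar>sin t\<bar>"
    using mult_left_le[of "\<bar>sin t\<bar>" "\<bar>sin t\<bar>"] by (simp add: power2_eq_square flip: abs_mult)
  also have "\<dots> \<le> 2 * \<bar>t\<bar>" using abs_sin_x_le_abs_x[of t] by simp
  finally show ?thesis .
qed

text \<open>This trigonometric minorant of the triangle wave consists of eigenfunctions of \<open>avg\<close>.\<close>

definition trig_minorant :: "nat \<Rightarrow> real \<Rightarrow> real" where
  "trig_minorant k z = (1 - cos (2 * pi * real k * z)) / (2 * pi * real k)"

lemma trig_minorant_le:
  assumes "k > 0"
  shows "trig_minorant k z \<le> min (frac z) (1 - frac z)"
proof -
  define w where "w = frac z"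
  have w: "0 \<le> w" "w < 1" by (auto simp: w_def frac_lt_1)
  have per: "trig_minorant k (z + 1) = trig_minorant k z" for z
  proof -
    have "2 * pi * real k * (z + 1) = 2 * pi * real k * z + 2 * real k * pi" by (simp add: algebra_simps)
    then show ?thesis unfolding trig_minorant_def by (simp add: cos_add del: distrib_left)
  qed
  have bd: "trig_minorant k v \<le> \<bar>v\<bar>" for v
    using one_minus_cos_le[of "pi * real k * v"] assms
    by (simp add: trig_minorant_def divide_le_eq abs_mult algebra_simps)
  have "trig_minorant k z = trig_minorant k w" using periodic_frac[of "trig_minorant k" z, OF per] by (simp add: w_def)
  moreover have "trig_minorant k w = trig_minorant k (w - 1)" using per[of "w - 1"] by simp
  ultimately show ?thesis using bd[of w] bd[of "w - 1"] w by (simp add: w_def[symmetric])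
qed

lemma avg_cos:
  assumes "d > 0" "\<omega> > 0"
  shows "avg d (\<lambda>x. cos (\<omega> * x)) x = sin (\<omega> * d) / (\<omega> * d) * cos (\<omega> * x)"
proof -
  define F where "F = (\<lambda>u. sin (\<omega> * (x + u)) / \<omega>)"
  have "((\<lambda>u. cos (\<omega> * (x + u))) has_integral (F d - F (-d))) {-d..d}"
  proof (rule fundamental_theorem_of_calculus)
    fix u
    have "(F has_real_derivative cos (\<omega> * (x + u))) (at u within {-d..d})"
      unfolding F_def using assms by (auto intro!: derivative_eq_intros)
    then show "(F has_vector_derivative cos (\<omega> * (x + u))) (at u within {-d..d})"
      by (simp add: has_real_derivative_iff_has_vector_derivative)
  qed (use assms in auto)
  moreover have "F d - F (-d) = 2 * sin (\<omega> * d) * cos (\<omega> * x) / \<omega>"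
    by (simp add: F_def distrib_left sin_add right_diff_distrib sin_diff diff_divide_distrib[symmetric])
  ultimately show ?thesis using assms by (simp add: avg_def integral_unique)
qed

lemma bmeas_cos [intro]: "bmeas (\<lambda>x. cos (\<omega> * x + s))"
  by (rule bmeasI[where C=1]) auto

lemma bmeas_trig_minorant [intro, simp]: "bmeas (trig_minorant k)"
proof -
  have "bmeas (\<lambda>z. (1 / (2 * pi * real k)) * (1 - cos (2 * pi * real k * z + 0)))"
    by (intro bmeas_cmult bmeas_diff bmeas_const bmeas_cos)
  then show ?thesis by (simp add: trig_minorant_def[abs_def])
qed

lemma avg_pow_trig:
  assumes "d > 0" "\<omega> > 0"
  shows "(avg d ^^ n) (\<lambda>x. A + B * cos (\<omega> * x)) x = A + B * (sin (\<omega> * d) / (\<omega> * d)) ^ n * cos (\<omega> * x)"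
proof (induction n arbitrary: x)
  case (Suc n)
  define B' where "B' = B * (sin (\<omega> * d) / (\<omega> * d)) ^ n"
  have IH: "(avg d ^^ n) (\<lambda>x. A + B * cos (\<omega> * x)) = (\<lambda>x. A + B' * cos (\<omega> * x))"
    using Suc by (simp add: B'_def fun_eq_iff)
  have "bmeas (\<lambda>x. B' * cos (\<omega> * x))" using bmeas_cos[of \<omega> 0] by (auto intro!: bmeas_cmult)
  then have "avg d (\<lambda>x. A + B' * cos (\<omega> * x)) x = A + avg d (\<lambda>x. B' * cos (\<omega> * x)) x"
    using assms by (subst avg_add) auto
  also have "\<dots> = A + B' * (sin (\<omega> * d) / (\<omega> * d) * cos (\<omega> * x))"
    using avg_cos[OF assms] by simp
  finally show ?case unfolding funpow.simps o_def IH by (simp add: B'_def)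
qed auto

text \<open>Twice this number is the probability that a walk with step size d, started uniformly
  where \<open>upper\<close> vanishes, is found after n steps where \<open>upper\<close> is
  1.\<close>

definition flow :: "real \<Rightarrow> nat \<Rightarrow> real" where
  "flow d n = integral {0..1} (\<lambda>y. (1 - upper y) * (avg d ^^ n) upper y)"

lemma flow_corr: "d > 0 \<Longrightarrow> flow d n = (avg d ^^ n) (corr upper) 0"
  by (simp add: flow_def corr_def flip: corr_avg_pow)

lemma flow_ge_trig:
  assumes "d > 0" "k > 0"
  shows "(1 - (sin (2 * pi * real k * d) / (2 * pi * real k * d)) ^ n) / (2 * pi * real k) \<le> flow d n"
proof -
  have "(avg d ^^ n) (trig_minorant k) 0 \<le> (avg d ^^ n) (corr upper) 0"
    using assms corr_avg(2)[of d upper]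
    by (intro avg_pow_mono order_trans[OF trig_minorant_le[OF assms(2)] corr_upper_ge]) auto
  moreover have "trig_minorant k = (\<lambda>x. 1 / (2 * pi * real k) + (- 1 / (2 * pi * real k)) * cos (2 * pi * real k * x))"
    by (simp add: trig_minorant_def fun_eq_iff diff_divide_distrib)
  moreover have "(avg d ^^ n) (\<lambda>x. 1 / (2 * pi * real k) + (- 1 / (2 * pi * real k)) * cos (2 * pi * real k * x)) 0 =
      1 / (2 * pi * real k) + (- 1 / (2 * pi * real k)) * (sin (2 * pi * real k * d) / (2 * pi * real k * d)) ^ n * cos (2 * pi * real k * 0)"
    using assms by (intro avg_pow_trig) auto
  ultimately show ?thesis
    using assms by (simp only: flow_corr) (simp add: diff_divide_distrib)
qed

text \<open>The point is to stay clear of 1 / 2: with that flow every cycle would switch the level,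
  and the two-level chain would oscillate instead of mixing. A point and its shift by 1 / 2 cannot
  both have \<open>upper\<close> equal to 1, which turns the lower bound for the triangle wave into
  an upper one.\<close>

lemma flow_le:
  assumes d: "0 < d" "d < 1 / 4"
  shows "flow d n \<le> 1 / 2 - 1 / (2 * pi)"
proof -
  have le: "corr upper z \<le> (1 / 2 - 1 / (2 * pi)) + (- 1 / (2 * pi)) * cos (2 * pi * z)" for z
  proof -
    have "corr upper z + corr upper (z + 1 / 2) = integral {0..1} (\<lambda>y. (1 - upper y) * upper (y + z) + (1 - upper y) * upper (y + (z + 1 / 2)))"
      unfolding corr_def
      by (intro integral_add[symmetric] bmeas_integrable_on bmeas_mult bmeas_diff bmeas_const bmeas_shift' bmeas_upper)
    also have "\<dots> \<le> integral {0..1} (\<lambda>y. 1 - upper y)"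
    proof (rule integral_le)
      fix y :: real
      have "upper v + upper (v + 1 / 2) \<le> 1" for v
        by (auto simp: upper_def frac_add less_imp_le[OF frac_lt_1] split: if_splits)
      from this[of "y + z"] have "(1 - upper y) * (upper (y + z) + upper (y + (z + 1 / 2))) \<le> (1 - upper y) * 1"
        by (intro mult_left_mono) (auto simp: add.assoc)
      then show "(1 - upper y) * upper (y + z) + (1 - upper y) * upper (y + (z + 1 / 2)) \<le> 1 - upper y"
        by (simp add: distrib_left)
    qed (intro bmeas_integrable_on bmeas_add bmeas_mult bmeas_diff bmeas_const bmeas_shift' bmeas_upper)+
    also have "\<dots> = 1 / 2" by (rule integral_upper)
    finally have "corr upper z \<le> 1 / 2 - corr upper (z + 1 / 2)" by simp
    also have "\<dots> \<le> 1 / 2 - trig_minorant 1 (z + 1 / 2)"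
      using order_trans[OF trig_minorant_le[of 1 "z + 1 / 2"] corr_upper_ge] by simp
    also have "2 * pi * (z + 1 / 2) = 2 * pi * z + pi" by (simp add: algebra_simps)
    then have "trig_minorant 1 (z + 1 / 2) = (1 + cos (2 * pi * z)) / (2 * pi)"
      by (simp add: trig_minorant_def)
    finally show ?thesis by (simp add: add_divide_distrib)
  qed
  have bm: "bmeas (\<lambda>z. (1 / 2 - 1 / (2 * pi)) + (- 1 / (2 * pi)) * cos (2 * pi * z))"
    using bmeas_cos[of "2 * pi" 0] by (intro bmeas_add bmeas_cmult bmeas_const) auto
  have "flow d n \<le> (1 / 2 - 1 / (2 * pi)) + (- 1 / (2 * pi)) * (sin (2 * pi * d) / (2 * pi * d)) ^ n * cos (2 * pi * 0)"
  proof -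
    have "(avg d ^^ n) (corr upper) 0 \<le> (avg d ^^ n) (\<lambda>z. (1 / 2 - 1 / (2 * pi)) + (- 1 / (2 * pi)) * cos (2 * pi * z)) 0"
      by (intro avg_pow_mono corr_avg(2)[OF d(1)] bm le d bmeas_upper)
    also have "\<dots> = (1 / 2 - 1 / (2 * pi)) + (- 1 / (2 * pi)) * (sin (2 * pi * d) / (2 * pi * d)) ^ n * cos (2 * pi * 0)"
      using d by (intro avg_pow_trig) auto
    finally show ?thesis unfolding flow_corr[OF d(1)] .
  qed
  moreover have "sin (2 * pi * d) \<ge> 0" using d by (intro sin_ge_zero) auto
  then have "(sin (2 * pi * d) / (2 * pi * d)) ^ n \<ge> 0" using d by simp
  ultimately show ?thesis by (simp add: field_simps)
qed

lemma sinc_le: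
  fixes z :: real
  assumes "0 < z" "z\<^sup>2 \<le> 10"
  shows "sin z / z \<le> 1 - z\<^sup>2 / 12"
proof -
  have "\<bar>sin z - (\<Sum>m<5. sin_coeff m * z ^ m)\<bar> \<le> inverse (fact 5) * \<bar>z\<bar> ^ 5"
    by (rule Maclaurin_sin_bound)
  moreover have "(\<Sum>m<5. sin_coeff m * z ^ m) = z - z ^ 3 / 6"
    by (simp add: lessThan_nat_numeral lessThan_Suc sin_coeff_def fact_numeral)
  moreover have "inverse (fact 5) * \<bar>z\<bar> ^ 5 = z ^ 5 / 120"
    using assms(1) by (simp add: fact_numeral)
  ultimately have "sin z \<le> z - z ^ 3 / 6 + z ^ 5 / 120"
    unfolding abs_le_iff by linarith
  also have "z ^ 5 / 120 \<le> z ^ 3 / 12"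
  proof -
    have "z ^ 3 * z\<^sup>2 \<le> z ^ 3 * 10" using assms by (intro mult_left_mono) auto
    then show ?thesis by (simp add: power_add[symmetric])
  qed
  finally have "sin z \<le> z * (1 - z\<^sup>2 / 12)" by (simp add: algebra_simps power2_eq_square power3_eq_cube)
  then show ?thesis using assms(1) by (simp add: divide_le_eq mult.commute)
qed

text \<open>The walk spreads over a distance of order d sqrt n. The frequency k is the least one
  with 2 pi k d at least 1 / sqrt n: then n averaging steps damp the cosine in the minorant to at
  most 12 / 13 of its size, while the prefactor 1 / (2 pi k) still has the order of min (d sqrt n)
  1.\<close>

lemma flow_ge:
  assumes d: "0 < d" "d < 1 / 4" and n: "n \<ge> 1"
  shows "min (d * sqrt (real n)) 1 / 95 \<le> flow d n"
proof -
  define k where "k = nat \<lceil>1 / (2 * pi * d * sqrt (real n))\<rceil>"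
  define z where "z = 2 * pi * real k * d"
  have pos: "1 / (2 * pi * d * sqrt (real n)) > 0" using d n by simp
  have k0: "k > 0" using pos by (simp add: k_def)
  have k1: "1 / (2 * pi * d * sqrt (real n)) \<le> real k" using pos by (simp add: k_def)
  have k2: "real k \<le> 1 / (2 * pi * d * sqrt (real n)) + 1" using pos unfolding k_def by linarith
  have sn: "1 \<le> sqrt (real n)" using n by simp
  have pi: "pi < 3.2" using pi_approx by simp
  have z1: "1 / sqrt (real n) \<le> z"
    using mult_left_mono[OF k1, of "2 * pi * d"] d sn by (simp add: z_def mult.commute mult.left_commute)
  have "z \<le> 2 * pi * d * (1 / (2 * pi * d * sqrt (real n)) + 1)"
    using mult_left_mono[OF k2, of "2 * pi * d"] d by (simp add: z_def mult.commute mult.left_commute)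
  also have "\<dots> = 1 / sqrt (real n) + 2 * pi * d" using d by (simp add: distrib_left)
  also have "\<dots> \<le> 1 + pi / 2"
  proof -
    have "2 * pi * d \<le> 2 * pi * (1 / 4)" using d by (intro mult_left_mono) auto
    then have "2 * pi * d \<le> pi / 2" by simp
    moreover have "1 / sqrt (real n) \<le> 1" using sn by (simp add: divide_le_eq)
    ultimately show ?thesis by (rule add_mono[rotated])
  qed
  finally have z2: "z \<le> 1 + pi / 2" .
  have z0: "z > 0" using d k0 by (simp add: z_def)
  have "z \<le> 2.6" using z2 pi by simp
  then have "z\<^sup>2 \<le> 2.6\<^sup>2" using z0 by (intro power_mono) auto
  then have z10: "z\<^sup>2 \<le> 10" by (simp add: power2_eq_square)
  have sin0: "0 \<le> sin z" using z0 z2 pi pi_gt3 by (intro sin_ge_zero) auto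
  have "1 / real n \<le> z\<^sup>2"
    using power_mono[OF z1, of 2] sn n by (simp add: power_divide)
  then have "1 / (12 * real n) \<le> z\<^sup>2 / 12" by simp
  with sinc_le[OF z0 z10] have rho: "sin z / z \<le> 1 - 1 / (12 * real n)" by linarith
  have nn: "1 / (12 * real n) \<le> 1" using n by simp
  have "(sin z / z) ^ n \<le> (1 - 1 / (12 * real n)) ^ n"
    using rho sin0 z0 by (intro power_mono) auto
  also have "\<dots> \<le> 12 / 13"
  proof -
    have "(1 - 1 / (12 * real n)) ^ n * (1 + real n * (1 / (12 * real n))) \<le> (1 - 1 / (12 * real n)) ^ n * (1 + 1 / (12 * real n)) ^ n"
      using nn by (intro mult_left_mono Bernoulli_inequality) (auto intro: order_trans[of _ 0])
    also have "\<dots> = (1 - (1 / (12 * real n))\<^sup>2) ^ n" by (simp add: power_mult_distrib[symmetric] algebra_simps power2_eq_square)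
    also have "\<dots> \<le> 1"
    proof (rule power_le_one)
      have "(1 / (12 * real n))\<^sup>2 \<le> 1" using nn by (intro power_le_one) auto
      then show "0 \<le> 1 - (1 / (12 * real n))\<^sup>2" by simp
    qed simp
    finally show ?thesis using n by simp
  qed
  finally have "1 / 13 \<le> 1 - (sin z / z) ^ n" by simp
  then have "(1 / 13) / (2 * pi * real k) \<le> (1 - (sin z / z) ^ n) / (2 * pi * real k)"
    by (intro divide_right_mono) auto
  also have "\<dots> \<le> flow d n" using flow_ge_trig[OF d(1) k0, of n] by (simp add: z_def)
  finally have fl: "(1 / 13) / (2 * pi * real k) \<le> flow d n" .
  define m where "m = min (d * sqrt (real n)) 1"
  have m: "0 < m" "m \<le> 1" "m \<le> d * sqrt (real n)" using d n by (auto simp: m_def)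
  have "2 * pi * real k * m \<le> 2 * pi * (1 / (2 * pi * d * sqrt (real n)) + 1) * m"
    using k2 m by (intro mult_right_mono mult_left_mono) auto
  also have "\<dots> = m / (d * sqrt (real n)) + 2 * pi * m" using d n by (simp add: field_simps)
  also have "\<dots> \<le> 1 + 2 * pi * 1"
    using m d n by (intro add_mono mult_left_mono) (auto simp: divide_le_eq)
  \<comment> \<open>1 + 2 pi is about 7.283; the 95 of the statement is 13 times this number,
    rounded up.\<close>
  also have "\<dots> \<le> 95 / 13" using pi_approx by simp
  finally have "m / 95 \<le> (1 / 13) / (2 * pi * real k)" using k0 by (simp add: field_simps)
  with fl show ?thesis by (simp add: m_def)
qed

section \<open>The Metropolis operator\<close>

interpretation circ: prob_space circ_leb
  by (rule prob_space_circ_leb)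

lemma circ_dist_measurable_pair [measurable]:
  "(\<lambda>(x, y). circ_dist x y) \<in> borel_measurable (borel \<Otimes>\<^sub>M borel)"
  unfolding circ_dist_def by measurable

lemma circ_dist_commute: "circ_dist x y = circ_dist y x"
  by (simp add: circ_dist_def abs_minus_commute)

lemma circ_dist_frac_le: "circ_dist (frac x) (frac y) \<le> \<bar>x - y\<bar>"
proof -
  have *: "\<bar>frac x - frac y\<bar> < 1" using frac_lt_1[of x] frac_lt_1[of y] frac_ge_0[of x] frac_ge_0[of y] by linarith
  show ?thesis
  proof (cases "\<bar>x - y\<bar> \<ge> 1 / 2")
    case True
    then show ?thesis using * by (auto simp: circ_dist_def min_def)
  next
    case False
    define k where "k = \<lfloor>x\<rfloor> - \<lfloor>y\<rfloor>"
    have k: "x - y = frac x - frac y + of_int k" by (simp add: frac_def k_def)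
    then have "\<bar>of_int k :: real\<bar> < 2" using False * by linarith
    then have "k = -1 \<or> k = 0 \<or> k = 1" by linarith
    then show ?thesis using k * by (auto simp: circ_dist_def)
  qed
qed

lemma frac_Omega [simp]: "frac x \<in> Omega"
  by (simp add: Omega_def frac_lt_1)

lemma frac_id_Omega: "x \<in> Omega \<Longrightarrow> frac x = x"
  by (simp add: Omega_def frac_eq)

lemma id_borel_circ_leb: "(\<lambda>x. x) \<in> borel_measurable circ_leb"
  by (rule circ_leb_measurable) simp

lemma bmeas_integrable_circ [intro]:
  assumes "bmeas \<phi>" shows "integrable circ_leb \<phi>"
proof -
  obtain C where "\<And>x. \<bar>\<phi> x\<bar> \<le> C" "C \<ge> 0" using assms by (meson bmeasE)
  then show ?thesis using assms by (intro circ.integrable_const_bound[where B=C]) (auto intro: circ_leb_measurable)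
qed

lemma bmeas_if_circ_dist:
  assumes "bmeas \<phi>"
  shows "bmeas (\<lambda>y. if circ_dist x y < c then \<phi> y else 0)"
proof -
  obtain C where C: "\<And>x. \<bar>\<phi> x\<bar> \<le> C" "C \<ge> 0" using assms by (meson bmeasE)
  have [measurable]: "\<phi> \<in> borel_measurable borel" using assms by auto
  show ?thesis by (rule bmeasI[where C=C]) (measurable, use C in auto)
qed

text \<open>Written through increments of \<phi>, the step needs no separate term for the rejected
  mass, and operators with different acceptance functions differ by a single integral.\<close>

definition mh_op :: "real \<Rightarrow> (real \<Rightarrow> real \<Rightarrow> real) \<Rightarrow> (real \<Rightarrow> real) \<Rightarrow> real \<Rightarrow> real" where
  "mh_op c a \<phi> x = \<phi> x + (1 / (2 * c)) * (LINT y|circ_leb. (if circ_dist x y < c then a x y * (\<phi> y - \<phi> x) else 0))"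

locale acceptance =
  fixes a :: "real \<Rightarrow> real \<Rightarrow> real"
  assumes a_meas: "(\<lambda>(x, y). a x y) \<in> borel_measurable (borel \<Otimes>\<^sub>M borel)"
    and a_bounds: "\<And>x y. 0 \<le> a x y" "\<And>x y. a x y \<le> 1"
begin

lemma a_meas_comp:
  "f \<in> borel_measurable M \<Longrightarrow> g \<in> borel_measurable M \<Longrightarrow> (\<lambda>x. a (f x) (g x)) \<in> borel_measurable M"
  using measurable_compose[OF measurable_Pair a_meas, of f M g] by simp

lemma bmeas_a: "bmeas (a x)"
  by (rule bmeasI[where C=1, OF a_meas_comp]) (use a_bounds[of x] in auto)

lemma bmeas_integrand: "bmeas \<phi> \<Longrightarrow> bmeas (\<lambda>y. if circ_dist x y < c then a x y * (\<phi> y - \<phi> x) else 0)"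
  by (intro bmeas_if_circ_dist bmeas_mult bmeas_diff bmeas_const bmeas_a)

lemma bmeas_mh_op:
  assumes c: "c > 0" and \<phi>: "bmeas \<phi>"
  shows "bmeas (mh_op c a \<phi>)"
proof -
  obtain C where C: "\<And>x. \<bar>\<phi> x\<bar> \<le> C" "C \<ge> 0" using \<phi> by (meson bmeasE)
  have [measurable]: "\<phi> \<in> borel_measurable borel" using \<phi> by auto
  have snd [measurable]: "(\<lambda>p. snd p) \<in> borel_measurable (borel \<Otimes>\<^sub>M circ_leb)"
    by (rule measurable_compose[OF measurable_snd id_borel_circ_leb])
  have [measurable]: "(\<lambda>p. a (fst p) (snd p)) \<in> borel_measurable (borel \<Otimes>\<^sub>M circ_leb)"
    by (rule a_meas_comp) measurable
  have "(\<lambda>p. if circ_dist (fst p) (snd p) < c then a (fst p) (snd p) * (\<phi> (snd p) - \<phi> (fst p)) else 0)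
      \<in> borel_measurable (borel \<Otimes>\<^sub>M circ_leb)"
    by measurable
  then have "(\<lambda>x. LINT y|circ_leb. (if circ_dist x y < c then a x y * (\<phi> y - \<phi> x) else 0)) \<in> borel_measurable borel"
    by (intro circ.borel_measurable_lebesgue_integral) (simp add: split_beta')
  then have m: "mh_op c a \<phi> \<in> borel_measurable borel"
    unfolding mh_op_def[abs_def] by measurable
  have "\<bar>mh_op c a \<phi> x\<bar> \<le> C + (1 / (2 * c)) * (2 * C)" for x
  proof -
    have "\<bar>LINT y|circ_leb. (if circ_dist x y < c then a x y * (\<phi> y - \<phi> x) else 0)\<bar> \<le> (LINT y|circ_leb. 2 * C)"
      unfolding real_norm_def[symmetric]
    proof (rule Bochner_Integration.integral_norm_bound_integral)
      fix y
      have "\<bar>a x y * (\<phi> y - \<phi> x)\<bar> \<le> 1 * (2 * C)"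
        unfolding abs_mult
      proof (rule mult_mono)
        show "\<bar>\<phi> y - \<phi> x\<bar> \<le> 2 * C" using C(1)[of x] C(1)[of y] by linarith
      qed (use a_bounds[of x y] in auto)
      then show "norm (if circ_dist x y < c then a x y * (\<phi> y - \<phi> x) else 0) \<le> 2 * C"
        using C by auto
    qed (use bmeas_integrand[OF \<phi>] in auto)
    then have "\<bar>LINT y|circ_leb. (if circ_dist x y < c then a x y * (\<phi> y - \<phi> x) else 0)\<bar> \<le> 2 * C"
      using circ.prob_space by simp
    then have "\<bar>(1 / (2 * c)) * (LINT y|circ_leb. (if circ_dist x y < c then a x y * (\<phi> y - \<phi> x) else 0))\<bar> \<le> (1 / (2 * c)) * (2 * C)"
      using c unfolding abs_mult by (intro mult_mono) auto
    then show ?thesis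
      unfolding mh_op_def using C(1)[of x] by (intro order_trans[OF abs_triangle_ineq add_mono])
  qed
  then show ?thesis using m by (intro bmeasI)
qed

end

lemma measure_circ_ball:
  assumes c: "0 < c" "c \<le> 1 / 2" and x: "x \<in> Omega"
  shows "(LINT y|circ_leb. (if circ_dist x y < c then b else 0)) = 2 * c * b"
proof -
  have "(LINT y|circ_leb. (if circ_dist x y < c then b else 0)) = (LINT y|circ_leb. b * indicator {y \<in> Omega. circ_dist x y < c} y)"
    by (intro Bochner_Integration.integral_cong) auto
  also have "\<dots> = b * measure circ_leb {y \<in> Omega. circ_dist x y < c}"
  proof -
    have "{y \<in> Omega. circ_dist x y < c} \<inter> Omega = {y \<in> Omega. circ_dist x y < c}" by auto
    then show ?thesis using circ_ball_measurable[of x c] by simp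
  qed
  also have "measure circ_leb {y \<in> Omega. circ_dist x y < c} = 2 * c"
    using emeasure_circ_ball[OF assms] c by (simp add: measure_def)
  finally show ?thesis by simp
qed

context acceptance
begin

lemma mh_op_le:
  assumes c: "0 < c" "c \<le> 1 / 2" and x: "x \<in> Omega" and \<phi>: "bmeas \<phi>"
    and le: "\<phi> x \<le> b" "\<And>y. y \<in> Omega \<Longrightarrow> circ_dist x y < c \<Longrightarrow> a x y \<noteq> 0 \<Longrightarrow> \<phi> y \<le> b"
  shows "mh_op c a \<phi> x \<le> b"
proof -
  have "(LINT y|circ_leb. (if circ_dist x y < c then a x y * (\<phi> y - \<phi> x) else 0)) \<le>
      (LINT y|circ_leb. (if circ_dist x y < c then b - \<phi> x else 0))"
  proof (rule integral_mono)
    fix y assume y: "y \<in> space circ_leb"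
    show "(if circ_dist x y < c then a x y * (\<phi> y - \<phi> x) else 0) \<le> (if circ_dist x y < c then b - \<phi> x else 0)"
    proof (cases "circ_dist x y < c \<and> a x y \<noteq> 0")
      case True
      then have "a x y * (\<phi> y - \<phi> x) \<le> a x y * (b - \<phi> x)"
        using le(2)[of y] y a_bounds[of x y] by (intro mult_left_mono) auto
      also have "\<dots> \<le> 1 * (b - \<phi> x)" using le(1) a_bounds[of x y] by (intro mult_right_mono) auto
      finally show ?thesis using True by simp
    qed (use le(1) in auto)
  next
    have "bmeas (\<lambda>y. if circ_dist x y < c then b - \<phi> x else 0)"
      by (intro bmeas_if_circ_dist bmeas_const)
    then show "integrable circ_leb (\<lambda>y. if circ_dist x y < c then b - \<phi> x else 0)" by auto
  qed (use bmeas_integrand[OF \<phi>] in auto)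
  also have "\<dots> = 2 * c * (b - \<phi> x)" by (rule measure_circ_ball[OF c x])
  finally show ?thesis using c by (simp add: mh_op_def field_simps)
qed

lemma mh_op_uminus: "mh_op c a (\<lambda>x. - \<phi> x) x = - mh_op c a \<phi> x"
proof -
  have "(\<lambda>y. if circ_dist x y < c then a x y * (- \<phi> y - - \<phi> x) else 0) =
      (\<lambda>y. - (if circ_dist x y < c then a x y * (\<phi> y - \<phi> x) else 0))"
    by (auto simp: fun_eq_iff algebra_simps)
  then show ?thesis by (simp add: mh_op_def)
qed

lemma mh_op_ge:
  assumes c: "0 < c" "c \<le> 1 / 2" and x: "x \<in> Omega" and \<phi>: "bmeas \<phi>"
    and le: "b \<le> \<phi> x" "\<And>y. y \<in> Omega \<Longrightarrow> circ_dist x y < c \<Longrightarrow> a x y \<noteq> 0 \<Longrightarrow> b \<le> \<phi> y"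
  shows "b \<le> mh_op c a \<phi> x"
  using mh_op_le[OF c x bmeas_uminus[OF \<phi>], of "-b"] le by (simp add: mh_op_uminus)

lemma mh_op_diff_le:
  assumes c: "0 < c" "c \<le> 1 / 2" and x: "x \<in> Omega" and \<phi>: "bmeas \<phi>"
    and a': "acceptance a'"
    and e: "\<And>y. \<bar>a x y - a' x y\<bar> \<le> e" and osc: "\<And>y. y \<in> Omega \<Longrightarrow> \<bar>\<phi> y - \<phi> x\<bar> \<le> s"
  shows "\<bar>mh_op c a \<phi> x - mh_op c a' \<phi> x\<bar> \<le> e * s"
proof -
  interpret a': acceptance a' by fact
  let ?I = "\<lambda>a y. if circ_dist x y < c then a x y * (\<phi> y - \<phi> x) else 0"
  have "\<bar>LINT y|circ_leb. ?I a y - ?I a' y\<bar> \<le> (LINT y|circ_leb. (if circ_dist x y < c then e * s else 0))"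
    unfolding real_norm_def[symmetric]
  proof (rule Bochner_Integration.integral_norm_bound_integral)
    fix y assume y: "y \<in> space circ_leb"
    have "\<bar>(a x y - a' x y) * (\<phi> y - \<phi> x)\<bar> \<le> e * s"
      unfolding abs_mult using e[of y] osc[of y] y by (intro mult_mono) auto
    then show "norm (?I a y - ?I a' y) \<le> (if circ_dist x y < c then e * s else 0)"
      by (auto simp: left_diff_distrib)
  next
    have "bmeas (\<lambda>y. if circ_dist x y < c then e * s else 0)"
      by (intro bmeas_if_circ_dist bmeas_const)
    then show "integrable circ_leb (\<lambda>y. if circ_dist x y < c then e * s else 0)" by auto
  qed (intro bmeas_integrable_circ bmeas_diff bmeas_integrand a'.bmeas_integrand \<phi>)
  also have "\<dots> = 2 * c * (e * s)" by (rule measure_circ_ball[OF c x])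
  also have "(LINT y|circ_leb. ?I a y - ?I a' y) = 2 * c * (mh_op c a \<phi> x - mh_op c a' \<phi> x)"
  proof -
    have "(LINT y|circ_leb. ?I a y - ?I a' y) = (LINT y|circ_leb. ?I a y) - (LINT y|circ_leb. ?I a' y)"
      by (intro Bochner_Integration.integral_diff bmeas_integrable_circ bmeas_integrand a'.bmeas_integrand \<phi>)
    also have "\<dots> = 2 * c * (mh_op c a \<phi> x - mh_op c a' \<phi> x)" using c by (simp add: mh_op_def right_diff_distrib)
    finally show ?thesis .
  qed
  finally show ?thesis using c by (simp add: abs_mult)
qed

text \<open>Detailed balance makes \<psi> x * a x y * (\<phi> y - \<phi> x), restricted to close
  pairs, antisymmetric in x and y; by Fubini its double integral equals its own negative.\<close>

lemma mh_op_detailed_balance: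
  assumes c: "c > 0" and \<psi>: "bmeas \<psi>" and \<phi>: "bmeas \<phi>"
    and db: "\<And>x y. \<psi> x * a x y = \<psi> y * a y x"
  shows "(LINT x|circ_leb. \<psi> x * mh_op c a \<phi> x) = (LINT x|circ_leb. \<psi> x * \<phi> x)"
proof -
  interpret pair_prob_space circ_leb circ_leb ..
  obtain C where C: "\<And>x. \<bar>\<phi> x\<bar> \<le> C" "C \<ge> 0" using \<phi> by (meson bmeasE)
  obtain D where D: "\<And>x. \<bar>\<psi> x\<bar> \<le> D" "D \<ge> 0" using \<psi> by (meson bmeasE)
  have [measurable]: "\<phi> \<in> borel_measurable borel" "\<psi> \<in> borel_measurable borel" using \<phi> \<psi> by auto
  define G where "G = (\<lambda>x y. \<psi> x * (if circ_dist x y < c then a x y * (\<phi> y - \<phi> x) else 0))"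
  have G_eq: "G x y = (if circ_dist x y < c then (\<psi> x * a x y) * (\<phi> y - \<phi> x) else 0)" for x y
    by (simp add: G_def)
  have anti: "G x y = - G y x" for x y
    unfolding G_eq[of x y] G_eq[of y x] db[of x y] circ_dist_commute[of x y] by (simp flip: mult_minus_right)
  have [measurable]: "(\<lambda>p. fst p) \<in> borel_measurable (circ_leb \<Otimes>\<^sub>M circ_leb)"
    "(\<lambda>p. snd p) \<in> borel_measurable (circ_leb \<Otimes>\<^sub>M circ_leb)"
    using measurable_compose[OF measurable_snd id_borel_circ_leb] measurable_compose[OF measurable_fst id_borel_circ_leb] by auto
  have [measurable]: "(\<lambda>p. a (fst p) (snd p)) \<in> borel_measurable (circ_leb \<Otimes>\<^sub>M circ_leb)"
    by (rule a_meas_comp) measurable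
  have "integrable (circ_leb \<Otimes>\<^sub>M circ_leb) (case_prod G)"
  proof (rule P.integrable_const_bound[where B="D * (2 * C)"])
    show "AE p in circ_leb \<Otimes>\<^sub>M circ_leb. norm (case_prod G p) \<le> D * (2 * C)"
    proof (rule AE_I2, clarify)
      fix x y :: real
      have "\<bar>a x y * (\<phi> y - \<phi> x)\<bar> \<le> 1 * (2 * C)"
        unfolding abs_mult
      proof (rule mult_mono)
        show "\<bar>\<phi> y - \<phi> x\<bar> \<le> 2 * C" using C(1)[of x] C(1)[of y] by linarith
      qed (use a_bounds[of x y] in auto)
      then show "norm (G x y) \<le> D * (2 * C)"
        using D C unfolding G_def real_norm_def case_prod_conv abs_mult[of "\<psi> x"] by (intro mult_mono) auto
    qed
    show "case_prod G \<in> borel_measurable (circ_leb \<Otimes>\<^sub>M circ_leb)"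
      unfolding G_def split_beta' by measurable
  qed
  then have "(LINT x|circ_leb. LINT y|circ_leb. G x y) = (LINT y|circ_leb. LINT x|circ_leb. G x y)"
    by (rule Fubini_integral[symmetric])
  also have "\<dots> = - (LINT y|circ_leb. LINT x|circ_leb. G y x)"
    by (subst anti) simp
  finally have zero: "(LINT x|circ_leb. LINT y|circ_leb. G x y) = 0" by simp
  have "\<psi> x * mh_op c a \<phi> x = \<psi> x * \<phi> x + (1 / (2 * c)) * (LINT y|circ_leb. G x y)" for x
    by (simp add: mh_op_def G_def distrib_left)
  then have eq: "(LINT y|circ_leb. G x y) = 2 * c * (\<psi> x * mh_op c a \<phi> x - \<psi> x * \<phi> x)" for x
    using c by (simp add: field_simps)
  have "integrable circ_leb (\<lambda>x. \<psi> x * mh_op c a \<phi> x)" "integrable circ_leb (\<lambda>x. \<psi> x * \<phi> x)"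
    using bmeas_mh_op[OF c \<phi>] \<phi> \<psi> by auto
  then show ?thesis
    using zero c unfolding eq by simp
qed

end

lemma integral_periodic_shift:
  assumes F: "bmeas F" and per: "\<And>x. F (x + 1) = F x"
  shows "integral {s..s + 1} F = integral {0..1} F"
proof -
  define w where "w = frac s"
  have w: "0 \<le> w" "w < 1" by (auto simp: w_def frac_lt_1)
  have "integral {s..s + 1} F = integral {w..w + 1} (\<lambda>u. F (of_int \<lfloor>s\<rfloor> + u))"
    by (subst integral_shift_real[OF F]) (simp add: w_def frac_def)
  also have "(\<lambda>u. F (of_int \<lfloor>s\<rfloor> + u)) = F"
    using periodic_int[of F _ "\<lfloor>s\<rfloor>", OF per] by (simp add: add.commute fun_eq_iff)
  also have "integral {w..w + 1} F = integral {w..1} F + integral {1..w + 1} F"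
    using w F by (intro Henstock_Kurzweil_Integration.integral_combine[symmetric]) auto
  also have "integral {1..w + 1} F = integral {0..w} (\<lambda>u. F (1 + u))"
    by (subst integral_shift_real[OF F]) (simp add: add.commute)
  also have "(\<lambda>u. F (1 + u)) = F" using per by (simp add: add.commute)
  also have "integral {w..1} F + integral {0..w} F = integral {0..1} F"
    using w Henstock_Kurzweil_Integration.integral_combine[of 0 w 1 F] bmeas_integrable_on[OF F, of 0 1] by simp
  finally show ?thesis .
qed

lemma circ_ball_integral:
  assumes c: "0 < c" "c \<le> 1 / 2" and x: "x \<in> Omega" and \<phi>: "bmeas \<phi>" and per: "\<And>x. \<phi> (x + 1) = \<phi> x"
  shows "(LINT y|circ_leb. (if circ_dist x y < c then \<phi> y else 0)) = integral {x - c..x + c} \<phi>"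
proof -
  \<comment> \<open>The restricted integrand is continued with period 1. The period [0, 1] may then
    be exchanged for the one centred at x, on which the circular distance is simply the absolute
    difference.\<close>
  define F where "F = (\<lambda>y. if circ_dist x (frac y) < c then \<phi> y else 0)"
  obtain C where C: "\<And>x. \<bar>\<phi> x\<bar> \<le> C" "C \<ge> 0" using \<phi> by (meson bmeasE)
  have [measurable]: "\<phi> \<in> borel_measurable borel" using \<phi> by auto
  have [measurable]: "(frac :: real \<Rightarrow> real) \<in> borel_measurable borel" unfolding frac_def[abs_def] by measurable
  have F: "bmeas F" unfolding F_def by (rule bmeasI[where C=C]) (measurable, use C in auto)
  have Fper: "F (y + 1) = F y" for y using per by (simp add: F_def frac_def)
  have "(LINT y|circ_leb. (if circ_dist x y < c then \<phi> y else 0)) = (LINT y|circ_leb. F y)"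
    by (intro Bochner_Integration.integral_cong) (auto simp: F_def frac_id_Omega)
  also have "\<dots> = integral {0..1} F" by (rule circ_leb_integral[OF F])
  also have "\<dots> = integral {x - 1/2..x + 1/2} F"
    using integral_periodic_shift[OF F Fper, of "x - 1/2"] by (simp add: add.commute)
  also have "\<dots> = integral {x - 1/2..x + 1/2} (\<lambda>y. if y \<in> {x - c<..<x + c} then \<phi> y else 0)"
  proof (rule Henstock_Kurzweil_Integration.integral_cong)
    fix y assume y: "y \<in> {x - 1/2..x + 1/2}"
    have x01: "0 \<le> x" "x < 1" using x by (auto simp: Omega_def)
    consider "0 \<le> y" "y < 1" | "y < 0" | "1 \<le> y" by linarith
    then have "circ_dist x (frac y) = \<bar>x - y\<bar>"
    proof cases
      case 1
      then show ?thesis using y by (auto simp: frac_eq circ_dist_def min_def abs_if)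
    next
      case 2
      then have "frac y = y + 1" using y x01 by (intro frac_unique_iff[THEN iffD2]) auto
      then show ?thesis using y x01 2 by (auto simp: circ_dist_def min_def abs_if)
    next
      case 3
      then have "frac y = y - 1" using y x01 by (intro frac_unique_iff[THEN iffD2]) auto
      then show ?thesis using y x01 3 by (auto simp: circ_dist_def min_def abs_if)
    qed
    then show "F y = (if y \<in> {x - c<..<x + c} then \<phi> y else 0)" by (auto simp: F_def)
  qed
  also have "\<dots> = integral {x - 1/2..x + 1/2} (\<lambda>y. if y \<in> {x - c..x + c} then \<phi> y else 0)"
    by (rule integral_spike[of "{x - c, x + c}"]) auto
  also have "\<dots> = integral {x - c..x + c} \<phi>"
    by (rule integral_restrict_Int[THEN trans], rule arg_cong[where f = "\<lambda>S. integral S \<phi>"]) (use c in auto)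
  finally show ?thesis .
qed

lemma mh_op_avg:
  assumes c: "0 < c" "c \<le> 1 / 2" and x: "x \<in> Omega" and \<phi>: "bmeas \<phi>" and per: "\<And>x. \<phi> (x + 1) = \<phi> x"
  shows "mh_op c (\<lambda>_ _. 1) \<phi> x = avg c \<phi> x"
proof -
  have "bmeas (\<lambda>y. \<phi> y - \<phi> x)" using \<phi> by auto
  then have "(LINT y|circ_leb. (if circ_dist x y < c then \<phi> y - \<phi> x else 0)) = integral {x - c..x + c} (\<lambda>y. \<phi> y - \<phi> x)"
    by (rule circ_ball_integral[OF c x]) (simp add: per)
  also have "\<dots> = integral {x - c..x + c} \<phi> - 2 * c * \<phi> x"
    using c \<phi> by (subst integral_diff) auto
  finally show ?thesis
    using c by (simp add: mh_op_def avg_alt[OF \<phi>] field_simps cong: if_cong)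
qed

lemma acceptance_one: "acceptance (\<lambda>_ _. 1)"
  by unfold_locales auto

text \<open>Acceptance probability of the Metropolis-Hastings step when moves from the low to the high
  potential are accepted with probability \<open>\<delta>\<close>; \<open>\<delta> = exp (- H)\<close> gives the actual step.\<close>

definition acc :: "nat \<Rightarrow> real \<Rightarrow> real \<Rightarrow> real \<Rightarrow> real" where
  "acc M \<delta> x y = 1 - (1 - \<delta>) * (upper (real M * x) * (1 - upper (real M * y)))"

lemma upper_cases: "upper x = 0 \<or> upper x = 1" by (auto simp: upper_def)

lemma acceptance_acc: "0 \<le> \<delta> \<Longrightarrow> \<delta> \<le> 1 \<Longrightarrow> acceptance (acc M \<delta>)"
proof
  assume \<delta>: "0 \<le> \<delta>" "\<delta> \<le> 1"
  show "(\<lambda>(x, y). acc M \<delta> x y) \<in> borel_measurable (borel \<Otimes>\<^sub>M borel)"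
    unfolding acc_def by measurable
  show "0 \<le> acc M \<delta> x y" "acc M \<delta> x y \<le> 1" for x y
    using upper_cases[of "real M * x"] upper_cases[of "real M * y"] \<delta> by (auto simp: acc_def)
qed

lemma acc_target_dens:
  assumes "H \<ge> 0"
  shows "min 1 (target_dens M H y / target_dens M H x) = acc M (exp (- H)) x y"
proof -
  have e: "1 + exp H > 0" by (simp add: add_pos_pos)
  have "1 \<le> exp H" using assms by simp
  moreover have "(2 / (1 + E)) / (2 * E / (1 + E)) = 1 / E" "(2 * E / (1 + E)) / (2 / (1 + E)) = E"
    if "E > 0" for E :: real
  proof -
    have *: "(u / s) / (v / s) = u / v" if "s \<noteq> 0" for u v s :: real
      using that by (cases "v = 0") (auto simp: field_simps)
    show "(2 / (1 + E)) / (2 * E / (1 + E)) = 1 / E" "(2 * E / (1 + E)) / (2 / (1 + E)) = E"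
      using that *[of "1 + E" 2 "2 * E"] *[of "1 + E" "2 * E" 2] by simp_all
  qed
  from this[of "exp H"] have "(2 / (1 + exp H)) / (2 * exp H / (1 + exp H)) = exp (- H)"
    "(2 * exp H / (1 + exp H)) / (2 / (1 + exp H)) = exp H"
    by (simp_all only: exp_gt_zero exp_minus inverse_eq_divide)
  ultimately show ?thesis using e assms
    by (auto simp: target_dens_def acc_def upper_def)
qed

lemma potential_upper: "potential M H x = H * (1 - upper (real M * x))"
  by (simp add: potential_def upper_def)

lemma integral_bind_bounded:
  fixes f :: "'b \<Rightarrow> real"
  assumes M: "M \<in> space (prob_algebra A)" and N: "N \<in> A \<rightarrow>\<^sub>M prob_algebra B"
    and f [measurable]: "f \<in> borel_measurable B" and bd: "\<And>x. x \<in> space B \<Longrightarrow> \<bar>f x\<bar> \<le> C"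
  shows "(\<integral>x. f x \<partial>(M \<bind> N)) = (\<integral>x. (\<integral>y. f y \<partial>N x) \<partial>M)"
proof -
  have sM: "sets M = sets A" and pM: "prob_space M" using M by (auto simp: space_prob_algebra)
  have spM: "space M = space A" using sM by (rule sets_eq_imp_space_eq)
  interpret M: prob_space M by fact
  have bind: "M \<bind> N \<in> space (prob_algebra B)" using M N by (rule bind_in_prob_algebra)
  then interpret b: prob_space "M \<bind> N" by (auto simp: space_prob_algebra)
  have sb: "sets (M \<bind> N) = sets B" using bind by (auto simp: space_prob_algebra)
  have Nx: "prob_space (N x)" "sets (N x) = sets B" if "x \<in> space M" for x
    using measurable_space[OF N, of x] that spM by (auto simp: space_prob_algebra)
  have N': "N \<in> M \<rightarrow>\<^sub>M subprob_algebra B"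
    using measurable_prob_algebraD[OF N] sM by (simp cong: measurable_cong_sets)
  \<comment> \<open>Adding C makes the integrand nonnegative, so that the rule for nonnegative
    integrals over a bind applies; C is subtracted again at the end.\<close>
  define g where "g = (\<lambda>x. f x + C)"
  have g0: "x \<in> space B \<Longrightarrow> 0 \<le> g x" for x using bd[of x] by (auto simp: g_def abs_le_iff)
  have fm: "f \<in> borel_measurable K" if "sets K = sets B" for K using f that by (simp cong: measurable_cong_sets)
  have fi: "integrable K f" if "prob_space K" "sets K = sets B" for K
  proof -
    interpret K: prob_space K by fact
    show ?thesis
      by (rule K.integrable_const_bound[where B=C])
         (use fm[OF that(2)] bd sets_eq_imp_space_eq[OF that(2)] in auto)
  qed
  have gi: "integrable K g" "(\<integral>x. g x \<partial>K) = (\<integral>x. f x \<partial>K) + C" "(\<integral>\<^sup>+x. g x \<partial>K) = ennreal (\<integral>x. g x \<partial>K)" "0 \<le> (\<integral>x. g x \<partial>K)"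
    "(\<integral>x. g x \<partial>K) \<le> 2 * C"
    if "prob_space K" "sets K = sets B" for K
  proof -
    interpret K: prob_space K by fact
    note i = fi[OF that]
    have sp: "space K = space B" by (rule sets_eq_imp_space_eq[OF that(2)])
    show gi: "integrable K g" using i by (simp add: g_def)
    show "(\<integral>x. g x \<partial>K) = (\<integral>x. f x \<partial>K) + C" using i by (simp add: g_def K.prob_space)
    show "(\<integral>\<^sup>+x. g x \<partial>K) = ennreal (\<integral>x. g x \<partial>K)"
      by (rule nn_integral_eq_integral[OF gi]) (use g0 sp in auto)
    show "0 \<le> (\<integral>x. g x \<partial>K)" by (rule integral_nonneg_AE) (use g0 sp in auto)
    have "(\<integral>x. g x \<partial>K) \<le> (\<integral>x. 2 * C \<partial>K)"
      by (rule integral_mono[OF gi]) (use bd sp in \<open>auto simp: g_def abs_le_iff\<close>)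
    then show "(\<integral>x. g x \<partial>K) \<le> 2 * C" by (simp add: K.prob_space)
  qed
  have mG: "(\<lambda>x. \<integral>y. g y \<partial>N x) \<in> borel_measurable M"
    by (rule measurable_compose[OF N' integral_measurable_subprob_algebra]) (simp add: g_def)
  have iG: "integrable M (\<lambda>x. \<integral>y. g y \<partial>N x)"
    by (rule M.integrable_const_bound[where B="2*C"]) (use gi(4,5)[OF Nx] mG in auto)
  have "ennreal (\<integral>x. g x \<partial>(M \<bind> N)) = (\<integral>\<^sup>+x. g x \<partial>(M \<bind> N))"
    using gi(3)[of "M \<bind> N"] sb b.prob_space_axioms by simp
  also have "\<dots> = (\<integral>\<^sup>+x. \<integral>\<^sup>+y. g y \<partial>N x \<partial>M)"
    by (rule nn_integral_bind[OF _ N']) (simp add: g_def)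
  also have "\<dots> = (\<integral>\<^sup>+x. ennreal (\<integral>y. g y \<partial>N x) \<partial>M)"
    by (intro nn_integral_cong gi(3) Nx)
  also have "\<dots> = ennreal (\<integral>x. \<integral>y. g y \<partial>N x \<partial>M)"
    by (rule nn_integral_eq_integral[OF iG]) (use gi(4)[OF Nx] in auto)
  finally have "(\<integral>x. g x \<partial>(M \<bind> N)) = (\<integral>x. \<integral>y. g y \<partial>N x \<partial>M)"
    
  proof (subst (asm) ennreal_inj)
    show "0 \<le> (\<integral>x. \<integral>y. g y \<partial>N x \<partial>M)" by (rule integral_nonneg_AE) (use gi(4)[OF Nx] in auto)
  qed (use gi(4)[of "M \<bind> N"] sb b.prob_space_axioms in auto)
  moreover have "(\<integral>x. \<integral>y. g y \<partial>N x \<partial>M) = (\<integral>x. (\<integral>y. f y \<partial>N x) + C \<partial>M)"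
    by (intro Bochner_Integration.integral_cong refl gi(2) Nx)
  moreover have "integrable M (\<lambda>x. \<integral>y. f y \<partial>N x)"
  proof -
    have "integrable M (\<lambda>x. (\<integral>y. g y \<partial>N x) - C)" using iG by simp
    then show ?thesis by (rule Bochner_Integration.integrable_cong[THEN iffD1, rotated 2]) (auto simp: gi(2)[OF Nx])
  qed
  then have "(\<integral>x. (\<integral>y. f y \<partial>N x) + C \<partial>M) = (\<integral>x. \<integral>y. f y \<partial>N x \<partial>M) + C"
    by (simp add: M.prob_space)
  ultimately show ?thesis
    using gi(2)[of "M \<bind> N"] sb b.prob_space_axioms by simp
qed

lemma integral_proposal:
  assumes "bmeas \<phi>" and that: "c > 0"
  shows "(\<integral>y. \<phi> y \<partial>proposal c x) = (1 / (2 * c)) * (LINT y|circ_leb. (if circ_dist x y < c then \<phi> y else 0))"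
proof -
  have [measurable]: "\<phi> \<in> borel_measurable borel" using assms by auto
  have "proposal c x = density circ_leb (\<lambda>y. ennreal (1 / (2 * c) * indicator {y. circ_dist x y < c} y))"
    unfolding proposal_def by (intro arg_cong[where f="density circ_leb"] ext) (simp add: indicator_def)
  then have "(\<integral>y. \<phi> y \<partial>proposal c x) = (LINT y|circ_leb. (1 / (2 * c) * indicator {y. circ_dist x y < c} y) *\<^sub>R \<phi> y)"
    using that by (simp only:) (rule integral_density, auto intro: circ_leb_measurable)
  also have "\<dots> = (LINT y|circ_leb. 1 / (2 * c) * (if circ_dist x y < c then \<phi> y else 0))"
    by (intro Bochner_Integration.integral_cong) (auto simp: indicator_def)
  finally show ?thesis by simp
qed

lemma integral_mh_kernel:
  assumes c: "0 < c" "c \<le> 1 / 2" and x: "x \<in> Omega" and \<phi>: "bmeas \<phi>"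
    and w [measurable]: "w \<in> borel_measurable borel" and w0: "\<And>y. 0 \<le> w y"
  shows "(\<integral>y. \<phi> y \<partial>mh_kernel c w x) = mh_op c (\<lambda>x y. min 1 (w y / w x)) \<phi> x"
proof -
  obtain C where C: "\<And>x. \<bar>\<phi> x\<bar> \<le> C" "C \<ge> 0" using \<phi> by (meson bmeasE)
  have [measurable]: "\<phi> \<in> borel_measurable borel" using \<phi> by auto
  define r where "r = (\<lambda>y. min 1 (w y / w x))"
  have r: "0 \<le> r y" "r y \<le> 1" for y using w0 by (auto simp: r_def)
  have [measurable]: "r \<in> borel_measurable borel" by (simp add: r_def)
  have acc: "acceptance (\<lambda>x y. min 1 (w y / w x))" by unfold_locales (use w0 in auto)
  have [measurable]: "(\<lambda>y. measure_pmf (bernoulli_pmf (r y))) \<in> circ_leb \<rightarrow>\<^sub>M prob_algebra (count_space UNIV)"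
    by (rule bernoulli_kernel) (use r in \<open>auto intro: circ_leb_measurable\<close>)
  have [measurable]: "(\<lambda>y. x) \<in> circ_leb \<Otimes>\<^sub>M count_space (UNIV :: bool set) \<rightarrow>\<^sub>M circ_leb"
    using x by simp
  let ?N = "\<lambda>y. measure_pmf (bernoulli_pmf (r y)) \<bind> (\<lambda>accept. return circ_leb (if accept then y else x))"
  have N: "?N \<in> circ_leb \<rightarrow>\<^sub>M prob_algebra circ_leb"
    by (rule measurable_bind_prob_space2[where N = "count_space UNIV"]) measurable
  have inner: "(\<integral>z. \<phi> z \<partial>?N y) = r y * \<phi> y + (1 - r y) * \<phi> x" if y: "y \<in> Omega" for y
  proof -
    have "(\<integral>z. \<phi> z \<partial>?N y) = (\<integral>b. (\<integral>z. \<phi> z \<partial>return circ_leb (if b then y else x)) \<partial>measure_pmf (bernoulli_pmf (r y)))"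
    proof (rule integral_bind_bounded[where A="count_space UNIV" and B=circ_leb and C=C])
      show "measure_pmf (bernoulli_pmf (r y)) \<in> space (prob_algebra (count_space UNIV))"
        by (simp add: space_prob_algebra measure_pmf.prob_space_axioms)
      show "(\<lambda>accept. return circ_leb (if accept then y else x)) \<in> count_space UNIV \<rightarrow>\<^sub>M prob_algebra circ_leb"
        using x y by (auto simp: space_prob_algebra intro!: prob_space_return)
    qed (use C in \<open>auto intro: circ_leb_measurable\<close>)
    also have "\<dots> = (\<integral>b. \<phi> (if b then y else x) \<partial>measure_pmf (bernoulli_pmf (r y)))"
      using x y by (intro Bochner_Integration.integral_cong integral_return) (auto intro: circ_leb_measurable)
    also have "\<dots> = r y * \<phi> y + (1 - r y) * \<phi> x" using r[of y] by (simp add: mult.commute)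
    finally show ?thesis .
  qed
  have "mh_kernel c w x = proposal c x \<bind> ?N" by (simp add: mh_kernel_def r_def)
  also have "(\<integral>y. \<phi> y \<partial>(proposal c x \<bind> ?N)) = (\<integral>y. (\<integral>z. \<phi> z \<partial>?N y) \<partial>proposal c x)"
  proof (rule integral_bind_bounded[OF _ N circ_leb_measurable])
    show "proposal c x \<in> space (prob_algebra circ_leb)"
      using prob_space_proposal[OF c x] by (simp add: space_prob_algebra)
  qed (use C in auto)
  also have "\<dots> = (\<integral>y. r y * \<phi> y + (1 - r y) * \<phi> x \<partial>proposal c x)"
    by (intro Bochner_Integration.integral_cong inner) auto
  also have "\<dots> = (1 / (2 * c)) * (LINT y|circ_leb. (if circ_dist x y < c then r y * \<phi> y + (1 - r y) * \<phi> x else 0))"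
  proof (rule integral_proposal)
    have "bmeas r" by (rule bmeasI[where C=1]) (use r in auto)
    then show "bmeas (\<lambda>y. r y * \<phi> y + (1 - r y) * \<phi> x)"
      by (intro bmeas_add bmeas_mult bmeas_diff bmeas_const \<phi>)
  qed (fact c)
  also have "(LINT y|circ_leb. (if circ_dist x y < c then r y * \<phi> y + (1 - r y) * \<phi> x else 0)) =
     (LINT y|circ_leb. (if circ_dist x y < c then r y * (\<phi> y - \<phi> x) else 0) + (if circ_dist x y < c then \<phi> x else 0))"
    by (intro Bochner_Integration.integral_cong) (auto simp: algebra_simps)
  also have "\<dots> = (LINT y|circ_leb. (if circ_dist x y < c then r y * (\<phi> y - \<phi> x) else 0)) + 2 * c * \<phi> x"
  proof -
    have "bmeas (\<lambda>y. if circ_dist x y < c then \<phi> x else 0)"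
      by (intro bmeas_if_circ_dist bmeas_const)
    moreover have "bmeas (\<lambda>y. if circ_dist x y < c then r y * (\<phi> y - \<phi> x) else 0)"
      using acceptance.bmeas_integrand[OF acc \<phi>, of x c] unfolding r_def .
    ultimately show ?thesis
      by (subst Bochner_Integration.integral_add) (auto simp: measure_circ_ball[OF c x])
  qed
  finally show ?thesis using c unfolding mh_op_def r_def by (simp add: field_simps)
qed

section \<open>Reflected walk and Koksma's inequality\<close>

lemma integral_le_open:
  fixes f g :: "real \<Rightarrow> real"
  assumes "f integrable_on {a..b}" "g integrable_on {a..b}" "\<And>y. a < y \<Longrightarrow> y < b \<Longrightarrow> f y \<le> g y"
  shows "integral {a..b} f \<le> integral {a..b} g"
proof -
  have "integral {a<..<b} f \<le> integral {a<..<b} g"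
    using assms by (intro integral_le) (auto simp: integrable_on_open_interval_real)
  then show ?thesis by (simp add: integral_open_interval_real)
qed

text \<open>On a single arc \<open>(l, r)\<close> of the set of low potential, this is a random walk step of size at
  most \<open>c\<close> in which moves that would leave the arc are rejected.\<close>

definition reject :: "real \<Rightarrow> real \<Rightarrow> real \<Rightarrow> (real \<Rightarrow> real) \<Rightarrow> real \<Rightarrow> real" where
  "reject c l r \<phi> x = \<phi> x + (1 / (2 * c)) * integral {max l (x - c)..min r (x + c)} (\<lambda>y. \<phi> y - \<phi> x)"

text \<open>Stochastic monotonicity. In passing from x to x' the upward part U loses at most c
  \<Delta> and the downward part L gains at most c \<Delta>. After the prefactor 1 / (2 c) this
  costs at most \<Delta>, which is what the leading term \<phi> gains.\<close>

lemma reject_mono: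
  assumes c: "c > 0" and int: "\<And>a b. \<phi> integrable_on {a..b::real}"
    and mono: "\<And>x y. l < x \<Longrightarrow> x \<le> y \<Longrightarrow> y < r \<Longrightarrow> \<phi> x \<le> \<phi> y"
    and x: "l < x" "x \<le> x'" "x' < r"
  shows "reject c l r \<phi> x \<le> reject c l r \<phi> x'"
proof -
  define \<Delta> where "\<Delta> = \<phi> x' - \<phi> x"
  have \<Delta>: "\<Delta> \<ge> 0" using mono[OF x] by (simp add: \<Delta>_def)
  have i: "(\<lambda>y. \<phi> y - b) integrable_on {u..v}" "(\<lambda>y. b - \<phi> y) integrable_on {u..v}" for b u v
    by (intro integrable_diff int integrable_const_ivl)+
  define U where "U = (\<lambda>x. integral {x..min r (x + c)} (\<lambda>y. \<phi> y - \<phi> x))"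
  define L where "L = (\<lambda>x. integral {max l (x - c)..x} (\<lambda>y. \<phi> x - \<phi> y))"
  have split: "reject c l r \<phi> x = \<phi> x + (1 / (2 * c)) * (U x - L x)" if "l < x" "x < r" for x
  proof -
    have "integral {max l (x - c)..x} (\<lambda>y. \<phi> y - \<phi> x) + integral {x..min r (x + c)} (\<lambda>y. \<phi> y - \<phi> x) =
        integral {max l (x - c)..min r (x + c)} (\<lambda>y. \<phi> y - \<phi> x)"
      using that c by (intro Henstock_Kurzweil_Integration.integral_combine i) auto
    moreover have "L x = - integral {max l (x - c)..x} (\<lambda>y. \<phi> y - \<phi> x)"
      unfolding L_def by (subst integral_neg[symmetric]) simp
    ultimately show ?thesis by (simp add: reject_def U_def)
  qed
  have U0: "U x' \<ge> 0"
    unfolding U_def using integral_le_open[of "\<lambda>_. 0" x' "min r (x' + c)" "\<lambda>y. \<phi> y - \<phi> x'"] mono x i by auto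
  have L0: "L x \<ge> 0"
    unfolding L_def using integral_le_open[of "\<lambda>_. 0" "max l (x - c)" x "\<lambda>y. \<phi> x - \<phi> y"] mono x i by auto
  have U: "U x \<le> c * \<Delta> + U x'"
  proof (cases "min r (x + c) \<le> x'")
    case True
    have "U x \<le> integral {x..min r (x + c)} (\<lambda>_. \<Delta>)"
      unfolding U_def using True x mono by (intro integral_le_open i) (auto simp: \<Delta>_def)
    also have "\<dots> = (min r (x + c) - x) * \<Delta>" using x c by auto
    also have "\<dots> \<le> c * \<Delta>" using \<Delta> by (intro mult_right_mono) auto
    finally show ?thesis using U0 by simp
  next
    case False
    have "U x = integral {x..x'} (\<lambda>y. \<phi> y - \<phi> x) + integral {x'..min r (x + c)} (\<lambda>y. \<phi> y - \<phi> x)"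
      unfolding U_def using x False by (intro Henstock_Kurzweil_Integration.integral_combine[symmetric] i) auto
    also have "integral {x..x'} (\<lambda>y. \<phi> y - \<phi> x) \<le> integral {x..x'} (\<lambda>_. \<Delta>)"
      using x mono by (intro integral_le_open i) (auto simp: \<Delta>_def)
    also have "integral {x..x'} (\<lambda>_. \<Delta>) = (x' - x) * \<Delta>" using x by auto
    also have "integral {x'..min r (x + c)} (\<lambda>y. \<phi> y - \<phi> x) = integral {x'..min r (x + c)} (\<lambda>y. (\<phi> y - \<phi> x') + \<Delta>)"
      by (simp add: \<Delta>_def)
    also have "\<dots> = integral {x'..min r (x + c)} (\<lambda>y. \<phi> y - \<phi> x') + (min r (x + c) - x') * \<Delta>"
      using False by (subst integral_add) (auto intro: i)
    also have "integral {x'..min r (x + c)} (\<lambda>y. \<phi> y - \<phi> x') \<le> U x'"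
    proof -
      have "integral {x'..min r (x + c)} (\<lambda>y. \<phi> y - \<phi> x') + integral {min r (x + c)..min r (x' + c)} (\<lambda>y. \<phi> y - \<phi> x') = U x'"
        unfolding U_def using False x by (intro Henstock_Kurzweil_Integration.integral_combine i) auto
      moreover have "0 \<le> integral {min r (x + c)..min r (x' + c)} (\<lambda>y. \<phi> y - \<phi> x')"
        using integral_le_open[of "\<lambda>_. 0" "min r (x + c)" "min r (x' + c)" "\<lambda>y. \<phi> y - \<phi> x'"] mono x i False by auto
      ultimately show ?thesis by simp
    qed
    finally have "U x \<le> U x' + (min r (x + c) - x) * \<Delta>" by (simp add: algebra_simps)
    also have "(min r (x + c) - x) * \<Delta> \<le> c * \<Delta>" using \<Delta> by (intro mult_right_mono) auto
    finally show ?thesis by simp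
  qed
  have L: "L x' \<le> c * \<Delta> + L x"
  proof (cases "x \<le> max l (x' - c)")
    case True
    have "L x' \<le> integral {max l (x' - c)..x'} (\<lambda>_. \<Delta>)"
      unfolding L_def using True x mono by (intro integral_le_open i) (auto simp: \<Delta>_def)
    also have "\<dots> = (x' - max l (x' - c)) * \<Delta>" using x c by auto
    also have "\<dots> \<le> c * \<Delta>" using \<Delta> by (intro mult_right_mono) auto
    finally show ?thesis using L0 by simp
  next
    case False
    have "L x' = integral {max l (x' - c)..x} (\<lambda>y. \<phi> x' - \<phi> y) + integral {x..x'} (\<lambda>y. \<phi> x' - \<phi> y)"
      unfolding L_def using x False by (intro Henstock_Kurzweil_Integration.integral_combine[symmetric] i) auto
    also have "integral {x..x'} (\<lambda>y. \<phi> x' - \<phi> y) \<le> integral {x..x'} (\<lambda>_. \<Delta>)"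
      using x mono by (intro integral_le_open i) (auto simp: \<Delta>_def)
    also have "integral {x..x'} (\<lambda>_. \<Delta>) = (x' - x) * \<Delta>" using x by auto
    also have "integral {max l (x' - c)..x} (\<lambda>y. \<phi> x' - \<phi> y) = integral {max l (x' - c)..x} (\<lambda>y. (\<phi> x - \<phi> y) + \<Delta>)"
      by (simp add: \<Delta>_def)
    also have "\<dots> = integral {max l (x' - c)..x} (\<lambda>y. \<phi> x - \<phi> y) + (x - max l (x' - c)) * \<Delta>"
      using False by (subst integral_add) (auto intro: i)
    also have "integral {max l (x' - c)..x} (\<lambda>y. \<phi> x - \<phi> y) \<le> L x"
    proof -
      have "integral {max l (x - c)..max l (x' - c)} (\<lambda>y. \<phi> x - \<phi> y) + integral {max l (x' - c)..x} (\<lambda>y. \<phi> x - \<phi> y) = L x"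
        unfolding L_def using False x by (intro Henstock_Kurzweil_Integration.integral_combine i) auto
      moreover have "0 \<le> integral {max l (x - c)..max l (x' - c)} (\<lambda>y. \<phi> x - \<phi> y)"
        using integral_le_open[of "\<lambda>_. 0" "max l (x - c)" "max l (x' - c)" "\<lambda>y. \<phi> x - \<phi> y"] mono x i False by auto
      ultimately show ?thesis by simp
    qed
    finally have "L x' \<le> L x + (x' - max l (x' - c)) * \<Delta>" by (simp add: algebra_simps)
    also have "(x' - max l (x' - c)) * \<Delta> \<le> c * \<Delta>" using \<Delta> by (intro mult_right_mono) auto
    finally show ?thesis by simp
  qed
  have "(1 / (2 * c)) * (U x - L x - (U x' - L x')) \<le> (1 / (2 * c)) * (2 * c * \<Delta>)"
    using U L c by (intro mult_left_mono) auto
  then have "(1 / (2 * c)) * (U x - L x) - (1 / (2 * c)) * (U x' - L x') \<le> \<Delta>"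
    using c by (simp add: right_diff_distrib)
  then show ?thesis
    using split[of x] split[of x'] x by (simp add: \<Delta>_def)
qed

lemma reject_id:
  assumes c: "c > 0" and x: "l < x" "x < r"
  shows "reject c l r (\<lambda>y. y) x = x + (1 / (4 * c)) * ((min (r - x) c)\<^sup>2 - (min (x - l) c)\<^sup>2)"
proof -
  have "((\<lambda>y. y - x) has_integral ((min r (x + c) - x)\<^sup>2 / 2 - (max l (x - c) - x)\<^sup>2 / 2)) {max l (x - c)..min r (x + c)}"
  proof (rule fundamental_theorem_of_calculus)
    fix y
    have "((\<lambda>y. (y - x)\<^sup>2 / 2) has_real_derivative (y - x)) (at y within {max l (x - c)..min r (x + c)})"
      by (auto intro!: derivative_eq_intros)
    then show "((\<lambda>y. (y - x)\<^sup>2 / 2) has_vector_derivative (y - x)) (at y within {max l (x - c)..min r (x + c)})"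
      by (simp add: has_real_derivative_iff_has_vector_derivative)
  qed (use c x in auto)
  moreover have "min r (x + c) - x = min (r - x) c" "max l (x - c) - x = - min (x - l) c"
    by (auto simp: min_def max_def)
  ultimately have "reject c l r (\<lambda>y. y) x = x + (1 / (2 * c)) * ((min (r - x) c)\<^sup>2 / 2 - (min (x - l) c)\<^sup>2 / 2)"
    by (simp add: reject_def integral_unique)
  also have "(1 / (2 * c)) * (A / 2 - B / 2) = (1 / (4 * c)) * (A - B)" for A B :: real
    by (simp add: diff_divide_distrib[symmetric])
  finally show ?thesis .
qed

text \<open>If \<phi> is 1-Lipschitz, then id + \<phi> and id - \<phi> are increasing, so
  \<open>reject_mono\<close> bounds the increment of the image of \<phi> by that of the image of id.
  The latter is not expanded, because the ends of the arc only push the walker inward.\<close>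

lemma reject_lipschitz:
  assumes c: "c > 0" and int: "\<And>a b. \<phi> integrable_on {a..b::real}"
    and lip: "\<And>x y. l < x \<Longrightarrow> x \<le> y \<Longrightarrow> y < r \<Longrightarrow> \<bar>\<phi> x - \<phi> y\<bar> \<le> y - x"
    and x: "l < x" "x \<le> x'" "x' < r"
  shows "\<bar>reject c l r \<phi> x - reject c l r \<phi> x'\<bar> \<le> x' - x"
proof -
  have iid: "(\<lambda>y::real. y) integrable_on {a..b}" for a b
    by (rule integrable_continuous_real) (rule continuous_on_id)
  have id: "reject c l r (\<lambda>y. y) x' - reject c l r (\<lambda>y. y) x \<le> x' - x"
  proof -
    have "(min (r - x') c)\<^sup>2 \<le> (min (r - x) c)\<^sup>2" "(min (x - l) c)\<^sup>2 \<le> (min (x' - l) c)\<^sup>2"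
      using x c by (auto intro!: power_mono)
    then have "(1 / (4 * c)) * ((min (r - x') c)\<^sup>2 - (min (x' - l) c)\<^sup>2) \<le> (1 / (4 * c)) * ((min (r - x) c)\<^sup>2 - (min (x - l) c)\<^sup>2)"
      using c by (intro mult_left_mono) auto
    then show ?thesis using x c by (simp add: reject_id)
  qed
  have lin: "reject c l r (\<lambda>y. y + s * \<phi> y) z = reject c l r (\<lambda>y. y) z + s * reject c l r \<phi> z" for s z
  proof -
    let ?I = "{max l (z - c)..min r (z + c)}"
    have "integral ?I (\<lambda>y. (y + s * \<phi> y) - (z + s * \<phi> z)) = integral ?I (\<lambda>y. (y - z) + s * (\<phi> y - \<phi> z))"
      by (simp add: algebra_simps)
    also have "\<dots> = integral ?I (\<lambda>y. y - z) + s * integral ?I (\<lambda>y. \<phi> y - \<phi> z)"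
      by (subst integral_add) (auto intro!: integrable_diff int iid integrable_on_mult_right)
    finally show ?thesis by (simp add: reject_def algebra_simps)
  qed
  have mono: "reject c l r (\<lambda>y. y + s * \<phi> y) x \<le> reject c l r (\<lambda>y. y + s * \<phi> y) x'" if "s = 1 \<or> s = -1" for s
  proof (rule reject_mono[OF c _ _ x])
    show "(\<lambda>y. y + s * \<phi> y) integrable_on {a..b}" for a b
      by (intro integrable_add iid integrable_on_mult_right int)
    show "x + s * \<phi> x \<le> y + s * \<phi> y" if "l < x" "x \<le> y" "y < r" for x y
      using lip[OF that] \<open>s = 1 \<or> s = -1\<close> by auto
  qed
  show ?thesis
    using mono[of 1] mono[of "-1"] id unfolding lin by (auto simp: abs_le_iff)
qed

section \<open>Arcs of low potential and iterates of the walk that rejects exits\<close>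

definition same_arc :: "nat \<Rightarrow> real \<Rightarrow> real \<Rightarrow> bool" where
  "same_arc M x y \<longleftrightarrow> \<lfloor>real M * x\<rfloor> = \<lfloor>real M * y\<rfloor>"

locale stripes =
  fixes M :: nat and c :: real
  assumes M: "M > 1" and c: "0 < c" "c < 1 / (4 * real M)"
begin

lemma Mc: "real M * c < 1 / 4" "0 < real M * c" "c < 1 / 8" "c \<le> 1 / 2" "c \<le> 1 / 4"
proof -
  show 1: "real M * c < 1 / 4" using c M by (simp add: field_simps)
  show "0 < real M * c" using c M by simp
  have "2 * c \<le> real M * c" using M c by (intro mult_right_mono) auto
  then show "c < 1 / 8" "c \<le> 1 / 2" "c \<le> 1 / 4" using 1 by auto
qed

lemma same_arc_bounds:
  assumes "upper (real M * x) = 1"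
  shows "(of_int \<lfloor>real M * x\<rfloor> + 1 / 2) / real M < x" "x < (of_int \<lfloor>real M * x\<rfloor> + 1) / real M"
proof -
  have "frac (real M * x) > 1 / 2" using assms by (auto simp: upper_def split: if_splits)
  then show "(of_int \<lfloor>real M * x\<rfloor> + 1 / 2) / real M < x"
    using M by (simp add: frac_def field_simps)
  show "x < (of_int \<lfloor>real M * x\<rfloor> + 1) / real M"
    using M floor_correct[of "real M * x"] by (simp add: field_simps)
qed

lemma in_arc:
  assumes "(of_int j + 1 / 2) / real M < y" "y < (of_int j + 1) / real M"
  shows "upper (real M * y) = 1" "\<lfloor>real M * y\<rfloor> = j"
proof -
  have *: "of_int j + 1 / 2 < real M * y" "real M * y < of_int j + 1" using assms M by (simp_all add: field_simps)
  show fl: "\<lfloor>real M * y\<rfloor> = j" using * by (intro floor_unique) auto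
  then show "upper (real M * y) = 1" using * by (simp add: upper_def frac_def)
qed

lemma different_arcs:
  assumes "upper (real M * x) = 1" "upper (real M * y) = 1" "\<not> same_arc M x y"
  shows "\<bar>x - y\<bar> \<ge> 1 / (2 * real M)"
proof -
  have *: "y - x \<ge> 1 / (2 * real M)" if xy: "upper (real M * x) = 1" "upper (real M * y) = 1" "\<lfloor>real M * x\<rfloor> < \<lfloor>real M * y\<rfloor>" for x y
  proof -
    have "real M * x < of_int \<lfloor>real M * x\<rfloor> + 1" by linarith
    moreover have "frac (real M * y) > 1 / 2" using xy by (auto simp: upper_def split: if_splits)
    then have "real M * y > of_int \<lfloor>real M * y\<rfloor> + 1 / 2" by (simp add: frac_def)
    moreover have "(of_int \<lfloor>real M * x\<rfloor> :: real) + 1 \<le> of_int \<lfloor>real M * y\<rfloor>" using xy(3) by linarith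
    ultimately have "real M * (y - x) \<ge> 1 / 2" by (simp add: algebra_simps)
    then show ?thesis using M by (simp add: field_simps)
  qed
  show ?thesis
    using assms *[of x y] *[of y x] by (cases "\<lfloor>real M * x\<rfloor> < \<lfloor>real M * y\<rfloor>") (auto simp: same_arc_def)
qed

lemma same_arc_le:
  assumes "upper (real M * x) = 1" "upper (real M * y) = 1" "same_arc M x y"
  shows "\<bar>x - y\<bar> \<le> 1 / (2 * real M)"
proof -
  have "frac (real M * x) > 1 / 2" "frac (real M * y) > 1 / 2"
    using assms by (auto simp: upper_def split: if_splits)
  then have "\<bar>real M * x - real M * y\<bar> < 1 / 2"
  proof -
    assume *: "frac (real M * x) > 1 / 2" "frac (real M * y) > 1 / 2"
    have "(of_int \<lfloor>real M * x\<rfloor> :: real) = of_int \<lfloor>real M * y\<rfloor>" using assms(3) by (simp add: same_arc_def)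
    then show ?thesis
      using * frac_lt_1[of "real M * x"] frac_lt_1[of "real M * y"] unfolding frac_def by linarith
  qed
  then have "real M * \<bar>x - y\<bar> < 1 / 2" using M by (simp flip: right_diff_distrib add: abs_mult)
  then show ?thesis using M by (simp add: field_simps)
qed

text \<open>Different arcs are at least 1 / (2 M) > c apart. Points near 0 on the right, up to 1 /
  (2 M), belong to the other level, so two arcs cannot come close through the identification of 0
  and 1 either.\<close>

lemma close_upper:
  assumes x: "x \<in> Omega" "upper (real M * x) = 1" and y: "y \<in> Omega" "upper (real M * y) = 1"
    and d: "circ_dist x y < c"
  shows "\<bar>x - y\<bar> < c" "same_arc M x y"
proof -
  have lo: "z \<ge> 1 / (2 * real M)" if "z \<in> Omega" "upper (real M * z) = 1" for z
  proof (rule ccontr)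
    assume "\<not> z \<ge> 1 / (2 * real M)"
    then have "real M * z < 1 / 2" using M by (simp add: field_simps)
    moreover have "0 \<le> real M * z" using that by (auto simp: Omega_def)
    ultimately have "upper (real M * z) = 0" by (simp add: upper_def frac_eq[THEN iffD2])
    with that show False by simp
  qed
  have "c < 1 / (2 * real M)" using c(2) by (rule order_less_le_trans) (use M in \<open>simp add: field_simps\<close>)
  moreover have "x < 1" "y < 1" using x y by (auto simp: Omega_def)
  ultimately show "\<bar>x - y\<bar> < c" using d lo[OF x] lo[OF y] by (auto simp: circ_dist_def min_def abs_if split: if_splits)
  then show "same_arc M x y"
    using different_arcs[OF x(2) y(2)] \<open>c < 1 / (2 * real M)\<close> by auto
qed

lemma mh_op_reject:
  assumes x: "x \<in> Omega" "upper (real M * x) = 1" and \<phi>: "bmeas \<phi>"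
  shows "mh_op c (acc M 0) \<phi> x =
    reject c ((of_int \<lfloor>real M * x\<rfloor> + 1 / 2) / real M) ((of_int \<lfloor>real M * x\<rfloor> + 1) / real M) \<phi> x"
proof -
  define l where "l = (of_int \<lfloor>real M * x\<rfloor> + 1 / 2) / real M"
  define r where "r = (of_int \<lfloor>real M * x\<rfloor> + 1) / real M"
  have lx: "l < x" "x < r" using same_arc_bounds[OF x(2)] by (auto simp: l_def r_def)
  have x01: "0 \<le> x" "x < 1" using x by (auto simp: Omega_def)
  have j: "0 \<le> \<lfloor>real M * x\<rfloor>" "\<lfloor>real M * x\<rfloor> < int M"
    using x01 M by (auto simp: floor_less_iff)
  have l0: "0 \<le> l" using j by (simp add: l_def)
  have r1: "r \<le> 1"
  proof -
    have "of_int \<lfloor>real M * x\<rfloor> + 1 \<le> real M" using j(2) by linarith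
    then show ?thesis using M by (simp add: r_def)
  qed
  have eq: "(if circ_dist x y < c then acc M 0 x y * (\<phi> y - \<phi> x) else 0) =
      (if y \<in> {max l (x - c)<..<min r (x + c)} then \<phi> y - \<phi> x else 0)" if y: "y \<in> Omega" for y
  proof (cases "y \<in> {max l (x - c)<..<min r (x + c)}")
    case True
    then have "upper (real M * y) = 1" using in_arc[of "\<lfloor>real M * x\<rfloor>" y] by (auto simp: l_def r_def)
    moreover have "\<bar>x - y\<bar> < c" using True by (auto simp: abs_less_iff)
    then have "circ_dist x y < c" by (simp add: circ_dist_def min_less_iff_disj)
    ultimately show ?thesis using True x by (simp add: acc_def)
  next
    case False
    have "\<not> (circ_dist x y < c \<and> upper (real M * y) = 1)"
    proof
      assume *: "circ_dist x y < c \<and> upper (real M * y) = 1"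
      then have "\<bar>x - y\<bar> < c" "same_arc M x y" using close_upper[OF x y] by auto
      moreover have "l < y" "y < r"
        using same_arc_bounds[of y] * \<open>same_arc M x y\<close> by (auto simp: l_def r_def same_arc_def)
      ultimately show False using False by auto
    qed
    then show ?thesis using False x upper_cases[of "real M * y"] by (auto simp: acc_def)
  qed
  obtain C where C: "\<And>x. \<bar>\<phi> x\<bar> \<le> C" "C \<ge> 0" using \<phi> by (meson bmeasE)
  have [measurable]: "\<phi> \<in> borel_measurable borel" using \<phi> by auto
  have bm: "bmeas (\<lambda>y. if y \<in> {max l (x - c)<..<min r (x + c)} then \<phi> y - \<phi> x else 0)"
  proof (rule bmeasI[where C="2 * C"])
    show "\<bar>if y \<in> {max l (x - c)<..<min r (x + c)} then \<phi> y - \<phi> x else 0\<bar> \<le> 2 * C" for y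
      using C(1)[of x] C(1)[of y] by auto
  qed measurable
  have "(LINT y|circ_leb. (if circ_dist x y < c then acc M 0 x y * (\<phi> y - \<phi> x) else 0)) =
      (LINT y|circ_leb. (if y \<in> {max l (x - c)<..<min r (x + c)} then \<phi> y - \<phi> x else 0))"
    by (intro Bochner_Integration.integral_cong) (auto simp only: eq space_circ_leb)
  also have "\<dots> = integral {0..1} (\<lambda>y. if y \<in> {max l (x - c)<..<min r (x + c)} then \<phi> y - \<phi> x else 0)"
    by (rule circ_leb_integral[OF bm])
  also have "\<dots> = integral ({0..1} \<inter> {max l (x - c)<..<min r (x + c)}) (\<lambda>y. \<phi> y - \<phi> x)"
    by (subst integral_restrict_Int) (simp only: Int_commute)
  also have "{0..1} \<inter> {max l (x - c)<..<min r (x + c)} = {max l (x - c)<..<min r (x + c)}"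
    using l0 r1 by auto
  also have "integral \<dots> (\<lambda>y. \<phi> y - \<phi> x) = integral {max l (x - c)..min r (x + c)} (\<lambda>y. \<phi> y - \<phi> x)"
    by (rule integral_open_interval_real[symmetric])
  finally show ?thesis by (simp add: mh_op_def reject_def l_def r_def)
qed

lemma acceptance_reject: "acceptance (acc M 0)"
  by (rule acceptance_acc) auto

lemma bmeas_reject_pow [intro]: "bmeas f \<Longrightarrow> bmeas ((mh_op c (acc M 0) ^^ n) f)"
  by (induction n) (auto intro: acceptance.bmeas_mh_op[OF acceptance_reject] c(1))

text \<open>The rejected walk never leaves its arc. The first bound is preserved by
  \<open>reject_lipschitz\<close>; the second says that averaging f within an arc of length 1 / (2
  M) moves it by no more than its oscillation there.\<close>

lemma reject_pow_invariants:
  assumes f: "bmeas f" and lip: "\<And>x y. x \<in> Omega \<Longrightarrow> y \<in> Omega \<Longrightarrow> \<bar>f x - f y\<bar> \<le> \<bar>x - y\<bar>"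
    and x: "x \<in> Omega" "upper (real M * x) = 1" and y: "y \<in> Omega" "upper (real M * y) = 1"
    and arc: "same_arc M x y"
  defines "\<phi> \<equiv> \<lambda>n. (mh_op c (acc M 0) ^^ n) f"
  shows "\<bar>\<phi> n x - \<phi> n y\<bar> \<le> \<bar>x - y\<bar>" "\<bar>\<phi> n x - f y\<bar> \<le> 1 / (2 * real M)"
proof -
  have "\<bar>\<phi> n x - \<phi> n y\<bar> \<le> \<bar>x - y\<bar> \<and> \<bar>\<phi> n x - f y\<bar> \<le> 1 / (2 * real M)"
    using x y arc
  proof (induction n arbitrary: x y)
    case 0
    then show ?case using lip[of x y] same_arc_le[of x y] by (simp add: \<phi>_def)
  next
    case (Suc n)
    have bm: "bmeas (\<phi> n)" using f by (auto simp: \<phi>_def)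
    have S: "\<phi> (Suc n) = mh_op c (acc M 0) (\<phi> n)" by (simp add: \<phi>_def)
    have fl: "\<lfloor>real M * x\<rfloor> = \<lfloor>real M * y\<rfloor>" using Suc.prems by (simp add: same_arc_def)
    define l where "l = (of_int \<lfloor>real M * x\<rfloor> + 1 / 2) / real M"
    define r where "r = (of_int \<lfloor>real M * x\<rfloor> + 1) / real M"
    have bx: "l < x" "x < r" using same_arc_bounds[of x] Suc.prems by (auto simp: l_def r_def)
    have byy: "l < y" "y < r" using same_arc_bounds[of y] Suc.prems fl by (auto simp: l_def r_def)
    have x01: "0 \<le> x" "x < 1" using Suc.prems by (auto simp: Omega_def)
    have jj: "0 \<le> \<lfloor>real M * x\<rfloor>" "\<lfloor>real M * x\<rfloor> < int M"
      using x01 M by (auto simp: floor_less_iff)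
    have l0: "0 \<le> l" using jj by (simp add: l_def)
    have r1: "r \<le> 1"
    proof -
      have "of_int \<lfloor>real M * x\<rfloor> + 1 \<le> real M" using jj(2) by linarith
      then show ?thesis using M by (simp add: r_def)
    qed
    have liparc: "\<bar>\<phi> n u - \<phi> n v\<bar> \<le> v - u" if "l < u" "u \<le> v" "v < r" for u v
    proof -
      have "upper (real M * u) = 1" "upper (real M * v) = 1" "same_arc M u v"
        using in_arc[of "\<lfloor>real M * x\<rfloor>" u] in_arc[of "\<lfloor>real M * x\<rfloor>" v] that
        by (auto simp: l_def r_def same_arc_def)
      moreover have "u \<in> Omega" "v \<in> Omega" using that l0 r1 by (auto simp: Omega_def)
      ultimately show ?thesis using Suc.IH[of u v] that by auto
    qed
    have eqs: "\<phi> (Suc n) x = reject c l r (\<phi> n) x" "\<phi> (Suc n) y = reject c l r (\<phi> n) y"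
      unfolding S using Suc.prems bm fl by (simp_all add: mh_op_reject l_def r_def)
    have 1: "\<bar>\<phi> (Suc n) x - \<phi> (Suc n) y\<bar> \<le> \<bar>x - y\<bar>"
    proof (cases "x \<le> y")
      case True
      then show ?thesis
        unfolding eqs using reject_lipschitz[of c "\<phi> n" l r x y] liparc bx byy c(1) bmeas_integrable_on[OF bm] by auto
    next
      case False
      then show ?thesis
        unfolding eqs using reject_lipschitz[of c "\<phi> n" l r y x] liparc bx byy c(1) bmeas_integrable_on[OF bm] by (auto simp: abs_minus_commute)
    qed
    have near: "\<bar>\<phi> n z - f y\<bar> \<le> 1 / (2 * real M)" if z: "z \<in> Omega" "circ_dist x z < c" "acc M 0 x z \<noteq> 0" for z
    proof -
      have "upper (real M * z) = 1" using z Suc.prems upper_cases[of "real M * z"] by (auto simp: acc_def)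
      moreover from this have "same_arc M x z" using close_upper[of x z] z Suc.prems by auto
      ultimately show ?thesis using Suc.IH[of z y] z Suc.prems by (auto simp: same_arc_def)
    qed
    have nearx: "\<bar>\<phi> n x - f y\<bar> \<le> 1 / (2 * real M)" using Suc.IH[of x y] Suc.prems by auto
    have "\<phi> (Suc n) x \<le> f y + 1 / (2 * real M)"
      unfolding S by (rule acceptance.mh_op_le[OF acceptance_reject c(1) Mc(4) _ bm])
        (use near nearx Suc.prems in \<open>auto simp: abs_le_iff algebra_simps\<close>)
    moreover have "f y - 1 / (2 * real M) \<le> \<phi> (Suc n) x"
      unfolding S by (rule acceptance.mh_op_ge[OF acceptance_reject c(1) Mc(4) _ bm])
        (use near nearx Suc.prems in \<open>auto simp: abs_le_iff algebra_simps\<close>)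
    ultimately show ?case using 1 by (auto simp: abs_le_iff algebra_simps)
  qed
  then show "\<bar>\<phi> n x - \<phi> n y\<bar> \<le> \<bar>x - y\<bar>" "\<bar>\<phi> n x - f y\<bar> \<le> 1 / (2 * real M)" by auto
qed

text \<open>Across arcs, each of the two values has moved by at most 1 / (2 M), and this is at most
  the distance of the points because the arcs lie that far apart; together with f itself this makes
  the factor 3.\<close>

lemma reject_pow_lipschitz:
  assumes f: "bmeas f" and lip: "\<And>x y. x \<in> Omega \<Longrightarrow> y \<in> Omega \<Longrightarrow> \<bar>f x - f y\<bar> \<le> \<bar>x - y\<bar>"
    and x: "x \<in> Omega" "upper (real M * x) = 1" and y: "y \<in> Omega" "upper (real M * y) = 1"
  shows "\<bar>(mh_op c (acc M 0) ^^ n) f x - (mh_op c (acc M 0) ^^ n) f y\<bar> \<le> 3 * \<bar>x - y\<bar>"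
proof (cases "same_arc M x y")
  case True
  have "\<bar>(mh_op c (acc M 0) ^^ n) f x - (mh_op c (acc M 0) ^^ n) f y\<bar> \<le> \<bar>x - y\<bar>"
    using f lip x y True by (rule reject_pow_invariants(1))
  also have "\<dots> \<le> 3 * \<bar>x - y\<bar>" by simp
  finally show ?thesis .
next
  case False
  have "\<bar>(mh_op c (acc M 0) ^^ n) f x - f x\<bar> \<le> 1 / (2 * real M)"
    using f lip x x by (rule reject_pow_invariants(2)) (auto simp: same_arc_def)
  moreover have "\<bar>(mh_op c (acc M 0) ^^ n) f y - f y\<bar> \<le> 1 / (2 * real M)"
    using f lip y y by (rule reject_pow_invariants(2)) (auto simp: same_arc_def)
  ultimately show ?thesis
    using lip[OF x(1) y(1)] different_arcs[OF x(2) y(2) False] by (simp add: abs_le_iff)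
qed

end

text \<open>McShane's extension, clipped to [-B, B]. The iterates of the rejected walk are Lipschitz
  on the low-potential set only, while \<open>koksma\<close> wants a Lipschitz factor on the whole
  line.\<close>

lemma lipschitz_extension:
  fixes \<phi> :: "real \<Rightarrow> real"
  assumes S: "S \<noteq> {}" and C: "C \<ge> 0"
    and lip: "\<And>x y. x \<in> S \<Longrightarrow> y \<in> S \<Longrightarrow> \<bar>\<phi> x - \<phi> y\<bar> \<le> C * \<bar>x - y\<bar>"
    and B: "\<And>x. x \<in> S \<Longrightarrow> \<bar>\<phi> x\<bar> \<le> B"
  obtains \<psi> where "\<And>x. x \<in> S \<Longrightarrow> \<psi> x = \<phi> x" "\<And>x y. \<bar>\<psi> x - \<psi> y\<bar> \<le> C * \<bar>x - y\<bar>" "\<And>x. \<bar>\<psi> x\<bar> \<le> B"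
proof -
  define \<psi> where "\<psi> = (\<lambda>x. INF y\<in>S. \<phi> y + C * \<bar>x - y\<bar>)"
  obtain y0 where y0: "y0 \<in> S" using S by auto
  have bdd: "bdd_below ((\<lambda>y. \<phi> y + C * \<bar>x - y\<bar>) ` S)" for x
  proof (rule bdd_belowI2)
    fix y assume "y \<in> S"
    have "C * \<bar>y0 - y\<bar> \<le> C * (\<bar>x - y\<bar> + \<bar>x - y0\<bar>)" using C by (intro mult_left_mono) auto
    then show "\<phi> y0 - C * \<bar>x - y0\<bar> \<le> \<phi> y + C * \<bar>x - y\<bar>"
      using lip[OF y0 \<open>y \<in> S\<close>] by (simp add: algebra_simps)
  qed
  have eq: "\<psi> x = \<phi> x" if "x \<in> S" for x
  proof (rule antisym)
    show "\<psi> x \<le> \<phi> x" unfolding \<psi>_def using cINF_lower[OF bdd that, of x] by simp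
    show "\<phi> x \<le> \<psi> x" unfolding \<psi>_def
    proof (rule cINF_greatest[OF S])
      fix y assume "y \<in> S"
      then show "\<phi> x \<le> \<phi> y + C * \<bar>x - y\<bar>" using lip[OF that \<open>y \<in> S\<close>] by linarith
    qed
  qed
  have le: "\<psi> x \<le> \<psi> z + C * \<bar>x - z\<bar>" for x z
  proof -
    have "\<psi> x - C * \<bar>x - z\<bar> \<le> \<psi> z" unfolding \<psi>_def
    proof (rule cINF_greatest[OF S])
      fix y assume y: "y \<in> S"
      have "(INF y\<in>S. \<phi> y + C * \<bar>x - y\<bar>) \<le> \<phi> y + C * \<bar>x - y\<bar>" by (rule cINF_lower[OF bdd y])
      also have "C * \<bar>x - y\<bar> \<le> C * (\<bar>x - z\<bar> + \<bar>z - y\<bar>)" using C by (intro mult_left_mono) auto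
      finally show "(INF y\<in>S. \<phi> y + C * \<bar>x - y\<bar>) - C * \<bar>x - z\<bar> \<le> \<phi> y + C * \<bar>z - y\<bar>" by (simp add: algebra_simps)
    qed
    then show ?thesis by simp
  qed
  have lip': "\<bar>\<psi> x - \<psi> y\<bar> \<le> C * \<bar>x - y\<bar>" for x y
    using le[of x y] le[of y x] by (simp add: abs_le_iff abs_minus_commute)
  have B0: "B \<ge> 0" using B[OF y0] by linarith
  define \<psi>' where "\<psi>' = (\<lambda>x. max (- B) (min B (\<psi> x)))"
  have "\<psi>' x = \<phi> x" if "x \<in> S" for x
    using eq[OF that] B[OF that] by (auto simp: \<psi>'_def abs_le_iff)
  moreover have "\<bar>\<psi>' x - \<psi>' y\<bar> \<le> C * \<bar>x - y\<bar>" for x y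
  proof -
    have "\<bar>\<psi>' x - \<psi>' y\<bar> \<le> \<bar>\<psi> x - \<psi> y\<bar>" by (auto simp: \<psi>'_def min_def max_def)
    with lip'[of x y] show ?thesis by (rule order_trans[rotated])
  qed
  moreover have "\<bar>\<psi>' x\<bar> \<le> B" for x using B0 by (auto simp: \<psi>'_def)
  ultimately show thesis by (rule that)
qed

lemma lipschitz_bmeas:
  fixes \<psi> :: "real \<Rightarrow> real"
  assumes "\<And>x y. \<bar>\<psi> x - \<psi> y\<bar> \<le> C * \<bar>x - y\<bar>" "\<And>x. \<bar>\<psi> x\<bar> \<le> B"
  shows "bmeas \<psi>"
proof (rule bmeasI[OF _ assms(2)])
  have "C \<ge> 0" using assms(1)[of 0 1] by simp
  then have "C-lipschitz_on UNIV \<psi>" using assms(1) by (auto simp: lipschitz_on_def dist_real_def)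
  then show "\<psi> \<in> borel_measurable borel"
    by (intro borel_measurable_continuous_onI lipschitz_on_continuous_on)
qed

section \<open>Empirical means and their discrepancy\<close>

definition emp :: "(nat \<Rightarrow> real) \<Rightarrow> nat \<Rightarrow> (real \<Rightarrow> real) \<Rightarrow> real" where
  "emp \<xi> t h = (\<Sum>s\<le>t. h (\<xi> s)) / (real t + 1)"

abbreviation lam :: "(real \<Rightarrow> real) \<Rightarrow> real" where
  "lam h \<equiv> (LINT x|circ_leb. h x)"

lemma emp_add: "emp \<xi> t (\<lambda>x. g x + h x) = emp \<xi> t g + emp \<xi> t h"
  by (simp add: emp_def sum.distrib add_divide_distrib)

lemma emp_diff: "emp \<xi> t (\<lambda>x. g x - h x) = emp \<xi> t g - emp \<xi> t h"
  by (simp add: emp_def sum_subtractf diff_divide_distrib)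

lemma emp_cmult: "emp \<xi> t (\<lambda>x. a * h x) = a * emp \<xi> t h"
  by (simp add: emp_def sum_distrib_left)

lemma emp_const [simp]: "emp \<xi> t (\<lambda>_. a) = a"
  by (simp add: emp_def add.commute)

lemma emp_mono: "(\<And>s. s \<le> t \<Longrightarrow> g (\<xi> s) \<le> h (\<xi> s)) \<Longrightarrow> emp \<xi> t g \<le> emp \<xi> t h"
  unfolding emp_def by (intro divide_right_mono sum_mono) auto

lemma emp_cong: "(\<And>s. s \<le> t \<Longrightarrow> g (\<xi> s) = h (\<xi> s)) \<Longrightarrow> emp \<xi> t g = emp \<xi> t h"
  unfolding emp_def by (auto intro!: arg_cong[where f="\<lambda>x. x / _"] sum.cong)

lemma emp_abs_le: "(\<And>s. s \<le> t \<Longrightarrow> \<bar>h (\<xi> s)\<bar> \<le> a) \<Longrightarrow> \<bar>emp \<xi> t h\<bar> \<le> a"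
  using emp_mono[of t h \<xi> "\<lambda>_. a"] emp_mono[of t "\<lambda>_. -a" \<xi> h] by (auto simp: abs_le_iff minus_le_iff)

text \<open>These cuts play the role of the intervals in the star discrepancy, with weight \<theta>
  and on a grid, so that finitely many tests suffice. The last one, i = G, gives back \<theta>
  itself.\<close>

definition initial_cut :: "(real \<Rightarrow> real) \<Rightarrow> nat \<Rightarrow> nat \<Rightarrow> real \<Rightarrow> real" where
  "initial_cut \<theta> G i x = \<theta> x * (if frac x < real i / real G then 1 else 0)"

lemma bmeas_initial_cut: "bmeas \<theta> \<Longrightarrow> bmeas (initial_cut \<theta> G i)"
proof -
  assume \<theta>: "bmeas \<theta>"
  have "bmeas (\<lambda>x. if frac x < real i / real G then 1 else 0)"
    unfolding frac_def by (rule bmeasI[where C=1]) auto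
  then show ?thesis using \<theta> unfolding initial_cut_def[abs_def] by (intro bmeas_mult)
qed

text \<open>Discretise and sum by parts.\<close>

lemma koksma:
  assumes G: "G > 0" and \<theta>: "bmeas \<theta>" "\<And>x. 0 \<le> \<theta> x" "\<And>x. \<theta> x \<le> 1" and C: "C \<ge> 0"
    and lip: "\<And>x y. \<bar>\<psi> x - \<psi> y\<bar> \<le> C * \<bar>x - y\<bar>" and D: "\<bar>\<psi> 1\<bar> \<le> D"
    and \<xi>: "\<And>s. \<xi> s \<in> Omega" and \<psi>: "bmeas (\<lambda>x. \<theta> x * \<psi> x)"
    and tests: "\<And>i. i \<le> G \<Longrightarrow> \<bar>emp \<xi> t (initial_cut \<theta> G i) - lam (initial_cut \<theta> G i)\<bar> \<le> \<eta>"
  shows "\<bar>emp \<xi> t (\<lambda>x. \<theta> x * \<psi> x) - lam (\<lambda>x. \<theta> x * \<psi> x)\<bar> \<le> 2 * C / real G + \<eta> * (C + D)"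
proof -
  define E where "E = (\<lambda>h. emp \<xi> t h - lam h)"
  define v where "v = (\<lambda>i. \<psi> (real i / real G))"
  define e where "e = (\<lambda>i. E (initial_cut \<theta> G i))"
  define step where "step = (\<lambda>n x. \<Sum>i<n. v i * (initial_cut \<theta> G (Suc i) x - initial_cut \<theta> G i x))"
  have \<eta>: "\<eta> \<ge> 0" using tests[of 0] by linarith
  have bmcut: "bmeas (initial_cut \<theta> G i)" for i by (rule bmeas_initial_cut) (rule \<theta>)
  have bmstep: "bmeas (step n)" for n unfolding step_def by (intro bmeas_sum bmeas_cmult bmeas_diff bmcut)
  have Elin: "E (step n) = (\<Sum>i<n. v i * (e (Suc i) - e i))" for n
  proof (induction n)
    case 0
    then show ?case by (simp add: step_def E_def)
  next
    case (Suc n)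
    have "step (Suc n) = (\<lambda>x. step n x + v n * (initial_cut \<theta> G (Suc n) x - initial_cut \<theta> G n x))"
      by (simp add: step_def fun_eq_iff)
    moreover have "lam (\<lambda>x. step n x + v n * (initial_cut \<theta> G (Suc n) x - initial_cut \<theta> G n x)) =
        lam (step n) + v n * (lam (initial_cut \<theta> G (Suc n)) - lam (initial_cut \<theta> G n))"
      using bmeas_integrable_circ[OF bmstep] bmeas_integrable_circ[OF bmcut] by simp
    ultimately show ?case using Suc
      by (simp add: E_def e_def emp_add emp_cmult emp_diff algebra_simps)
  qed
  have e0: "e 0 = 0"
  proof -
    have "initial_cut \<theta> G 0 = (\<lambda>_. 0)" by (auto simp: initial_cut_def fun_eq_iff leD[OF frac_ge_0])
    then show ?thesis by (simp add: e_def E_def)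
  qed
  have eb: "\<bar>e i\<bar> \<le> \<eta>" if "i \<le> G" for i using tests[OF that] by (simp add: e_def E_def)
  have abel: "\<bar>E (step n) - v n * e n\<bar> \<le> real n * (C / real G) * \<eta>" if "n \<le> G" for n
    using that
  proof (induction n)
    case 0
    then show ?case using e0 by (simp add: Elin)
  next
    case (Suc n)
    have "\<bar>v n - v (Suc n)\<bar> \<le> C * \<bar>real n / real G - real (Suc n) / real G\<bar>"
      unfolding v_def by (rule lip)
    also have "real n / real G - real (Suc n) / real G = - 1 / real G" by (simp add: diff_divide_distrib[symmetric])
    finally have vd: "\<bar>v n - v (Suc n)\<bar> \<le> C / real G" by simp
    have "\<bar>(v n - v (Suc n)) * e (Suc n)\<bar> \<le> (C / real G) * \<eta>"
      unfolding abs_mult using vd eb[of "Suc n"] Suc.prems C by (intro mult_mono) auto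
    moreover have "E (step (Suc n)) - v (Suc n) * e (Suc n) = (E (step n) - v n * e n) + (v n - v (Suc n)) * e (Suc n)"
      by (simp add: Elin algebra_simps)
    ultimately have "\<bar>E (step (Suc n)) - v (Suc n) * e (Suc n)\<bar> \<le> real n * (C / real G) * \<eta> + (C / real G) * \<eta>"
      using Suc abs_triangle_ineq[of "E (step n) - v n * e n" "(v n - v (Suc n)) * e (Suc n)"] by simp
    then show ?case by (simp add: distrib_right add_divide_distrib)
  qed
  have "v G = \<psi> 1" using G by (simp add: v_def)
  then have "\<bar>v G * e G\<bar> \<le> D * \<eta>"
    unfolding abs_mult using D eb[of G] by (intro mult_mono) auto
  with abel[of G] have Estep: "\<bar>E (step G)\<bar> \<le> \<eta> * (C + D)"
    using G by (simp add: abs_le_iff algebra_simps)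
  have close: "\<bar>\<theta> x * \<psi> x - step G x\<bar> \<le> C / real G" if x: "x \<in> Omega" for x
  proof -
    define k where "k = nat \<lfloor>real G * x\<rfloor>"
    have x01: "0 \<le> x" "x < 1" using x by (auto simp: Omega_def)
    have k: "real k \<le> real G * x" "real G * x < real k + 1"
      using x01 G by (auto simp: k_def)
    have "real k < real G" using k(1) x01 G mult_strict_left_mono[of x 1 "real G"] by linarith
    then have kG: "k < G" by simp
    have fr: "frac x = x" using x01 by (simp add: frac_eq)
    have val: "initial_cut \<theta> G (Suc i) x - initial_cut \<theta> G i x = (if i = k then \<theta> x else 0)" for i
    proof -
      have 1: "x < real i / real G \<longleftrightarrow> k < i" for i
      proof -
        have "x < real i / real G \<longleftrightarrow> real G * x < real i" using G by (simp add: field_simps)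
        also have "\<dots> \<longleftrightarrow> k < i"
        proof
          assume "real G * x < real i"
          then have "real k < real i" using k(1) by linarith
          then show "k < i" by simp
        next
          assume "k < i"
          then have "real k + 1 \<le> real i" by simp
          then show "real G * x < real i" using k(2) by linarith
        qed
        finally show ?thesis .
      qed
      show ?thesis unfolding initial_cut_def fr 1 by auto
    qed
    have "step G x = v k * \<theta> x"
      unfolding step_def val using kG by (simp add: if_distrib cong: if_cong)
    then have "\<theta> x * \<psi> x - step G x = \<theta> x * (\<psi> x - v k)" by (simp add: algebra_simps)
    also have "\<bar>\<dots>\<bar> \<le> 1 * (C * \<bar>x - real k / real G\<bar>)"
      unfolding abs_mult v_def using \<theta>(2,3)[of x] by (intro mult_mono lip) auto
    also have "\<bar>x - real k / real G\<bar> \<le> 1 / real G"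
    proof -
      have "\<bar>(real G * x - real k) / real G\<bar> \<le> 1 / real G"
        unfolding abs_divide using k by (intro frac_le) (use G in auto)
      then show ?thesis using G by (simp add: diff_divide_distrib)
    qed
    then have "1 * (C * \<bar>x - real k / real G\<bar>) \<le> C / real G"
      using C mult_left_mono[of "\<bar>x - real k / real G\<bar>" "1 / real G" C] by simp
    finally show ?thesis .
  qed
  have "\<bar>emp \<xi> t (\<lambda>x. \<theta> x * \<psi> x) - emp \<xi> t (step G)\<bar> \<le> C / real G"
    unfolding emp_diff[symmetric] by (rule emp_abs_le) (use close \<xi> in auto)
  moreover have "\<bar>lam (\<lambda>x. \<theta> x * \<psi> x) - lam (step G)\<bar> \<le> C / real G"
  proof -
    have "\<bar>lam (\<lambda>x. \<theta> x * \<psi> x - step G x)\<bar> \<le> lam (\<lambda>_. C / real G)"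
      unfolding real_norm_def[symmetric]
      by (rule Bochner_Integration.integral_norm_bound_integral)
         (use close bmeas_diff[OF \<psi> bmstep] in auto)
    then show ?thesis
      using bmeas_integrable_circ[OF \<psi>] bmeas_integrable_circ[OF bmstep] by (simp add: circ.prob_space[unfolded space_circ_leb])
  qed
  moreover have "2 * C / real G = C / real G + C / real G" by simp
  ultimately show ?thesis
    using Estep unfolding E_def abs_le_iff by linarith
qed

section \<open>Renewal estimates\<close>

text \<open>The second index counts walk steps to be made after a ring jump: a step raises it with
  weight q = 1 - p, a jump ends the cycle with weight p. Unrolling down to the last jump produces
  geometric weights, and the errors q e of the steps add up to q e / p.\<close>

lemma renewal_expand:
  fixes A J :: "nat \<Rightarrow> nat \<Rightarrow> real"
  assumes p: "0 < p" "p < 1" and q: "q = 1 - p" and e: "e \<ge> 0"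
    and rec: "\<And>S n. \<bar>A (Suc S) n - (q * A S (Suc n) + p * J S n)\<bar> \<le> q * e"
  shows "\<bar>A S k - ((\<Sum>n<S. p * q ^ n * J (S - 1 - n) (k + n)) + q ^ S * A 0 (k + S))\<bar> \<le> q * e / p"
proof (induction S arbitrary: k)
  case 0
  then show ?case using p q e by simp
next
  case (Suc S)
  define R where "R = (\<lambda>S k. (\<Sum>n<S. p * q ^ n * J (S - 1 - n) (k + n)) + q ^ S * A 0 (k + S))"
  have R: "R (Suc S) k = q * R S (Suc k) + p * J S k"
    unfolding R_def by (simp add: sum.lessThan_Suc_shift sum_distrib_left algebra_simps del: sum.lessThan_Suc)
  have "\<bar>A S (Suc k) - R S (Suc k)\<bar> \<le> q * e / p" using Suc[of "Suc k"] by (simp add: R_def)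
  then have "q * \<bar>A S (Suc k) - R S (Suc k)\<bar> \<le> q * (q * e / p)" using p q by (intro mult_left_mono) auto
  then have "\<bar>q * A S (Suc k) - q * R S (Suc k)\<bar> \<le> q * (q * e / p)"
    using p q by (simp only: right_diff_distrib[symmetric] abs_mult)
  then have "\<bar>A (Suc S) k - R (Suc S) k\<bar> \<le> q * e + q * (q * e / p)"
    using rec[of S k] unfolding R abs_le_iff by linarith
  also have "\<dots> = q * e / p" using p by (simp add: q field_simps)
  finally show ?case by (simp add: R_def)
qed

text \<open>Here 1 / g is the decay per time step. A cycle with n steps carries the weight p q^n
  g^(n + 1), times 1 - s if n > 0, and the total must not exceed 1. A cycle without steps does not
  contract, which is why g - 1 is limited by p q s rather than by p s.\<close>

lemma geometric_weights:
  fixes p q g s :: real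
  assumes p: "0 < p" "p < 1" and q: "q = 1 - p" and s: "0 < s" "s \<le> 1 / 2" and g: "1 \<le> g" "g - 1 \<le> p * q * s / 2"
  shows "p * g * s + p * g * (1 - s) / (1 - q * g) \<le> 1" "q * g < 1" "1 - q * g \<le> p"
    "p * g / (1 - q * g) \<le> 2"
proof -
  define y where "y = g - 1"
  have y: "0 \<le> y" "y \<le> p * q * s / 2" using g by (auto simp: y_def)
  have "p * (q * s) \<le> p * (1 * 1)" using p q s by (intro mult_left_mono mult_mono) auto
  then have yp: "y \<le> p / 2" using y by simp
  then have "q * y < p" using p q y mult_left_le_one_le[of y q] by simp
  moreover have eq: "1 - q * g = p - q * y" by (simp add: y_def q algebra_simps)
  ultimately show pos: "q * g < 1" by simp
  show "1 - q * g \<le> p" unfolding eq using y p q by simp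
  have sq: "p * q * s \<le> p * (q * s) * 1" by simp
  have key: "p * g * (1 - s * q) \<le> p - q * y"
  proof -
    have "p * g * (1 - s * q) = p + p * y - p * s * q * (1 + y)" by (simp add: y_def algebra_simps)
    also have "\<dots> \<le> p + p * y - p * s * q" using p q s y by simp
    also have "p * y + q * y = y" by (simp add: q algebra_simps)
    then have "p + p * y - p * s * q \<le> p - q * y" using y by (simp add: algebra_simps)
    finally show ?thesis .
  qed
  have "p * g * s * (1 - q * g) + p * g * (1 - s) = p * g * (1 - s * q * g)" by (simp add: algebra_simps)
  also have "\<dots> \<le> p * g * (1 - s * q * 1)"
    using p q s g by (intro mult_left_mono diff_left_mono mult_left_mono) auto
  also have "\<dots> \<le> 1 - q * g" using key eq by simp
  finally show "p * g * s + p * g * (1 - s) / (1 - q * g) \<le> 1" using pos by (simp add: field_simps)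
  have "s * q \<le> 1 / 2" using s p q mult_mono[of s "1/2" q 1] by simp
  then have "p * g * (1 / 2) \<le> p * g * (1 - s * q)" using p g by (intro mult_left_mono) auto
  also have "\<dots> \<le> 1 - q * g" using key eq by simp
  finally show "p * g / (1 - q * g) \<le> 2" using pos by (simp add: divide_le_eq)
qed

lemma geometric_conv:
  fixes p q g :: real
  assumes p: "0 < p" "p < 1" and q: "q = 1 - p" and s: "0 < s" "s \<le> 1 / 2" and g: "1 \<le> g" "g - 1 \<le> p * q * s / 2"
  shows "(\<Sum>n<S. p * q ^ n * (1 / g ^ (S - 1 - n))) \<le> 2 / g ^ S"
proof -
  note G = geometric_weights[OF assms]
  have "(\<Sum>n<S. p * q ^ n * (1 / g ^ (S - 1 - n))) = (\<Sum>n<S. p * g * (q * g) ^ n / g ^ S)"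
  proof (rule sum.cong[OF refl])
    fix n assume "n \<in> {..<S}"
    then have "g ^ S = g ^ (S - 1 - n) * (g * g ^ n)"
      by (simp flip: power_add power_Suc)
    then show "p * q ^ n * (1 / g ^ (S - 1 - n)) = p * g * (q * g) ^ n / g ^ S"
      using g by (simp add: power_mult_distrib)
  qed
  also have "\<dots> = p * g * ((1 - (q * g) ^ S) / (1 - q * g)) / g ^ S"
    using G(2) by (simp add: sum_distrib_left[symmetric] sum_divide_distrib[symmetric] sum_gp_strict)
  also have "\<dots> = (p * g / (1 - q * g)) * (1 - (q * g) ^ S) / g ^ S" by simp
  also have "\<dots> \<le> 2 * 1 / g ^ S"
  proof (intro divide_right_mono mult_mono)
    have "0 \<le> q * g" using p q g by simp
    then show "0 \<le> 1 - (q * g) ^ S" "1 - (q * g) ^ S \<le> 1" using G(2) by (auto intro: power_le_one)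
  qed (use G g p q in auto)
  finally show ?thesis by simp
qed

text \<open>Strong induction. The constant E reproduces itself because a cycle contracts away the
  fraction q s of it, which leaves room for F. The initial term q^S / 2 is paid for by the tail (q
  g)^S that is missing from the finite geometric sum, whose coefficient B is at least 1 / 2.\<close>

lemma renewal_decay:
  fixes y :: "nat \<Rightarrow> real"
  assumes p: "0 < p" "p < 1" and q: "q = 1 - p" and s: "0 < s" "s \<le> 1 / 2" and g: "1 \<le> g" "g - 1 \<le> p * q * s / 2"
    and E: "E \<ge> 0" "F \<le> q * s * E"
    and rec: "\<And>S. y S \<le> (\<Sum>n<S. p * q ^ n * ((if n = 0 then 1 else 1 - s) * y (S - 1 - n))) + q ^ S / 2 + F"
  shows "y S \<le> E + 1 / g ^ S"
proof (induction S rule: less_induct)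
  case (less S)
  note G = geometric_weights[OF p q s g]
  show ?case
  proof (cases S)
    case 0
    have "q * s \<le> 1" using p q s mult_mono[of q 1 s 1] by simp
    then have "q * s * E \<le> 1 * E" using E by (intro mult_right_mono) auto
    then have "F \<le> E" using E by simp
    then show ?thesis using rec[of 0] 0 by simp
  next
    case (Suc S')
    define w where "w = (\<lambda>n::nat. if n = 0 then 1 else 1 - s)"
    have w0: "w n \<ge> 0" for n using s by (simp add: w_def)
    have q0: "0 < q" using p q by simp
    have "y S \<le> (\<Sum>n<S. p * q ^ n * (w n * y (S - 1 - n))) + q ^ S / 2 + F"
      using rec[of S] by (simp add: w_def)
    also have "(\<Sum>n<S. p * q ^ n * (w n * y (S - 1 - n))) \<le> (\<Sum>n<S. p * q ^ n * (w n * (E + 1 / g ^ (S - 1 - n))))"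
      using p q0 w0 by (intro sum_mono mult_left_mono less.IH) auto
    also have "\<dots> = E * (\<Sum>n<S. p * q ^ n * w n) + (\<Sum>n<S. p * q ^ n * (w n * (1 / g ^ (S - 1 - n))))"
      by (simp add: sum_distrib_left sum.distrib[symmetric] algebra_simps)
    also have "(\<Sum>n<S. p * q ^ n * w n) = p + (1 - s) * (q - q ^ S)"
    proof -
      have "(\<Sum>n<S. p * q ^ n * w n) = p + (\<Sum>n<S'. p * q ^ Suc n * (1 - s))"
        unfolding Suc sum.lessThan_Suc_shift by (simp add: w_def)
      also have "(\<Sum>n<S'. p * q ^ Suc n * (1 - s)) = p * q * (1 - s) * (\<Sum>n<S'. q ^ n)"
        by (subst sum_distrib_left) (simp add: ac_simps)
      also have "(\<Sum>n<S'. q ^ n) = (1 - q ^ S') / p"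
        using p q by (simp add: sum_gp_strict)
      also have "p * q * (1 - s) * ((1 - q ^ S') / p) = (1 - s) * (q - q ^ S)"
      proof -
        have "p * q * (1 - s) * ((1 - q ^ S') / p) = (q * (1 - s)) * (1 - q ^ S')" using p by simp
        then show ?thesis by (simp add: Suc algebra_simps)
      qed
      finally show ?thesis .
    qed
    also have "(\<Sum>n<S. p * q ^ n * (w n * (1 / g ^ (S - 1 - n)))) = (p * g * s + p * g * (1 - s) / (1 - q * g) * (1 - (q * g) ^ S)) / g ^ S"
    proof -
      have "(\<Sum>n<S. p * q ^ n * (w n * (1 / g ^ (S - 1 - n)))) = (\<Sum>n<S. w n * (p * g * (q * g) ^ n)) / g ^ S"
        unfolding sum_divide_distrib
      proof (rule sum.cong[OF refl])
        fix n assume "n \<in> {..<S}"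
        then have "g ^ S = g ^ (S - 1 - n) * (g * g ^ n)"
          by (simp flip: power_add power_Suc)
        then show "p * q ^ n * (w n * (1 / g ^ (S - 1 - n))) = w n * (p * g * (q * g) ^ n) / g ^ S"
          using g by (simp add: power_mult_distrib)
      qed
      also have "(\<Sum>n<S. w n * (p * g * (q * g) ^ n)) = p * g * s + (1 - s) * (\<Sum>n<S. p * g * (q * g) ^ n)"
        unfolding Suc sum.lessThan_Suc_shift by (simp add: w_def sum_distrib_left algebra_simps)
      also have "(\<Sum>n<S. p * g * (q * g) ^ n) = p * g * ((1 - (q * g) ^ S) / (1 - q * g))"
        using G(2) by (simp add: sum_distrib_left[symmetric] sum_gp_strict)
      finally show ?thesis by (simp add: algebra_simps)
    qed
    finally have "y S \<le> E * (p + (1 - s) * (q - q ^ S)) + F + ((p * g * s + p * g * (1 - s) / (1 - q * g) * (1 - (q * g) ^ S)) / g ^ S + q ^ S / 2)"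
      by simp
    also have "E * (p + (1 - s) * (q - q ^ S)) + F \<le> E"
    proof -
      have "E * (p + (1 - s) * (q - q ^ S)) + F \<le> E * (p + (1 - s) * q) + q * s * E"
        using E s q0 by (intro add_mono mult_left_mono add_left_mono) auto
      also have "\<dots> = E" by (simp add: q algebra_simps)
      finally show ?thesis .
    qed
    also have "(p * g * s + p * g * (1 - s) / (1 - q * g) * (1 - (q * g) ^ S)) / g ^ S + q ^ S / 2 \<le> 1 / g ^ S"
    proof -
      define B where "B = p * g * (1 - s) / (1 - q * g)"
      have "B \<ge> 1 / 2"
      proof -
        have "(1 - q * g) * (1 / 2) \<le> p * (1 - s)" using G(3) s p by (intro mult_mono) auto
        also have "\<dots> \<le> p * g * (1 - s)" using p g s by simp
        finally show ?thesis using G(2) by (simp add: B_def field_simps)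
      qed
      then have "(1 / 2 - B) * (q * g) ^ S \<le> 0"
        using q0 g by (intro mult_nonpos_nonneg) auto
      then have "p * g * s + B * (1 - (q * g) ^ S) + (q * g) ^ S / 2 \<le> p * g * s + B"
        by (simp add: algebra_simps)
      also have "\<dots> \<le> 1" using G(1) by (simp add: B_def)
      finally have "(p * g * s + B * (1 - (q * g) ^ S) + (q * g) ^ S / 2) / g ^ S \<le> 1 / g ^ S"
        using g by (intro divide_right_mono) auto
      moreover have "(q * g) ^ S / 2 / g ^ S = q ^ S / 2" using g by (simp add: power_mult_distrib)
      ultimately show ?thesis by (simp add: B_def add_divide_distrib)
    qed
    finally show ?thesis by simp
  qed
qed

text \<open>A single step need not contract, since a walker may sit in its level far from the other
  one. Two steps do: a ring jump redistributes the walker, and the next move can cross over.\<close>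

lemma two_step_decay:
  fixes u :: "nat \<Rightarrow> real"
  assumes g: "1 \<le> g" "g \<le> 2" and r: "0 < r" "1 - r \<le> 1 / g\<^sup>2" "r \<le> 1" and h: "h \<ge> 0"
    and u1: "u 0 \<le> 1" "u 1 \<le> 1" and rec: "\<And>S. u (Suc (Suc S)) \<le> u S * (1 - r) + 2 * h"
  shows "u S \<le> 2 / g ^ S + 2 * h / r"
proof (induction S rule: less_induct)
  case (less S)
  show ?case
  proof (cases "S \<le> 1")
    case True
    then consider "S = 0" | "S = 1" by linarith
    then show ?thesis
    proof cases
      case 2
      have "1 \<le> 2 / g" using g by simp
      then show ?thesis using 2 u1 h r by (simp add: add_increasing2)
    qed (use u1 h r in \<open>auto intro: add_increasing2\<close>)
  next
    case False
    then obtain S' where S': "S = Suc (Suc S')" by (metis Suc_leI not_less_eq_eq less_Suc_eq_le not0_implies_Suc One_nat_def le0 le_Suc_eq)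
    have "u S \<le> u S' * (1 - r) + 2 * h" using rec S' by simp
    also have "\<dots> \<le> (2 / g ^ S' + 2 * h / r) * (1 - r) + 2 * h"
      using less.IH[of S'] S' r by (intro add_right_mono mult_right_mono) auto
    also have "\<dots> = 2 / g ^ S' * (1 - r) + 2 * h / r" using r by (simp add: field_simps)
    also have "2 / g ^ S' * (1 - r) \<le> 2 / g ^ S' * (1 / g\<^sup>2)" using r g by (intro mult_left_mono) auto
    also have "\<dots> = 2 / g ^ S" using S' by (simp add: power2_eq_square)
    finally show ?thesis by simp
  qed
qed

section \<open>Indicators of the two levels and their exchange under the walk\<close>

definition lowI :: "nat \<Rightarrow> real \<Rightarrow> real" where "lowI M x = 1 - upper (real M * x)"

text \<open>The names refer to the target density: \<open>upI\<close> marks high density, that is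
  potential 0 (the set B), and \<open>lowI\<close> marks low density, that is potential H (the set
  A).\<close>

definition upI :: "nat \<Rightarrow> real \<Rightarrow> real" where "upI M x = upper (real M * x)"

lemma bmeas_upI [intro, simp]: "bmeas (upI M)"
  unfolding upI_def[abs_def] by (rule bmeas_compose[OF bmeas_upper]) simp

lemma bmeas_lowI [intro, simp]: "bmeas (lowI M)"
  using bmeas_diff[OF bmeas_const[of 1] bmeas_upI[of M]] by (simp add: lowI_def[abs_def] upI_def)

lemma upI_periodic [simp]: "upI M (x + 1) = upI M x"
  using upper_periodic_int[of "real M * x" "int M"] by (simp add: upI_def distrib_left)

lemma lowI_periodic [simp]: "lowI M (x + 1) = lowI M x"
  using upI_periodic[of M x] by (simp add: upI_def lowI_def)

lemma lowI_upI: "lowI M x = 1 - upI M x" "upI M x = 1 - lowI M x" by (simp_all add: lowI_def upI_def)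

lemma lowI_upI_cases: "(lowI M x = 0 \<and> upI M x = 1) \<or> (lowI M x = 1 \<and> upI M x = 0)"
  using upper_cases[of "real M * x"] by (auto simp: lowI_def upI_def)

lemma lowI_upI_bounds [simp]: "0 \<le> lowI M x" "lowI M x \<le> 1" "0 \<le> upI M x" "upI M x \<le> 1"
  using lowI_upI_cases[of M x] by auto

context stripes
begin

abbreviation K :: "(real \<Rightarrow> real) \<Rightarrow> real \<Rightarrow> real" where "K \<equiv> avg c"

text \<open>As a function of the starting point, the probability that the proposal walk is in B
  after n steps.\<close>

definition bK :: "nat \<Rightarrow> real \<Rightarrow> real" where "bK n = (K ^^ n) (upI M)"

lemma bmeas_bK [intro, simp]: "bmeas (bK n)"
  unfolding bK_def using c(1) by auto

lemma bK_bounds [simp]: "0 \<le> bK n x" "bK n x \<le> 1"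
  unfolding bK_def using avg_pow_bounds[OF c(1), of "upI M" 0 1 n x] by auto

lemma bK_periodic [simp]: "bK n (x + 1) = bK n x"
  unfolding bK_def by (rule avg_pow_periodic) simp

lemma bK_scaled: "bK n x = (avg (real M * c) ^^ n) upper (real M * x)"
  unfolding bK_def upI_def[abs_def] using M c by (intro avg_pow_scale) auto

lemma lam_scaled: "bmeas h \<Longrightarrow> (\<And>x. h (x + 1) = h x) \<Longrightarrow> lam (\<lambda>x. h (real M * x)) = integral {0..1} h"
  using M by (intro circ_leb_integral_scale) auto

lemma lam_upI: "lam (upI M) = 1 / 2" and lam_lowI: "lam (lowI M) = 1 / 2"
proof -
  show u: "lam (upI M) = 1 / 2"
    using lam_scaled[of upper] integral_upper by (simp add: upI_def[abs_def])
  show "lam (lowI M) = 1 / 2"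
    using u bmeas_integrable_circ[OF bmeas_upI[of M]]
    by (simp add: lowI_upI(1)[abs_def] circ.prob_space[unfolded space_circ_leb])
qed

lemma lam_K:
  assumes "bmeas h" "\<And>x. h (x + 1) = h x"
  shows "lam (K h) = lam h"
proof -
  have "lam (K h) = lam (\<lambda>x. 1 * mh_op c (\<lambda>_ _. 1) h x)"
    using mh_op_avg[OF c(1) Mc(4) _ assms] by (intro Bochner_Integration.integral_cong) auto
  also have "\<dots> = lam (\<lambda>x. 1 * h x)"
    by (rule acceptance.mh_op_detailed_balance[OF acceptance_one c(1)]) (use assms in auto)
  finally show ?thesis by simp
qed

lemma lam_K_pow:
  assumes "bmeas h" "\<And>x. h (x + 1) = h x"
  shows "lam ((K ^^ n) h) = lam h"
proof (induction n)
  case (Suc n)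
  have "lam (K ((K ^^ n) h)) = lam ((K ^^ n) h)"
    by (rule lam_K) (use assms c(1) avg_pow_periodic[of h 1] in auto)
  then show ?case using Suc by simp
qed auto

lemma lam_low_bK: "lam (\<lambda>x. lowI M x * bK n x) = flow (real M * c) n"
proof -
  have "bmeas (\<lambda>y. (1 - upper y) * (avg (real M * c) ^^ n) upper y)"
    using Mc(2) by (intro bmeas_mult bmeas_diff bmeas_const bmeas_upper bmeas_avg_pow)
  then show ?thesis
    unfolding bK_scaled lowI_def flow_def
    by (rule lam_scaled) (simp add: avg_pow_periodic)
qed

text \<open>Lebesgue measure is invariant under the walk, so \<open>upI M\<close> and
  \<open>bK n\<close> have the same integral: what flows from A to B is balanced by what flows
  back.\<close>

lemma lam_up_bK: "lam (\<lambda>x. upI M x * (1 - bK n x)) = flow (real M * c) n"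
proof -
  have int: "integrable circ_leb (\<lambda>x. lowI M x * bK n x)" "integrable circ_leb (bK n)" "integrable circ_leb (upI M)"
    by (intro bmeas_integrable_circ bmeas_mult bmeas_lowI bmeas_upI bmeas_bK)+
  have "(\<lambda>x. upI M x * (1 - bK n x)) = (\<lambda>x. upI M x - bK n x + lowI M x * bK n x)"
    by (simp add: lowI_upI(1) algebra_simps)
  then have "lam (\<lambda>x. upI M x * (1 - bK n x)) = lam (upI M) - lam (bK n) + lam (\<lambda>x. lowI M x * bK n x)"
    using int by simp
  moreover have "lam (bK n) = lam (upI M)" unfolding bK_def by (rule lam_K_pow) auto
  ultimately show ?thesis by (simp add: lam_low_bK)
qed

lemma bK_mixed:
  assumes n: "n > 0"
  shows "\<bar>bK n x - 1 / 2\<bar> \<le> (1 / (4 * (real M * c)\<^sup>2))\<^sup>2 / real n"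
proof -
  define e where "e = (1 / (4 * (real M * c)\<^sup>2))\<^sup>2 / real n"
  have "\<bar>upper x - upper y\<bar> \<le> 1" for x y using upper_cases[of x] upper_cases[of y] by auto
  then have osc: "\<bar>bK n x - bK n y\<bar> \<le> e" for x y
    unfolding bK_scaled e_def using Mc n by (intro avg_pow_osc) auto
  have "lam (bK n) = 1 / 2" unfolding bK_def by (subst lam_K_pow) (auto simp: lam_upI)
  then have "\<bar>bK n x - 1 / 2\<bar> = \<bar>lam (\<lambda>y. bK n x - bK n y)\<bar>"
    using bmeas_integrable_circ[OF bmeas_bK[of n]] by (simp add: circ.prob_space[unfolded space_circ_leb])
  also have "\<dots> \<le> lam (\<lambda>_. e)"
    unfolding real_norm_def[symmetric]
    by (rule Bochner_Integration.integral_norm_bound_integral)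
       (use osc in \<open>auto intro!: bmeas_integrable_circ bmeas_diff\<close>)
  finally show ?thesis by (simp add: e_def circ.prob_space[unfolded space_circ_leb])
qed

end

text \<open>Numbers describing one renewal cycle of the two-ring chain: \<open>a\<close> is the fraction of the
  level-1 samples with high potential, \<open>\<alpha>\<close> and \<open>\<beta>\<close> are the probabilities of changing the potential
  between two consecutive ring jumps.\<close>

lemma cycle_bounds:
  fixes a \<eta> \<theta> E1 E2 m \<epsilon> :: real
  assumes eps: "0 < \<epsilon>" "\<epsilon> \<le> 1 / 512" and m: "0 < m" "m \<le> 1" "\<epsilon> \<le> m / 384"
    and a: "\<bar>a - 1 / 2\<bar> \<le> \<epsilon> / 50" and E: "\<bar>E1 - \<theta>\<bar> \<le> \<epsilon> / 50" "\<bar>E2 - \<theta>\<bar> \<le> \<epsilon> / 50"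
    and \<theta>: "m / 95 \<le> \<theta>" "\<theta> \<le> 11 / 32" and bal: "\<bar>E1 - E2\<bar> \<le> m * \<epsilon> / 25"
  defines "\<alpha> \<equiv> E1 / a" and "\<beta> \<equiv> E2 / (1 - a)"
  defines "\<kappa> \<equiv> 1 - \<bar>1 - \<alpha> - \<beta>\<bar>"
  shows "m / 25 \<le> \<kappa>" "\<bar>\<alpha> - \<beta>\<bar> / 2 \<le> 1.1 * \<epsilon> * \<kappa>"
proof -
  have a0: "0.49 < a" "a < 0.51" using a eps unfolding abs_le_iff by auto
  have e50: "\<epsilon> / 50 \<le> m / 19200" "\<epsilon> / 50 \<le> 1 / 25600" using eps m by auto
  have E1b: "E1 \<ge> \<theta> - \<epsilon> / 50" "E1 \<le> \<theta> + \<epsilon> / 50" "E2 \<ge> \<theta> - \<epsilon> / 50" "E2 \<le> \<theta> + \<epsilon> / 50"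
    using E unfolding abs_le_iff by auto
  have E0: "E1 \<ge> 0" "E2 \<ge> 0" using E1b \<theta> e50 m by auto
  define b1 b2 :: real where "b1 = 1 / 2 + 1 / 25600" and "b2 = 1 / 2 - 1 / (25600::real)"
  have ab: "b2 \<le> a" "a \<le> b1" "b2 \<le> 1 - a" "1 - a \<le> b1"
    using a e50 unfolding abs_le_iff b1_def b2_def by auto
  have b: "0 < b2" "0 < b1" by (auto simp: b1_def b2_def)
  have lo: "E1 / b1 \<le> \<alpha>" "E2 / b1 \<le> \<beta>"
    unfolding \<alpha>_def \<beta>_def using ab b a0 E0 by (auto intro!: divide_left_mono)
  have hi: "\<alpha> \<le> E1 / b2" "\<beta> \<le> E2 / b2"
    unfolding \<alpha>_def \<beta>_def using ab b a0 E0 by (auto intro!: divide_left_mono)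
  have "m / 25 \<le> (2 * \<theta> - 2 * (\<epsilon> / 50)) / b1"
    using \<theta> e50 m by (simp add: b1_def field_simps)
  also have "\<dots> \<le> (E1 + E2) / b1" using E1b b by (intro divide_right_mono) auto
  also have "\<dots> \<le> \<alpha> + \<beta>" using lo by (simp add: add_divide_distrib)
  finally have s1: "m / 25 \<le> \<alpha> + \<beta>" .
  have "\<alpha> + \<beta> \<le> (E1 + E2) / b2" using hi by (simp add: add_divide_distrib)
  also have "\<dots> \<le> (2 * \<theta> + 2 * (\<epsilon> / 50)) / b2" using E1b b by (intro divide_right_mono) auto
  \<comment> \<open>The bound 11 / 32 makes 4 \<theta> at most 1.375, safely below 2, the value of
    \<alpha> + \<beta> at which \<kappa> would vanish again.\<close>
  also have "\<dots> \<le> 1.4" using \<theta> e50 by (simp add: b2_def field_simps)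
  finally have s2: "\<alpha> + \<beta> \<le> 1.4" .
  show \<kappa>: "m / 25 \<le> \<kappa>" using s1 s2 m unfolding \<kappa>_def by (auto simp: abs_if)
  have ks: "\<alpha> + \<beta> \<le> 2.5 * \<kappa>" using s1 s2 m unfolding \<kappa>_def by (auto simp: abs_if)
  \<comment> \<open>The imbalance has two sources, unequal flows and unequal ring sizes. The second
    is multiplied by \<alpha> + \<beta>, so it is small relative to the flow by itself.\<close>
  have "(\<alpha> - \<beta>) / 2 = (E1 - E2) - (a - 1 / 2) * (\<alpha> + \<beta>)"
  proof -
    have "E1 = a * \<alpha>" "E2 = (1 - a) * \<beta>" using a0 by (auto simp: \<alpha>_def \<beta>_def)
    then show ?thesis by (simp add: field_simps)
  qed
  also have "\<bar>\<dots>\<bar> \<le> m * \<epsilon> / 25 + (\<epsilon> / 50) * (2.5 * \<kappa>)"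
  proof -
    have "\<bar>(a - 1 / 2) * (\<alpha> + \<beta>)\<bar> \<le> (\<epsilon> / 50) * (2.5 * \<kappa>)"
      unfolding abs_mult using a ks s1 m eps by (intro mult_mono) auto
    then show ?thesis using bal by linarith
  qed
  also have "m * \<epsilon> / 25 \<le> \<epsilon> * \<kappa>" using mult_left_mono[OF \<kappa>, of \<epsilon>] eps by (simp add: mult.commute)
  also have "\<epsilon> * \<kappa> + (\<epsilon> / 50) * (2.5 * \<kappa>) \<le> 1.1 * \<epsilon> * \<kappa>"
    using eps m \<kappa> by simp
  finally show "\<bar>\<alpha> - \<beta>\<bar> / 2 \<le> 1.1 * \<epsilon> * \<kappa>" by simp
qed

text \<open>For large n each transition probability is within \<epsilon> / 100 of 1 / 2 whatever the
  ring sizes are, so one cycle almost forgets the level.\<close>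

lemma cycle_bounds_mixed:
  fixes a E1 E2 m \<epsilon> :: real
  assumes eps: "0 < \<epsilon>" "\<epsilon> \<le> 1 / 512" and m: "0 < m" "m \<le> 1" and a: "0 < a" "a < 1"
    and E: "\<bar>E1 - a / 2\<bar> \<le> a * (\<epsilon> / 100)" "\<bar>E2 - (1 - a) / 2\<bar> \<le> (1 - a) * (\<epsilon> / 100)"
  defines "\<alpha> \<equiv> E1 / a" and "\<beta> \<equiv> E2 / (1 - a)"
  defines "\<kappa> \<equiv> 1 - \<bar>1 - \<alpha> - \<beta>\<bar>"
  shows "m / 25 \<le> \<kappa>" "\<bar>\<alpha> - \<beta>\<bar> / 2 \<le> 1.1 * \<epsilon> * \<kappa>"
proof -
  have A: "\<bar>\<alpha> - 1 / 2\<bar> \<le> \<epsilon> / 100"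
  proof -
    have "\<bar>E1 - a / 2\<bar> / a \<le> a * (\<epsilon> / 100) / a" using E a by (intro divide_right_mono) auto
    moreover have "\<bar>E1 - a / 2\<bar> / a = \<bar>(E1 - a / 2) / a\<bar>" using a by simp
    moreover have "(E1 - a / 2) / a = \<alpha> - 1 / 2" using a by (simp add: \<alpha>_def diff_divide_distrib)
    ultimately show ?thesis using a by simp
  qed
  have B: "\<bar>\<beta> - 1 / 2\<bar> \<le> \<epsilon> / 100"
  proof -
    have "\<bar>E2 - (1 - a) / 2\<bar> / (1 - a) \<le> (1 - a) * (\<epsilon> / 100) / (1 - a)" using E a by (intro divide_right_mono) auto
    moreover have "(1 - a) * (\<epsilon> / 100) / (1 - a) = \<epsilon> / 100"
      using a by (intro nonzero_mult_div_cancel_left) simp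
    moreover have "\<bar>E2 - (1 - a) / 2\<bar> / (1 - a) = \<bar>(E2 - (1 - a) / 2) / (1 - a)\<bar>" using a by simp
    moreover have "(E2 - (1 - a) / 2) / (1 - a) = \<beta> - 1 / 2" using a by (simp add: \<beta>_def field_simps)
    ultimately show ?thesis by metis
  qed
  have k: "\<kappa> \<ge> 0.9" using A B eps unfolding \<kappa>_def abs_le_iff by (auto simp: abs_if)
  show "m / 25 \<le> \<kappa>" using k m by simp
  have "\<bar>\<alpha> - \<beta>\<bar> / 2 \<le> \<epsilon> / 100" using A B unfolding abs_le_iff by (auto simp: abs_if)
  also have "\<dots> \<le> 1.1 * \<epsilon> * 0.9" using eps by simp
  also have "\<dots> \<le> 1.1 * \<epsilon> * \<kappa>" using eps k by (intro mult_left_mono) auto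
  finally show "\<bar>\<alpha> - \<beta>\<bar> / 2 \<le> 1.1 * \<epsilon> * \<kappa>" .
qed

section \<open>The level-0 recursion for a fixed level-1 trajectory\<close>

lemma avg_lipschitz:
  assumes c: "c > 0" and \<phi>: "bmeas \<phi>" and lip: "\<And>x y. \<bar>\<phi> x - \<phi> y\<bar> \<le> \<bar>x - y\<bar>"
  shows "\<bar>avg c \<phi> x - avg c \<phi> y\<bar> \<le> \<bar>x - y\<bar>"
proof -
  have "avg c \<phi> y = avg c (\<lambda>z. \<phi> (z + (y - x))) x"
    by (simp add: avg_def algebra_simps)
  then have "avg c \<phi> x - avg c \<phi> y = avg c (\<lambda>z. \<phi> z - \<phi> (z + (y - x))) x"
    using avg_diff[OF \<phi> bmeas_shift'[OF \<phi>], of c "y - x" x] by simp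
  also have "\<bar>\<dots>\<bar> \<le> \<bar>x - y\<bar>"
  proof (rule avg_abs_le[OF c bmeas_diff[OF \<phi> bmeas_shift'[OF \<phi>]]])
    fix u
    have "\<bar>\<phi> (x + u) - \<phi> (x + u + (y - x))\<bar> \<le> \<bar>(x + u) - (x + u + (y - x))\<bar>" by (rule lip)
    then show "\<bar>\<phi> (x + u) - \<phi> (x + u + (y - x))\<bar> \<le> \<bar>x - y\<bar>" by simp
  qed
  finally show ?thesis .
qed

text \<open>Here f is already extended 1-periodically to the line. \<open>f_mean\<close> is centring
  under the target, whose density is proportional to 1 on A and to exp H on B.\<close>

locale ee_setup = stripes +
  fixes p H \<epsilon> :: real and f :: "real \<Rightarrow> real"
  assumes p: "0 < p" "p < 1" and H: "H \<ge> 0"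
    and eps: "0 < \<epsilon>" "\<epsilon> < 1 / 512" "\<epsilon> < c * real M / 384"
    and f_lip: "\<And>x y. \<bar>f x - f y\<bar> \<le> \<bar>x - y\<bar>" and f_per: "\<And>x. f (x + 1) = f x"
    and f_bound: "\<And>x. \<bar>f x\<bar> \<le> 1 / 2"
    and f_mean: "lam (\<lambda>x. lowI M x * f x) + exp H * lam (\<lambda>x. upI M x * f x) = 0"
begin

text \<open>The grid is fine enough for the discretisation error 2 C / G in \<open>koksma\<close> to
  be at most C \<epsilon> / 50.\<close>

definition G :: nat where "G = nat \<lceil>100 / \<epsilon>\<rceil>"
text \<open>\<open>bK_mixed\<close> gives an error of order (M c)^(-4) / n, and M c exceeds 384
  \<epsilon>; the exponent 5 leaves one factor \<epsilon> over.\<close>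

definition N :: nat where "N = nat \<lceil>1 / \<epsilon> ^ 5\<rceil>"

definition P :: "(real \<Rightarrow> real) \<Rightarrow> real \<Rightarrow> real" where "P = mh_op c (acc M (exp (- H)))"
definition R :: "(real \<Rightarrow> real) \<Rightarrow> real \<Rightarrow> real" where "R = mh_op c (acc M 0)"
definition fK :: "nat \<Rightarrow> real \<Rightarrow> real" where "fK n = (K ^^ n) f"
definition fR :: "nat \<Rightarrow> real \<Rightarrow> real" where "fR n = (R ^^ n) f"

lemma acceptance_P: "acceptance (acc M (exp (- H)))"
  using H by (intro acceptance_acc) auto

lemma bmeas_f [intro, simp]: "bmeas f"
  by (rule lipschitz_bmeas[where C=1 and B="1/2"]) (use f_lip f_bound in simp_all)

lemma bmeas_fK [intro, simp]: "bmeas (fK n)"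
  unfolding fK_def using c(1) by auto

lemma bmeas_fR [intro, simp]: "bmeas (fR n)"
  unfolding fR_def R_def by (rule bmeas_reject_pow) simp

lemma bmeas_P [intro]: "bmeas \<phi> \<Longrightarrow> bmeas (P \<phi>)"
  unfolding P_def by (rule acceptance.bmeas_mh_op[OF acceptance_P c(1)])

lemma fK_per [simp]: "fK n (x + 1) = fK n x"
  unfolding fK_def by (rule avg_pow_periodic) (rule f_per)

lemma fK_bound: "\<bar>fK n x\<bar> \<le> 1 / 2"
proof -
  have "-1/2 \<le> f x" "f x \<le> 1/2" for x using f_bound[of x] by linarith+
  from avg_pow_bounds[OF c(1) bmeas_f this, of n x] show ?thesis unfolding fK_def by linarith
qed

lemma fK_lip: "\<bar>fK n x - fK n y\<bar> \<le> \<bar>x - y\<bar>"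
proof (induction n arbitrary: x y)
  case (Suc n)
  have "fK (Suc n) = avg c (fK n)" by (simp add: fK_def)
  then show ?case using avg_lipschitz[OF c(1) bmeas_fK Suc] by simp
qed (simp add: fK_def f_lip)

lemma fR_bound: "x \<in> Omega \<Longrightarrow> \<bar>fR n x\<bar> \<le> 1 / 2"
proof (induction n arbitrary: x)
  case (Suc n)
  have S: "fR (Suc n) = mh_op c (acc M 0) (fR n)" by (simp add: fR_def R_def)
  have IH: "fR n y \<le> 1 / 2" "- 1 / 2 \<le> fR n y" if "y \<in> Omega" for y using Suc.IH[OF that] by linarith+
  have "fR (Suc n) x \<le> 1 / 2"
    unfolding S by (rule acceptance.mh_op_le[OF acceptance_reject c(1) Mc(4) Suc.prems bmeas_fR IH(1)[OF Suc.prems] IH(1)])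
  moreover have "- 1 / 2 \<le> fR (Suc n) x"
    unfolding S by (rule acceptance.mh_op_ge[OF acceptance_reject c(1) Mc(4) Suc.prems bmeas_fR IH(2)[OF Suc.prems] IH(2)])
  ultimately show ?case by linarith
qed (simp only: fR_def funpow_0 f_bound)

lemma P_close_K:
  assumes "x \<in> Omega" "bmeas \<phi>" "\<And>x. \<phi> (x + 1) = \<phi> x" "\<And>y. \<bar>\<phi> y - \<phi> x\<bar> \<le> 1"
  shows "\<bar>P \<phi> x - K \<phi> x\<bar> \<le> H"
proof -
  have e: "0 \<le> 1 - exp (- H)" using H by simp
  have "\<bar>mh_op c (acc M (exp (- H))) \<phi> x - mh_op c (\<lambda>_ _. 1) \<phi> x\<bar> \<le> (1 - exp (- H)) * 1"
  proof (rule acceptance.mh_op_diff_le[OF acceptance_P c(1) Mc(4) assms(1,2) acceptance_one])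
    show "\<bar>acc M (exp (- H)) x y - 1\<bar> \<le> 1 - exp (- H)" for y
      using upper_cases[of "real M * x"] upper_cases[of "real M * y"] e by (auto simp: acc_def)
  qed (use assms in auto)
  also have "\<dots> \<le> H" using exp_ge_add_one_self[of "- H"] by simp
  finally show ?thesis using mh_op_avg[OF c(1) Mc(4) assms(1,2,3)] by (simp add: P_def)
qed

lemma P_close_R:
  assumes "x \<in> Omega" "bmeas \<phi>" "\<And>y. y \<in> Omega \<Longrightarrow> \<bar>\<phi> y - \<phi> x\<bar> \<le> 1"
  shows "\<bar>P \<phi> x - R \<phi> x\<bar> \<le> exp (- H)"
proof -
  have "\<bar>mh_op c (acc M (exp (- H))) \<phi> x - mh_op c (acc M 0) \<phi> x\<bar> \<le> exp (- H) * 1"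
  proof (rule acceptance.mh_op_diff_le[OF acceptance_P c(1) Mc(4) assms(1,2) acceptance_reject])
    show "\<bar>acc M (exp (- H)) x y - acc M 0 x y\<bar> \<le> exp (- H)" for y
      using upper_cases[of "real M * x"] upper_cases[of "real M * y"] by (auto simp: acc_def)
  qed (use assms in auto)
  then show ?thesis by (simp add: P_def R_def)
qed

text \<open>From A every move is accepted, so there the Metropolis step is the proposal walk. From B
  the chain enters A with probability at most exp (- H).\<close>

lemma low_high:
  assumes "x \<in> Omega" shows "P (lowI M) x \<le> (lowI M x - lowI M x * bK 1 x) + exp (- H)"
proof (cases "lowI M x = 0")
  case True
  have "R (lowI M) x \<le> 0"
    unfolding R_def
  proof (rule acceptance.mh_op_le[OF acceptance_reject c(1) Mc(4) assms bmeas_lowI])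
    fix y assume "acc M 0 x y \<noteq> 0"
    then show "lowI M y \<le> 0" using True upper_cases[of "real M * y"] by (auto simp: acc_def lowI_def)
  qed (use True in auto)
  moreover have "\<bar>P (lowI M) x - R (lowI M) x\<bar> \<le> exp (- H)"
  proof (rule P_close_R[OF assms bmeas_lowI])
    show "\<bar>lowI M y - lowI M x\<bar> \<le> 1" for y
      using lowI_upI_cases[of M x] lowI_upI_cases[of M y] by auto
  qed
  ultimately show ?thesis using True by simp
next
  case False
  then have u: "upper (real M * x) = 0" "lowI M x = 1" using lowI_upI_cases[of M x] by (auto simp: upI_def)
  have "P (lowI M) x = mh_op c (\<lambda>_ _. 1) (lowI M) x"
    unfolding P_def mh_op_def using u by (simp add: acc_def cong: if_cong)
  also have "\<dots> = K (lowI M) x" by (rule mh_op_avg[OF c(1) Mc(4) assms]) auto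
  also have "\<dots> = 1 - K (upI M) x"
    unfolding lowI_upI(1)[abs_def] using c(1) by (subst avg_diff) auto
  finally show ?thesis using u by (simp add: bK_def)
qed

lemma G_pos: "G > 0" "2 / real G \<le> \<epsilon> / 50"
proof -
  have "100 / \<epsilon> > 0" using eps by simp
  then show g: "G > 0" by (simp add: G_def)
  have "100 / \<epsilon> \<le> real G" using eps by (simp add: G_def)
  then show "2 / real G \<le> \<epsilon> / 50" using eps g by (simp add: field_simps)
qed

text \<open>The cuts feed \<open>koksma\<close>, the next two families fix the flows between the
  levels, and the last one their imbalance. Its tolerance grows like sqrt n, in step with the lower
  bound of \<open>flow_ge\<close>, because the imbalance is later divided by the flow.\<close>

definition good :: "nat \<Rightarrow> (nat \<Rightarrow> real) \<Rightarrow> bool" where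
  "good T \<xi> \<longleftrightarrow> (\<forall>t\<ge>T.
     (\<forall>i\<le>G. \<bar>emp \<xi> t (initial_cut (lowI M) G i) - lam (initial_cut (lowI M) G i)\<bar> \<le> \<epsilon> / 50 \<and>
             \<bar>emp \<xi> t (initial_cut (upI M) G i) - lam (initial_cut (upI M) G i)\<bar> \<le> \<epsilon> / 50) \<and>
     (\<forall>n\<in>{1..N}. \<bar>emp \<xi> t (\<lambda>x. lowI M x * bK n x) - lam (\<lambda>x. lowI M x * bK n x)\<bar> \<le> \<epsilon> / 50 \<and>
             \<bar>emp \<xi> t (\<lambda>x. upI M x * (1 - bK n x)) - lam (\<lambda>x. upI M x * (1 - bK n x))\<bar> \<le> \<epsilon> / 50 \<and>
             \<bar>emp \<xi> t (\<lambda>x. upI M x - bK n x)\<bar> \<le> sqrt (real n) * \<epsilon> * c / 16))"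

definition ring_mean :: "(nat \<Rightarrow> real) \<Rightarrow> nat \<Rightarrow> (real \<Rightarrow> real) \<Rightarrow> (real \<Rightarrow> real) \<Rightarrow> real" where
  "ring_mean \<xi> t \<theta> \<phi> = emp \<xi> t (\<lambda>x. \<theta> x * \<phi> x) / emp \<xi> t \<theta>"

text \<open>The functions to which the recursion and the comparisons are applied. The set is
  countable, so almost sure identities for single functions hold for all of them outside one null
  set.\<close>

definition fam :: "(real \<Rightarrow> real) set" where
  "fam = (\<lambda>a _. a) ` {0, 1, 1/2, -1/2} \<union> {lowI M, upI M, \<lambda>x. lowI M x * bK 1 x, \<lambda>x. lowI M x - lowI M x * bK 1 x} \<union>
     range bK \<union> range fK \<union> range fR"

lemma bmeas_fam: "\<phi> \<in> fam \<Longrightarrow> bmeas \<phi>"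
  unfolding fam_def by (auto intro!: bmeas_mult bmeas_diff)

lemma fK_Suc: "fK (Suc n) = K (fK n)" and bK_Suc: "bK (Suc n) = K (bK n)" and fR_Suc: "fR (Suc n) = R (fR n)"
  by (simp_all add: fK_def bK_def fR_def)

end

text \<open>A deterministic model of one realisation: \<xi> is the level-1 trajectory and m S \<phi>
  stands for the conditional expectation of \<phi> at time T + S. For H = 0 the two potentials
  coincide, and the only ring consists of all visited points.\<close>

locale ee_run = ee_setup +
  fixes T :: nat and \<xi> :: "nat \<Rightarrow> real" and m :: "nat \<Rightarrow> (real \<Rightarrow> real) \<Rightarrow> real"
  assumes xi: "\<And>s. \<xi> s \<in> Omega" and good: "good T \<xi>"
    and m_rec: "\<And>S \<phi>. \<phi> \<in> fam \<Longrightarrow> m (Suc S) \<phi> = (1 - p) * m S (P \<phi>) + p *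
        (if H = 0 then emp \<xi> (T + S) \<phi>
         else m S (lowI M) * ring_mean \<xi> (T + S) (lowI M) \<phi> + m S (upI M) * ring_mean \<xi> (T + S) (upI M) \<phi>)"
    and m_le: "\<And>S \<phi> \<psi> e. \<phi> \<in> fam \<union> P ` fam \<Longrightarrow> \<psi> \<in> fam \<union> P ` fam \<Longrightarrow> e \<in> {0, H, exp (- H)} \<Longrightarrow>
        (\<And>x. x \<in> Omega \<Longrightarrow> \<phi> x \<le> \<psi> x + e) \<Longrightarrow> m S \<phi> \<le> m S \<psi> + e"
    and m_diff: "\<And>S \<phi> \<psi>. \<phi> \<in> fam \<Longrightarrow> \<psi> \<in> fam \<Longrightarrow> m S (\<lambda>x. \<phi> x - \<psi> x) = m S \<phi> - m S \<psi>"
    and m_const: "\<And>S a. a \<in> {0, 1, 1/2, -1/2} \<Longrightarrow> m S (\<lambda>_. a) = a"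
begin

lemma in_fam [intro, simp]: "(\<lambda>_. 0) \<in> fam" "(\<lambda>_. 1) \<in> fam" "(\<lambda>_. 1/2) \<in> fam" "(\<lambda>_. -1/2) \<in> fam"
    "lowI M \<in> fam" "upI M \<in> fam" "(\<lambda>x. lowI M x * bK 1 x) \<in> fam" "(\<lambda>x. lowI M x - lowI M x * bK 1 x) \<in> fam"
    "bK n \<in> fam" "fK n \<in> fam" "fR n \<in> fam"
  by (auto simp: fam_def)

lemma m_upper: "\<phi> \<in> fam \<union> P ` fam \<Longrightarrow> a \<in> {0, 1, 1/2, -1/2} \<Longrightarrow> (\<And>x. x \<in> Omega \<Longrightarrow> \<phi> x \<le> a) \<Longrightarrow> m S \<phi> \<le> a"
proof -
  assume *: "\<phi> \<in> fam \<union> P ` fam" "a \<in> {0, 1, 1/2, -1/2}" "\<And>x. x \<in> Omega \<Longrightarrow> \<phi> x \<le> a"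
  have "(\<lambda>_. a) \<in> fam \<union> P ` fam" using *(2) by (auto simp: fam_def)
  from m_le[OF *(1) this, of 0 S] m_const[OF *(2), of S] *(3) show ?thesis by simp
qed

lemma m_lower: "\<phi> \<in> fam \<union> P ` fam \<Longrightarrow> a \<in> {0, 1, 1/2, -1/2} \<Longrightarrow> (\<And>x. x \<in> Omega \<Longrightarrow> a \<le> \<phi> x) \<Longrightarrow> a \<le> m S \<phi>"
proof -
  assume *: "\<phi> \<in> fam \<union> P ` fam" "a \<in> {0, 1, 1/2, -1/2}" "\<And>x. x \<in> Omega \<Longrightarrow> a \<le> \<phi> x"
  have "(\<lambda>_. a) \<in> fam \<union> P ` fam" using *(2) by (auto simp: fam_def)
  from m_le[OF this *(1), of 0 S] m_const[OF *(2), of S] *(3) show ?thesis by simp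
qed

lemma m_close: "\<phi> \<in> fam \<union> P ` fam \<Longrightarrow> \<psi> \<in> fam \<union> P ` fam \<Longrightarrow> e \<in> {0, H, exp (- H)} \<Longrightarrow>
    (\<And>x. x \<in> Omega \<Longrightarrow> \<bar>\<phi> x - \<psi> x\<bar> \<le> e) \<Longrightarrow> \<bar>m S \<phi> - m S \<psi>\<bar> \<le> e"
proof -
  assume *: "\<phi> \<in> fam \<union> P ` fam" "\<psi> \<in> fam \<union> P ` fam" "e \<in> {0, H, exp (- H)}" "\<And>x. x \<in> Omega \<Longrightarrow> \<bar>\<phi> x - \<psi> x\<bar> \<le> e"
  have "\<phi> x \<le> \<psi> x + e" "\<psi> x \<le> \<phi> x + e" if "x \<in> Omega" for x using *(4)[OF that] by linarith+
  from m_le[OF *(1-3) this(1), of S] m_le[OF *(2,1,3) this(2), of S] show ?thesis by linarith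
qed

lemma m_low: "m S (lowI M) = 1 - m S (upI M)"
proof -
  have "lowI M = (\<lambda>x. 1 - upI M x)" by (simp add: lowI_upI(1) fun_eq_iff)
  then show ?thesis using m_diff[of "\<lambda>_. 1" "upI M" S] m_const[of 1 S] by simp
qed

lemma m_up_bounds: "0 \<le> m S (upI M)" "m S (upI M) \<le> 1"
  by (rule m_lower m_upper; auto)+

abbreviation "\<mu> S \<equiv> emp \<xi> (T + S)"

lemma test_cut:
  assumes "i \<le> G"
  shows "\<bar>\<mu> S (initial_cut (lowI M) G i) - lam (initial_cut (lowI M) G i)\<bar> \<le> \<epsilon> / 50"
    "\<bar>\<mu> S (initial_cut (upI M) G i) - lam (initial_cut (upI M) G i)\<bar> \<le> \<epsilon> / 50"
  using good assms unfolding good_def by (meson le_add1)+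

lemma test_bK:
  assumes "n \<ge> 1" "n \<le> N"
  shows "\<bar>\<mu> S (\<lambda>x. lowI M x * bK n x) - lam (\<lambda>x. lowI M x * bK n x)\<bar> \<le> \<epsilon> / 50"
    "\<bar>\<mu> S (\<lambda>x. upI M x * (1 - bK n x)) - lam (\<lambda>x. upI M x * (1 - bK n x))\<bar> \<le> \<epsilon> / 50"
    "\<bar>\<mu> S (\<lambda>x. upI M x - bK n x)\<bar> \<le> sqrt (real n) * \<epsilon> * c / 16"
  using good assms unfolding good_def by (meson atLeastAtMost_iff le_add1)+

lemma low_frac: "\<bar>\<mu> S (lowI M) - 1 / 2\<bar> \<le> \<epsilon> / 50" "\<mu> S (upI M) = 1 - \<mu> S (lowI M)"
    "0.49 < \<mu> S (lowI M)" "\<mu> S (lowI M) < 0.51"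
proof -
  have "initial_cut (lowI M) G G = lowI M"
    using G_pos frac_lt_1 by (auto simp: initial_cut_def fun_eq_iff)
  then show 1: "\<bar>\<mu> S (lowI M) - 1 / 2\<bar> \<le> \<epsilon> / 50" using test_cut(1)[of G S] by (simp add: lam_lowI)
  show "\<mu> S (upI M) = 1 - \<mu> S (lowI M)"
    using emp_diff[of \<xi> "T + S" "\<lambda>_. 1" "lowI M"] by (simp add: lowI_upI(2)[abs_def])
  show "0.49 < \<mu> S (lowI M)" "\<mu> S (lowI M) < 0.51" using 1 eps unfolding abs_le_iff by auto
qed

lemma koksma_fK:
  assumes \<theta>: "\<theta> = lowI M \<or> \<theta> = upI M"
  shows "\<bar>\<mu> S (\<lambda>x. \<theta> x * fK n x) - lam (\<lambda>x. \<theta> x * fK n x)\<bar> \<le> \<epsilon> / 20"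
proof -
  have "\<bar>\<mu> S (\<lambda>x. \<theta> x * fK n x) - lam (\<lambda>x. \<theta> x * fK n x)\<bar> \<le> 2 * 1 / real G + \<epsilon> / 50 * (1 + 1 / 2)"
    by (rule koksma) (use \<theta> xi G_pos fK_lip fK_bound test_cut in \<open>auto intro!: bmeas_mult\<close>)
  also have "\<dots> \<le> \<epsilon> / 20" using G_pos by simp
  finally show ?thesis .
qed

lemma koksma_fR: "\<bar>\<mu> S (\<lambda>x. upI M x * fR n x) - lam (\<lambda>x. upI M x * fR n x)\<bar> \<le> 13 / 100 * \<epsilon>"
proof -
  define B where "B = {x \<in> Omega. upI M x = 1}"
  have "3 / (4 * real M) \<in> B"
  proof -
    have "3 / (4 * real M) < 1" using M by simp
    moreover have "real M * (3 / (4 * real M)) = 3 / 4" using M by simp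
    moreover have "frac (3 / 4 :: real) = 3 / 4" by (simp add: frac_eq)
    ultimately show ?thesis by (simp add: B_def Omega_def upI_def upper_def)
  qed
  then have B: "B \<noteq> {}" by auto
  have lip: "\<bar>fR n x - fR n y\<bar> \<le> 3 * \<bar>x - y\<bar>" if "x \<in> B" "y \<in> B" for x y
    unfolding fR_def R_def using that f_lip by (intro reject_pow_lipschitz) (auto simp: B_def upI_def)
  have bd: "\<bar>fR n x\<bar> \<le> 1 / 2" if "x \<in> B" for x using that fR_bound[of x n] unfolding B_def by blast
  obtain \<psi> where \<psi>: "\<And>x. x \<in> B \<Longrightarrow> \<psi> x = fR n x" "\<And>x y. \<bar>\<psi> x - \<psi> y\<bar> \<le> 3 * \<bar>x - y\<bar>" "\<And>x. \<bar>\<psi> x\<bar> \<le> 1 / 2"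
    using lipschitz_extension[OF B _ lip bd] by (metis zero_le_numeral)
  have eq: "upI M x * fR n x = upI M x * \<psi> x" if "x \<in> Omega" for x
    using that \<psi>(1)[of x] lowI_upI_cases[of M x] by (auto simp: B_def)
  have "bmeas \<psi>" by (rule lipschitz_bmeas[OF \<psi>(2,3)])
  then have "\<bar>\<mu> S (\<lambda>x. upI M x * \<psi> x) - lam (\<lambda>x. upI M x * \<psi> x)\<bar> \<le> 2 * 3 / real G + \<epsilon> / 50 * (3 + 1 / 2)"
    by (intro koksma) (use xi G_pos \<psi> test_cut in \<open>auto intro!: bmeas_mult\<close>)
  also have "\<mu> S (\<lambda>x. upI M x * \<psi> x) = \<mu> S (\<lambda>x. upI M x * fR n x)"
    by (rule emp_cong) (simp add: eq xi)
  also have "lam (\<lambda>x. upI M x * \<psi> x) = lam (\<lambda>x. upI M x * fR n x)"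
    by (rule Bochner_Integration.integral_cong) (auto simp: eq)
  also have "2 * 3 / real G + \<epsilon> / 50 * (3 + 1 / 2) \<le> 13 / 100 * \<epsilon>" using G_pos by simp
  finally show ?thesis .
qed

lemma ring_mean_abs_le:
  assumes \<theta>: "\<theta> = lowI M \<or> \<theta> = upI M" and \<phi>: "\<And>x. x \<in> Omega \<Longrightarrow> \<bar>\<phi> x\<bar> \<le> 1 / 2"
  shows "\<bar>ring_mean \<xi> (T + S) \<theta> \<phi>\<bar> \<le> 1 / 2"
proof -
  have pos: "\<mu> S \<theta> > 0" using \<theta> low_frac[of S] by auto
  have t0: "0 \<le> \<theta> x" for x using \<theta> by auto
  have "\<mu> S (\<lambda>x. \<theta> x * \<phi> x) \<le> \<mu> S (\<lambda>x. (1 / 2) * \<theta> x)"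
  proof (rule emp_mono)
    fix s
    have "\<phi> (\<xi> s) * \<theta> (\<xi> s) \<le> (1 / 2) * \<theta> (\<xi> s)"
      using \<phi>[OF xi[of s]] t0[of "\<xi> s"] by (intro mult_right_mono) (auto simp: abs_le_iff)
    then show "\<theta> (\<xi> s) * \<phi> (\<xi> s) \<le> (1 / 2) * \<theta> (\<xi> s)" by (simp add: mult.commute)
  qed
  moreover have "\<mu> S (\<lambda>x. (- 1 / 2) * \<theta> x) \<le> \<mu> S (\<lambda>x. \<theta> x * \<phi> x)"
  proof (rule emp_mono)
    fix s
    have "(- 1 / 2) * \<theta> (\<xi> s) \<le> \<phi> (\<xi> s) * \<theta> (\<xi> s)"
      using \<phi>[OF xi[of s]] t0[of "\<xi> s"] by (intro mult_right_mono) (auto simp: abs_le_iff)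
    then show "(- 1 / 2) * \<theta> (\<xi> s) \<le> \<theta> (\<xi> s) * \<phi> (\<xi> s)" by (simp add: mult.commute)
  qed
  ultimately have "\<bar>\<mu> S (\<lambda>x. \<theta> x * \<phi> x)\<bar> \<le> (1 / 2) * \<mu> S \<theta>"
    unfolding emp_cmult[of \<xi> "T + S" "1 / 2" \<theta>] emp_cmult[of \<xi> "T + S" "- 1 / 2" \<theta>] by linarith
  then show ?thesis using pos by (simp add: ring_mean_def abs_divide divide_le_eq)
qed

lemma lam_half_bound:
  assumes \<theta>: "\<theta> = lowI M \<or> \<theta> = upI M" and \<phi>: "bmeas \<phi>" "\<And>x. x \<in> Omega \<Longrightarrow> \<bar>\<phi> x\<bar> \<le> 1 / 2"
  shows "\<bar>lam (\<lambda>x. \<theta> x * \<phi> x)\<bar> \<le> 1 / 4"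
proof -
  have t: "bmeas \<theta>" "0 \<le> \<theta> x" for x using \<theta> by auto
  have "\<bar>lam (\<lambda>x. \<theta> x * \<phi> x)\<bar> \<le> lam (\<lambda>x. (1 / 2) * \<theta> x)"
    unfolding real_norm_def[symmetric]
  proof (rule Bochner_Integration.integral_norm_bound_integral)
    fix x assume "x \<in> space circ_leb"
    then show "norm (\<theta> x * \<phi> x) \<le> 1 / 2 * \<theta> x"
      using \<phi>(2)[of x] t(2)[of x] mult_left_mono[of "\<bar>\<phi> x\<bar>" "1/2" "\<theta> x"] by (simp add: abs_mult mult.commute)
  qed (intro bmeas_integrable_circ bmeas_mult bmeas_cmult t(1) \<phi>(1))+
  also have "\<dots> = 1 / 4" using \<theta> lam_lowI lam_upI by auto
  finally show ?thesis .
qed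

text \<open>Each level has Lebesgue measure 1 / 2, so the limit of a ring mean is twice the
  integral. The term \<epsilon> / 100 is the error of the ring size, and 0.49 bounds that size from
  below.\<close>

lemma ring_mean_approx:
  assumes \<theta>: "\<theta> = lowI M \<or> \<theta> = upI M" and \<phi>: "bmeas \<phi>" "\<And>x. x \<in> Omega \<Longrightarrow> \<bar>\<phi> x\<bar> \<le> 1 / 2"
    and k: "\<bar>\<mu> S (\<lambda>x. \<theta> x * \<phi> x) - lam (\<lambda>x. \<theta> x * \<phi> x)\<bar> \<le> k"
  shows "\<bar>ring_mean \<xi> (T + S) \<theta> \<phi> - 2 * lam (\<lambda>x. \<theta> x * \<phi> x)\<bar> \<le> (k + \<epsilon> / 100) / 0.49"
proof -
  define a where "a = \<mu> S \<theta>"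
  define E where "E = \<mu> S (\<lambda>x. \<theta> x * \<phi> x)"
  define l where "l = lam (\<lambda>x. \<theta> x * \<phi> x)"
  have "\<bar>(1 - b) - 1 / 2\<bar> = \<bar>b - 1 / 2\<bar>" for b :: real by linarith
  then have a: "a > 0.49" "\<bar>a - 1 / 2\<bar> \<le> \<epsilon> / 50" using \<theta> low_frac[of S] by (auto simp: a_def)
  have l: "\<bar>l\<bar> \<le> 1 / 4" unfolding l_def by (rule lam_half_bound[OF \<theta> \<phi>])
  have "\<bar>(2 * l) * (1 / 2 - a)\<bar> \<le> (1 / 2) * (\<epsilon> / 50)"
    unfolding abs_mult using l a eps by (intro mult_mono) (auto simp: abs_minus_commute)
  moreover have "E - 2 * l * a = (E - l) + (2 * l) * (1 / 2 - a)" by (simp add: algebra_simps)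
  ultimately have num: "\<bar>E - 2 * l * a\<bar> \<le> k + \<epsilon> / 100" using k unfolding E_def[symmetric] l_def[symmetric] by linarith
  have "\<bar>E / a - 2 * l\<bar> = \<bar>E - 2 * l * a\<bar> / a"
  proof -
    have "E / a - 2 * l = (E - 2 * l * a) / a" using a by (simp add: field_simps)
    then show ?thesis using a by (simp add: abs_divide)
  qed
  also have "\<dots> \<le> (k + \<epsilon> / 100) / 0.49" using num a by (intro frac_le) auto
  finally show ?thesis by (simp add: ring_mean_def E_def a_def l_def)
qed

text \<open>Centring reads l + exp H * u = 0 for the integrals l over A and u over B. As l is
  bounded, u is of order exp (- H), while l + u = (1 - exp (- H)) * l is of order H: one estimate
  for each regime of H.\<close>

lemma lam_f: "\<bar>lam (\<lambda>x. lowI M x * f x) + lam (\<lambda>x. upI M x * f x)\<bar> \<le> H / 4"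
    "\<bar>lam (\<lambda>x. upI M x * f x)\<bar> \<le> exp (- H) / 4"
proof -
  define l where "l = lam (\<lambda>x. lowI M x * f x)"
  define u where "u = lam (\<lambda>x. upI M x * f x)"
  have lb: "\<bar>l\<bar> \<le> 1 / 4" unfolding l_def by (rule lam_half_bound[OF _ bmeas_f f_bound]) simp
  have "l = - (exp H * u)" using f_mean by (simp add: l_def u_def)
  then have "exp (- H) * l = - u" by (simp add: exp_minus)
  then have u: "u = - (exp (- H) * l)" by simp
  have "\<bar>u\<bar> = exp (- H) * \<bar>l\<bar>" unfolding u by (simp add: abs_mult)
  also have "\<dots> \<le> exp (- H) * (1 / 4)" using lb by (intro mult_left_mono) auto
  finally show "\<bar>u\<bar> \<le> exp (- H) / 4" by simp
  have "l + u = (1 - exp (- H)) * l" unfolding u by (simp add: algebra_simps)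
  then have "\<bar>l + u\<bar> = (1 - exp (- H)) * \<bar>l\<bar>" using H by (simp add: abs_mult)
  also have "\<dots> \<le> H * (1 / 4)" using lb exp_ge_add_one_self[of "- H"] H by (intro mult_mono) auto
  finally show "\<bar>l + u\<bar> \<le> H / 4" by simp
qed

lemma lam_fK: "lam (\<lambda>x. lowI M x * fK n x) + lam (\<lambda>x. upI M x * fK n x) = lam (\<lambda>x. lowI M x * f x) + lam (\<lambda>x. upI M x * f x)"
proof -
  have *: "lam (\<lambda>x. lowI M x * \<phi> x) + lam (\<lambda>x. upI M x * \<phi> x) = lam \<phi>" if "bmeas \<phi>" for \<phi>
  proof -
    have i: "integrable circ_leb (\<lambda>x. lowI M x * \<phi> x)" "integrable circ_leb (\<lambda>x. upI M x * \<phi> x)"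
      using that by (auto intro!: bmeas_integrable_circ bmeas_mult)
    have "lam (\<lambda>x. lowI M x * \<phi> x) + lam (\<lambda>x. upI M x * \<phi> x) = lam (\<lambda>x. lowI M x * \<phi> x + upI M x * \<phi> x)"
      using i by simp
    also have "(\<lambda>x. lowI M x * \<phi> x + upI M x * \<phi> x) = \<phi>" by (simp add: lowI_upI(1) fun_eq_iff algebra_simps)
    finally show ?thesis .
  qed
  show ?thesis unfolding *[OF bmeas_fK] *[OF bmeas_f] unfolding fK_def by (rule lam_K_pow) (auto simp: f_per)
qed

text \<open>Lebesgue measure on B is reversible for the walk that rejects exits from B, so the
  integral over B is the same for all iterates.\<close>

lemma lam_fR: "lam (\<lambda>x. upI M x * fR n x) = lam (\<lambda>x. upI M x * f x)"
proof (induction n)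
  case (Suc n)
  have "lam (\<lambda>x. upI M x * mh_op c (acc M 0) (fR n) x) = lam (\<lambda>x. upI M x * fR n x)"
  proof (rule acceptance.mh_op_detailed_balance[OF acceptance_reject c(1) bmeas_upI bmeas_fR])
    show "upI M x * acc M 0 x y = upI M y * acc M 0 y x" for x y
      using upper_cases[of "real M * x"] upper_cases[of "real M * y"] by (auto simp: upI_def acc_def)
  qed
  then show ?case using Suc by (simp add: fR_Suc R_def)
qed (simp add: fR_def)

end

section \<open>Decay of the level masses and of the correlation along one trajectory\<close>

context ee_run
begin

definition rate :: real where "rate = p * (1 - p) * (real M * c)"
text \<open>Since A1 * c equals rate / 32, as \<open>run_bound\<close> shows, this is exp (A1 * c /
  4): the claimed decay per time step, before S / 4 is rounded down.\<close>

definition gr :: real where "gr = exp (rate / 128)"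

lemma rate_bounds: "0 < rate" "rate \<le> 1 / 4" "rate \<le> p * (real M * c)"
proof -
  show "0 < rate" using p Mc by (simp add: rate_def)
  show r: "rate \<le> p * (real M * c)"
    unfolding rate_def using p Mc mult_left_le[of "1 - p" p] by (intro mult_right_mono) auto
  have "p * (real M * c) \<le> 1 * (1 / 4)" using p Mc by (intro mult_mono) auto
  with r show "rate \<le> 1 / 4" by simp
qed

lemma rate_le_p: "rate \<le> p"
proof -
  have "p * (real M * c) \<le> p * 1" using p Mc by (intro mult_left_mono) auto
  then show ?thesis using rate_bounds(3) by simp
qed

lemma gr_bounds: "1 \<le> gr" "gr \<le> 2" "gr - 1 \<le> p * (1 - p) * (real M * c / 25) / 2" "1 - rate / 50 \<le> 1 / gr\<^sup>2"
proof -
  define y where "y = rate / 128"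
  have y: "0 < y" "y \<le> 1 / 512" using rate_bounds by (auto simp: y_def)
  have "exp y \<le> 1 + y + y\<^sup>2" using y by (intro exp_bound) auto
  also have "y\<^sup>2 \<le> y * (1 / 512)" unfolding power2_eq_square using y by (intro mult_left_mono) auto
  finally have e: "gr \<le> 1 + y + y * (1 / 512)" by (simp add: gr_def y_def)
  show "1 \<le> gr" using y by (simp add: gr_def y_def)
  show "gr \<le> 2" using e y by simp
  have "gr - 1 \<le> rate / 50" using e rate_bounds by (simp add: y_def)
  then show "gr - 1 \<le> p * (1 - p) * (real M * c / 25) / 2" by (simp add: rate_def)
  have "1 / gr\<^sup>2 = exp (- (rate / 64))"
    by (simp add: gr_def exp_minus inverse_eq_divide flip: exp_of_nat_mult exp_double)
  moreover have "1 + (- (rate / 64)) \<le> exp (- (rate / 64))" by (rule exp_ge_add_one_self)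
  ultimately show "1 - rate / 50 \<le> 1 / gr\<^sup>2" using rate_bounds by simp
qed

lemma bK_0: "bK 0 = upI M" by (simp add: bK_def)

text \<open>Starting from a uniform point of a ring, \<alpha> is the probability of being carried
  from A to B by n walk steps and \<beta> that of being carried from B to A; one cycle multiplies
  the deviation of the mass of B from 1 / 2 by 1 - \<alpha> - \<beta>. The unnormalised
  probabilities E1 and E2 differ by the empirical mean of \<open>upI M\<close> minus
  \<open>bK n\<close>, the third kind of test.\<close>

lemma ring_mean_bK:
  fixes S n
  defines "\<alpha> \<equiv> ring_mean \<xi> (T + S) (lowI M) (bK n)" and "\<beta> \<equiv> 1 - ring_mean \<xi> (T + S) (upI M) (bK n)"
  assumes n: "n \<ge> 1"
  defines "\<kappa> \<equiv> 1 - \<bar>1 - \<alpha> - \<beta>\<bar>"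
  shows "real M * c / 25 \<le> \<kappa>" "\<bar>\<alpha> - \<beta>\<bar> / 2 \<le> 1.1 * \<epsilon> * \<kappa>"
proof -
  define a where "a = \<mu> S (lowI M)"
  define E1 where "E1 = \<mu> S (\<lambda>x. lowI M x * bK n x)"
  define E2 where "E2 = \<mu> S (\<lambda>x. upI M x * (1 - bK n x))"
  have a: "0.49 < a" "a < 0.51" "\<bar>a - 1 / 2\<bar> \<le> \<epsilon> / 50" using low_frac[of S] by (auto simp: a_def)
  have up: "\<mu> S (upI M) = 1 - a" using low_frac[of S] by (simp add: a_def)
  have \<alpha>: "\<alpha> = E1 / a" by (simp add: \<alpha>_def ring_mean_def E1_def a_def)
  have "E2 = \<mu> S (upI M) - \<mu> S (\<lambda>x. upI M x * bK n x)"
    unfolding E2_def emp_diff[symmetric] by (simp add: right_diff_distrib)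
  then have E2': "E2 = (1 - a) - \<mu> S (\<lambda>x. upI M x * bK n x)" unfolding up .
  have \<beta>: "\<beta> = E2 / (1 - a)"
    unfolding E2' using a by (simp add: \<beta>_def ring_mean_def up diff_divide_distrib)
  have Mc1: "real M * c \<le> 1" "0 < real M * c" using Mc by auto
  define m where "m = min (real M * c * sqrt (real n)) 1"
  have sn: "1 \<le> sqrt (real n)" using n by simp
  have m: "0 < m" "m \<le> 1" "real M * c \<le> m"
    using Mc1 sn mult_left_mono[OF sn, of "real M * c"] by (auto simp: m_def)
  have e384: "\<epsilon> \<le> m / 384" using eps(3) m(3) by (simp add: mult.commute)
  have "m / 25 \<le> \<kappa> \<and> \<bar>\<alpha> - \<beta>\<bar> / 2 \<le> 1.1 * \<epsilon> * \<kappa>"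
  proof (cases "n \<le> N")
    case True
    note t = test_bK[OF n True, of S]
    define \<theta> where "\<theta> = flow (real M * c) n"
    have E: "\<bar>E1 - \<theta>\<bar> \<le> \<epsilon> / 50" "\<bar>E2 - \<theta>\<bar> \<le> \<epsilon> / 50"
      using t(1,2) by (simp_all add: E1_def E2_def \<theta>_def lam_low_bK lam_up_bK)
    have \<theta>1: "m / 95 \<le> \<theta>" unfolding \<theta>_def m_def using flow_ge[of "real M * c" n] Mc n by simp
    have "1 / (2 * 3.2) \<le> 1 / (2 * pi)" using pi_approx by (intro divide_left_mono) auto
    then have \<theta>2: "\<theta> \<le> 11 / 32" using flow_le[of "real M * c" n] Mc by (simp add: \<theta>_def)
    have "E2 - E1 = \<mu> S (\<lambda>x. upI M x - bK n x)"
      unfolding E1_def E2_def emp_diff[symmetric] by (simp add: lowI_upI(1) algebra_simps)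
    then have d: "\<bar>E1 - E2\<bar> \<le> sqrt (real n) * \<epsilon> * c / 16" using t(3) by linarith
    have bal: "\<bar>E1 - E2\<bar> \<le> m * \<epsilon> / 25"
    proof (cases "real M * c * sqrt (real n) \<le> 1")
      case True
      then have "m = real M * c * sqrt (real n)" by (simp add: m_def)
      \<comment> \<open>M \<ge> 2 turns the tolerance, which contains c sqrt n, into a multiple of M
        c sqrt n, which is m.\<close>
      moreover have "2 * (sqrt (real n) * \<epsilon> * c) \<le> real M * (sqrt (real n) * \<epsilon> * c)"
        using M eps c by (intro mult_right_mono) auto
      ultimately have "sqrt (real n) * \<epsilon> * c / 16 \<le> m * \<epsilon> / 32" by (simp add: algebra_simps)
      also have "\<dots> \<le> m * \<epsilon> / 25" using m eps by simp
      finally show ?thesis using d by simp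
    next
      case False
      then have "m = 1" by (simp add: m_def)
      then show ?thesis using E unfolding abs_le_iff by auto
    qed
    show ?thesis
      unfolding \<kappa>_def \<alpha> \<beta>
      using cycle_bounds[OF eps(1) _ m(1,2) e384 a(3) E \<theta>1 \<theta>2 bal] eps by simp
  next
    case False
    have n0: "n > 0" using n by simp
    have N: "1 / \<epsilon> ^ 5 \<le> real n" using False by (simp add: N_def) linarith
    have mix: "\<bar>bK n x - 1 / 2\<bar> \<le> \<epsilon> / 100" for x
    proof -
      have "384 * \<epsilon> \<le> real M * c" using eps by (simp add: mult.commute)
      then have "(384 * \<epsilon>)\<^sup>2 \<le> (real M * c)\<^sup>2" using eps by (intro power_mono) auto
      then have "1 / (4 * (real M * c)\<^sup>2) \<le> 1 / (4 * (384 * \<epsilon>)\<^sup>2)"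
        using eps Mc1 M by (intro divide_left_mono mult_pos_pos) auto
      then have "(1 / (4 * (real M * c)\<^sup>2))\<^sup>2 \<le> (1 / (4 * (384 * \<epsilon>)\<^sup>2))\<^sup>2"
        by (intro power_mono) auto
      then have "(1 / (4 * (real M * c)\<^sup>2))\<^sup>2 / real n \<le> (1 / (4 * (384 * \<epsilon>)\<^sup>2))\<^sup>2 / (1 / \<epsilon> ^ 5)"
        using N eps by (intro frac_le) auto
      also have "\<dots> = \<epsilon> / (4 * 384\<^sup>2)\<^sup>2" using eps by (simp add: field_simps power_mult_distrib eval_nat_numeral)
      also have "\<dots> \<le> \<epsilon> / 100" using eps by (intro divide_left_mono) auto
      finally show ?thesis using bK_mixed[OF n0, of x] by linarith
    qed
    have E1: "\<bar>E1 - a / 2\<bar> \<le> a * (\<epsilon> / 100)"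
    proof -
      have "E1 - a / 2 = \<mu> S (\<lambda>x. lowI M x * bK n x - (1 / 2) * lowI M x)"
        using emp_cmult[of \<xi> "T + S" "1 / 2" "lowI M"] unfolding E1_def a_def emp_diff by simp
      also have "\<dots> \<le> \<mu> S (\<lambda>x. (\<epsilon> / 100) * lowI M x)"
      proof (rule emp_mono)
        fix s
        have "bK n (\<xi> s) - 1 / 2 \<le> \<epsilon> / 100" using mix[of "\<xi> s"] by linarith
        from mult_left_mono[OF this, of "lowI M (\<xi> s)"]
        show "lowI M (\<xi> s) * bK n (\<xi> s) - (1 / 2) * lowI M (\<xi> s) \<le> (\<epsilon> / 100) * lowI M (\<xi> s)" by (simp add: algebra_simps)
      qed
      also have "\<dots> = (\<epsilon> / 100) * a" by (simp only: emp_cmult a_def)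
      finally have 1: "E1 - a / 2 \<le> (\<epsilon> / 100) * a" .
      have "(- (\<epsilon> / 100)) * a = \<mu> S (\<lambda>x. (- (\<epsilon> / 100)) * lowI M x)" by (simp only: emp_cmult a_def)
      also have "\<dots> \<le> \<mu> S (\<lambda>x. lowI M x * bK n x - (1 / 2) * lowI M x)"
      proof (rule emp_mono)
        fix s
        have "- (\<epsilon> / 100) \<le> bK n (\<xi> s) - 1 / 2" using mix[of "\<xi> s"] by linarith
        from mult_left_mono[OF this, of "lowI M (\<xi> s)"]
        show "(- (\<epsilon> / 100)) * lowI M (\<xi> s) \<le> lowI M (\<xi> s) * bK n (\<xi> s) - (1 / 2) * lowI M (\<xi> s)" by (simp add: algebra_simps)
      qed
      also have "\<dots> = E1 - a / 2"
        using emp_cmult[of \<xi> "T + S" "1 / 2" "lowI M"] unfolding E1_def a_def emp_diff by simp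
      finally show ?thesis using 1 by (intro abs_leI; simp only: mult.commute minus_mult_left; linarith)
    qed
    have E2: "\<bar>E2 - (1 - a) / 2\<bar> \<le> (1 - a) * (\<epsilon> / 100)"
    proof -
      have "E2 - (1 - a) / 2 = \<mu> S (\<lambda>x. upI M x * (1 - bK n x) - (1 / 2) * upI M x)"
        using emp_cmult[of \<xi> "T + S" "1 / 2" "upI M"] unfolding E2_def up[symmetric] emp_diff by simp
      also have "\<dots> \<le> \<mu> S (\<lambda>x. (\<epsilon> / 100) * upI M x)"
      proof (rule emp_mono)
        fix s
        have "1 / 2 - bK n (\<xi> s) \<le> \<epsilon> / 100" using mix[of "\<xi> s"] by linarith
        from mult_left_mono[OF this, of "upI M (\<xi> s)"]
        show "upI M (\<xi> s) * (1 - bK n (\<xi> s)) - (1 / 2) * upI M (\<xi> s) \<le> (\<epsilon> / 100) * upI M (\<xi> s)" by (simp add: algebra_simps)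
      qed
      also have "\<dots> = (\<epsilon> / 100) * (1 - a)" by (simp only: emp_cmult up)
      finally have 1: "E2 - (1 - a) / 2 \<le> (\<epsilon> / 100) * (1 - a)" .
      have "(- (\<epsilon> / 100)) * (1 - a) = \<mu> S (\<lambda>x. (- (\<epsilon> / 100)) * upI M x)" by (simp only: emp_cmult up)
      also have "\<dots> \<le> \<mu> S (\<lambda>x. upI M x * (1 - bK n x) - (1 / 2) * upI M x)"
      proof (rule emp_mono)
        fix s
        have "- (\<epsilon> / 100) \<le> 1 / 2 - bK n (\<xi> s)" using mix[of "\<xi> s"] by linarith
        from mult_left_mono[OF this, of "upI M (\<xi> s)"]
        show "(- (\<epsilon> / 100)) * upI M (\<xi> s) \<le> upI M (\<xi> s) * (1 - bK n (\<xi> s)) - (1 / 2) * upI M (\<xi> s)" by (simp add: algebra_simps)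
      qed
      also have "\<dots> = E2 - (1 - a) / 2"
        using emp_cmult[of \<xi> "T + S" "1 / 2" "upI M"] unfolding E2_def up[symmetric] emp_diff by simp
      finally show ?thesis using 1 by (intro abs_leI; simp only: mult.commute minus_mult_left; linarith)
    qed
    have "0 < a" "a < 1" "\<epsilon> \<le> 1 / 512" using a eps by auto
    note cb = cycle_bounds_mixed[OF eps(1) \<open>\<epsilon> \<le> 1 / 512\<close> m(1,2) \<open>0 < a\<close> \<open>a < 1\<close> E1 E2]
    show ?thesis unfolding \<kappa>_def \<alpha> \<beta> using cb by blast
  qed
  then show "real M * c / 25 \<le> \<kappa>" "\<bar>\<alpha> - \<beta>\<bar> / 2 \<le> 1.1 * \<epsilon> * \<kappa>" using m(3) by auto
qed

text \<open>The deviation w of the mass of B from 1 / 2 obeys a renewal inequality: a cycle with at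
  least one step contracts its excess over \<delta> by 1 - s, a cycle without steps keeps it.
  Working with the positive part of w - \<delta> disposes of the bias of every cycle at once,
  because \<delta> is the fixed point of these bounds.\<close>

lemma low_balance:
  assumes H0: "H > 0"
  shows "\<bar>m S (upI M) - 1 / 2\<bar> \<le> 1.1 * \<epsilon> + H / (p * (real M * c / 25)) + 1 / gr ^ S"
proof -
  define q where "q = 1 - p"
  define s where "s = real M * c / 25"
  define \<delta> where "\<delta> = 1.1 * \<epsilon>"
  define w where "w = (\<lambda>S. \<bar>m S (upI M) - 1 / 2\<bar>)"
  define J where "J = (\<lambda>S n. m S (lowI M) * ring_mean \<xi> (T + S) (lowI M) (bK n) + m S (upI M) * ring_mean \<xi> (T + S) (upI M) (bK n) - 1 / 2)"
  define A where "A = (\<lambda>S n. m S (bK n) - 1 / 2)"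
  have q: "0 < q" "q < 1" using p by (auto simp: q_def)
  have s: "0 < s" "s \<le> 1 / 2" using Mc by (auto simp: s_def)
  have \<delta>0: "\<delta> \<ge> 0" using eps by (simp add: \<delta>_def)
  have rec: "\<bar>A (Suc S) n - (q * A S (Suc n) + p * J S n)\<bar> \<le> q * H" for S n
  proof -
    have "\<bar>m S (P (bK n)) - m S (bK (Suc n))\<bar> \<le> H"
    proof (rule m_close)
      fix x assume x: "x \<in> Omega"
      show "\<bar>P (bK n) x - bK (Suc n) x\<bar> \<le> H"
        unfolding bK_Suc
      proof (rule P_close_K[OF x])
        show "\<bar>bK n y - bK n x\<bar> \<le> 1" for y using bK_bounds[of n x] bK_bounds[of n y] by linarith
      qed auto
    qed auto
    then have "\<bar>q * (m S (P (bK n)) - m S (bK (Suc n)))\<bar> \<le> q * H"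
      unfolding abs_mult using q by (intro mult_mono) auto
    moreover have "A (Suc S) n - (q * A S (Suc n) + p * J S n) = q * (m S (P (bK n)) - m S (bK (Suc n)))"
      using H0 by (simp add: A_def J_def m_rec q_def algebra_simps diff_divide_distrib)
    ultimately show ?thesis by simp
  qed
  have Jb: "\<bar>J S n\<bar> \<le> (if n = 0 then 1 else 1 - s) * max 0 (w S - \<delta>) + \<delta>" for S n
  proof (cases "n = 0")
    case True
    have "ring_mean \<xi> (T + S) (lowI M) (bK 0) = 0"
    proof -
      have "(\<lambda>x. lowI M x * upI M x) = (\<lambda>_. 0)" using lowI_upI_cases by (auto simp: fun_eq_iff)
      then show ?thesis by (simp add: ring_mean_def bK_0)
    qed
    moreover have "ring_mean \<xi> (T + S) (upI M) (bK 0) = 1"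
    proof -
      have "(\<lambda>x. upI M x * upI M x) = upI M" using lowI_upI_cases by (fastforce simp: fun_eq_iff)
      then show ?thesis using low_frac[of S] by (simp add: ring_mean_def bK_0)
    qed
    ultimately have "\<bar>J S n\<bar> = w S" using True by (simp add: J_def w_def)
    then show ?thesis using True by (simp add: max_def)
  next
    case False
    then have n: "n \<ge> 1" by simp
    define \<alpha> where "\<alpha> = ring_mean \<xi> (T + S) (lowI M) (bK n)"
    define \<beta> where "\<beta> = 1 - ring_mean \<xi> (T + S) (upI M) (bK n)"
    define \<kappa> where "\<kappa> = 1 - \<bar>1 - \<alpha> - \<beta>\<bar>"
    have k: "s \<le> \<kappa>" "\<bar>\<alpha> - \<beta>\<bar> / 2 \<le> \<delta> * \<kappa>"
      using ring_mean_bK[OF n, of S] by (simp_all add: s_def \<delta>_def \<kappa>_def \<alpha>_def \<beta>_def)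
    have k1: "\<kappa> \<le> 1" by (simp add: \<kappa>_def)
    define v where "v = m S (upI M)"
    have "J S n = (1 - v) * \<alpha> + v * (1 - \<beta>) - 1 / 2" by (simp add: J_def m_low v_def \<alpha>_def \<beta>_def)
    also have "\<dots> = (v - 1 / 2) * (1 - \<alpha> - \<beta>) + (\<alpha> - \<beta>) / 2" by (simp add: field_simps)
    also have "\<bar>\<dots>\<bar> \<le> \<bar>v - 1 / 2\<bar> * \<bar>1 - \<alpha> - \<beta>\<bar> + \<bar>\<alpha> - \<beta>\<bar> / 2"
      using abs_triangle_ineq[of "(v - 1 / 2) * (1 - \<alpha> - \<beta>)" "(\<alpha> - \<beta>) / 2"] by (simp add: abs_mult)
    also have "\<dots> \<le> w S * (1 - \<kappa>) + \<delta> * \<kappa>" using k(2) by (simp add: w_def v_def \<kappa>_def)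
    also have "\<dots> = (1 - \<kappa>) * (w S - \<delta>) + \<delta>" by (simp add: algebra_simps)
    also have "(1 - \<kappa>) * (w S - \<delta>) \<le> (1 - \<kappa>) * max 0 (w S - \<delta>)" using k1 by (intro mult_left_mono) auto
    also have "\<dots> \<le> (1 - s) * max 0 (w S - \<delta>)" using k by (intro mult_right_mono) auto
    finally show ?thesis using False by simp
  qed
  have A0: "\<bar>A 0 n\<bar> \<le> 1 / 2" for n
  proof -
    have "0 \<le> m 0 (bK n)" "m 0 (bK n) \<le> 1" by (rule m_lower m_upper; auto)+
    then show ?thesis unfolding A_def by linarith
  qed
  have y: "max 0 (w S - \<delta>) \<le> (\<Sum>n<S. p * q ^ n * ((if n = 0 then 1 else 1 - s) * max 0 (w (S - 1 - n) - \<delta>))) + q ^ S / 2 + q * H / p" for S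
  proof -
    define Sg where "Sg = (\<Sum>n<S. p * q ^ n * ((if n = 0 then 1 else 1 - s) * max 0 (w (S - 1 - n) - \<delta>)))"
    have ex: "\<bar>A S 0 - ((\<Sum>n<S. p * q ^ n * J (S - 1 - n) (0 + n)) + q ^ S * A 0 (0 + S))\<bar> \<le> q * H / p"
      by (rule renewal_expand[where A=A, OF p q_def H rec])
    have "w S = \<bar>A S 0\<bar>" by (simp add: w_def A_def bK_0)
    have "\<bar>\<Sum>n<S. p * q ^ n * J (S - 1 - n) (0 + n)\<bar> \<le> (\<Sum>n<S. p * q ^ n * ((if n = 0 then 1 else 1 - s) * max 0 (w (S - 1 - n) - \<delta>) + \<delta>))"
    proof (rule order_trans[OF sum_abs sum_mono])
      fix n
      have pq: "0 \<le> p * q ^ n" using p q by simp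
      have "\<bar>p * q ^ n * J (S - 1 - n) n\<bar> = p * q ^ n * \<bar>J (S - 1 - n) n\<bar>" using pq by (simp only: abs_mult[of "p * q ^ n"] abs_of_nonneg)
      also have "\<dots> \<le> p * q ^ n * ((if n = 0 then 1 else 1 - s) * max 0 (w (S - 1 - n) - \<delta>) + \<delta>)"
        using Jb[of "S - 1 - n" n] pq by (rule mult_left_mono)
      finally show "\<bar>p * q ^ n * J (S - 1 - n) (0 + n)\<bar> \<le> p * q ^ n * ((if n = 0 then 1 else 1 - s) * max 0 (w (S - 1 - n) - \<delta>) + \<delta>)" by simp
    qed
    also have "\<dots> = Sg + (\<Sum>n<S. p * q ^ n) * \<delta>"
      by (simp only: Sg_def distrib_left sum.distrib sum_distrib_right)
    also have "(\<Sum>n<S. p * q ^ n) * \<delta> \<le> \<delta>"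
    proof -
      have "(\<Sum>n<S. p * q ^ n) = 1 - q ^ S"
        using p q by (simp add: sum_distrib_left[symmetric] sum_gp_strict q_def)
      then have "(\<Sum>n<S. p * q ^ n) \<le> 1" using q by simp
      then show ?thesis using \<delta>0 mult_right_mono[of _ 1 \<delta>] by fastforce
    qed
    finally have 1: "\<bar>\<Sum>n<S. p * q ^ n * J (S - 1 - n) (0 + n)\<bar> \<le> Sg + \<delta>" by simp
    have 2: "\<bar>q ^ S * A 0 (0 + S)\<bar> \<le> q ^ S / 2"
      using A0[of S] q mult_left_mono[of "\<bar>A 0 S\<bar>" "1/2" "q ^ S"] by (simp add: abs_mult)
    have "w S - \<delta> \<le> Sg + q ^ S / 2 + q * H / p"
      unfolding \<open>w S = \<bar>A S 0\<bar>\<close> using ex 1 2 unfolding abs_le_iff by linarith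
    moreover have "0 \<le> Sg" unfolding Sg_def using p q s by (intro sum_nonneg mult_nonneg_nonneg) auto
    then have "0 \<le> Sg + q ^ S / 2 + q * H / p" using p q H by simp
    ultimately show ?thesis unfolding Sg_def by simp
  qed
  have "max 0 (w S - \<delta>) \<le> H / (p * s) + 1 / gr ^ S"
  proof (rule renewal_decay[OF p q_def s gr_bounds(1) _ _ _ y])
    show "gr - 1 \<le> p * q * s / 2" using gr_bounds(3) by (simp add: q_def s_def)
    show "0 \<le> H / (p * s)" using H p s by simp
    show "q * H / p \<le> q * s * (H / (p * s))" using s by simp
  qed
  then show ?thesis unfolding w_def \<delta>_def s_def by linarith
qed

text \<open>Decompose at the last ring jump. The ring means are close to 2 L and 2 U with L + U of
  order H, so in the mixture of the two rings the difference U - L appears only together with the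
  deviation from 1 / 2 that \<open>low_balance\<close> controls.\<close>

lemma final_bound_small_H:
  assumes H1: "H < 1"
  shows "\<bar>m S f\<bar> \<le> 2 * \<epsilon> + 30 * H / rate + 3 / gr ^ S"
proof -
  define q where "q = 1 - p"
  define s where "s = real M * c / 25"
  define E where "E = H / (p * s)"
  have q: "0 < q" "q < 1" using p by (auto simp: q_def)
  have s: "0 < s" "s \<le> 1 / 2" using Mc by (auto simp: s_def)
  have g1: "gr - 1 \<le> p * q * s / 2" using gr_bounds(3) by (simp add: q_def s_def)
  have E0: "E \<ge> 0" using H p s by (simp add: E_def)
  define J where "J = (\<lambda>S n. if H = 0 then \<mu> S (fK n)
         else m S (lowI M) * ring_mean \<xi> (T + S) (lowI M) (fK n) + m S (upI M) * ring_mean \<xi> (T + S) (upI M) (fK n))"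
  define A where "A = (\<lambda>S n. m S (fK n))"
  have rec: "\<bar>A (Suc S) n - (q * A S (Suc n) + p * J S n)\<bar> \<le> q * H" for S n
  proof -
    have "\<bar>m S (P (fK n)) - m S (fK (Suc n))\<bar> \<le> H"
    proof (rule m_close)
      fix x assume x: "x \<in> Omega"
      show "\<bar>P (fK n) x - fK (Suc n) x\<bar> \<le> H"
        unfolding fK_Suc
      proof (rule P_close_K[OF x])
        show "\<bar>fK n y - fK n x\<bar> \<le> 1" for y using fK_bound[of n x] fK_bound[of n y] by linarith
      qed auto
    qed auto
    then have "\<bar>q * (m S (P (fK n)) - m S (fK (Suc n)))\<bar> \<le> q * H"
      unfolding abs_mult using q by (intro mult_mono) auto
    moreover have "A (Suc S) n - (q * A S (Suc n) + p * J S n) = q * (m S (P (fK n)) - m S (fK (Suc n)))"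
      by (simp add: A_def J_def m_rec q_def algebra_simps)
    ultimately show ?thesis by simp
  qed
  have Jb: "\<bar>J S n\<bar> \<le> 1.3 * \<epsilon> + H / 4 + E + 1 / gr ^ S" for S n
  proof -
    define L where "L = lam (\<lambda>x. lowI M x * fK n x)"
    define U where "U = lam (\<lambda>x. upI M x * fK n x)"
    have LU: "\<bar>L + U\<bar> \<le> H / 4" unfolding L_def U_def lam_fK by (rule lam_f(1))
    have L4: "\<bar>L\<bar> \<le> 1 / 4" unfolding L_def by (rule lam_half_bound[OF _ bmeas_fK fK_bound]) simp
    have U4: "\<bar>U\<bar> \<le> 1 / 4" unfolding U_def by (rule lam_half_bound[OF _ bmeas_fK fK_bound]) simp
    have kL: "\<bar>\<mu> S (\<lambda>x. lowI M x * fK n x) - L\<bar> \<le> \<epsilon> / 20" unfolding L_def by (rule koksma_fK) simp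
    have kU: "\<bar>\<mu> S (\<lambda>x. upI M x * fK n x) - U\<bar> \<le> \<epsilon> / 20" unfolding U_def by (rule koksma_fK) simp
    have gS: "0 \<le> 1 / gr ^ S" using gr_bounds by simp
    show ?thesis
    proof (cases "H = 0")
      case True
      have "\<mu> S (fK n) = \<mu> S (\<lambda>x. lowI M x * fK n x + upI M x * fK n x)"
        by (rule emp_cong) (simp add: lowI_upI(1) algebra_simps)
      also have "\<dots> = \<mu> S (\<lambda>x. lowI M x * fK n x) + \<mu> S (\<lambda>x. upI M x * fK n x)" by (rule emp_add)
      finally have "\<bar>\<mu> S (fK n)\<bar> \<le> \<epsilon> / 10" using kL kU LU True unfolding abs_le_iff by linarith
      then have "\<bar>J S n\<bar> \<le> \<epsilon> / 10" using True by (simp add: J_def)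
      then show ?thesis using True eps E0 gS by linarith
    next
      case False
      define v where "v = m S (upI M)"
      have v: "0 \<le> v" "v \<le> 1" using m_up_bounds by (auto simp: v_def)
      have w: "\<bar>v - 1 / 2\<bar> \<le> 1.1 * \<epsilon> + E + 1 / gr ^ S"
        using low_balance[of S] H False by (simp add: v_def E_def s_def)
      define a where "a = ring_mean \<xi> (T + S) (lowI M) (fK n)"
      define b where "b = ring_mean \<xi> (T + S) (upI M) (fK n)"
      have a: "\<bar>a - 2 * L\<bar> \<le> 13 / 100 * \<epsilon>"
        using ring_mean_approx[OF _ bmeas_fK fK_bound koksma_fK, of "lowI M" S n] eps by (simp add: a_def L_def)
      have b: "\<bar>b - 2 * U\<bar> \<le> 13 / 100 * \<epsilon>"
        using ring_mean_approx[OF _ bmeas_fK fK_bound koksma_fK, of "upI M" S n] eps by (simp add: b_def U_def)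
      have "J S n = (1 - v) * a + v * b" using False by (simp add: J_def m_low a_def b_def v_def)
      also have "\<dots> = (1 - v) * (a - 2 * L) + v * (b - 2 * U) + (L + U) + (v - 1 / 2) * (2 * (U - L))"
        by (simp add: algebra_simps)
      finally have "J S n = (1 - v) * (a - 2 * L) + v * (b - 2 * U) + (L + U) + (v - 1 / 2) * (2 * (U - L))" .
      moreover have "\<bar>x1 + x2 + x3 + x4\<bar> \<le> \<bar>x1\<bar> + \<bar>x2\<bar> + \<bar>x3\<bar> + \<bar>x4\<bar>" for x1 x2 x3 x4 :: real by linarith
      ultimately have J: "\<bar>J S n\<bar> \<le> \<bar>(1 - v) * (a - 2 * L)\<bar> + \<bar>v * (b - 2 * U)\<bar> + \<bar>L + U\<bar> + \<bar>(v - 1 / 2) * (2 * (U - L))\<bar>" by metis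
      have "\<bar>(1 - v) * (a - 2 * L)\<bar> \<le> (1 - v) * (13 / 100 * \<epsilon>)" "\<bar>v * (b - 2 * U)\<bar> \<le> v * (13 / 100 * \<epsilon>)"
        unfolding abs_mult using a b v by (intro mult_mono; simp)+
      moreover have "\<bar>(v - 1 / 2) * (2 * (U - L))\<bar> \<le> \<bar>v - 1 / 2\<bar> * 1"
      proof -
        have "\<bar>U - L\<bar> \<le> 1 / 2" using L4 U4 by linarith
        then have "\<bar>2 * (U - L)\<bar> \<le> 1" unfolding abs_mult by simp
        then show ?thesis unfolding abs_mult[of "v - 1 / 2"] by (intro mult_left_mono) auto
      qed
      moreover have "(1 - v) * k + v * k = k" for k by (simp add: algebra_simps)
      from this[of "13 / 100 * \<epsilon>"] have "(1 - v) * (13 / 100 * \<epsilon>) + v * (13 / 100 * \<epsilon>) = 13 / 100 * \<epsilon>" .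
      ultimately have "\<bar>J S n\<bar> \<le> 13 / 100 * \<epsilon> + H / 4 + \<bar>v - 1 / 2\<bar>" using LU J by linarith
      then show ?thesis using w eps by simp
    qed
  qed
  have ex: "\<bar>A S 0 - ((\<Sum>n<S. p * q ^ n * J (S - 1 - n) (0 + n)) + q ^ S * A 0 (0 + S))\<bar> \<le> q * H / p"
    by (rule renewal_expand[where A=A, OF p q_def H rec])
  define B where "B = 1.3 * \<epsilon> + H / 4 + E"
  have B0: "B \<ge> 0" using eps H E0 by (simp add: B_def)
  have "\<bar>\<Sum>n<S. p * q ^ n * J (S - 1 - n) (0 + n)\<bar> \<le> (\<Sum>n<S. p * q ^ n * (B + 1 / gr ^ (S - 1 - n)))"
  proof (rule order_trans[OF sum_abs sum_mono])
    fix n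
    have pq: "0 \<le> p * q ^ n" using p q by simp
    have "\<bar>p * q ^ n * J (S - 1 - n) n\<bar> = p * q ^ n * \<bar>J (S - 1 - n) n\<bar>" using pq by (simp only: abs_mult[of "p * q ^ n"] abs_of_nonneg)
    also have "\<dots> \<le> p * q ^ n * (B + 1 / gr ^ (S - 1 - n))"
      using Jb[of "S - 1 - n" n] pq unfolding B_def by (rule mult_left_mono)
    finally show "\<bar>p * q ^ n * J (S - 1 - n) (0 + n)\<bar> \<le> p * q ^ n * (B + 1 / gr ^ (S - 1 - n))" by simp
  qed
  also have "\<dots> = (\<Sum>n<S. p * q ^ n) * B + (\<Sum>n<S. p * q ^ n * (1 / gr ^ (S - 1 - n)))"
    by (simp only: distrib_left sum.distrib sum_distrib_right)
  also have "(\<Sum>n<S. p * q ^ n) * B \<le> B"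
  proof -
    have "(\<Sum>n<S. p * q ^ n) = 1 - q ^ S"
      using p q by (simp add: sum_distrib_left[symmetric] sum_gp_strict q_def)
    then have "(\<Sum>n<S. p * q ^ n) \<le> 1" using q by simp
    then show ?thesis using B0 mult_right_mono[of _ 1 B] by fastforce
  qed
  also have "(\<Sum>n<S. p * q ^ n * (1 / gr ^ (S - 1 - n))) \<le> 2 / gr ^ S"
    by (rule geometric_conv[OF p q_def s gr_bounds(1) g1])
  finally have 1: "\<bar>\<Sum>n<S. p * q ^ n * J (S - 1 - n) (0 + n)\<bar> \<le> B + 2 / gr ^ S" by simp
  have 2: "\<bar>q ^ S * A 0 (0 + S)\<bar> \<le> 1 / gr ^ S"
  proof -
    have "- 1 / 2 \<le> fK S x" "fK S x \<le> 1 / 2" for x using fK_bound[of S x] by linarith+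
    then have "-1/2 \<le> m 0 (fK S)" "m 0 (fK S) \<le> 1 / 2" by (intro m_lower m_upper; simp)+
    then have "\<bar>A 0 S\<bar> \<le> 1" by (simp add: A_def abs_le_iff)
    moreover have "q ^ S \<le> (1 / gr) ^ S"
    proof (rule power_mono)
      show "q \<le> 1 / gr" using geometric_weights(2)[OF p q_def s gr_bounds(1) g1] gr_bounds(1) by (simp add: field_simps)
    qed (use q in auto)
    ultimately have "\<bar>q ^ S\<bar> * \<bar>A 0 S\<bar> \<le> (1 / gr) ^ S * 1" using q gr_bounds by (intro mult_mono) auto
    then show ?thesis by (simp add: abs_mult power_one_over)
  qed
  have "\<bar>m S f\<bar> \<le> B + q * H / p + 3 / gr ^ S"
    using ex 1 2 by (simp add: A_def fK_def abs_le_iff)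
  also have "B + q * H / p \<le> 2 * \<epsilon> + 30 * H / rate"
  proof -
    \<comment> \<open>In this unit E costs 25, and H / 4 and q * H / p cost at most 1 each, which
      stays below the 30 of the statement.\<close>
    define z where "z = H / rate"
    have zr: "H = z * rate" using rate_bounds by (simp add: z_def)
    have z0: "z \<ge> 0" using H rate_bounds by (simp add: z_def)
    have "E = 25 * (H / (p * (real M * c)))" by (simp add: E_def s_def)
    also have "H / (p * (real M * c)) \<le> z"
      unfolding z_def using rate_bounds H by (intro divide_left_mono) (use p Mc in auto)
    finally have E: "E \<le> 25 * z" by simp
    have "H / 4 \<le> z"
      using z0 rate_bounds mult_left_mono[of rate "1/4" z] unfolding zr by simp
    moreover have "q * H / p \<le> z"
    proof -
      have "q * H / p \<le> H / p" using q H p mult_right_mono[of q 1 H] by (intro divide_right_mono) auto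
      also have "\<dots> \<le> z" unfolding z_def using rate_bounds rate_le_p H p
        by (intro divide_left_mono) auto
      finally show ?thesis .
    qed
    ultimately show ?thesis using E eps z0 by (simp add: B_def z_def)
  qed
  finally show ?thesis by simp
qed

text \<open>\<psi> is the probability of sitting in A with the next proposal in B. After a ring jump
  it is at least M c / 50 on average over A, by the lower bound on the flow for n = 1. A jump
  followed by a move thus removes the fraction rate / 50 of the mass of A, up to the returns of
  order exp (- H).\<close>

lemma low_decay: "m S (lowI M) \<le> 2 / gr ^ S + 100 * exp (- H) / rate" if H0: "H > 0"
proof -
  define q where "q = 1 - p"
  define u where "u = (\<lambda>S. m S (lowI M))"
  define \<psi> where "\<psi> = (\<lambda>x. lowI M x * bK 1 x)"
  have q: "0 < q" "q < 1" using p by (auto simp: q_def)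
  have u01: "0 \<le> u S" "u S \<le> 1" for S using m_up_bounds[of S] by (auto simp: u_def m_low)
  have pf: "\<psi> \<in> fam" unfolding \<psi>_def by (rule in_fam)
  have rl: "ring_mean \<xi> (T + S) (lowI M) (lowI M) = 1" "ring_mean \<xi> (T + S) (upI M) (lowI M) = 0" for S
  proof -
    have "(\<lambda>x. lowI M x * lowI M x) = lowI M" "(\<lambda>x. upI M x * lowI M x) = (\<lambda>_. 0)"
      using lowI_upI_cases by (fastforce simp: fun_eq_iff)+
    then show "ring_mean \<xi> (T + S) (lowI M) (lowI M) = 1" "ring_mean \<xi> (T + S) (upI M) (lowI M) = 0"
      using low_frac[of S] by (simp_all add: ring_mean_def)
  qed
  have step: "u (Suc S) \<le> u S - q * m S \<psi> + exp (- H)" for S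
  proof -
    have d: "m S (\<lambda>x. lowI M x - \<psi> x) = u S - m S \<psi>"
      unfolding u_def by (rule m_diff) (auto simp: pf)
    have "m S (P (lowI M)) \<le> m S (\<lambda>x. lowI M x - \<psi> x) + exp (- H)"
      unfolding \<psi>_def
    proof (rule m_le)
      show "P (lowI M) \<in> fam \<union> P ` fam" by simp
      show "(\<lambda>x. lowI M x - lowI M x * bK 1 x) \<in> fam \<union> P ` fam" by (rule UnI1) (rule in_fam)
    qed (use low_high in auto)
    then have "q * m S (P (lowI M)) \<le> q * (u S - m S \<psi> + exp (- H))" unfolding d using q by (intro mult_left_mono) auto
    moreover have "u (Suc S) = q * m S (P (lowI M)) + p * u S"
      using H0 by (simp add: u_def m_rec rl q_def)
    moreover have "q * exp (- H) \<le> exp (- H)" using q by simp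
    ultimately show ?thesis by (simp add: q_def algebra_simps)
  qed
  have \<psi>0: "0 \<le> m S \<psi>" for S by (rule m_lower[OF UnI1[OF pf]]) (auto simp: \<psi>_def)
  have \<psi>1: "p * u S * (real M * c / 50) \<le> m (Suc S) \<psi>" for S
  proof -
    have "0 \<le> m S (P \<psi>)"
    proof (rule m_lower)
      fix x assume x: "x \<in> Omega"
      show "0 \<le> P \<psi> x"
        unfolding P_def by (rule acceptance.mh_op_ge[OF acceptance_P c(1) Mc(4) x bmeas_fam[OF pf]]) (auto simp: \<psi>_def)
    qed (auto simp: pf)
    moreover have "ring_mean \<xi> (T + S) (upI M) \<psi> = 0"
    proof -
      have "(\<lambda>x. upI M x * \<psi> x) = (\<lambda>_. 0)" using lowI_upI_cases by (fastforce simp: fun_eq_iff \<psi>_def)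
      then show ?thesis by (simp add: ring_mean_def)
    qed
    moreover have "real M * c / 50 \<le> ring_mean \<xi> (T + S) (lowI M) \<psi>"
    proof -
      have N1: "1 \<le> N"
      proof -
        have "1 / \<epsilon> ^ 5 > 0" using eps by simp
        then show ?thesis unfolding N_def by linarith
      qed
      have e: "\<epsilon> / 50 \<le> real M * c / 19200" using eps by (simp add: mult.commute)
      have "(\<lambda>x. lowI M x * \<psi> x) = (\<lambda>x. lowI M x * bK 1 x)" using lowI_upI_cases by (fastforce simp: fun_eq_iff \<psi>_def)
      then have rm: "ring_mean \<xi> (T + S) (lowI M) \<psi> = \<mu> S (\<lambda>x. lowI M x * bK 1 x) / \<mu> S (lowI M)" by (simp add: ring_mean_def)
      have "real M * c / 95 \<le> flow (real M * c) 1" using flow_ge[of "real M * c" 1] Mc by simp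
      then have "real M * c / 95 - real M * c / 19200 \<le> \<mu> S (\<lambda>x. lowI M x * bK 1 x)"
        using test_bK(1)[of 1 S, unfolded lam_low_bK] N1 e unfolding abs_le_iff by linarith
      then have "real M * c / 98 \<le> \<mu> S (\<lambda>x. lowI M x * bK 1 x)" using Mc by linarith
      then have "real M * c / 98 / 0.51 \<le> ring_mean \<xi> (T + S) (lowI M) \<psi>"
        unfolding rm using low_frac(3,4)[of S] Mc by (intro frac_le) auto
      moreover have "real M * c / 50 \<le> real M * c / 98 / 0.51" using Mc(2) M c by simp
      ultimately show ?thesis by (rule order_trans[rotated])
    qed
    then have "u S * (real M * c / 50) \<le> u S * ring_mean \<xi> (T + S) (lowI M) \<psi>" using u01 by (intro mult_left_mono) auto
    ultimately show ?thesis
      using p H0 mult_left_mono[of "u S * (real M * c / 50)" "u S * ring_mean \<xi> (T + S) (lowI M) \<psi>" p] m_rec[OF pf, of S]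
      by (simp add: u_def mult.assoc add_increasing)
  qed
  have rec: "u (Suc (Suc S)) \<le> u S * (1 - rate / 50) + 2 * exp (- H)" for S
  proof -
    have "u (Suc S) \<le> u S + exp (- H)" using step[of S] mult_nonneg_nonneg[OF less_imp_le[OF q(1)] \<psi>0[of S]] by linarith
    moreover have "q * (p * u S * (real M * c / 50)) \<le> q * m (Suc S) \<psi>" using \<psi>1[of S] q by (intro mult_left_mono) auto
    moreover have "q * (p * u S * (real M * c / 50)) = u S * (rate / 50)" by (simp add: rate_def q_def)
    moreover have "u S * (1 - rate / 50) = u S - u S * (rate / 50)" by (simp only: right_diff_distrib mult_1_right)
    ultimately show ?thesis using step[of "Suc S"] by linarith
  qed
  have "u S \<le> 2 / gr ^ S + 2 * exp (- H) / (rate / 50)"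
    by (rule two_step_decay[where u=u, OF gr_bounds(1,2) _ gr_bounds(4) _ _ _ _ rec]) (use rate_bounds u01 in auto)
  then show ?thesis by (simp add: u_def)
qed

text \<open>After the decay of the mass u of A, only the ring of B matters. There the ring mean of
  an iterate of the rejected walk is close to twice its integral over B, which does not depend on
  the iterate and is of order exp (- H). Rejecting costs another exp (- H) per step, summed over a
  cycle to q * h / p.\<close>

lemma final_bound_large_H:
  assumes H1: "H \<ge> 1"
  shows "\<bar>m S f\<bar> \<le> 2 * \<epsilon> + 60 * exp (- H) / rate + 3 / gr ^ S"
proof -
  define q where "q = 1 - p"
  define s where "s = real M * c / 25"
  define h where "h = exp (- H)"
  have h: "0 < h" by (simp add: h_def)
  have q: "0 < q" "q < 1" using p by (auto simp: q_def)
  have s: "0 < s" "s \<le> 1 / 2" using Mc by (auto simp: s_def)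
  have g1: "gr - 1 \<le> p * q * s / 2" using gr_bounds(3) by (simp add: q_def s_def)
  define J where "J = (\<lambda>S n. m S (lowI M) * ring_mean \<xi> (T + S) (lowI M) (fR n) + m S (upI M) * ring_mean \<xi> (T + S) (upI M) (fR n))"
  define A where "A = (\<lambda>S n. m S (fR n))"
  have rec: "\<bar>A (Suc S) n - (q * A S (Suc n) + p * J S n)\<bar> \<le> q * h" for S n
  proof -
    have "\<bar>m S (P (fR n)) - m S (fR (Suc n))\<bar> \<le> h"
    proof (rule m_close)
      fix x assume x: "x \<in> Omega"
      show "\<bar>P (fR n) x - fR (Suc n) x\<bar> \<le> h"
        unfolding fR_Suc h_def
      proof (rule P_close_R[OF x bmeas_fR])
        show "\<bar>fR n y - fR n x\<bar> \<le> 1" if "y \<in> Omega" for y using fR_bound[OF x, of n] fR_bound[OF that, of n] by linarith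
      qed
    qed (auto simp: h_def)
    then have "\<bar>q * (m S (P (fR n)) - m S (fR (Suc n)))\<bar> \<le> q * h"
      unfolding abs_mult using q by (intro mult_mono) auto
    moreover have "A (Suc S) n - (q * A S (Suc n) + p * J S n) = q * (m S (P (fR n)) - m S (fR (Suc n)))"
      using H1 by (simp add: A_def J_def m_rec q_def algebra_simps)
    ultimately show ?thesis by simp
  qed
  define B where "B = 1 / 2 * \<epsilon> + 51 * h / rate"
  have B0: "B \<ge> 0" using eps h rate_bounds by (simp add: B_def)
  have Jb: "\<bar>J S n\<bar> \<le> B + 1 / gr ^ S" for S n
  proof -
    define u where "u = m S (lowI M)"
    have u: "0 \<le> u" "u \<le> 1" using m_up_bounds[of S] by (auto simp: u_def m_low)
    have ub: "u \<le> 2 / gr ^ S + 100 * h / rate" using low_decay[of S] H1 by (simp add: u_def h_def)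
    define a where "a = ring_mean \<xi> (T + S) (lowI M) (fR n)"
    define b where "b = ring_mean \<xi> (T + S) (upI M) (fR n)"
    have a: "\<bar>a\<bar> \<le> 1 / 2" unfolding a_def by (rule ring_mean_abs_le[OF _ fR_bound]) auto
    have "\<bar>b - 2 * lam (\<lambda>x. upI M x * fR n x)\<bar> \<le> (13 / 100 * \<epsilon> + \<epsilon> / 100) / 0.49"
      unfolding b_def by (rule ring_mean_approx[OF _ bmeas_fR fR_bound koksma_fR]) auto
    moreover have "\<bar>2 * lam (\<lambda>x. upI M x * fR n x)\<bar> \<le> h / 2" unfolding lam_fR using lam_f(2) by (simp add: h_def)
    ultimately have b: "\<bar>b\<bar> \<le> \<epsilon> / 2 + h / 2" using eps unfolding abs_le_iff by auto
    have "\<bar>u * a\<bar> \<le> u * (1 / 2)" unfolding abs_mult using a u by (intro mult_mono) auto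
    moreover have "\<bar>(1 - u) * b\<bar> \<le> 1 * (\<epsilon> / 2 + h / 2)" unfolding abs_mult using b u by (intro mult_mono) auto
    moreover have "J S n = u * a + (1 - u) * b" by (simp add: J_def u_def a_def b_def m_low)
    ultimately have "\<bar>J S n\<bar> \<le> u / 2 + \<epsilon> / 2 + h / 2"
      using abs_triangle_ineq[of "u * a" "(1 - u) * b"] by simp
    moreover have "h / 2 \<le> h / rate" using rate_bounds h by (intro divide_left_mono) auto
    ultimately show ?thesis using ub by (simp add: B_def)
  qed
  have ex: "\<bar>A S 0 - ((\<Sum>n<S. p * q ^ n * J (S - 1 - n) (0 + n)) + q ^ S * A 0 (0 + S))\<bar> \<le> q * h / p"
    by (rule renewal_expand[where A=A, OF p q_def less_imp_le[OF h] rec])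
  have "\<bar>\<Sum>n<S. p * q ^ n * J (S - 1 - n) (0 + n)\<bar> \<le> (\<Sum>n<S. p * q ^ n * (B + 1 / gr ^ (S - 1 - n)))"
  proof (rule order_trans[OF sum_abs sum_mono])
    fix n
    have pq: "0 \<le> p * q ^ n" using p q by simp
    have "\<bar>p * q ^ n * J (S - 1 - n) n\<bar> = p * q ^ n * \<bar>J (S - 1 - n) n\<bar>" using pq by (simp only: abs_mult[of "p * q ^ n"] abs_of_nonneg)
    also have "\<dots> \<le> p * q ^ n * (B + 1 / gr ^ (S - 1 - n))"
      using Jb[of "S - 1 - n" n] pq by (rule mult_left_mono)
    finally show "\<bar>p * q ^ n * J (S - 1 - n) (0 + n)\<bar> \<le> p * q ^ n * (B + 1 / gr ^ (S - 1 - n))" by simp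
  qed
  also have "\<dots> = (\<Sum>n<S. p * q ^ n) * B + (\<Sum>n<S. p * q ^ n * (1 / gr ^ (S - 1 - n)))"
    by (simp only: distrib_left sum.distrib sum_distrib_right)
  also have "(\<Sum>n<S. p * q ^ n) * B \<le> B"
  proof -
    have "(\<Sum>n<S. p * q ^ n) = 1 - q ^ S"
      using p q by (simp add: sum_distrib_left[symmetric] sum_gp_strict q_def)
    then have "(\<Sum>n<S. p * q ^ n) \<le> 1" using q by simp
    then show ?thesis using B0 mult_right_mono[of _ 1 B] by fastforce
  qed
  also have "(\<Sum>n<S. p * q ^ n * (1 / gr ^ (S - 1 - n))) \<le> 2 / gr ^ S"
    by (rule geometric_conv[OF p q_def s gr_bounds(1) g1])
  finally have 1: "\<bar>\<Sum>n<S. p * q ^ n * J (S - 1 - n) (0 + n)\<bar> \<le> B + 2 / gr ^ S" by simp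
  have 2: "\<bar>q ^ S * A 0 (0 + S)\<bar> \<le> 1 / gr ^ S"
  proof -
    have "- 1 / 2 \<le> fR S x" "fR S x \<le> 1 / 2" if "x \<in> Omega" for x using fR_bound[OF that, of S] by linarith+
    then have "-1/2 \<le> m 0 (fR S)" "m 0 (fR S) \<le> 1 / 2" by (intro m_lower m_upper; simp)+
    then have "\<bar>A 0 S\<bar> \<le> 1" by (simp add: A_def abs_le_iff)
    moreover have "q ^ S \<le> (1 / gr) ^ S"
    proof (rule power_mono)
      show "q \<le> 1 / gr" using geometric_weights(2)[OF p q_def s gr_bounds(1) g1] gr_bounds(1) by (simp add: field_simps)
    qed (use q in auto)
    ultimately have "\<bar>q ^ S\<bar> * \<bar>A 0 S\<bar> \<le> (1 / gr) ^ S * 1" using q gr_bounds by (intro mult_mono) auto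
    then show ?thesis by (simp add: abs_mult power_one_over)
  qed
  have "\<bar>m S f\<bar> \<le> B + q * h / p + 3 / gr ^ S"
    using ex 1 2 by (simp add: A_def fR_def abs_le_iff)
  also have "q * h / p \<le> h / rate"
  proof -
    have "q * h / p \<le> h / p" using q h p mult_right_mono[of q 1 h] by (intro divide_right_mono) auto
    also have "\<dots> \<le> h / rate" using rate_bounds rate_le_p h p
      by (intro divide_left_mono) auto
    finally show ?thesis .
  qed
  also have "B + h / rate \<le> 2 * \<epsilon> + 60 * h / rate"
  proof -
    have "0 \<le> h / rate" using h rate_bounds by simp
    then show ?thesis using eps by (simp add: B_def)
  qed
  finally show ?thesis by (simp add: h_def)
qed

theorem run_bound:
  assumes A1: "A1 = min (p * (1 - p) * real M / 32) (p / (2 * c))"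
    and A2: "A2 = 16 * exp 1 * H / (A1 * c) * exp (- H)" and b: "\<bar>b\<bar> \<le> 1 / 2"
  shows "b * m S f \<le> 2 * exp (- A1 * c * real_of_int \<lfloor>real S / 4\<rfloor>) + 2 * \<epsilon> + A2"
proof -
  \<comment> \<open>Because M c < 1 / 4, the minimum defining A1 is its first entry.\<close>
  have "p * (1 - p) * real M / 32 \<le> p / (2 * c)"
  proof -
    have "(1 - p) * (real M * c) \<le> 1 * 1" using p Mc by (intro mult_mono) auto
    then have "p * ((1 - p) * (real M * c)) \<le> p * 16" using p by (intro mult_left_mono) auto
    then show ?thesis using c by (simp add: field_simps)
  qed
  then have A1c: "A1 * c = rate / 32" by (simp add: A1 rate_def)
  have r: "0 < rate" by (rule rate_bounds)
  \<comment> \<open>H * exp (1 - H) dominates H for H < 1 and exp (- H) for H \<ge> 1, so a single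
    expression covers both regimes; the factor exp 1 in A2 makes this possible.\<close>
  have A2': "A2 = 512 * (H * exp (1 - H)) / rate"
    unfolding A2 A1c using r by (simp add: exp_diff exp_minus field_simps)
  have key: "\<bar>m S f\<bar> \<le> 2 * \<epsilon> + A2 / 4 + 3 / gr ^ S"
  proof (cases "H < 1")
    case True
    have "H * 1 \<le> H * exp (1 - H)" using True H by (intro mult_left_mono) auto
    then have "30 * H / rate \<le> (512 * (H * exp (1 - H)) / 4) / rate"
      using r H by (intro divide_right_mono) auto
    then show ?thesis using final_bound_small_H[OF True, of S] by (simp add: A2')
  next
    case False
    have "exp (- H) * 1 \<le> exp (1 - H) * H" using False by (intro mult_mono) auto
    moreover have "0 \<le> exp (1 - H) * H" using H by simp
    ultimately have "60 * exp (- H) \<le> 512 * (H * exp (1 - H)) / 4" unfolding mult.commute[of H] by linarith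
    then have "60 * exp (- H) / rate \<le> (512 * (H * exp (1 - H)) / 4) / rate"
      using r by (intro divide_right_mono) auto
    then show ?thesis using final_bound_large_H[of S] False by (simp add: A2')
  qed
  have "1 / gr ^ S = exp (- (real S * (rate / 128)))"
    by (simp add: gr_def exp_minus inverse_eq_divide flip: exp_of_nat_mult)
  also have "\<dots> \<le> exp (- A1 * c * real_of_int \<lfloor>real S / 4\<rfloor>)"
  proof -
    have "rate / 32 * real_of_int \<lfloor>real S / 4\<rfloor> \<le> rate / 32 * (real S / 4)"
      using r of_int_floor_le[of "real S / 4"] by (intro mult_left_mono) simp_all
    moreover have "- A1 * c = - (rate / 32)" using A1c by simp
    moreover have "rate / 32 * (real S / 4) = real S * (rate / 128)" by simp
    ultimately show ?thesis by (simp only: exp_le_cancel_iff)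
  qed
  finally have g: "1 / gr ^ S \<le> exp (- A1 * c * real_of_int \<lfloor>real S / 4\<rfloor>)" .
  have "A2 \<ge> 0" using r H by (simp add: A2')
  have "b * m S f \<le> \<bar>b\<bar> * \<bar>m S f\<bar>" by (metis abs_ge_self abs_mult)
  also have "\<dots> \<le> (1 / 2) * (2 * \<epsilon> + A2 / 4 + 3 / gr ^ S)"
    using b key by (intro mult_mono) auto
  also have "\<dots> = \<epsilon> + A2 / 8 + 1.5 * (1 / gr ^ S)" by simp
  also have "\<dots> \<le> 2 * exp (- A1 * c * real_of_int \<lfloor>real S / 4\<rfloor>) + 2 * \<epsilon> + A2"
  proof -
    have "0 \<le> exp (- A1 * c * real_of_int \<lfloor>real S / 4\<rfloor>)" by simp
    then show ?thesis using g eps \<open>A2 \<ge> 0\<close> by linarith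
  qed
  finally show ?thesis .
qed

end

section \<open>Conditional laws and maximal inequalities\<close>

lemma subalgebra_vimage_algebra:
  assumes f: "f \<in> P \<rightarrow>\<^sub>M N"
  shows "subalgebra P (vimage_algebra (space P) f N)"
proof -
  have "f \<in> space P \<rightarrow> space N" using measurable_space[OF f] by auto
  then show ?thesis
    using measurable_sets[OF f] by (auto simp: subalgebra_def sets_vimage_algebra2)
qed

text \<open>\<open>has_cond_law\<close> treats one set at a time, each with its own null set. The
  level sets of floor (n \<phi>) are countably many and approximate \<phi> uniformly within 1 / n,
  so one null set suffices for the integral of \<phi>.\<close>

lemma cond_law_integral:
  fixes \<phi> :: "'b \<Rightarrow> real"
  assumes P: "prob_space P" and F: "subalgebra P F" and Y [measurable]: "Y \<in> P \<rightarrow>\<^sub>M N"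
    and K: "\<And>\<omega>. \<omega> \<in> space P \<Longrightarrow> prob_space (K \<omega>)" "\<And>\<omega>. \<omega> \<in> space P \<Longrightarrow> sets (K \<omega>) = sets N"
    and law: "has_cond_law P F N Y K"
    and \<phi> [measurable]: "\<phi> \<in> borel_measurable N" and C: "\<And>x. x \<in> space N \<Longrightarrow> \<bar>\<phi> x\<bar> \<le> C"
  shows "AE \<omega> in P. real_cond_exp P F (\<lambda>\<omega>. \<phi> (Y \<omega>)) \<omega> = (\<integral>y. \<phi> y \<partial>K \<omega>)"
proof -
  interpret P: prob_space P by fact
  interpret finite_measure_subalgebra P F by unfold_locales (rule F)
  define A where "A = (\<lambda>n k. {x \<in> space N. \<lfloor>real n * \<phi> x\<rfloor> = k})"
  define I where "I = (\<lambda>n. {- \<lceil>real n * C\<rceil> - 1..\<lceil>real n * C\<rceil> + 1})"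
  have A [measurable]: "A n k \<in> sets N" for n k unfolding A_def by measurable
  have rep: "(\<Sum>k\<in>I n. (of_int k / real n) * indicator (A n k) x) = of_int \<lfloor>real n * \<phi> x\<rfloor> / real n"
    if "x \<in> space N" for n x
  proof -
    have "\<bar>real n * \<phi> x\<bar> \<le> real n * C" using C[OF that] by (simp add: abs_mult mult_left_mono)
    then have "\<lfloor>real n * \<phi> x\<rfloor> \<in> I n" unfolding I_def by (simp add: abs_le_iff) linarith
    moreover have "(\<Sum>k\<in>I n. (of_int k / real n) * indicator (A n k) x) = (\<Sum>k\<in>I n. if k = \<lfloor>real n * \<phi> x\<rfloor> then of_int k / real n else 0)"
      using that by (intro sum.cong) (auto simp: A_def indicator_def)
    ultimately show ?thesis by (simp add: I_def)
  qed
  have approx: "\<bar>\<phi> x - (\<Sum>k\<in>I n. (of_int k / real n) * indicator (A n k) x)\<bar> \<le> 1 / real n" if "x \<in> space N" "n > 0" for n x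
  proof -
    have "\<bar>real n * \<phi> x - of_int \<lfloor>real n * \<phi> x\<rfloor>\<bar> \<le> 1" by linarith
    then have "\<bar>real n * \<phi> x - of_int \<lfloor>real n * \<phi> x\<rfloor>\<bar> / real n \<le> 1 / real n" by (rule divide_right_mono) simp
    moreover have "\<phi> x - of_int \<lfloor>real n * \<phi> x\<rfloor> / real n = (real n * \<phi> x - of_int \<lfloor>real n * \<phi> x\<rfloor>) / real n"
      using that(2) by (simp add: field_simps)
    ultimately show ?thesis unfolding rep[OF that(1)] by (simp add: abs_divide)
  qed
  have YN: "\<omega> \<in> space P \<Longrightarrow> Y \<omega> \<in> space N" for \<omega> using measurable_space[OF Y] by auto
  have intY: "integrable P (\<lambda>\<omega>. \<phi> (Y \<omega>))"
    by (rule P.integrable_const_bound[where B=C]) (use C YN in auto)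
  have ind: "AE \<omega> in P. \<forall>n k. real_cond_exp P F (indicator (Y -` A n k \<inter> space P)) \<omega> = measure (K \<omega>) (A n k)"
    unfolding AE_all_countable using law A by (auto simp: has_cond_law_def)
  define S where "S = (\<lambda>n \<omega>. \<Sum>k\<in>I n. (of_int k / real n) * indicator (Y -` A n k \<inter> space P) \<omega> :: real)"
  have intS: "integrable P (S n)" for n
    unfolding S_def by (intro Bochner_Integration.integrable_sum integrable_mult_right) (simp add: P.emeasure_eq_measure)
  have S: "AE \<omega> in P. \<forall>n. real_cond_exp P F (S n) \<omega> = (\<Sum>k\<in>I n. (of_int k / real n) * measure (K \<omega>) (A n k))"
    unfolding AE_all_countable
  proof
    fix n
    have i: "integrable P (\<lambda>\<omega>. (of_int k / real n) * indicator (Y -` A n k \<inter> space P) \<omega> :: real)" for k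
      by (intro integrable_mult_right) (simp add: P.emeasure_eq_measure)
    have "AE \<omega> in P. real_cond_exp P F (S n) \<omega> = (\<Sum>k\<in>I n. real_cond_exp P F (\<lambda>\<omega>. (of_int k / real n) * indicator (Y -` A n k \<inter> space P) \<omega>) \<omega>)"
      unfolding S_def by (rule real_cond_exp_sum) (rule i)
    moreover have "AE \<omega> in P. \<forall>k\<in>I n. real_cond_exp P F (\<lambda>\<omega>. (of_int k / real n) * indicator (Y -` A n k \<inter> space P) \<omega>) \<omega> =
        (of_int k / real n) * real_cond_exp P F (indicator (Y -` A n k \<inter> space P)) \<omega>"
    proof (rule AE_finite_allI)
      show "finite (I n)" by (simp add: I_def)
      show "AE \<omega> in P. real_cond_exp P F (\<lambda>\<omega>. (of_int k / real n) * indicator (Y -` A n k \<inter> space P) \<omega>) \<omega> =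
        (of_int k / real n) * real_cond_exp P F (indicator (Y -` A n k \<inter> space P)) \<omega>" for k
        by (rule real_cond_exp_cmult) (simp add: P.emeasure_eq_measure)
    qed
    ultimately show "AE \<omega> in P. real_cond_exp P F (S n) \<omega> = (\<Sum>k\<in>I n. (of_int k / real n) * measure (K \<omega>) (A n k))"
      using ind by eventually_elim simp
  qed
  have close: "AE \<omega> in P. \<forall>n. \<bar>real_cond_exp P F (\<lambda>\<omega>. \<phi> (Y \<omega>)) \<omega> - real_cond_exp P F (S (Suc n)) \<omega>\<bar> \<le> 1 / real (Suc n)"
    unfolding AE_all_countable
  proof
    fix n
    have Sx: "S (Suc n) \<omega> = (\<Sum>k\<in>I (Suc n). (of_int k / real (Suc n)) * indicator (A (Suc n) k) (Y \<omega>))" if "\<omega> \<in> space P" for \<omega>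
      unfolding S_def using that by (intro sum.cong) (auto simp: indicator_def)
    have b: "\<bar>\<phi> (Y \<omega>) - S (Suc n) \<omega>\<bar> \<le> 1 / real (Suc n)" if "\<omega> \<in> space P" for \<omega>
      unfolding Sx[OF that] using approx[OF YN[OF that], of "Suc n"] by simp
    have "AE \<omega> in P. real_cond_exp P F (\<lambda>\<omega>. \<phi> (Y \<omega>) - S (Suc n) \<omega>) \<omega> \<le> 1 / real (Suc n)"
      by (rule real_cond_exp_le_c) (use intY intS b in \<open>auto intro!: AE_I2 simp: abs_le_iff\<close>)
    moreover have "AE \<omega> in P. - 1 / real (Suc n) \<le> real_cond_exp P F (\<lambda>\<omega>. \<phi> (Y \<omega>) - S (Suc n) \<omega>) \<omega>"
    proof (rule real_cond_exp_ge_c)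
      show "AE \<omega> in P. - 1 / real (Suc n) \<le> \<phi> (Y \<omega>) - S (Suc n) \<omega>"
      proof (rule AE_I2)
        fix \<omega> assume "\<omega> \<in> space P"
        from b[OF this] show "- 1 / real (Suc n) \<le> \<phi> (Y \<omega>) - S (Suc n) \<omega>" by (simp add: abs_le_iff)
      qed
    qed (use intY intS in auto)
    moreover have "AE \<omega> in P. real_cond_exp P F (\<lambda>\<omega>. \<phi> (Y \<omega>) - S (Suc n) \<omega>) \<omega> = real_cond_exp P F (\<lambda>\<omega>. \<phi> (Y \<omega>)) \<omega> - real_cond_exp P F (S (Suc n)) \<omega>"
      by (rule real_cond_exp_diff[OF intY intS])
    ultimately show "AE \<omega> in P. \<bar>real_cond_exp P F (\<lambda>\<omega>. \<phi> (Y \<omega>)) \<omega> - real_cond_exp P F (S (Suc n)) \<omega>\<bar> \<le> 1 / real (Suc n)"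
      by eventually_elim (auto simp: abs_le_iff)
  qed
  have Kint: "\<bar>(\<integral>y. \<phi> y \<partial>K \<omega>) - (\<Sum>k\<in>I (Suc n). (of_int k / real (Suc n)) * measure (K \<omega>) (A (Suc n) k))\<bar> \<le> 1 / real (Suc n)"
    if \<omega>: "\<omega> \<in> space P" for \<omega> n
  proof -
    interpret K: prob_space "K \<omega>" by (rule K(1)[OF \<omega>])
    have sp: "space (K \<omega>) = space N" by (rule sets_eq_imp_space_eq[OF K(2)[OF \<omega>]])
    have [measurable]: "A n k \<in> sets (K \<omega>)" for n k using A K(2)[OF \<omega>] by simp
    have \<phi>K: "\<phi> \<in> borel_measurable (K \<omega>)" using \<phi> K(2)[OF \<omega>] by (simp cong: measurable_cong_sets)
    have i1: "integrable (K \<omega>) \<phi>" by (rule K.integrable_const_bound[where B=C]) (use C sp \<phi>K in auto)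
    have i2: "integrable (K \<omega>) (\<lambda>x. \<Sum>k\<in>I (Suc n). (of_int k / real (Suc n)) * indicator (A (Suc n) k) x)"
      by (intro Bochner_Integration.integrable_sum integrable_mult_right) (simp add: K.emeasure_eq_measure)
    have "(\<integral>x. (\<Sum>k\<in>I (Suc n). (of_int k / real (Suc n)) * indicator (A (Suc n) k) x) \<partial>K \<omega>) =
        (\<Sum>k\<in>I (Suc n). (of_int k / real (Suc n)) * measure (K \<omega>) (A (Suc n) k))"
      by (subst Bochner_Integration.integral_sum) (auto simp: K.emeasure_eq_measure)
    then have "(\<integral>y. \<phi> y \<partial>K \<omega>) - (\<Sum>k\<in>I (Suc n). (of_int k / real (Suc n)) * measure (K \<omega>) (A (Suc n) k)) =
       (\<integral>x. \<phi> x - (\<Sum>k\<in>I (Suc n). (of_int k / real (Suc n)) * indicator (A (Suc n) k) x) \<partial>K \<omega>)"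
      using i1 i2 by simp
    also have "\<bar>\<dots>\<bar> \<le> (\<integral>x. \<bar>\<phi> x - (\<Sum>k\<in>I (Suc n). (of_int k / real (Suc n)) * indicator (A (Suc n) k) x)\<bar> \<partial>K \<omega>)"
      by (rule integral_abs_bound)
    also have "\<dots> \<le> (\<integral>x. 1 / real (Suc n) \<partial>K \<omega>)"
      by (rule integral_mono) (use i1 i2 approx[of _ "Suc n"] sp in \<open>auto simp del: of_nat_Suc\<close>)
    finally show ?thesis by (simp add: K.prob_space)
  qed
  show ?thesis
    using S close AE_space
  proof eventually_elim
    case (elim \<omega>)
    define d where "d = \<bar>real_cond_exp P F (\<lambda>\<omega>. \<phi> (Y \<omega>)) \<omega> - (\<integral>y. \<phi> y \<partial>K \<omega>)\<bar>"
    have le: "d \<le> 2 * inverse (real (Suc n))" for n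
      using elim(1)[rule_format, of "Suc n"] elim(2)[rule_format, of n] Kint[OF elim(3), of n]
      unfolding d_def inverse_eq_divide by linarith
    have "(\<lambda>n. 2 * inverse (real (Suc n))) \<longlonglongrightarrow> 2 * 0"
      by (intro tendsto_mult tendsto_const LIMSEQ_inverse_real_of_nat)
    from LIMSEQ_le_const[OF this] have "d \<le> 0" using le by auto
    then show ?case by (simp add: d_def)
  qed
qed

text \<open>The supermartingale property is asked in integrated form and only on the event E t that
  the level a has not been reached, so no conditional expectation occurs. The invariant is a times
  the probability of having crossed plus the mean of W on E n: at a first crossing W is at least a,
  so counting a instead does not increase the sum.\<close>

lemma (in prob_space) ville:
  fixes W :: "nat \<Rightarrow> 'a \<Rightarrow> real"
  assumes W [measurable]: "\<And>t. W t \<in> borel_measurable M" and W0: "\<And>t \<omega>. 0 \<le> W t \<omega>"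
    and bd: "\<And>t. \<exists>B. \<forall>\<omega>\<in>space M. W t \<omega> \<le> B"
    and init: "\<And>\<omega>. W 0 \<omega> = 1" and a: "a > 0"
    and step: "\<And>t. expectation (\<lambda>\<omega>. W (Suc t) \<omega> * indicator {\<omega> \<in> space M. \<forall>s\<le>t. W s \<omega> < a} \<omega>) \<le>
                   expectation (\<lambda>\<omega>. W t \<omega> * indicator {\<omega> \<in> space M. \<forall>s\<le>t. W s \<omega> < a} \<omega>)"
  shows "prob {\<omega> \<in> space M. \<exists>t. a \<le> W t \<omega>} \<le> 1 / a"
proof -
  define E where "E = (\<lambda>t. {\<omega> \<in> space M. \<forall>s\<le>t. W s \<omega> < a})"
  have E [measurable]: "E t \<in> events" for t unfolding E_def by measurable
  have int: "integrable M (\<lambda>\<omega>. W t \<omega> * indicator (E s) \<omega>)" for s t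
  proof -
    obtain B where "\<forall>\<omega>\<in>space M. W t \<omega> \<le> B" using bd by blast
    then show ?thesis
      by (intro integrable_const_bound[where B="max B 0"]) (auto simp: indicator_def W0 max_def intro!: AE_I2)
  qed
  have main: "a * prob (space M - E n) + expectation (\<lambda>\<omega>. W n \<omega> * indicator (E n) \<omega>) \<le> 1" for n
  proof (induction n)
    case 0
    have eq: "a * prob (space M - E 0) + expectation (\<lambda>\<omega>. W 0 \<omega> * indicator (E 0) \<omega>) =
       expectation (\<lambda>\<omega>. a * indicator (space M - E 0) \<omega> + W 0 \<omega> * indicator (E 0) \<omega>)"
      using int by (simp add: emeasure_eq_measure)
    also have "\<dots> \<le> expectation (\<lambda>_. 1)"
    proof (rule integral_mono)
      show "integrable M (\<lambda>\<omega>. a * indicator (space M - E 0) \<omega> + W 0 \<omega> * indicator (E 0) \<omega>)"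
        using int by (intro Bochner_Integration.integrable_add) (auto simp: emeasure_eq_measure)
      fix \<omega> assume "\<omega> \<in> space M"
      then show "a * indicator (space M - E 0) \<omega> + W 0 \<omega> * indicator (E 0) \<omega> \<le> 1"
        using init[of \<omega>] by (auto simp: E_def indicator_def)
    qed auto
    finally show ?case by (simp add: prob_space)
  next
    case (Suc n)
    have "a * prob (space M - E (Suc n)) + expectation (\<lambda>\<omega>. W (Suc n) \<omega> * indicator (E (Suc n)) \<omega>) =
       expectation (\<lambda>\<omega>. a * indicator (space M - E (Suc n)) \<omega> + W (Suc n) \<omega> * indicator (E (Suc n)) \<omega>)"
      using int by (simp add: emeasure_eq_measure)
    also have "\<dots> \<le> expectation (\<lambda>\<omega>. a * indicator (space M - E n) \<omega> + W (Suc n) \<omega> * indicator (E n) \<omega>)"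
    proof (rule integral_mono)
      fix \<omega> assume \<omega>: "\<omega> \<in> space M"
      have "W (Suc n) \<omega> \<ge> a" if "\<omega> \<in> E n" "\<omega> \<notin> E (Suc n)"
        using that \<omega> by (auto simp: E_def le_Suc_eq)
      moreover have "\<omega> \<in> E (Suc n) \<Longrightarrow> \<omega> \<in> E n" by (auto simp: E_def)
      ultimately show "a * indicator (space M - E (Suc n)) \<omega> + W (Suc n) \<omega> * indicator (E (Suc n)) \<omega>
          \<le> a * indicator (space M - E n) \<omega> + W (Suc n) \<omega> * indicator (E n) \<omega>"
        using \<omega> by (auto simp: indicator_def)
    qed (use int in \<open>auto intro!: Bochner_Integration.integrable_add simp: emeasure_eq_measure\<close>)
    also have "\<dots> = a * prob (space M - E n) + expectation (\<lambda>\<omega>. W (Suc n) \<omega> * indicator (E n) \<omega>)"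
      using int by (simp add: emeasure_eq_measure)
    also have "\<dots> \<le> 1" using Suc step[of n] by (simp add: E_def)
    finally show ?case .
  qed
  have le: "prob (space M - E n) \<le> 1 / a" for n
  proof -
    have "0 \<le> expectation (\<lambda>\<omega>. W n \<omega> * indicator (E n) \<omega>)" by (intro integral_nonneg_AE) (auto simp: W0)
    then have "a * prob (space M - E n) \<le> 1" using main[of n] by simp
    then show ?thesis using a by (simp add: field_simps)
  qed
  have "(\<lambda>n. prob (space M - E n)) \<longlonglongrightarrow> prob (\<Union>n. space M - E n)"
  proof (rule finite_Lim_measure_incseq)
    show "range (\<lambda>n. space M - E n) \<subseteq> events" by auto
    show "incseq (\<lambda>n. space M - E n)" by (auto simp: incseq_def E_def)
  qed
  then have "prob (\<Union>n. space M - E n) \<le> 1 / a" by (rule LIMSEQ_le_const2) (use le in auto)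
  also have "(\<Union>n. space M - E n) = {\<omega> \<in> space M. \<exists>t. a \<le> W t \<omega>}"
    by (auto simp: E_def not_less) (meson le_refl not_less)
  finally show ?thesis .
qed

text \<open>Hoeffding's lemma for the uniform law U on [x - c, x + c]. The range R is the
  oscillation of g within one step, which for potentials is far better controlled than the global
  one.\<close>

lemma avg_hoeffding:
  assumes c: "c > 0" and g: "bmeas g" and R: "\<And>u v. \<bar>u - v\<bar> \<le> 2 * c \<Longrightarrow> \<bar>g u - g v\<bar> \<le> R" and \<theta>: "\<theta> > 0"
  shows "avg c (\<lambda>y. exp (\<theta> * g y)) x \<le> exp (\<theta> * avg c g x + \<theta>\<^sup>2 * R\<^sup>2 / 8)"
proof -
  define U where "U = density lborel (\<lambda>u. ennreal (indicator {x - c..x + c} u / (2 * c)))"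
  have [measurable]: "g \<in> borel_measurable borel" using g by auto
  have intU: "(\<integral>u. \<phi> u \<partial>U) = avg c \<phi> x" if \<phi>: "bmeas \<phi>" for \<phi>
  proof -
    have [measurable]: "\<phi> \<in> borel_measurable borel" using \<phi> by auto
    have "(\<integral>u. \<phi> u \<partial>U) = (\<integral>u. (indicator {x - c..x + c} u / (2 * c)) *\<^sub>R \<phi> u \<partial>lborel)"
      unfolding U_def using c by (intro integral_density) (auto simp: indicator_def)
    also have "\<dots> = (\<integral>u. (1 / (2 * c)) * (indicator {x - c..x + c} u * \<phi> u) \<partial>lborel)" by simp
    also have "\<dots> = (1 / (2 * c)) * (\<integral>u. indicator {x - c..x + c} u * \<phi> u \<partial>lborel)" by (rule integral_mult_right_zero)
    also have "(\<integral>u. indicator {x - c..x + c} u * \<phi> u \<partial>lborel) = integral {x - c..x + c} \<phi>"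
      by (simp add: bmeas_integral_eq[OF \<phi>] set_lebesgue_integral_def)
    finally show ?thesis by (simp add: avg_alt[OF \<phi>])
  qed
  interpret U: prob_space U
  proof (rule prob_spaceI)
    have "emeasure U (space U) = (\<integral>\<^sup>+u. ennreal (1 / (2 * c)) * indicator {x - c..x + c} u \<partial>lborel)"
      unfolding U_def using c
      by (simp add: emeasure_density) (intro nn_integral_cong, auto simp: indicator_def)
    also have "\<dots> = ennreal (1 / (2 * c)) * ennreal (2 * c)"
      using c by (subst nn_integral_cmult_indicator) auto
    also have "\<dots> = 1" using c by (simp flip: ennreal_mult)
    finally show "emeasure U (space U) = 1" .
  qed
  define a where "a = (INF u\<in>{x - c..x + c}. g u)"
  obtain C where C: "\<And>x. \<bar>g x\<bar> \<le> C" "C \<ge> 0" using g by (meson bmeasE)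
  have bdd: "bdd_below (g ` {x - c..x + c})" using C by (intro bdd_belowI[of _ "-C"]) (auto simp: abs_le_iff minus_le_iff)
  have a1: "a \<le> g u" if "u \<in> {x - c..x + c}" for u unfolding a_def by (rule cINF_lower[OF bdd that])
  have a2: "g u \<le> a + R" if "u \<in> {x - c..x + c}" for u
  proof -
    have "g u - R \<le> a" unfolding a_def
    proof (rule cINF_greatest)
      fix v assume "v \<in> {x - c..x + c}"
      then have "\<bar>u - v\<bar> \<le> 2 * c" using that by auto
      from R[OF this] show "g u - R \<le> g v" by linarith
    qed (use c in auto)
    then show ?thesis by simp
  qed
  have sU [measurable_cong]: "sets U = sets borel" by (simp add: U_def)
  interpret H: interval_bounded_random_variable U g a "a + R"
  proof
    show "g \<in> borel_measurable U" by measurable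
    have "AE u in U. u \<in> {x - c..x + c}"
      unfolding U_def by (subst AE_density) (auto simp: indicator_def)
    then show "AE u in U. g u \<in> {a..a + R}" by eventually_elim (use a1 a2 in auto)
  qed
  have Eg: "U.expectation g = avg c g x" by (rule intU[OF g])
  have "nn_integral U (\<lambda>u. ennreal (exp (\<theta> * (g u - U.expectation g)))) \<le> ennreal (exp (\<theta>\<^sup>2 * (a + R - a)\<^sup>2 / 8))"
    by (rule H.Hoeffdings_lemma_nn_integral[OF \<theta>])
  then have nn: "nn_integral U (\<lambda>u. ennreal (exp (\<theta> * (g u - avg c g x)))) \<le> ennreal (exp (\<theta>\<^sup>2 * R\<^sup>2 / 8))"
    by (simp add: Eg)
  have be: "bmeas (\<lambda>u. exp (\<theta> * (g u - avg c g x)))"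
  proof (rule bmeasI[where C="exp (\<theta> * (C - avg c g x))"])
    show "\<bar>exp (\<theta> * (g u - avg c g x))\<bar> \<le> exp (\<theta> * (C - avg c g x))" for u
      using C(1)[of u] \<theta> by (simp add: abs_le_iff)
  qed measurable
  obtain B where B: "\<And>u. \<bar>exp (\<theta> * (g u - avg c g x))\<bar> \<le> B" using bmeasE[OF be] by metis
  have "integrable U (\<lambda>u. exp (\<theta> * (g u - avg c g x)))"
    by (rule U.integrable_const_bound[where B=B]) (use B in auto)
  then have "nn_integral U (\<lambda>u. ennreal (exp (\<theta> * (g u - avg c g x)))) = ennreal (\<integral>u. exp (\<theta> * (g u - avg c g x)) \<partial>U)"
    by (intro nn_integral_eq_integral) auto
  with nn have "(\<integral>u. exp (\<theta> * (g u - avg c g x)) \<partial>U) \<le> exp (\<theta>\<^sup>2 * R\<^sup>2 / 8)"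
    by (simp add: ennreal_le_iff)
  then have 1: "avg c (\<lambda>u. exp (\<theta> * (g u - avg c g x))) x \<le> exp (\<theta>\<^sup>2 * R\<^sup>2 / 8)" by (simp add: intU[OF be])
  have "exp (\<theta> * g u) = exp (\<theta> * avg c g x) * exp (\<theta> * (g u - avg c g x))" for u
    by (simp add: algebra_simps flip: exp_add)
  then have "avg c (\<lambda>y. exp (\<theta> * g y)) x = exp (\<theta> * avg c g x) * avg c (\<lambda>u. exp (\<theta> * (g u - avg c g x))) x"
    by simp
  also have "\<dots> \<le> exp (\<theta> * avg c g x) * exp (\<theta>\<^sup>2 * R\<^sup>2 / 8)" using 1 by (intro mult_left_mono) auto
  finally show ?thesis by (simp add: exp_add)
qed

section \<open>Concentration for the level-1 chain\<close>

locale level1 = equi_energy_sampler P M H c p_ee Q T x X1 X0 + stripes M c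
  for P :: "'a measure" and M :: nat and H c p_ee :: real and Q :: "real measure" and T :: nat and x :: real
    and X1 X0 :: "nat \<Rightarrow> 'a \<Rightarrow> real"
begin

lemma X1_Omega: "\<omega> \<in> space P \<Longrightarrow> X1 s \<omega> \<in> Omega"
  using measurable_space[OF X1_measurable[of s]] by simp

lemma X1_borel [measurable]: "X1 s \<in> borel_measurable P"
  using measurable_compose[OF X1_measurable id_borel_circ_leb] by simp

lemma history1_map [measurable]: "(\<lambda>\<omega>. \<lambda>s\<in>{..t}. X1 s \<omega>) \<in> P \<rightarrow>\<^sub>M (\<Pi>\<^sub>M s\<in>{..t}. circ_leb)"
  by (rule measurable_restrict) (rule X1_measurable)

lemma subalgebra_history1: "subalgebra P (history1 P X1 t)"
  unfolding history1_def by (rule subalgebra_vimage_algebra[OF history1_map])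

lemma space_history1: "space (history1 P X1 t) = space P"
  by (simp add: history1_def)

lemma X1_history1:
  assumes "s \<le> t" shows "X1 s \<in> borel_measurable (history1 P X1 t)"
proof -
  have "(\<lambda>\<omega>. \<lambda>s\<in>{..t}. X1 s \<omega>) \<in> history1 P X1 t \<rightarrow>\<^sub>M (\<Pi>\<^sub>M s\<in>{..t}. circ_leb)"
    unfolding history1_def using measurable_space[OF history1_map] by (intro measurable_vimage_algebra1) auto
  moreover have "(\<lambda>f. f s) \<in> (\<Pi>\<^sub>M s\<in>{..t}. circ_leb) \<rightarrow>\<^sub>M circ_leb"
    using assms by (intro measurable_component_singleton) auto
  ultimately have "(\<lambda>\<omega>. (\<lambda>s\<in>{..t}. X1 s \<omega>) s) \<in> history1 P X1 t \<rightarrow>\<^sub>M circ_leb"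
    by (rule measurable_compose)
  then have "X1 s \<in> history1 P X1 t \<rightarrow>\<^sub>M circ_leb" using assms by simp
  from measurable_compose[OF this id_borel_circ_leb] show ?thesis by simp
qed

text \<open>The Markov property, integrated against bounded weights that depend on the past.\<close>

lemma expectation_X1_step:
  assumes W: "W \<in> borel_measurable (history1 P X1 t)" and B: "\<And>\<omega>. \<omega> \<in> space P \<Longrightarrow> \<bar>W \<omega>\<bar> \<le> B"
    and \<phi>: "bmeas \<phi>" and per: "\<And>x. \<phi> (x + 1) = \<phi> x"
  shows "expectation (\<lambda>\<omega>. W \<omega> * \<phi> (X1 (Suc t) \<omega>)) = expectation (\<lambda>\<omega>. W \<omega> * avg c \<phi> (X1 t \<omega>))"
proof -
  let ?F = "history1 P X1 t"
  interpret F: finite_measure_subalgebra P ?F by unfold_locales (rule subalgebra_history1)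
  obtain C where C: "\<And>x. \<bar>\<phi> x\<bar> \<le> C" "C \<ge> 0" using \<phi> by (meson bmeasE)
  have [measurable]: "\<phi> \<in> borel_measurable borel" using \<phi> by auto
  have [measurable]: "W \<in> borel_measurable P" by (rule measurable_from_subalg[OF subalgebra_history1 W])
  have ae0: "AE \<omega> in P. real_cond_exp P ?F (\<lambda>\<omega>. \<phi> (X1 (Suc t) \<omega>)) \<omega> = (\<integral>y. \<phi> y \<partial>mh_kernel c (\<lambda>_. 1) (X1 t \<omega>))"
  proof (rule cond_law_integral[OF prob_space_axioms subalgebra_history1 X1_measurable _ _ X1_step])
    fix \<omega> assume "\<omega> \<in> space P"
    then have "mh_kernel c (\<lambda>_. 1) (X1 t \<omega>) \<in> space (prob_algebra circ_leb)"
      by (intro mh_kernel_in_prob_algebra c Mc X1_Omega) auto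
    then show "prob_space (mh_kernel c (\<lambda>_. 1) (X1 t \<omega>))" "sets (mh_kernel c (\<lambda>_. 1) (X1 t \<omega>)) = sets circ_leb"
      by (auto simp: space_prob_algebra)
  qed (use C in \<open>auto intro: circ_leb_measurable\<close>)
  have eq0: "(\<integral>y. \<phi> y \<partial>mh_kernel c (\<lambda>_. 1) (X1 t \<omega>)) = avg c \<phi> (X1 t \<omega>)" if "\<omega> \<in> space P" for \<omega>
    using mh_op_avg[OF c(1) Mc(4) X1_Omega[OF that] \<phi> per] c(1) Mc(4)
    by (subst integral_mh_kernel[OF c(1) Mc(4) X1_Omega[OF that] \<phi>]) auto
  have ae: "AE \<omega> in P. real_cond_exp P ?F (\<lambda>\<omega>. \<phi> (X1 (Suc t) \<omega>)) \<omega> = avg c \<phi> (X1 t \<omega>)"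
    using ae0 AE_space by eventually_elim (simp add: eq0)
  have int: "integrable P (\<lambda>\<omega>. W \<omega> * \<phi> (X1 (Suc t) \<omega>))"
  proof (rule integrable_const_bound[where B="B * C"])
    show "AE \<omega> in P. norm (W \<omega> * \<phi> (X1 (Suc t) \<omega>)) \<le> B * C"
    proof (rule AE_I2)
      fix \<omega> assume \<omega>: "\<omega> \<in> space P"
      have "0 \<le> B" using B[OF \<omega>] by linarith
      then show "norm (W \<omega> * \<phi> (X1 (Suc t) \<omega>)) \<le> B * C"
        unfolding real_norm_def abs_mult using B[OF \<omega>] C by (intro mult_mono) auto
    qed
  qed measurable
  have "expectation (\<lambda>\<omega>. W \<omega> * \<phi> (X1 (Suc t) \<omega>)) = expectation (\<lambda>\<omega>. W \<omega> * real_cond_exp P ?F (\<lambda>\<omega>. \<phi> (X1 (Suc t) \<omega>)) \<omega>)"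
    by (rule F.real_cond_exp_intg(2)[symmetric]) (use int W in auto)
  also have "\<dots> = expectation (\<lambda>\<omega>. W \<omega> * avg c \<phi> (X1 t \<omega>))"
  proof (rule integral_cong_AE)
    have "avg c \<phi> \<in> borel_measurable borel" by (rule bmeas_measurable[OF bmeas_avg[OF c(1) \<phi>]])
    then show "(\<lambda>\<omega>. W \<omega> * avg c \<phi> (X1 t \<omega>)) \<in> borel_measurable P" by measurable
  qed (use ae in auto)
  finally show ?thesis .
qed

definition mart :: "(real \<Rightarrow> real) \<Rightarrow> nat \<Rightarrow> 'a \<Rightarrow> real" where
  "mart g t \<omega> = (\<Sum>s<t. g (X1 (Suc s) \<omega>) - avg c g (X1 s \<omega>))"

lemma mart_measurable_history1:
  assumes g: "bmeas g" and "s \<le> t"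
  shows "mart g s \<in> borel_measurable (history1 P X1 t)"
  unfolding mart_def
proof (rule borel_measurable_sum)
  fix i assume "i \<in> {..<s}"
  then have [measurable]: "X1 (Suc i) \<in> borel_measurable (history1 P X1 t)" "X1 i \<in> borel_measurable (history1 P X1 t)"
    using assms(2) by (auto intro!: X1_history1)
  have [measurable]: "g \<in> borel_measurable borel" "avg c g \<in> borel_measurable borel"
    using g bmeas_measurable[OF bmeas_avg[OF c(1) g]] by auto
  show "(\<lambda>\<omega>. g (X1 (Suc i) \<omega>) - avg c g (X1 i \<omega>)) \<in> borel_measurable (history1 P X1 t)" by measurable
qed

lemma mart_measurable [measurable]: "bmeas g \<Longrightarrow> mart g t \<in> borel_measurable P"
  by (rule measurable_from_subalg[OF subalgebra_history1 mart_measurable_history1]) auto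

text \<open>By \<open>avg_hoeffding\<close>, W is a supermartingale. If the martingale is above the
  line \<eta> t at any t \<ge> T0, then W has reached a, so a single use of \<open>ville\<close>
  covers all times after T0 without a union bound.\<close>

lemma mart_crossing:
  assumes g: "bmeas g" and per: "\<And>x. g (x + 1) = g x" and R: "R > 0" "\<And>u v. \<bar>u - v\<bar> \<le> 2 * c \<Longrightarrow> \<bar>g u - g v\<bar> \<le> R"
    and \<eta>: "\<eta> > 0"
  shows "prob {\<omega> \<in> space P. \<exists>t\<ge>T0. \<eta> * real t \<le> mart g t \<omega>} \<le> exp (- (2 * real T0 * \<eta>\<^sup>2 / R\<^sup>2))"
proof -
  obtain C where C: "\<And>x. \<bar>g x\<bar> \<le> C" "C \<ge> 0" using g by (meson bmeasE)
  \<comment> \<open>The maximiser of \<theta> \<eta> -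
    \<open>\<theta>\<^sup>2 * R\<^sup>2 / 8\<close>; the maximal value is
    \<open>2 * \<eta>\<^sup>2 / R\<^sup>2\<close>.\<close>
  define \<theta> where "\<theta> = 4 * \<eta> / R\<^sup>2"
  have \<theta>: "\<theta> > 0" using \<eta> R by (simp add: \<theta>_def)
  define b where "b = \<theta>\<^sup>2 * R\<^sup>2 / 8"
  define W where "W = (\<lambda>t \<omega>. exp (\<theta> * mart g t \<omega> - real t * b))"
  define a where "a = exp (2 * real T0 * \<eta>\<^sup>2 / R\<^sup>2)"
  have mb: "\<bar>mart g t \<omega>\<bar> \<le> real t * (2 * C)" for t \<omega>
  proof -
    have "\<bar>mart g t \<omega>\<bar> \<le> (\<Sum>s<t. 2 * C)"
      unfolding mart_def
    proof (rule order_trans[OF sum_abs sum_mono])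
      fix s
      have "\<bar>avg c g (X1 s \<omega>)\<bar> \<le> C" by (rule avg_abs_le[OF c(1) g]) (rule C)
      then show "\<bar>g (X1 (Suc s) \<omega>) - avg c g (X1 s \<omega>)\<bar> \<le> 2 * C" using C(1)[of "X1 (Suc s) \<omega>"] by linarith
    qed
    then show ?thesis by simp
  qed
  have Wb: "W t \<omega> \<le> exp (\<theta> * (real t * (2 * C)) + real t * \<bar>b\<bar>)" for t \<omega>
  proof -
    have "\<theta> * mart g t \<omega> \<le> \<theta> * (real t * (2 * C))" using mb[of t \<omega>] \<theta> by (intro mult_left_mono) auto
    moreover have "- (real t * b) \<le> real t * \<bar>b\<bar>" by (simp add: b_def)
    ultimately show ?thesis unfolding W_def exp_le_cancel_iff by linarith
  qed
  have Wm: "W s \<in> borel_measurable (history1 P X1 t)" if "s \<le> t" for s t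
    unfolding W_def using mart_measurable_history1[OF g that] by measurable
  have [measurable]: "g \<in> borel_measurable borel" "avg c g \<in> borel_measurable borel"
    using g bmeas_measurable[OF bmeas_avg[OF c(1) g]] by auto
  have Wm' [measurable]: "W t \<in> borel_measurable P" for t
    by (rule measurable_from_subalg[OF subalgebra_history1 Wm[OF order_refl]])
  have "prob {\<omega> \<in> space P. \<exists>t. a \<le> W t \<omega>} \<le> 1 / a"
  proof (rule ville)
    show "\<exists>B. \<forall>\<omega>\<in>space P. W t \<omega> \<le> B" for t using Wb by blast
    show "a > 0" by (simp add: a_def)
    show "W 0 \<omega> = 1" for \<omega> by (simp add: W_def mart_def)
    show "0 \<le> W t \<omega>" for t \<omega> by (simp add: W_def)
    fix t
    define E where "E = {\<omega> \<in> space P. \<forall>s\<le>t. W s \<omega> < a}"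
    have EF: "E \<in> sets (history1 P X1 t)"
    proof -
      have "{\<omega> \<in> space (history1 P X1 t). \<forall>s\<in>{..t}. W s \<omega> < a} \<in> sets (history1 P X1 t)"
      proof (rule sets.sets_Collect_finite_All')
        fix s assume "s \<in> {..t}"
        then have [measurable]: "W s \<in> borel_measurable (history1 P X1 t)" by (intro Wm) auto
        show "{\<omega> \<in> space (history1 P X1 t). W s \<omega> < a} \<in> sets (history1 P X1 t)" by measurable
      qed auto
      also have "{\<omega> \<in> space (history1 P X1 t). \<forall>s\<in>{..t}. W s \<omega> < a} = E" by (auto simp: E_def space_history1)
      finally show ?thesis .
    qed
    have EP [measurable]: "E \<in> events" using EF subalgebra_history1 by (auto simp: subalgebra_def)
    \<comment> \<open>V collects everything known at time t: on E the next value of W is V times exp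
      (\<theta> * g) at the next state.\<close>
    define V where "V = (\<lambda>\<omega>. W t \<omega> * indicator E \<omega> * exp (- \<theta> * avg c g (X1 t \<omega>) - b))"
    have VF: "V \<in> borel_measurable (history1 P X1 t)"
    proof -
      have [measurable]: "W t \<in> borel_measurable (history1 P X1 t)" "X1 t \<in> borel_measurable (history1 P X1 t)" "E \<in> sets (history1 P X1 t)"
        by (auto intro: Wm X1_history1 EF)
      show ?thesis unfolding V_def by measurable
    qed
    have V0: "0 \<le> V \<omega>" for \<omega> by (simp add: V_def W_def)
    have VB: "\<bar>V \<omega>\<bar> \<le> exp (\<theta> * (real t * (2 * C)) + real t * \<bar>b\<bar>) * 1 * exp (\<theta> * C + \<bar>b\<bar>)" for \<omega>
      unfolding V_def abs_mult
    proof (intro mult_mono)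
      show "\<bar>W t \<omega>\<bar> \<le> exp (\<theta> * (real t * (2 * C)) + real t * \<bar>b\<bar>)" using Wb[of t \<omega>] by (simp add: W_def)
      have "\<bar>avg c g (X1 t \<omega>)\<bar> \<le> C" by (rule avg_abs_le[OF c(1) g]) (rule C)
      then have "\<theta> * (- avg c g (X1 t \<omega>)) \<le> \<theta> * C" using \<theta> by (intro mult_left_mono) auto
      moreover have "- \<theta> * avg c g (X1 t \<omega>) = \<theta> * (- avg c g (X1 t \<omega>))" "0 \<le> b" by (simp_all add: b_def)
      ultimately have "- \<theta> * avg c g (X1 t \<omega>) - b \<le> \<theta> * C + \<bar>b\<bar>" by linarith
      then show "\<bar>exp (- \<theta> * avg c g (X1 t \<omega>) - b)\<bar> \<le> exp (\<theta> * C + \<bar>b\<bar>)" by simp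
    qed (auto simp: indicator_def)
    have be: "bmeas (\<lambda>y. exp (\<theta> * g y))"
    proof (rule bmeasI[where C="exp (\<theta> * C)"])
      show "\<bar>exp (\<theta> * g u)\<bar> \<le> exp (\<theta> * C)" for u using C(1)[of u] \<theta> by (simp add: abs_le_iff)
    qed measurable
    have "expectation (\<lambda>\<omega>. W (Suc t) \<omega> * indicator E \<omega>) = expectation (\<lambda>\<omega>. V \<omega> * exp (\<theta> * g (X1 (Suc t) \<omega>)))"
    proof (rule arg_cong[where f=expectation], rule ext)
      fix \<omega>
      have "W (Suc t) \<omega> = W t \<omega> * (exp (- \<theta> * avg c g (X1 t \<omega>) - b) * exp (\<theta> * g (X1 (Suc t) \<omega>)))"
        by (simp add: W_def mart_def algebra_simps flip: exp_add)
      then show "W (Suc t) \<omega> * indicator E \<omega> = V \<omega> * exp (\<theta> * g (X1 (Suc t) \<omega>))" by (simp add: V_def)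
    qed
    also have "\<dots> = expectation (\<lambda>\<omega>. V \<omega> * avg c (\<lambda>y. exp (\<theta> * g y)) (X1 t \<omega>))"
      by (rule expectation_X1_step[OF VF VB be]) (simp add: per)
    also have "\<dots> \<le> expectation (\<lambda>\<omega>. W t \<omega> * indicator E \<omega>)"
    proof (rule integral_mono)
      have [measurable]: "V \<in> borel_measurable P" by (rule measurable_from_subalg[OF subalgebra_history1 VF])
      have [measurable]: "avg c (\<lambda>y. exp (\<theta> * g y)) \<in> borel_measurable borel" by (rule bmeas_measurable[OF bmeas_avg[OF c(1) be]])
      obtain D where D: "\<And>u. \<bar>avg c (\<lambda>y. exp (\<theta> * g y)) u\<bar> \<le> D" "D \<ge> 0" using bmeasE[OF bmeas_avg[OF c(1) be]] by metis
      show "integrable P (\<lambda>\<omega>. V \<omega> * avg c (\<lambda>y. exp (\<theta> * g y)) (X1 t \<omega>))"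
      proof (rule integrable_const_bound[where B="exp (\<theta> * (real t * (2 * C)) + real t * \<bar>b\<bar>) * 1 * exp (\<theta> * C + \<bar>b\<bar>) * D"])
        show "AE \<omega> in P. norm (V \<omega> * avg c (\<lambda>y. exp (\<theta> * g y)) (X1 t \<omega>)) \<le> exp (\<theta> * (real t * (2 * C)) + real t * \<bar>b\<bar>) * 1 * exp (\<theta> * C + \<bar>b\<bar>) * D"
          unfolding real_norm_def abs_mult by (intro AE_I2 mult_mono VB D) (auto simp: D)
      qed measurable
      show "integrable P (\<lambda>\<omega>. W t \<omega> * indicator E \<omega>)"
      proof (rule integrable_const_bound[where B="exp (\<theta> * (real t * (2 * C)) + real t * \<bar>b\<bar>)"])
        show "AE \<omega> in P. norm (W t \<omega> * indicator E \<omega>) \<le> exp (\<theta> * (real t * (2 * C)) + real t * \<bar>b\<bar>)"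
          using Wb by (intro AE_I2) (auto simp: indicator_def W_def)
      qed measurable
      fix \<omega>
      have "V \<omega> * avg c (\<lambda>y. exp (\<theta> * g y)) (X1 t \<omega>) \<le> V \<omega> * exp (\<theta> * avg c g (X1 t \<omega>) + b)"
        unfolding b_def by (intro mult_left_mono avg_hoeffding[OF c(1) g R(2) \<theta>] V0) auto
      also have "\<dots> = W t \<omega> * indicator E \<omega> * (exp (- \<theta> * avg c g (X1 t \<omega>) - b) * exp (\<theta> * avg c g (X1 t \<omega>) + b))"
        by (simp add: V_def)
      also have "\<dots> = W t \<omega> * indicator E \<omega>" by (simp flip: exp_add)
      finally show "V \<omega> * avg c (\<lambda>y. exp (\<theta> * g y)) (X1 t \<omega>) \<le> W t \<omega> * indicator E \<omega>" .
    qed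
    finally show "expectation (\<lambda>\<omega>. W (Suc t) \<omega> * indicator {\<omega> \<in> space P. \<forall>s\<le>t. W s \<omega> < a} \<omega>)
        \<le> expectation (\<lambda>\<omega>. W t \<omega> * indicator {\<omega> \<in> space P. \<forall>s\<le>t. W s \<omega> < a} \<omega>)" by (simp add: E_def)
  qed measurable
  moreover have "prob {\<omega> \<in> space P. \<exists>t\<ge>T0. \<eta> * real t \<le> mart g t \<omega>} \<le> prob {\<omega> \<in> space P. \<exists>t. a \<le> W t \<omega>}"
  proof (rule finite_measure_mono)
    show "{\<omega> \<in> space P. \<exists>t\<ge>T0. \<eta> * real t \<le> mart g t \<omega>} \<subseteq> {\<omega> \<in> space P. \<exists>t. a \<le> W t \<omega>}"
    proof clarify
      fix \<omega> t assume t: "T0 \<le> t" "\<eta> * real t \<le> mart g t \<omega>"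
      have "b = 2 * \<eta>\<^sup>2 / R\<^sup>2" using R by (simp add: b_def \<theta>_def power2_eq_square)
      then have "\<theta> * (\<eta> * real t) - real t * b = 2 * real t * \<eta>\<^sup>2 / R\<^sup>2"
        by (simp add: \<theta>_def power2_eq_square)
      moreover have "2 * real T0 * \<eta>\<^sup>2 / R\<^sup>2 \<le> 2 * real t * \<eta>\<^sup>2 / R\<^sup>2"
        using t(1) by (intro divide_right_mono mult_right_mono) auto
      moreover have "\<theta> * (\<eta> * real t) \<le> \<theta> * mart g t \<omega>" using t(2) \<theta> by (intro mult_left_mono) auto
      ultimately have "a \<le> W t \<omega>" unfolding a_def W_def exp_le_cancel_iff by linarith
      then show "\<exists>t. a \<le> W t \<omega>" by blast
    qed
  qed measurable
  moreover have "1 / a = exp (- (2 * real T0 * \<eta>\<^sup>2 / R\<^sup>2))" by (simp add: a_def exp_minus inverse_eq_divide)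
  ultimately show ?thesis by linarith
qed

lemma mart_uminus: "mart (\<lambda>y. - g y) t \<omega> = - mart g t \<omega>"
proof -
  have "avg c (\<lambda>y. - g y) z = - avg c g z" for z using avg_cmult[of c "-1" g z] by simp
  then show ?thesis by (simp add: mart_def sum_negf[symmetric])
qed

text \<open>Along the trajectory the sum of g - avg c g telescopes to the martingale plus a boundary
  term, which the global oscillation D bounds and which is divided by the time. The deviation
  probability involves only the local oscillation R.\<close>

lemma emp_poisson_tail:
  assumes g: "bmeas g" and per: "\<And>x. g (x + 1) = g x" and R: "R > 0" "\<And>u v. \<bar>u - v\<bar> \<le> 2 * c \<Longrightarrow> \<bar>g u - g v\<bar> \<le> R"
    and osc: "\<And>u v. \<bar>g u - g v\<bar> \<le> D" and \<eta>: "\<eta> > 0" and T0: "T0 > 0"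
  shows "prob {\<omega> \<in> space P. \<exists>t\<ge>T0. \<bar>emp (\<lambda>s. X1 s \<omega>) t (\<lambda>y. g y - avg c g y)\<bar> > \<eta> + D / real T0}
      \<le> 2 * exp (- (2 * real T0 * \<eta>\<^sup>2 / R\<^sup>2))"
proof -
  have [measurable]: "g \<in> borel_measurable borel" "avg c g \<in> borel_measurable borel"
    using g bmeas_measurable[OF bmeas_avg[OF c(1) g]] by auto
  have [measurable]: "mart g t \<in> borel_measurable P" "mart (\<lambda>y. - g y) t \<in> borel_measurable P" for t
    using mart_measurable[OF g] mart_measurable[OF bmeas_uminus[OF g]] by auto
  let ?B1 = "{\<omega> \<in> space P. \<exists>t\<ge>T0. \<eta> * real t \<le> mart g t \<omega>}"
  let ?B2 = "{\<omega> \<in> space P. \<exists>t\<ge>T0. \<eta> * real t \<le> mart (\<lambda>y. - g y) t \<omega>}"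
  have "prob {\<omega> \<in> space P. \<exists>t\<ge>T0. \<bar>emp (\<lambda>s. X1 s \<omega>) t (\<lambda>y. g y - avg c g y)\<bar> > \<eta> + D / real T0} \<le> prob (?B1 \<union> ?B2)"
  proof (rule finite_measure_mono)
    show "{\<omega> \<in> space P. \<exists>t\<ge>T0. \<bar>emp (\<lambda>s. X1 s \<omega>) t (\<lambda>y. g y - avg c g y)\<bar> > \<eta> + D / real T0} \<subseteq> ?B1 \<union> ?B2"
    proof clarify
      fix \<omega> t
      assume \<omega>: "\<omega> \<in> space P" and t: "T0 \<le> t" and big: "\<eta> + D / real T0 < \<bar>emp (\<lambda>s. X1 s \<omega>) t (\<lambda>y. g y - avg c g y)\<bar>"
        and n1: "\<not> (\<exists>t\<ge>T0. \<eta> * real t \<le> mart (\<lambda>y. - g y) t \<omega>)"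
      have "\<eta> * real t \<le> mart g t \<omega>"
      proof (rule ccontr)
        assume "\<not> \<eta> * real t \<le> mart g t \<omega>"
        moreover have "\<not> \<eta> * real t \<le> - mart g t \<omega>" using n1 t unfolding mart_uminus by blast
        ultimately have m: "\<bar>mart g t \<omega>\<bar> \<le> \<eta> * real t" by linarith
        have tel: "(\<Sum>s\<le>t. g (X1 s \<omega>) - avg c g (X1 s \<omega>)) = mart g t \<omega> + (g (X1 0 \<omega>) - avg c g (X1 t \<omega>))"
          unfolding mart_def by (induction t) simp_all
        have "\<bar>g (X1 0 \<omega>) - avg c g (X1 t \<omega>)\<bar> \<le> D"
        proof -
          have "avg c g (X1 t \<omega>) \<le> g (X1 0 \<omega>) + D"
            by (rule avg_le[OF c(1) g]) (use osc[of _ "X1 0 \<omega>"] in \<open>auto simp: abs_le_iff algebra_simps\<close>)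
          moreover have "g (X1 0 \<omega>) - D \<le> avg c g (X1 t \<omega>)"
            by (rule avg_ge[OF c(1) g]) (use osc[of "X1 0 \<omega>"] in \<open>auto simp: abs_le_iff algebra_simps\<close>)
          ultimately show ?thesis by linarith
        qed
        then have num: "\<bar>\<Sum>s\<le>t. g (X1 s \<omega>) - avg c g (X1 s \<omega>)\<bar> \<le> \<eta> * real t + D" using m unfolding tel by linarith
        have D0: "D \<ge> 0" using osc[of 0 0] by simp
        have "\<bar>emp (\<lambda>s. X1 s \<omega>) t (\<lambda>y. g y - avg c g y)\<bar> \<le> (\<eta> * real t + D) / (real t + 1)"
          unfolding emp_def abs_divide using num by (intro frac_le) auto
        also have "\<dots> = \<eta> * real t / (real t + 1) + D / (real t + 1)" by (rule add_divide_distrib)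
        also have "\<dots> \<le> \<eta> + D / real T0"
          using \<eta> D0 T0 t by (intro add_mono divide_left_mono) (auto simp: divide_le_eq)
        finally show False using big by simp
      qed
      then show "\<exists>t\<ge>T0. \<eta> * real t \<le> mart g t \<omega>" using t by blast
    qed
  qed measurable
  also have "\<dots> \<le> prob ?B1 + prob ?B2" by (rule measure_Un_le) measurable
  also have "\<dots> \<le> exp (- (2 * real T0 * \<eta>\<^sup>2 / R\<^sup>2)) + exp (- (2 * real T0 * \<eta>\<^sup>2 / R\<^sup>2))"
  proof (rule add_mono)
    show "prob ?B1 \<le> exp (- (2 * real T0 * \<eta>\<^sup>2 / R\<^sup>2))" by (rule mart_crossing[OF g per R \<eta>])
    show "prob ?B2 \<le> exp (- (2 * real T0 * \<eta>\<^sup>2 / R\<^sup>2))"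
    proof (rule mart_crossing[OF bmeas_uminus[OF g] _ R(1) _ \<eta>])
      show "\<bar>- g u - - g v\<bar> \<le> R" if "\<bar>u - v\<bar> \<le> 2 * c" for u v using R(2)[OF that] by linarith
    qed (simp add: per)
  qed
  finally show ?thesis by simp
qed

end

lemma potn_osc_periodic:
  assumes c: "0 < c" "c \<le> 1 / 4" and h: "bmeas h"
    and per: "\<And>x. h (x + 1) = h x" and osc: "\<And>x y. \<bar>h x - h y\<bar> \<le> 1"
  shows "\<bar>potn c h n u - potn c h n v\<bar> \<le> 1 / (4 * c\<^sup>2)"
proof -
  have *: "\<bar>potn c h n a - potn c h n b\<bar> \<le> 1 / (4 * c\<^sup>2)" if "a \<le> b" "b \<le> a + 1" for a b
  proof -
    have "c\<^sup>2 \<le> (1 / 4)\<^sup>2" using c by (intro power_mono) auto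
    then have "1 \<le> 1 / (16 * c\<^sup>2)" using c by (simp add: power2_eq_square field_simps)
    moreover have "3 / (16 * c\<^sup>2) + 1 / (16 * c\<^sup>2) = 1 / (4 * c\<^sup>2)" using c by (simp add: field_simps)
    moreover have "psi c 1 (b - a) \<le> 1 + 3 / (16 * c\<^sup>2)" using psi_bounds(2)[OF c(1), of "b - a"] that by simp
    moreover have "\<bar>potn c h n a - potn c h n b\<bar> \<le> psi c 1 (b - a)" using potn_osc[OF c h per osc, where x=a and y=b] that by simp
    ultimately show ?thesis by linarith
  qed
  have "potn c h n (frac z) = potn c h n z" for z by (rule periodic_frac) (rule potn_periodic, rule per)
  moreover have "\<bar>potn c h n (frac u) - potn c h n (frac v)\<bar> \<le> 1 / (4 * c\<^sup>2)"
  proof (cases "frac u \<le> frac v")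
    case True
    then show ?thesis using frac_lt_1[of v] frac_ge_0[of u] by (intro *) linarith+
  next
    case False
    then show ?thesis using frac_lt_1[of u] frac_ge_0[of v] *[of "frac v" "frac u"] unfolding abs_minus_commute[of "potn c h n (frac u)"] by linarith
  qed
  ultimately show ?thesis by simp
qed

lemma close_to_lam:
  assumes "bmeas h" "\<And>y. \<bar>h x - h y\<bar> \<le> e"
  shows "\<bar>h x - lam h\<bar> \<le> e"
proof -
  have "h x - e \<le> h y" "h y \<le> h x + e" for y using assms(2)[of y] by linarith+
  then have "h x - e \<le> lam h" "lam h \<le> h x + e"
    by (auto intro!: circ.integral_ge_const circ.integral_le_const bmeas_integrable_circ assms(1))
  then show ?thesis by linarith
qed

section \<open>Simultaneous control of all test functions after the burn-in\<close>

locale ee_chain = level1 \<Omega> M H c p Q T x X1 X0 + ee_setup M c p H \<epsilon> f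
  for \<Omega> :: "'a measure" and M :: nat and H c p :: real and Q :: "real measure" and T :: nat and x :: real
    and X1 X0 :: "nat \<Rightarrow> 'a \<Rightarrow> real" and \<epsilon> :: real and f :: "real \<Rightarrow> real" +
  assumes T_large: "real T > 110592 * (1 / c\<^sup>2) * (1 / \<epsilon> + 1)\<^sup>2 * ln (4608 * (1 / \<epsilon> + 1)\<^sup>2)"
begin

text \<open>The argument of the logarithm in the burn-in condition. That condition makes T c^2
  \<epsilon>^2 at least 110592 ln Z and so turns Gaussian tails into powers of Z.\<close>

definition Z :: real where "Z = 4608 * (1 / \<epsilon> + 1)\<^sup>2"

lemma Z_large: "Z \<ge> 4608" and ln_Z: "ln Z \<ge> 1" and T_eps: "real T * c\<^sup>2 * \<epsilon>\<^sup>2 \<ge> 110592 * ln Z" and T_pos: "T > 0"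
proof -
  have "1 / \<epsilon> + 1 \<ge> 1" using eps by simp
  then have "(1 / \<epsilon> + 1)\<^sup>2 \<ge> 1\<^sup>2" by (intro power_mono) auto
  then show Z: "Z \<ge> 4608" by (simp add: Z_def)
  have "exp 1 \<le> (3::real)" by (rule exp_le)
  then have "ln Z \<ge> ln (exp 1)" using Z by (subst ln_le_cancel_iff) auto
  then show l: "ln Z \<ge> 1" by simp
  have "(1 / \<epsilon> + 1)\<^sup>2 * \<epsilon>\<^sup>2 = (1 + \<epsilon>)\<^sup>2" using eps by (simp add: field_simps flip: power_mult_distrib)
  also have "\<dots> \<ge> 1" using eps by simp
  finally have z: "(1 / \<epsilon> + 1)\<^sup>2 * \<epsilon>\<^sup>2 \<ge> 1" .
  have "110592 * ln Z * 1 \<le> 110592 * ln Z * ((1 / \<epsilon> + 1)\<^sup>2 * \<epsilon>\<^sup>2)" using z l by (intro mult_left_mono) auto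
  also have "\<dots> = (110592 * (1 / c\<^sup>2) * (1 / \<epsilon> + 1)\<^sup>2 * ln Z) * (c\<^sup>2 * \<epsilon>\<^sup>2)" using c by simp
  also have "\<dots> \<le> real T * (c\<^sup>2 * \<epsilon>\<^sup>2)" using T_large by (intro mult_right_mono) (auto simp: Z_def)
  finally show *: "real T * c\<^sup>2 * \<epsilon>\<^sup>2 \<ge> 110592 * ln Z" by (simp add: mult.assoc)
  show "T > 0" using * l by (cases T) auto
qed

lemma exp_tail:
  assumes "4 * ln Z \<le> a" shows "2 * exp (- a) \<le> 2 / Z ^ 4"
proof -
  have "exp (- a) \<le> exp (- (4 * ln Z))" using assms by simp
  also have "\<dots> = 1 / exp (ln Z) ^ 4" by (simp add: exp_minus inverse_eq_divide flip: exp_of_nat_mult)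
  also have "\<dots> = 1 / Z ^ 4" using Z_large by simp
  finally show ?thesis by simp
qed

lemma emp_measurable [measurable]: "bmeas h \<Longrightarrow> (\<lambda>\<omega>. emp (\<lambda>s. X1 s \<omega>) t h) \<in> borel_measurable \<Omega>"
proof -
  assume "bmeas h"
  then have [measurable]: "h \<in> borel_measurable borel" by auto
  show ?thesis unfolding emp_def by measurable
qed

text \<open>Of the tolerance \<epsilon> / 50, the martingale takes \<epsilon> / 100, the boundary
  term and the remainder \<open>(K ^^ n) h\<close> at most \<epsilon> / 1000 each. The truncation n
  can be taken as large as the remainder demands, since the oscillation bounds for the potential do
  not involve n.\<close>

lemma equidistribution_tail:
  assumes h: "bmeas h" and per: "\<And>x. h (x + 1) = h x" and h01: "\<And>x. 0 \<le> h x" "\<And>x. h x \<le> 1"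
  shows "prob {\<omega> \<in> space \<Omega>. \<exists>t\<ge>T. \<bar>emp (\<lambda>s. X1 s \<omega>) t h - lam h\<bar> > \<epsilon> / 50} \<le> 2 / Z ^ 4"
proof -
  have osc: "\<bar>h u - h v\<bar> \<le> 1" for u v using h01[of u] h01[of v] by linarith
  define n where "n = Suc (nat \<lceil>(1 / (4 * c\<^sup>2))\<^sup>2 * (1000 / \<epsilon>)\<rceil>)"
  have n: "(1 / (4 * c\<^sup>2))\<^sup>2 / real n \<le> \<epsilon> / 1000"
  proof -
    have "(1 / (4 * c\<^sup>2))\<^sup>2 * (1000 / \<epsilon>) \<le> real n" unfolding n_def by linarith
    moreover have "real n > 0" by (simp add: n_def)
    ultimately show ?thesis using eps by (simp add: pos_divide_le_eq) (simp add: field_simps)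
  qed
  define g where "g = potn c h n"
  have g: "bmeas g" "\<And>x. g (x + 1) = g x" using h per c by (auto simp: g_def potn_periodic)
  have Kn: "\<bar>(K ^^ n) h x - lam h\<bar> \<le> \<epsilon> / 1000" for x
  proof -
    have "\<bar>(K ^^ n) h x - lam ((K ^^ n) h)\<bar> \<le> \<epsilon> / 1000"
    proof (rule close_to_lam)
      show "bmeas ((K ^^ n) h)" using h c by auto
      have "n > 0" by (simp add: n_def)
      then show "\<bar>(K ^^ n) h x - (K ^^ n) h y\<bar> \<le> \<epsilon> / 1000" for y
        by (rule order_trans[OF avg_pow_osc[OF c(1) Mc(5) h per osc] n])
    qed
    then show ?thesis using lam_K_pow[OF h per] by simp
  qed
  \<comment> \<open>At distances up to 2 c, \<open>psi\<close> is at most 1 + 3 / (2 c).\<close>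
  have loc: "\<bar>g u - g v\<bar> \<le> 2 / c" if uv: "\<bar>u - v\<bar> \<le> 2 * c" for u v
  proof -
    have *: "\<bar>g a - g b\<bar> \<le> 2 / c" if "a \<le> b" "b - a \<le> 2 * c" for a b
    proof -
      have "\<bar>g a - g b\<bar> \<le> psi c 1 (b - a)"
        unfolding g_def using that Mc by (intro potn_osc c h per osc) auto
      also have "\<dots> \<le> 1 + 3 / (4 * c\<^sup>2) * ((2 * c) * 1)"
        unfolding psi_def using that Mc c by (intro add_left_mono mult_left_mono mult_mono) auto
      also have "\<dots> = (c + 3 / 2) / c" using c by (simp add: field_simps power2_eq_square)
      also have "\<dots> \<le> 2 / c" using c Mc by (intro divide_right_mono) auto
      finally show ?thesis .
    qed
    show ?thesis using *[of u v] *[of v u] uv by (cases "u \<le> v") (auto simp: abs_minus_commute)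
  qed
  have small: "1 / (4 * c\<^sup>2) / real T \<le> \<epsilon> / 1000"
  proof -
    have "1 / (4 * c\<^sup>2) / real T = \<epsilon>\<^sup>2 / (4 * (real T * c\<^sup>2 * \<epsilon>\<^sup>2))" using eps c T_pos by (simp add: field_simps)
    also have "\<dots> \<le> \<epsilon>\<^sup>2 / (4 * 110592)"
    proof (rule divide_left_mono)
      show "4 * 110592 \<le> 4 * (real T * c\<^sup>2 * \<epsilon>\<^sup>2)" using T_eps ln_Z by linarith
    qed (use T_pos c eps in auto)
    also have "\<dots> = \<epsilon> * (\<epsilon> / (4 * 110592))" by (simp add: power2_eq_square)
    also have "\<dots> \<le> \<epsilon> * (1 / 1000)" using eps by (intro mult_left_mono) auto
    finally show ?thesis by simp
  qed
  have "prob {\<omega> \<in> space \<Omega>. \<exists>t\<ge>T. \<bar>emp (\<lambda>s. X1 s \<omega>) t h - lam h\<bar> > \<epsilon> / 50}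
      \<le> prob {\<omega> \<in> space \<Omega>. \<exists>t\<ge>T. \<bar>emp (\<lambda>s. X1 s \<omega>) t (\<lambda>y. g y - avg c g y)\<bar> > \<epsilon> / 100 + 1 / (4 * c\<^sup>2) / real T}"
  proof (rule finite_measure_mono)
    have "bmeas (\<lambda>y. g y - avg c g y)" by (intro bmeas_diff g bmeas_avg c)
    then have [measurable]: "(\<lambda>\<omega>. emp (\<lambda>s. X1 s \<omega>) t (\<lambda>y. g y - avg c g y)) \<in> borel_measurable \<Omega>" for t by measurable
    show "{\<omega> \<in> space \<Omega>. \<exists>t\<ge>T. \<epsilon> / 100 + 1 / (4 * c\<^sup>2) / real T < \<bar>emp (\<lambda>s. X1 s \<omega>) t (\<lambda>y. g y - avg c g y)\<bar>} \<in> events"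
      by measurable
    show "{\<omega> \<in> space \<Omega>. \<exists>t\<ge>T. \<bar>emp (\<lambda>s. X1 s \<omega>) t h - lam h\<bar> > \<epsilon> / 50}
      \<subseteq> {\<omega> \<in> space \<Omega>. \<exists>t\<ge>T. \<bar>emp (\<lambda>s. X1 s \<omega>) t (\<lambda>y. g y - avg c g y)\<bar> > \<epsilon> / 100 + 1 / (4 * c\<^sup>2) / real T}"
    proof clarify
      fix \<omega> t assume t: "T \<le> t" "\<epsilon> / 50 < \<bar>emp (\<lambda>s. X1 s \<omega>) t h - lam h\<bar>"
      let ?e = "emp (\<lambda>s. X1 s \<omega>) t"
      have "?e (\<lambda>y. g y - avg c g y) = ?e h - ?e ((K ^^ n) h)"
        unfolding g_def potn_poisson[OF c(1) h] by (rule emp_diff)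
      moreover have "\<bar>?e (\<lambda>y. (K ^^ n) h y - lam h)\<bar> \<le> \<epsilon> / 1000" by (rule emp_abs_le) (rule Kn)
      then have "\<bar>?e ((K ^^ n) h) - lam h\<bar> \<le> \<epsilon> / 1000" by (simp add: emp_diff)
      ultimately have "\<epsilon> / 100 + 1 / (4 * c\<^sup>2) / real T < \<bar>?e (\<lambda>y. g y - avg c g y)\<bar>"
        using t small eps by linarith
      then show "\<exists>t\<ge>T. \<epsilon> / 100 + 1 / (4 * c\<^sup>2) / real T < \<bar>emp (\<lambda>s. X1 s \<omega>) t (\<lambda>y. g y - avg c g y)\<bar>" using t by blast
    qed
  qed
  also have "\<dots> \<le> 2 * exp (- (2 * real T * (\<epsilon> / 100)\<^sup>2 / (2 / c)\<^sup>2))"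
    by (rule emp_poisson_tail[OF g _ loc])
       (use c eps T_pos potn_osc_periodic[OF c(1) Mc(5) h per osc] in \<open>auto simp: g_def\<close>)
  also have "\<dots> \<le> 2 / Z ^ 4"
  proof (rule exp_tail)
    have "2 * real T * (\<epsilon> / 100)\<^sup>2 / (2 / c)\<^sup>2 = real T * c\<^sup>2 * \<epsilon>\<^sup>2 / 20000" by (simp add: power_divide)
    then show "4 * ln Z \<le> 2 * real T * (\<epsilon> / 100)\<^sup>2 / (2 / c)\<^sup>2" using T_eps ln_Z by linarith
  qed
  finally show ?thesis .
qed

text \<open>Here n is prescribed and the remainder of the Poisson equation is part of the test
  function, so no truncation error arises. The local oscillation 6 sqrt n cancels against the sqrt n
  in the tolerance, and the probability bound is the same for all n.\<close>

lemma exchange_tail: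
  assumes n: "n \<ge> 1"
  shows "prob {\<omega> \<in> space \<Omega>. \<exists>t\<ge>T. \<bar>emp (\<lambda>s. X1 s \<omega>) t (\<lambda>x. upI M x - bK n x)\<bar> > sqrt (real n) * \<epsilon> * c / 16} \<le> 2 / Z ^ 4"
proof -
  define s where "s = sqrt (real n)"
  have s: "s \<ge> 1" using n by (simp add: s_def)
  define g where "g = potn c (upI M) n"
  have g: "bmeas g" "\<And>x. g (x + 1) = g x" using c by (auto simp: g_def potn_periodic)
  have gp: "g y - avg c g y = upI M y - bK n y" for y
    unfolding g_def bK_def by (rule potn_poisson) (use c in auto)
  have osc1: "\<bar>upI M u - upI M v\<bar> \<le> 1" for u v using lowI_upI_cases[of M u] lowI_upI_cases[of M v] by auto
  have loc: "\<bar>g u - g v\<bar> \<le> 6 * s" if uv: "\<bar>u - v\<bar> \<le> 2 * c" for u v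
  proof -
    have *: "\<bar>g a - g b\<bar> \<le> 6 * s" if "a \<le> b" "b - a \<le> 2 * c" for a b
      unfolding g_def s_def using that n by (intro potn_local_osc c osc1) auto
    show ?thesis using *[of u v] *[of v u] uv by (cases "u \<le> v") (auto simp: abs_minus_commute)
  qed
  have gsc: "g y = potn (real M * c) upper n (real M * y)" for y
    unfolding g_def potn_def using bK_scaled[unfolded bK_def] by simp
  \<comment> \<open>The oscillation is taken after rescaling by M. With this bound, the assumption
    \<epsilon> < c M / 384 can be spent once in the boundary term without leaving a factor M
    behind.\<close>
  have osc: "\<bar>g u - g v\<bar> \<le> 1 / (4 * (real M * c)\<^sup>2)" for u v
    unfolding gsc
  proof (rule potn_osc_periodic)
    show "\<bar>upper a - upper b\<bar> \<le> 1" for a b using upper_cases[of a] upper_cases[of b] by auto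
  qed (use Mc in \<open>auto simp: upper_def frac_1_eq\<close>)
  have M1: "real M \<ge> 1" using M by simp
  have small: "1 / (4 * (real M * c)\<^sup>2) / real T \<le> s * \<epsilon> * c / 32"
  proof -
    have "1 / (4 * (real M * c)\<^sup>2) / real T = \<epsilon>\<^sup>2 / (4 * (real M)\<^sup>2 * (real T * c\<^sup>2 * \<epsilon>\<^sup>2))"
      using eps c T_pos M1 by (simp add: field_simps)
    also have "\<dots> \<le> \<epsilon>\<^sup>2 / (4 * (real M)\<^sup>2 * 110592)"
      using T_eps ln_Z eps T_pos c M1 by (intro divide_left_mono mult_left_mono) (auto intro!: mult_pos_pos)
    also have "\<dots> = \<epsilon> * (\<epsilon> / (4 * (real M)\<^sup>2 * 110592))" by (simp add: power2_eq_square)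
    also have "\<dots> \<le> \<epsilon> * (c * real M / 384 / (4 * real M * 110592))"
    proof (intro mult_left_mono frac_le)
      have "real M * 1 \<le> real M * real M" using M1 by (intro mult_left_mono) auto
      then show "4 * real M * 110592 \<le> 4 * (real M)\<^sup>2 * 110592" by (simp add: power2_eq_square)
    qed (use eps c M1 in auto)
    also have "\<dots> \<le> \<epsilon> * (c / 32)" using M1 eps c by (intro mult_left_mono) auto
    also have "\<dots> \<le> s * (\<epsilon> * (c / 32))" using s eps c mult_right_mono[of 1 s "\<epsilon> * (c / 32)"] by simp
    finally show ?thesis by simp
  qed
  have "prob {\<omega> \<in> space \<Omega>. \<exists>t\<ge>T. \<bar>emp (\<lambda>s. X1 s \<omega>) t (\<lambda>x. upI M x - bK n x)\<bar> > s * \<epsilon> * c / 16}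
      \<le> prob {\<omega> \<in> space \<Omega>. \<exists>t\<ge>T. \<bar>emp (\<lambda>s. X1 s \<omega>) t (\<lambda>y. g y - avg c g y)\<bar> > s * \<epsilon> * c / 32 + 1 / (4 * (real M * c)\<^sup>2) / real T}"
    unfolding gp
  proof (rule finite_measure_mono)
    have "bmeas (\<lambda>y. upI M y - bK n y)" by (intro bmeas_diff) auto
    then have [measurable]: "(\<lambda>\<omega>. emp (\<lambda>s. X1 s \<omega>) t (\<lambda>y. upI M y - bK n y)) \<in> borel_measurable \<Omega>" for t by measurable
    show "{\<omega> \<in> space \<Omega>. \<exists>t\<ge>T. s * \<epsilon> * c / 32 + 1 / (4 * (real M * c)\<^sup>2) / real T < \<bar>emp (\<lambda>s. X1 s \<omega>) t (\<lambda>y. upI M y - bK n y)\<bar>} \<in> events"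
      by measurable
    have "s * \<epsilon> * c / 32 + 1 / (4 * (real M * c)\<^sup>2) / real T \<le> s * \<epsilon> * c / 16" using small by linarith
    then show "{\<omega> \<in> space \<Omega>. \<exists>t\<ge>T. \<bar>emp (\<lambda>s. X1 s \<omega>) t (\<lambda>x. upI M x - bK n x)\<bar> > s * \<epsilon> * c / 16}
      \<subseteq> {\<omega> \<in> space \<Omega>. \<exists>t\<ge>T. \<bar>emp (\<lambda>s. X1 s \<omega>) t (\<lambda>y. upI M y - bK n y)\<bar> > s * \<epsilon> * c / 32 + 1 / (4 * (real M * c)\<^sup>2) / real T}"
      using order_le_less_trans by blast
  qed
  also have "\<dots> \<le> 2 * exp (- (2 * real T * (s * \<epsilon> * c / 32)\<^sup>2 / (6 * s)\<^sup>2))"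
    by (rule emp_poisson_tail[OF g _ loc osc]) (use c eps T_pos s in auto)
  also have "\<dots> \<le> 2 / Z ^ 4"
  proof (rule exp_tail)
    have "2 * real T * (s * \<epsilon> * c / 32)\<^sup>2 / (6 * s)\<^sup>2 = real T * c\<^sup>2 * \<epsilon>\<^sup>2 / 18432"
      using s by (simp add: power_divide power_mult_distrib)
    then show "4 * ln Z \<le> 2 * real T * (s * \<epsilon> * c / 32)\<^sup>2 / (6 * s)\<^sup>2" using T_eps ln_Z by linarith
  qed
  finally show ?thesis by (simp add: s_def)
qed

definition tests :: "((real \<Rightarrow> real) \<times> real) set" where
  "tests = (\<lambda>i. (initial_cut (lowI M) G i, \<epsilon> / 50)) ` {..G} \<union> (\<lambda>i. (initial_cut (upI M) G i, \<epsilon> / 50)) ` {..G} \<union>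
     (\<lambda>n. (\<lambda>x. lowI M x * bK n x, \<epsilon> / 50)) ` {1..N} \<union> (\<lambda>n. (\<lambda>x. upI M x * (1 - bK n x), \<epsilon> / 50)) ` {1..N} \<union>
     (\<lambda>n. (\<lambda>x. upI M x - bK n x, sqrt (real n) * \<epsilon> * c / 16)) ` {1..N}"

lemma finite_tests: "finite tests" and card_tests: "card tests \<le> 2 * (G + 1) + 3 * N"
proof -
  show "finite tests" by (simp add: tests_def)
  have "card tests \<le> card {..G} + card {..G} + card {1..N} + card {1..N} + card {1..N}"
    unfolding tests_def by (intro order_trans[OF card_Un_le] add_mono card_image_le) auto
  then show "card tests \<le> 2 * (G + 1) + 3 * N" by simp
qed

lemma lam_exchange: "lam (\<lambda>x. upI M x - bK n x) = 0"
proof -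
  have "lam (\<lambda>x. upI M x - bK n x) = lam (upI M) - lam (bK n)"
    by (rule Bochner_Integration.integral_diff) (auto intro: bmeas_integrable_circ)
  then show ?thesis unfolding bK_def using lam_K_pow[of "upI M" n] by simp
qed

lemma test_tail:
  assumes "(h, e) \<in> tests"
  shows "bmeas h" "prob {\<omega> \<in> space \<Omega>. \<exists>t\<ge>T. \<bar>emp (\<lambda>s. X1 s \<omega>) t h - lam h\<bar> > e} \<le> 2 / Z ^ 4"
proof -
  have "bmeas h \<and> prob {\<omega> \<in> space \<Omega>. \<exists>t\<ge>T. \<bar>emp (\<lambda>s. X1 s \<omega>) t h - lam h\<bar> > e} \<le> 2 / Z ^ 4"
    using assms unfolding tests_def
  proof (elim UnE imageE, goal_cases)
    case (5 n)
    then have "h = (\<lambda>x. upI M x - bK n x)" "e = sqrt (real n) * \<epsilon> * c / 16" by (simp_all only: prod.inject)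
    moreover have "n \<ge> 1" using 5 by auto
    ultimately show ?case using exchange_tail[of n] by (simp only: lam_exchange) (auto intro!: bmeas_diff)
  qed (simp only: prod.inject, intro conjI equidistribution_tail bmeas_initial_cut bmeas_mult bmeas_diff;
      auto simp: initial_cut_def frac_1_eq mult_le_one)+
  then show "bmeas h" "prob {\<omega> \<in> space \<Omega>. \<exists>t\<ge>T. \<bar>emp (\<lambda>s. X1 s \<omega>) t h - lam h\<bar> > e} \<le> 2 / Z ^ 4" by auto
qed

text \<open>There are of order \<open>\<epsilon> ^ (-5)\<close> tests, and each fails with
  probability of order Z^(-4), that is \<open>\<epsilon> ^ 8\<close>. Three powers remain, one of
  which gives the factor \<epsilon>.\<close>

lemma tests_numeric: "real (2 * (G + 1) + 3 * N) * (2 / Z ^ 4) \<le> \<epsilon> / 12"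
proof -
  define z where "z = 1 / \<epsilon> + 1"
  have z: "z \<ge> 1" "1 / z \<le> \<epsilon>" using eps by (auto simp: z_def field_simps)
  have up: "real (nat \<lceil>a\<rceil>) \<le> a + 1" if "a \<ge> 0" for a :: real using that by linarith
  have "real G \<le> 100 / \<epsilon> + 1" using eps unfolding G_def by (intro up) auto
  then have "real (G + 1) \<le> 100 * z" by (simp add: z_def)
  also have "\<dots> \<le> 100 * z ^ 5" using z by (intro mult_left_mono) (auto intro: self_le_power)
  finally have G: "real (G + 1) \<le> 100 * z ^ 5" .
  have "real N \<le> 1 / \<epsilon> ^ 5 + 1" using eps unfolding N_def by (intro up) auto
  also have "\<dots> \<le> z ^ 5 + z ^ 5"
  proof (rule add_mono)
    show "1 / \<epsilon> ^ 5 \<le> z ^ 5" unfolding z_def power_one_over[symmetric] using eps by (intro power_mono) auto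
    show "1 \<le> z ^ 5" using z by (intro one_le_power)
  qed
  finally have N: "real N \<le> 2 * z ^ 5" by simp
  have Z: "Z ^ 4 = 4608 ^ 4 * z ^ 8" by (simp add: Z_def z_def power_mult_distrib flip: power_mult)
  have "real (2 * (G + 1) + 3 * N) * (2 / Z ^ 4) \<le> (206 * z ^ 5) * (2 / Z ^ 4)"
    using G N by (intro mult_right_mono) auto
  also have "\<dots> = 412 / 4608 ^ 4 * (1 / z ^ 3)" unfolding Z using z by (simp add: field_simps flip: power_add)
  also have "\<dots> \<le> 1 / 12 * (1 / z)"
    using z by (intro mult_mono divide_left_mono) (auto intro: self_le_power)
  also have "\<dots> \<le> \<epsilon> / 12" using z by simp
  finally show ?thesis .
qed

lemma good_event:
  obtains E where "E \<in> events" "prob E \<ge> 1 - \<epsilon> / 12" "\<And>\<omega>. \<omega> \<in> E \<Longrightarrow> good T (\<lambda>s. X1 s \<omega>)"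
proof -
  define B where "B = (\<lambda>(h, e). {\<omega> \<in> space \<Omega>. \<exists>t\<ge>T. \<bar>emp (\<lambda>s. X1 s \<omega>) t h - lam h\<bar> > e})"
  have BE: "B j \<in> events" if "j \<in> tests" for j
  proof -
    obtain h e where j: "j = (h, e)" by (cases j)
    then have [measurable]: "(\<lambda>\<omega>. emp (\<lambda>s. X1 s \<omega>) t h) \<in> borel_measurable \<Omega>" for t
      using that test_tail(1) by (intro emp_measurable) auto
    show ?thesis unfolding B_def j by simp
  qed
  have BU: "(\<Union>j\<in>tests. B j) \<in> events" using finite_tests BE by auto
  have "prob (\<Union>j\<in>tests. B j) \<le> (\<Sum>j\<in>tests. prob (B j))"
    using finite_tests BE by (intro finite_measure_subadditive_finite) auto
  also have "\<dots> \<le> (\<Sum>j\<in>tests. 2 / Z ^ 4)"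
    by (intro sum_mono) (use test_tail(2) in \<open>auto simp: B_def\<close>)
  also have "\<dots> \<le> real (2 * (G + 1) + 3 * N) * (2 / Z ^ 4)"
    using card_tests Z_large by (simp add: divide_right_mono)
  also have "\<dots> \<le> \<epsilon> / 12" by (rule tests_numeric)
  finally have "prob (space \<Omega> - (\<Union>j\<in>tests. B j)) \<ge> 1 - \<epsilon> / 12" using prob_compl[OF BU] by simp
  moreover have "good T (\<lambda>s. X1 s \<omega>)" if \<omega>: "\<omega> \<in> space \<Omega> - (\<Union>j\<in>tests. B j)" for \<omega>
  proof -
    have "\<bar>emp (\<lambda>s. X1 s \<omega>) t h - lam h\<bar> \<le> e" if "(h, e) \<in> tests" "t \<ge> T" for h e t
      using \<omega> that by (fastforce simp: B_def not_less)
    note * = this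
    have **: "\<bar>emp (\<lambda>s. X1 s \<omega>) t (\<lambda>x. upI M x - bK n x)\<bar> \<le> sqrt (real n) * \<epsilon> * c / 16" if "n \<in> {1..N}" "t \<ge> T" for n t
    proof -
      have "(\<lambda>x. upI M x - bK n x, sqrt (real n) * \<epsilon> * c / 16) \<in> tests" using that unfolding tests_def by blast
      from *[OF this that(2)] show ?thesis by (simp add: lam_exchange)
    qed
    show ?thesis unfolding good_def
      by (intro allI impI conjI ballI ** *) (simp_all add: tests_def)
  qed
  ultimately show thesis using BU by (intro that) auto
qed

end

section \<open>Distinct states and kernel integrals\<close>

text \<open>Indicator of one of k equal arcs, as a periodic function on the line so that the step
  formula of the walk applies to it.\<close>

definition cell :: "nat \<Rightarrow> nat \<Rightarrow> real \<Rightarrow> real" where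
  "cell k i y = (if \<lfloor>real k * frac y\<rfloor> = int i then 1 else 0)"

lemma bmeas_cell: "bmeas (cell k i)"
  unfolding cell_def[abs_def] frac_def by (rule bmeasI[where C=1]) auto

lemma cell_periodic: "cell k i (y + 1) = cell k i y"
  by (simp add: cell_def frac_1_eq)

lemma sum_cell: "k > 0 \<Longrightarrow> (\<Sum>i<k. cell k i y) = 1"
proof -
  assume k: "k > 0"
  define j where "j = nat \<lfloor>real k * frac y\<rfloor>"
  have "0 \<le> real k * frac y" by simp
  then have j: "\<lfloor>real k * frac y\<rfloor> = int j" by (simp add: j_def)
  have "real k * frac y < real k" using k frac_lt_1[of y] by simp
  then have "j < k" using j by linarith
  moreover have "(\<Sum>i<k. cell k i y) = (\<Sum>i<k. if i = j then 1 else 0)"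
    unfolding cell_def j by (intro sum.cong) auto
  ultimately show ?thesis by simp
qed

lemma lam_cell: "k > 0 \<Longrightarrow> lam (cell k i) \<le> 1 / real k"
proof -
  assume k: "k > 0"
  let ?I = "{real i / real k..real (Suc i) / real k}"
  have "lam (cell k i) \<le> lam (indicator ?I)"
  proof (rule integral_mono)
    have "bmeas (indicator ?I)" by (rule bmeasI[where C=1]) (auto simp: indicator_def)
    then show "integrable circ_leb (indicator ?I :: real \<Rightarrow> real)" by auto
    fix y assume "y \<in> space circ_leb"
    then have f: "frac y = y" by (simp add: frac_id_Omega)
    show "cell k i y \<le> indicator ?I y"
    proof (cases "\<lfloor>real k * y\<rfloor> = int i")
      case True
      then have "real i \<le> real k * y" "real k * y \<le> real (Suc i)" by linarith+
      then have "y \<in> ?I" using k by (simp add: field_simps)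
      then show ?thesis by (simp add: cell_def)
    qed (simp add: cell_def f)
  qed (use bmeas_cell in auto)
  also have "\<dots> = measure circ_leb (?I \<inter> Omega)" by simp
  also have "\<dots> = measure lborel (?I \<inter> Omega)"
    unfolding circ_leb_def by (rule measure_restrict_space) (auto simp: Omega_def)
  also have "\<dots> \<le> measure lborel ?I" by (rule measure_mono_fmeasurable) (auto simp: Omega_def emeasure_lborel_Icc_eq intro!: fmeasurableI)
  also have "\<dots> = 1 / real k" using k by (simp add: divide_right_mono field_simps)
  finally show ?thesis .
qed

lemma avg_le_lam:
  assumes c: "0 < c" "c \<le> 1 / 2" and x: "x \<in> Omega" and \<phi>: "bmeas \<phi>" "\<And>x. \<phi> (x + 1) = \<phi> x" "\<And>x. 0 \<le> \<phi> x"
  shows "avg c \<phi> x \<le> 1 / (2 * c) * lam \<phi>"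
proof -
  have "avg c \<phi> x = (\<integral>y. \<phi> y \<partial>mh_kernel c (\<lambda>_. 1) x)"
    using mh_op_avg[OF c x \<phi>(1,2)] by (subst integral_mh_kernel[OF c x \<phi>(1)]) auto
  also have "\<dots> = 1 / (2 * c) * (LINT y|circ_leb. (if circ_dist x y < c then \<phi> y else 0))"
    unfolding mh_kernel_uniform[OF c x] by (rule integral_proposal[OF \<phi>(1) c(1)])
  also have "\<dots> \<le> 1 / (2 * c) * lam \<phi>"
  proof (intro mult_left_mono integral_mono)
    have [measurable]: "\<phi> \<in> borel_measurable borel" using \<phi>(1) by auto
    have "bmeas (\<lambda>y. if circ_dist x y < c then \<phi> y else 0)"
    proof -
      obtain C where C: "\<And>x. \<bar>\<phi> x\<bar> \<le> C" "C \<ge> 0" using \<phi>(1) by (meson bmeasE)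
      show ?thesis by (rule bmeasI[where C=C]) (use C in auto)
    qed
    then show "integrable circ_leb (\<lambda>y. if circ_dist x y < c then \<phi> y else 0)" by auto
  qed (use c \<phi> in auto)
  finally show ?thesis .
qed

context level1
begin

text \<open>The proposal density is at most 1 / (2 c), so the next state falls into the arc of an
  earlier one with probability at most 1 / (2 c k). Summing over arcs bounds the coincidence by
  products of a function of the past and one of the next state; then k tends to infinity.\<close>

lemma X1_repeat:
  assumes st: "s \<le> t"
  shows "prob {\<omega> \<in> space P. X1 (Suc t) \<omega> = X1 s \<omega>} = 0"
proof -
  let ?A = "{\<omega> \<in> space P. X1 (Suc t) \<omega> = X1 s \<omega>}"
  have bound: "prob ?A \<le> 1 / (2 * c) / real k" if k: "k > 0" for k
  proof -
    have [measurable]: "cell k i \<in> borel_measurable borel" for i using bmeas_cell by auto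
    have c01: "0 \<le> cell k i y" "cell k i y \<le> 1" "\<bar>cell k i y\<bar> \<le> 1" for i y by (auto simp: cell_def)
    have int: "integrable P (\<lambda>\<omega>. cell k i (X1 a \<omega>) * cell k i (X1 b \<omega>))" for i a b
      by (rule integrable_const_bound[where B=1]) (auto simp: abs_mult c01 mult_le_one)
    have "prob ?A = expectation (indicator ?A)" by simp
    also have "\<dots> \<le> expectation (\<lambda>\<omega>. \<Sum>i<k. cell k i (X1 s \<omega>) * cell k i (X1 (Suc t) \<omega>))"
    proof (rule integral_mono)
      show "integrable P (indicator ?A :: 'a \<Rightarrow> real)" by (rule integrable_const_bound[where B=1]) auto
      fix \<omega>
      have "(\<Sum>i<k. cell k i (X1 s \<omega>) * cell k i (X1 s \<omega>)) = (\<Sum>i<k. cell k i (X1 s \<omega>))"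
        by (intro sum.cong) (auto simp: cell_def)
      then have "(\<Sum>i<k. cell k i (X1 s \<omega>) * cell k i (X1 s \<omega>)) = 1" using sum_cell[OF k] by simp
      then show "indicator ?A \<omega> \<le> (\<Sum>i<k. cell k i (X1 s \<omega>) * cell k i (X1 (Suc t) \<omega>))"
        by (auto simp: indicator_def c01 intro!: sum_nonneg)
    qed (use int in auto)
    also have "\<dots> = (\<Sum>i<k. expectation (\<lambda>\<omega>. cell k i (X1 s \<omega>) * cell k i (X1 (Suc t) \<omega>)))"
      by (rule Bochner_Integration.integral_sum) (rule int)
    also have "\<dots> \<le> (\<Sum>i<k. expectation (\<lambda>\<omega>. cell k i (X1 s \<omega>) * (1 / (2 * c) * (1 / real k))))"
    proof (rule sum_mono)
      fix i
      have [measurable]: "X1 s \<in> borel_measurable (history1 P X1 t)" by (rule X1_history1[OF st])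
      have [measurable]: "avg c (cell k i) \<in> borel_measurable borel" by (rule bmeas_measurable[OF bmeas_avg[OF c(1) bmeas_cell]])
      have av: "0 \<le> avg c (cell k i) y" "avg c (cell k i) y \<le> 1" for y
        by (auto intro!: avg_ge[OF c(1) bmeas_cell] avg_le[OF c(1) bmeas_cell] c01)
      have "expectation (\<lambda>\<omega>. cell k i (X1 s \<omega>) * cell k i (X1 (Suc t) \<omega>)) = expectation (\<lambda>\<omega>. cell k i (X1 s \<omega>) * avg c (cell k i) (X1 t \<omega>))"
        by (rule expectation_X1_step[where B=1]) (auto simp: c01 bmeas_cell cell_periodic)
      also have "\<dots> \<le> expectation (\<lambda>\<omega>. cell k i (X1 s \<omega>) * (1 / (2 * c) * (1 / real k)))"
      proof (rule integral_mono)
        show "integrable P (\<lambda>\<omega>. cell k i (X1 s \<omega>) * avg c (cell k i) (X1 t \<omega>))"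
          by (rule integrable_const_bound[where B=1]) (auto simp: abs_mult c01 av mult_le_one)
        show "integrable P (\<lambda>\<omega>. cell k i (X1 s \<omega>) * (1 / (2 * c) * (1 / real k)))"
          by (intro integrable_mult_left integrable_const_bound[where B=1]) (auto simp: c01)
        fix \<omega> assume \<omega>: "\<omega> \<in> space P"
        have "avg c (cell k i) (X1 t \<omega>) \<le> 1 / (2 * c) * lam (cell k i)"
          by (rule avg_le_lam[OF c(1) Mc(4) X1_Omega[OF \<omega>] bmeas_cell]) (auto simp: cell_periodic c01)
        also have "\<dots> \<le> 1 / (2 * c) * (1 / real k)" using c by (intro mult_left_mono lam_cell k) auto
        finally show "cell k i (X1 s \<omega>) * avg c (cell k i) (X1 t \<omega>) \<le> cell k i (X1 s \<omega>) * (1 / (2 * c) * (1 / real k))"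
          by (rule mult_left_mono) (rule c01)
      qed
      finally show "expectation (\<lambda>\<omega>. cell k i (X1 s \<omega>) * cell k i (X1 (Suc t) \<omega>))
        \<le> expectation (\<lambda>\<omega>. cell k i (X1 s \<omega>) * (1 / (2 * c) * (1 / real k)))" .
    qed
    also have "\<dots> = expectation (\<lambda>\<omega>. \<Sum>i<k. cell k i (X1 s \<omega>) * (1 / (2 * c) * (1 / real k)))"
      by (rule Bochner_Integration.integral_sum[symmetric]) (intro integrable_mult_left integrable_const_bound[where B=1], auto simp: c01)
    also have "\<dots> = 1 / (2 * c) / real k"
      unfolding sum_distrib_right[symmetric] sum_cell[OF k] by (simp add: prob_space)
    finally show ?thesis .
  qed
  have "(\<lambda>k. 1 / (2 * c) / real k) \<longlonglongrightarrow> 0" by (rule lim_const_over_n)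
  then have "prob ?A \<le> 0" by (rule LIMSEQ_le_const) (use bound in \<open>auto intro!: exI[of _ 1]\<close>)
  then show ?thesis by (simp add: measure_le_0_iff)
qed

lemma X1_inj: "AE \<omega> in P. inj (\<lambda>s. X1 s \<omega>)"
proof -
  have "AE \<omega> in P. X1 (Suc t) \<omega> \<noteq> X1 s \<omega>" if "s \<le> t" for s t
    using prob_eq_0[of "{\<omega> \<in> space P. X1 (Suc t) \<omega> = X1 s \<omega>}"] X1_repeat[OF that] by simp
  then have "AE \<omega> in P. \<forall>t s. s \<le> t \<longrightarrow> X1 (Suc t) \<omega> \<noteq> X1 s \<omega>" unfolding AE_all_countable by auto
  then show ?thesis
  proof eventually_elim
    case (elim \<omega>)
    have "X1 a \<omega> \<noteq> X1 b \<omega>" if "a < b" for a b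
    proof -
      have "\<exists>t. b = Suc t \<and> a \<le> t" using that by (cases b) auto
      then show ?thesis using elim by fastforce
    qed
    then show ?case by (intro injI) (metis linorder_neqE_nat)
  qed
qed

end

context ee_setup
begin

lemma integral_ee_jump:
  assumes xi: "\<And>s. \<xi> s \<in> Omega" "inj \<xi>" and x: "x \<in> Omega" and \<phi>: "bmeas \<phi>"
    and pos: "0 < emp \<xi> t (lowI M)" "0 < emp \<xi> t (upI M)"
  shows "(\<integral>y. \<phi> y \<partial>ee_jump M H \<xi> t x) =
      lowI M x * (if H = 0 then emp \<xi> t \<phi> else ring_mean \<xi> t (lowI M) \<phi>) +
      upI M x * (if H = 0 then emp \<xi> t \<phi> else ring_mean \<xi> t (upI M) \<phi>)"
proof -
  define v where "v = potential M H x"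
  define \<theta> where "\<theta> = (\<lambda>y. of_bool (potential M H y = v) :: real)"
  let ?I = "{s. s \<le> t \<and> potential M H (\<xi> s) = v}"
  let ?R = "energy_ring M H \<xi> t v"
  have low: "potential M H y = H * lowI M y" for y by (simp add: potential_upper lowI_def)
  have \<theta>: "\<theta> = (if H = 0 then (\<lambda>_. 1) else if lowI M x = 1 then lowI M else upI M)"
  proof
    show "\<theta> y = (if H = 0 then (\<lambda>_. 1) else if lowI M x = 1 then lowI M else upI M) y" for y
      unfolding \<theta>_def v_def low using lowI_upI_cases[of M x] lowI_upI_cases[of M y] by auto
  qed
  have R: "?R = \<xi> ` ?I" by (auto simp: energy_ring_def)
  have inj: "inj_on \<xi> ?I" using xi(2) by (rule inj_on_subset) simp
  have fin: "finite ?I" by simp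
  have emp_sum: "emp \<xi> t (\<lambda>y. \<theta> y * h y) = (\<Sum>s\<in>?I. h (\<xi> s)) / (real t + 1)" for h
  proof -
    have "(\<Sum>s\<le>t. \<theta> (\<xi> s) * h (\<xi> s)) = (\<Sum>s\<in>?I. h (\<xi> s))"
      by (rule sum.mono_neutral_cong_right) (auto simp: \<theta>_def)
    then show ?thesis by (simp add: emp_def)
  qed
  have card: "emp \<xi> t \<theta> = real (card ?I) / (real t + 1)" using emp_sum[of "\<lambda>_. 1"] by simp
  have "emp \<xi> t \<theta> > 0" unfolding \<theta> using pos by simp
  then have "card ?I \<noteq> 0" unfolding card by (intro notI) simp
  then have ne: "?I \<noteq> {}" by (metis card.empty)
  then have Rne: "?R \<noteq> {}" unfolding R by simp
  have Rfin: "finite ?R" unfolding R using fin by simp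
  have Rsub: "?R \<subseteq> Omega" unfolding R using xi(1) by auto
  have [measurable]: "\<phi> \<in> borel_measurable circ_leb" using \<phi> by (auto intro: circ_leb_measurable)
  have "(\<lambda>y. y) \<in> uniform_count_measure ?R \<rightarrow>\<^sub>M circ_leb"
    using Rsub by (auto simp: measurable_def space_uniform_count_measure sets_uniform_count_measure)
  then have "(\<integral>y. \<phi> y \<partial>ee_jump M H \<xi> t x) = (\<integral>y. \<phi> y \<partial>uniform_count_measure ?R)"
    using Rne by (simp add: ee_jump_def v_def Let_def integral_distr)
  also have "\<dots> = (\<Sum>y\<in>?R. \<phi> y) / real (card ?R)" by (rule integral_uniform_count_measure[OF Rfin])
  \<comment> \<open>The ring is a set, in which a repeated state would count once; injectivity turns
    the sum over it into a sum over visit times.\<close>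
  also have "\<dots> = (\<Sum>s\<in>?I. \<phi> (\<xi> s)) / real (card ?I)"
    unfolding R using inj by (simp add: sum.reindex card_image)
  also have "\<dots> = ring_mean \<xi> t \<theta> \<phi>" by (simp add: ring_mean_def emp_sum card)
  finally show ?thesis
    using lowI_upI_cases[of M x] by (auto simp: \<theta> ring_mean_def split: if_splits)
qed

lemma integral_level0_kernel:
  assumes xi: "\<And>s. \<xi> s \<in> Omega" and x: "x \<in> Omega" and \<phi>: "bmeas \<phi>"
  shows "(\<integral>y. \<phi> y \<partial>level0_kernel M H c p \<xi> t x) = (1 - p) * P \<phi> x + p * (\<integral>y. \<phi> y \<partial>ee_jump M H \<xi> t x)"
proof -
  obtain C where C: "\<And>x. \<bar>\<phi> x\<bar> \<le> C" using \<phi> by (meson bmeasE)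
  have "mh_kernel c (target_dens M H) x \<in> space (prob_algebra circ_leb)"
    using c(1) Mc(4) x by (rule mh_kernel_in_prob_algebra) (auto simp: target_dens_def add_nonneg_nonneg)
  moreover note ee_jump_in_prob_algebra[OF x xi]
  ultimately have k: "(\<lambda>jump. if jump then ee_jump M H \<xi> t x else mh_kernel c (target_dens M H) x)
      \<in> count_space UNIV \<rightarrow>\<^sub>M prob_algebra circ_leb"
    by auto
  have b: "measure_pmf (bernoulli_pmf p) \<in> space (prob_algebra (count_space UNIV))"
    by (simp add: space_prob_algebra measure_pmf.prob_space_axioms)
  have w: "target_dens M H \<in> borel_measurable borel"
    unfolding target_dens_def[abs_def] frac_def by measurable
  have "(\<integral>y. \<phi> y \<partial>level0_kernel M H c p \<xi> t x) =
      (\<integral>j. (\<integral>y. \<phi> y \<partial>(if j then ee_jump M H \<xi> t x else mh_kernel c (target_dens M H) x)) \<partial>measure_pmf (bernoulli_pmf p))"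
    unfolding level0_kernel_def
    by (rule integral_bind_bounded[OF b k]) (use \<phi> C in \<open>auto intro: circ_leb_measurable\<close>)
  also have "\<dots> = (1 - p) * (\<integral>y. \<phi> y \<partial>mh_kernel c (target_dens M H) x) + p * (\<integral>y. \<phi> y \<partial>ee_jump M H \<xi> t x)"
    using p by (subst integral_bernoulli_pmf) (auto simp: algebra_simps)
  also have "(\<integral>y. \<phi> y \<partial>mh_kernel c (target_dens M H) x) = P \<phi> x"
  proof -
    have "0 \<le> target_dens M H y" for y by (simp add: target_dens_def add_nonneg_nonneg)
    from integral_mh_kernel[OF c(1) Mc(4) x \<phi> w this] show ?thesis
      unfolding P_def acc_target_dens[OF H] .
  qed
  finally show ?thesis .
qed

end

section \<open>Conditional expectations of the level-0 process\<close>

text \<open>The quotient is 0 by convention when the ring is empty, so the bound holds for every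
  trajectory; this makes \<open>jump_mean\<close> bounded without restriction to an event.\<close>

lemma emp_weighted_bound:
  assumes "\<And>y. 0 \<le> \<theta> y" "\<And>y. \<bar>\<phi> y\<bar> \<le> C"
  shows "\<bar>emp \<xi> t (\<lambda>y. \<theta> y * \<phi> y) / emp \<xi> t \<theta>\<bar> \<le> C"
proof -
  have C: "C \<ge> 0" using assms(2)[of 0] by linarith
  have \<theta>: "0 \<le> emp \<xi> t \<theta>" unfolding emp_def using assms(1) by (intro divide_nonneg_nonneg sum_nonneg) auto
  have "\<phi> y * \<theta> y \<le> C * \<theta> y" "(- C) * \<theta> y \<le> \<phi> y * \<theta> y" for y
    using assms(1)[of y] assms(2)[of y] by (intro mult_right_mono; linarith)+
  then have "emp \<xi> t (\<lambda>y. \<theta> y * \<phi> y) \<le> emp \<xi> t (\<lambda>y. C * \<theta> y)" "emp \<xi> t (\<lambda>y. (- C) * \<theta> y) \<le> emp \<xi> t (\<lambda>y. \<theta> y * \<phi> y)"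
    by (auto intro!: emp_mono simp: mult.commute)
  then have "\<bar>emp \<xi> t (\<lambda>y. \<theta> y * \<phi> y)\<bar> \<le> C * emp \<xi> t \<theta>" unfolding emp_cmult by linarith
  then show ?thesis using \<theta> C by (cases "emp \<xi> t \<theta> = 0") (auto simp: abs_divide divide_le_eq)
qed

context ee_chain
begin

abbreviation "Tr \<equiv> trajectory1 \<Omega> X1"
abbreviation "Hist S \<equiv> history0 \<Omega> X1 X0 T (T + S)"

lemma trajectory_map: "(\<lambda>\<omega> s. X1 s \<omega>) \<in> \<Omega> \<rightarrow>\<^sub>M (\<Pi>\<^sub>M s\<in>UNIV. circ_leb)"
proof -
  have "(\<lambda>\<omega>. \<lambda>s\<in>UNIV. X1 s \<omega>) \<in> \<Omega> \<rightarrow>\<^sub>M (\<Pi>\<^sub>M s\<in>UNIV. circ_leb)" by (rule measurable_restrict) (rule X1_measurable)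
  then show ?thesis by (simp add: restrict_UNIV)
qed

lemma subalgebra_trajectory: "subalgebra \<Omega> Tr"
  unfolding trajectory1_def by (rule subalgebra_vimage_algebra[OF trajectory_map])

lemma history0_map: "(\<lambda>\<omega>. ((\<lambda>s. X1 s \<omega>), (\<lambda>s\<in>{T..T + S}. X0 s \<omega>))) \<in> \<Omega> \<rightarrow>\<^sub>M ((\<Pi>\<^sub>M s\<in>UNIV. circ_leb) \<Otimes>\<^sub>M (\<Pi>\<^sub>M s\<in>{T..T + S}. circ_leb))"
  by (intro measurable_Pair trajectory_map measurable_restrict X0_measurable) auto

lemma subalgebra_history0: "subalgebra \<Omega> (Hist S)"
  unfolding history0_def by (rule subalgebra_vimage_algebra[OF history0_map])

lemma subalgebra_history0_trajectory: "subalgebra (Hist S) Tr"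
proof -
  have "(\<lambda>\<omega>. ((\<lambda>s. X1 s \<omega>), (\<lambda>s\<in>{T..T + S}. X0 s \<omega>))) \<in> Hist S \<rightarrow>\<^sub>M ((\<Pi>\<^sub>M s\<in>UNIV. circ_leb) \<Otimes>\<^sub>M (\<Pi>\<^sub>M s\<in>{T..T + S}. circ_leb))"
    unfolding history0_def using measurable_space[OF history0_map] by (intro measurable_vimage_algebra1) auto
  from measurable_compose[OF this measurable_fst]
  have "(\<lambda>\<omega> s. X1 s \<omega>) \<in> Hist S \<rightarrow>\<^sub>M (\<Pi>\<^sub>M s\<in>UNIV. circ_leb)" by simp
  from subalgebra_vimage_algebra[OF this] show ?thesis by (simp add: trajectory1_def history0_def)
qed

lemma X1_trajectory [measurable]: "X1 s \<in> borel_measurable Tr"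
proof -
  have "(\<lambda>\<omega> s. X1 s \<omega>) \<in> Tr \<rightarrow>\<^sub>M (\<Pi>\<^sub>M s\<in>UNIV. circ_leb)"
    unfolding trajectory1_def using measurable_space[OF trajectory_map] by (intro measurable_vimage_algebra1) auto
  moreover have "(\<lambda>f. f s) \<in> (\<Pi>\<^sub>M s\<in>UNIV. circ_leb) \<rightarrow>\<^sub>M circ_leb"
    by (rule measurable_component_singleton) simp
  ultimately have "X1 s \<in> Tr \<rightarrow>\<^sub>M circ_leb" by (rule measurable_compose)
  from measurable_compose[OF this id_borel_circ_leb] show ?thesis by simp
qed

sublocale tr: finite_measure_subalgebra \<Omega> Tr
  by unfold_locales (rule subalgebra_trajectory)

lemma X0_Omega: "\<omega> \<in> space \<Omega> \<Longrightarrow> X0 (T + S) \<omega> \<in> Omega"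
  using measurable_space[OF X0_measurable[of "T + S"]] by simp

lemma X0_borel [measurable]: "X0 (T + S) \<in> borel_measurable \<Omega>"
  using measurable_compose[OF X0_measurable[of "T + S"] id_borel_circ_leb] by simp

lemma X0_bmeas_measurable: "bmeas \<phi> \<Longrightarrow> (\<lambda>\<omega>. \<phi> (X0 (T + S) \<omega>)) \<in> borel_measurable \<Omega>"
  by (rule measurable_compose[OF X0_borel]) auto

lemma X0_integrable: "bmeas \<phi> \<Longrightarrow> integrable \<Omega> (\<lambda>\<omega>. \<phi> (X0 (T + S) \<omega>))"
proof -
  assume \<phi>: "bmeas \<phi>"
  then obtain C where "\<And>x. \<bar>\<phi> x\<bar> \<le> C" by (meson bmeasE)
  then show ?thesis by (intro integrable_const_bound[where B=C] X0_bmeas_measurable[OF \<phi>]) auto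
qed

definition m :: "'a \<Rightarrow> nat \<Rightarrow> (real \<Rightarrow> real) \<Rightarrow> real" where
  "m \<omega> S \<phi> = real_cond_exp \<Omega> Tr (\<lambda>\<omega>. \<phi> (X0 (T + S) \<omega>)) \<omega>"

lemma m_pull_out:
  assumes U: "U \<in> borel_measurable Tr" "\<And>\<omega>. \<bar>U \<omega>\<bar> \<le> B" and \<phi>: "bmeas \<phi>"
  shows "integrable \<Omega> (\<lambda>\<omega>. U \<omega> * \<phi> (X0 (T + S) \<omega>))"
    "AE \<omega> in \<Omega>. real_cond_exp \<Omega> Tr (\<lambda>\<omega>. U \<omega> * \<phi> (X0 (T + S) \<omega>)) \<omega> = U \<omega> * m \<omega> S \<phi>"
proof -
  have [measurable]: "U \<in> borel_measurable \<Omega>" "(\<lambda>\<omega>. \<phi> (X0 (T + S) \<omega>)) \<in> borel_measurable \<Omega>"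
    using measurable_from_subalg[OF subalgebra_trajectory U(1)] X0_bmeas_measurable[OF \<phi>] by auto
  obtain C where C: "\<And>x. \<bar>\<phi> x\<bar> \<le> C" "C \<ge> 0" using \<phi> by (meson bmeasE)
  have B: "B \<ge> 0" using U(2) abs_ge_zero order_trans by blast
  show int: "integrable \<Omega> (\<lambda>\<omega>. U \<omega> * \<phi> (X0 (T + S) \<omega>))"
  proof (rule integrable_const_bound[where B="B * C"])
    show "AE \<omega> in \<Omega>. norm (U \<omega> * \<phi> (X0 (T + S) \<omega>)) \<le> B * C"
      unfolding real_norm_def abs_mult by (intro AE_I2 mult_mono U C) (auto simp: B)
  qed measurable
  show "AE \<omega> in \<Omega>. real_cond_exp \<Omega> Tr (\<lambda>\<omega>. U \<omega> * \<phi> (X0 (T + S) \<omega>)) \<omega> = U \<omega> * m \<omega> S \<phi>"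
    unfolding m_def by (rule tr.real_cond_exp_mult[OF U(1) _ int]) measurable
qed

text \<open>Indicator that both levels have been visited, the event on which the formula for a ring
  jump is valid. The trajectory determines it, so it can be moved in and out of the conditional
  expectation.\<close>

definition visited :: "nat \<Rightarrow> 'a \<Rightarrow> real" where
  "visited t \<omega> = of_bool (0 < emp (\<lambda>s. X1 s \<omega>) t (lowI M) \<and> 0 < emp (\<lambda>s. X1 s \<omega>) t (upI M))"

definition jump_mean :: "nat \<Rightarrow> (real \<Rightarrow> real) \<Rightarrow> (real \<Rightarrow> real) \<Rightarrow> 'a \<Rightarrow> real" where
  "jump_mean t \<theta> \<phi> \<omega> = (if H = 0 then emp (\<lambda>s. X1 s \<omega>) t \<phi> else ring_mean (\<lambda>s. X1 s \<omega>) t \<theta> \<phi>)"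

lemma emp_trajectory [measurable]: "bmeas h \<Longrightarrow> (\<lambda>\<omega>. emp (\<lambda>s. X1 s \<omega>) t h) \<in> borel_measurable Tr"
proof -
  assume "bmeas h"
  then have [measurable]: "h \<in> borel_measurable borel" by auto
  show ?thesis unfolding emp_def by measurable
qed

text \<open>The tower property: condition first on the level-0 history as well, where the transition
  law is known, and then on the trajectory alone. A ring jump depends on the current state only
  through its level, so the ring means are functions of the trajectory and come out of the
  expectation.\<close>

lemma m_step:
  assumes \<phi>: "bmeas \<phi>"
  shows "AE \<omega> in \<Omega>. 0 < emp (\<lambda>s. X1 s \<omega>) (T + S) (lowI M) \<longrightarrow> 0 < emp (\<lambda>s. X1 s \<omega>) (T + S) (upI M) \<longrightarrow>
    m \<omega> (Suc S) \<phi> = (1 - p) * m \<omega> S (P \<phi>) +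
      p * (jump_mean (T + S) (lowI M) \<phi> \<omega> * m \<omega> S (lowI M) + jump_mean (T + S) (upI M) \<phi> \<omega> * m \<omega> S (upI M))"
proof -
  let ?V = "visited (T + S)"
  let ?F = "Hist S"
  interpret F: finite_measure_subalgebra \<Omega> ?F by unfold_locales (rule subalgebra_history0)
  obtain C where C: "\<And>x. \<bar>\<phi> x\<bar> \<le> C" "C \<ge> 0" using \<phi> by (meson bmeasE)
  have [measurable]: "(\<lambda>\<omega>. emp (\<lambda>s. X1 s \<omega>) t (lowI M)) \<in> borel_measurable Tr" "(\<lambda>\<omega>. emp (\<lambda>s. X1 s \<omega>) t (upI M)) \<in> borel_measurable Tr"
    "(\<lambda>\<omega>. emp (\<lambda>s. X1 s \<omega>) t \<phi>) \<in> borel_measurable Tr" "(\<lambda>\<omega>. emp (\<lambda>s. X1 s \<omega>) t (\<lambda>y. lowI M y * \<phi> y)) \<in> borel_measurable Tr"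
    "(\<lambda>\<omega>. emp (\<lambda>s. X1 s \<omega>) t (\<lambda>y. upI M y * \<phi> y)) \<in> borel_measurable Tr" for t
    using \<phi> by (auto intro!: emp_trajectory bmeas_mult)
  have V: "?V \<in> borel_measurable Tr" unfolding visited_def by measurable
  have J: "jump_mean (T + S) (lowI M) \<phi> \<in> borel_measurable Tr" "jump_mean (T + S) (upI M) \<phi> \<in> borel_measurable Tr"
    unfolding jump_mean_def ring_mean_def by measurable
  have V01: "0 \<le> ?V \<omega>" "?V \<omega> \<le> 1" for \<omega> by (auto simp: visited_def)
  have JC: "\<bar>jump_mean (T + S) \<theta> \<phi> \<omega>\<bar> \<le> C" if "\<theta> = lowI M \<or> \<theta> = upI M" for \<theta> \<omega>
  proof (cases "H = 0")
    case True
    show ?thesis unfolding jump_mean_def if_P[OF True] by (rule emp_abs_le) (rule C)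
  next
    case False
    have "0 \<le> \<theta> y" for y using that by auto
    from emp_weighted_bound[OF this C(1)] False show ?thesis by (simp only: jump_mean_def ring_mean_def if_False)
  qed
  define U where "U = (\<lambda>\<theta> \<omega>. ?V \<omega> * p * jump_mean (T + S) \<theta> \<phi> \<omega>)"
  have U: "U (lowI M) \<in> borel_measurable Tr" "U (upI M) \<in> borel_measurable Tr" unfolding U_def using V J by measurable
  have UB: "\<bar>U \<theta> \<omega>\<bar> \<le> 1 * 1 * C" if "\<theta> = lowI M \<or> \<theta> = upI M" for \<theta> \<omega>
    unfolding U_def abs_mult using JC[OF that] V01 p C by (intro mult_mono) auto
  define V' where "V' = (\<lambda>\<omega>. (1 - p) * ?V \<omega>)"
  have V': "V' \<in> borel_measurable Tr" "\<bar>V' \<omega>\<bar> \<le> 1" for \<omega>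
    unfolding V'_def using V V01 p by (auto simp: abs_mult mult_le_one)
  have F: "AE \<omega> in \<Omega>. real_cond_exp \<Omega> ?F (\<lambda>\<omega>. \<phi> (X0 (T + Suc S) \<omega>)) \<omega> = (\<integral>y. \<phi> y \<partial>level0_kernel M H c p (\<lambda>s. X1 s \<omega>) (T + S) (X0 (T + S) \<omega>))"
  proof (rule cond_law_integral[OF prob_space_axioms subalgebra_history0])
    show "X0 (T + Suc S) \<in> \<Omega> \<rightarrow>\<^sub>M circ_leb" by (rule X0_measurable) simp
    show "has_cond_law \<Omega> (Hist S) circ_leb (X0 (T + Suc S)) (\<lambda>\<omega>. level0_kernel M H c p (\<lambda>s. X1 s \<omega>) (T + S) (X0 (T + S) \<omega>))"
      using X0_step[of "T + S"] by simp
    fix \<omega> assume "\<omega> \<in> space \<Omega>"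
    then have "level0_kernel M H c p (\<lambda>s. X1 s \<omega>) (T + S) (X0 (T + S) \<omega>) \<in> space (prob_algebra circ_leb)"
      using Mc(4) by (intro level0_kernel_in_prob_algebra c(1) X0_Omega X1_Omega)
    then show "prob_space (level0_kernel M H c p (\<lambda>s. X1 s \<omega>) (T + S) (X0 (T + S) \<omega>))"
      "sets (level0_kernel M H c p (\<lambda>s. X1 s \<omega>) (T + S) (X0 (T + S) \<omega>)) = sets circ_leb"
      by (auto simp: space_prob_algebra)
  qed (use \<phi> C in \<open>auto intro: circ_leb_measurable\<close>)
  let ?Y = "\<lambda>\<omega>. V' \<omega> * P \<phi> (X0 (T + S) \<omega>) + (U (lowI M) \<omega> * lowI M (X0 (T + S) \<omega>) + U (upI M) \<omega> * upI M (X0 (T + S) \<omega>))"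
  note int1 = m_pull_out(1)[OF V' bmeas_P[OF \<phi>], of S]
  note int2 = m_pull_out(1)[OF U(1) UB[OF disjI1[OF refl]] bmeas_lowI[of M], of S]
  note int3 = m_pull_out(1)[OF U(2) UB[OF disjI2[OF refl]] bmeas_upI[of M], of S]
  have intV: "integrable \<Omega> (\<lambda>\<omega>. ?V \<omega> * \<phi> (X0 (T + Suc S) \<omega>))"
    by (rule m_pull_out(1)[OF V _ \<phi>, where B=1]) (simp add: V01)
  have VF: "?V \<in> borel_measurable ?F" by (rule measurable_from_subalg[OF subalgebra_history0_trajectory V])
  have "AE \<omega> in \<Omega>. real_cond_exp \<Omega> ?F (\<lambda>\<omega>. ?V \<omega> * \<phi> (X0 (T + Suc S) \<omega>)) \<omega> = ?V \<omega> * real_cond_exp \<Omega> ?F (\<lambda>\<omega>. \<phi> (X0 (T + Suc S) \<omega>)) \<omega>"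
    by (rule F.real_cond_exp_mult[OF VF X0_bmeas_measurable[OF \<phi>] intV])
  then have E1: "AE \<omega> in \<Omega>. real_cond_exp \<Omega> ?F (\<lambda>\<omega>. ?V \<omega> * \<phi> (X0 (T + Suc S) \<omega>)) \<omega> = ?Y \<omega>"
    using F X1_inj AE_space
  proof eventually_elim
    case (elim \<omega>)
    show ?case
    proof (cases "?V \<omega> = 0")
      case False
      then have "0 < emp (\<lambda>s. X1 s \<omega>) (T + S) (lowI M)" "0 < emp (\<lambda>s. X1 s \<omega>) (T + S) (upI M)" and V1: "?V \<omega> = 1"
        by (auto simp: visited_def)
      note pos = this(1,2)
      show ?thesis
        unfolding elim(1,2) integral_level0_kernel[OF X1_Omega[OF elim(4)] X0_Omega[OF elim(4)] \<phi>]
          integral_ee_jump[OF X1_Omega[OF elim(4)] elim(3) X0_Omega[OF elim(4)] \<phi> pos]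
        by (simp add: V'_def U_def V1 jump_mean_def algebra_simps)
    qed (use elim in \<open>simp add: V'_def U_def\<close>)
  qed
  have [measurable]: "?Y \<in> borel_measurable \<Omega>"
    by (intro borel_measurable_add borel_measurable_integrable[OF int1] borel_measurable_integrable[OF int2] borel_measurable_integrable[OF int3])
  have "AE \<omega> in \<Omega>. real_cond_exp \<Omega> Tr (\<lambda>\<omega>. ?V \<omega> * \<phi> (X0 (T + Suc S) \<omega>)) \<omega> = ?V \<omega> * m \<omega> (Suc S) \<phi>"
    by (rule m_pull_out(2)[OF V _ \<phi>, where B=1]) (simp add: V01)
  moreover have "AE \<omega> in \<Omega>. real_cond_exp \<Omega> Tr (real_cond_exp \<Omega> ?F (\<lambda>\<omega>. ?V \<omega> * \<phi> (X0 (T + Suc S) \<omega>))) \<omega> = real_cond_exp \<Omega> Tr (\<lambda>\<omega>. ?V \<omega> * \<phi> (X0 (T + Suc S) \<omega>)) \<omega>"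
    by (rule tr.real_cond_exp_nested_subalg[OF subalgebra_history0 subalgebra_history0_trajectory intV])
  moreover have "AE \<omega> in \<Omega>. real_cond_exp \<Omega> Tr (real_cond_exp \<Omega> ?F (\<lambda>\<omega>. ?V \<omega> * \<phi> (X0 (T + Suc S) \<omega>))) \<omega> = real_cond_exp \<Omega> Tr ?Y \<omega>"
    by (rule tr.real_cond_exp_cong[OF E1]) measurable
  moreover have "AE \<omega> in \<Omega>. real_cond_exp \<Omega> Tr ?Y \<omega> = real_cond_exp \<Omega> Tr (\<lambda>\<omega>. V' \<omega> * P \<phi> (X0 (T + S) \<omega>)) \<omega> +
      real_cond_exp \<Omega> Tr (\<lambda>\<omega>. U (lowI M) \<omega> * lowI M (X0 (T + S) \<omega>) + U (upI M) \<omega> * upI M (X0 (T + S) \<omega>)) \<omega>"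
    by (rule tr.real_cond_exp_add[OF int1 Bochner_Integration.integrable_add[OF int2 int3]])
  moreover have "AE \<omega> in \<Omega>. real_cond_exp \<Omega> Tr (\<lambda>\<omega>. U (lowI M) \<omega> * lowI M (X0 (T + S) \<omega>) + U (upI M) \<omega> * upI M (X0 (T + S) \<omega>)) \<omega> =
      real_cond_exp \<Omega> Tr (\<lambda>\<omega>. U (lowI M) \<omega> * lowI M (X0 (T + S) \<omega>)) \<omega> + real_cond_exp \<Omega> Tr (\<lambda>\<omega>. U (upI M) \<omega> * upI M (X0 (T + S) \<omega>)) \<omega>"
    by (rule tr.real_cond_exp_add[OF int2 int3])
  moreover note m_pull_out(2)[OF V' bmeas_P[OF \<phi>], of S] m_pull_out(2)[OF U(1) UB[OF disjI1[OF refl]] bmeas_lowI[of M], of S]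
    m_pull_out(2)[OF U(2) UB[OF disjI2[OF refl]] bmeas_upI[of M], of S]
  ultimately show ?thesis
  proof eventually_elim
    case (elim \<omega>)
    show ?case
    proof (intro impI)
      assume "0 < emp (\<lambda>s. X1 s \<omega>) (T + S) (lowI M)" "0 < emp (\<lambda>s. X1 s \<omega>) (T + S) (upI M)"
      then have "?V \<omega> = 1" by (simp add: visited_def)
      then show "m \<omega> (Suc S) \<phi> = (1 - p) * m \<omega> S (P \<phi>) +
        p * (jump_mean (T + S) (lowI M) \<phi> \<omega> * m \<omega> S (lowI M) + jump_mean (T + S) (upI M) \<phi> \<omega> * m \<omega> S (upI M))"
        using elim by (simp add: V'_def U_def algebra_simps)
    qed
  qed
qed

lemma m_AE_mono:
  assumes "bmeas \<phi>" "bmeas \<psi>" "\<And>x. x \<in> Omega \<Longrightarrow> \<phi> x \<le> \<psi> x + e"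
  shows "AE \<omega> in \<Omega>. m \<omega> S \<phi> \<le> m \<omega> S \<psi> + e"
proof -
  have "AE \<omega> in \<Omega>. real_cond_exp \<Omega> Tr (\<lambda>\<omega>. \<phi> (X0 (T + S) \<omega>)) \<omega> \<le> real_cond_exp \<Omega> Tr (\<lambda>\<omega>. \<psi> (X0 (T + S) \<omega>) + e) \<omega>"
    by (rule tr.real_cond_exp_mono) (use assms X0_Omega in \<open>auto intro: X0_integrable\<close>)
  moreover have "AE \<omega> in \<Omega>. real_cond_exp \<Omega> Tr (\<lambda>\<omega>. \<psi> (X0 (T + S) \<omega>) + e) \<omega> =
      real_cond_exp \<Omega> Tr (\<lambda>\<omega>. \<psi> (X0 (T + S) \<omega>)) \<omega> + real_cond_exp \<Omega> Tr (\<lambda>\<omega>. e) \<omega>"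
    by (rule tr.real_cond_exp_add) (use assms in \<open>auto intro: X0_integrable\<close>)
  moreover have "AE \<omega> in \<Omega>. real_cond_exp \<Omega> Tr (\<lambda>\<omega>. e) \<omega> = e" by (rule tr.real_cond_exp_F_meas) auto
  ultimately show ?thesis by eventually_elim (simp add: m_def)
qed

lemma m_AE_diff:
  assumes "bmeas \<phi>" "bmeas \<psi>"
  shows "AE \<omega> in \<Omega>. m \<omega> S (\<lambda>x. \<phi> x - \<psi> x) = m \<omega> S \<phi> - m \<omega> S \<psi>"
  unfolding m_def by (rule tr.real_cond_exp_diff) (use assms in \<open>auto intro: X0_integrable\<close>)

lemma m_AE_const: "AE \<omega> in \<Omega>. m \<omega> S (\<lambda>_. a) = a"
  unfolding m_def by (rule tr.real_cond_exp_F_meas) auto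

lemma countable_fam: "countable fam" by (simp add: fam_def)

lemma m_AE_run: "AE \<omega> in \<Omega>. good T (\<lambda>s. X1 s \<omega>) \<longrightarrow> ee_run M c p H \<epsilon> f T (\<lambda>s. X1 s \<omega>) (m \<omega>)"
proof -
  have bm: "bmeas \<phi>" if "\<phi> \<in> fam \<union> P ` fam" for \<phi> using that bmeas_fam by auto
  have cf: "countable (fam \<union> P ` fam)" using countable_fam by simp
  have 1: "AE \<omega> in \<Omega>. \<forall>S. \<forall>\<phi>\<in>fam. 0 < emp (\<lambda>s. X1 s \<omega>) (T + S) (lowI M) \<longrightarrow> 0 < emp (\<lambda>s. X1 s \<omega>) (T + S) (upI M) \<longrightarrow>
    m \<omega> (Suc S) \<phi> = (1 - p) * m \<omega> S (P \<phi>) +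
      p * (jump_mean (T + S) (lowI M) \<phi> \<omega> * m \<omega> S (lowI M) + jump_mean (T + S) (upI M) \<phi> \<omega> * m \<omega> S (upI M))"
    unfolding AE_all_countable AE_ball_countable[OF countable_fam] using m_step bmeas_fam by blast
  \<comment> \<open>The premise does not involve \<omega>, so a case distinction on it moves it
    inside the almost sure statement, where it can be quantified together with the rest.\<close>
  have "AE \<omega> in \<Omega>. (\<forall>x\<in>Omega. \<phi> x \<le> \<psi> x + e) \<longrightarrow> m \<omega> S \<phi> \<le> m \<omega> S \<psi> + e"
    if "\<phi> \<in> fam \<union> P ` fam" "\<psi> \<in> fam \<union> P ` fam" for \<phi> \<psi> e S
    using m_AE_mono[OF bm[OF that(1)] bm[OF that(2)], of e S] by (cases "\<forall>x\<in>Omega. \<phi> x \<le> \<psi> x + e") auto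
  then have 2: "AE \<omega> in \<Omega>. \<forall>S. \<forall>\<phi>\<in>fam \<union> P ` fam. \<forall>\<psi>\<in>fam \<union> P ` fam. \<forall>e\<in>{0, H, exp (- H)}.
      (\<forall>x\<in>Omega. \<phi> x \<le> \<psi> x + e) \<longrightarrow> m \<omega> S \<phi> \<le> m \<omega> S \<psi> + e"
    unfolding AE_all_countable AE_ball_countable[OF cf] by (subst AE_ball_countable) auto
  have 3: "AE \<omega> in \<Omega>. \<forall>S. \<forall>\<phi>\<in>fam. \<forall>\<psi>\<in>fam. m \<omega> S (\<lambda>x. \<phi> x - \<psi> x) = m \<omega> S \<phi> - m \<omega> S \<psi>"
    unfolding AE_all_countable AE_ball_countable[OF countable_fam] using m_AE_diff bmeas_fam by blast
  have 4: "AE \<omega> in \<Omega>. \<forall>S. \<forall>a\<in>{0, 1, 1/2, -1/2}. m \<omega> S (\<lambda>_. a) = a"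
    unfolding AE_all_countable by (subst AE_ball_countable, simp) (intro allI ballI m_AE_const)
  have upd: "upI M = (\<lambda>x. 1 - lowI M x)" by (simp add: lowI_upI(2) fun_eq_iff)
  have famI: "(\<lambda>_. 1) \<in> fam" "lowI M \<in> fam" by (auto simp: fam_def)
  show ?thesis
    using 1 2 3 4 AE_space
  proof eventually_elim
    case (elim \<omega>)
    let ?x = "\<lambda>s. X1 s \<omega>"
    show ?case
    proof
      assume g: "good T ?x"
      have low: "0.49 < emp ?x (T + S) (lowI M)" "emp ?x (T + S) (lowI M) < 0.51" for S
      proof -
        have "initial_cut (lowI M) G G = lowI M"
          using G_pos frac_lt_1 by (auto simp: initial_cut_def fun_eq_iff)
        moreover have "\<bar>emp ?x (T + S) (initial_cut (lowI M) G G) - lam (initial_cut (lowI M) G G)\<bar> \<le> \<epsilon> / 50"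
          using g unfolding good_def by (meson le_add1 order_refl)
        ultimately have "\<bar>emp ?x (T + S) (lowI M) - 1 / 2\<bar> \<le> \<epsilon> / 50" by (simp add: lam_lowI)
        then show "0.49 < emp ?x (T + S) (lowI M)" "emp ?x (T + S) (lowI M) < 0.51" using eps unfolding abs_le_iff by auto
      qed
      have pos: "0 < emp ?x (T + S) (lowI M)" "0 < emp ?x (T + S) (upI M)" for S
        using low[of S] emp_diff[of ?x "T + S" "\<lambda>_. 1" "lowI M"] by (simp_all add: upd)
      have one: "m \<omega> S (upI M) = 1 - m \<omega> S (lowI M)" for S
        using elim(3,4) famI unfolding upd by auto
      show "ee_run M c p H \<epsilon> f T ?x (m \<omega>)"
      proof unfold_locales
        show "?x s \<in> Omega" for s using elim(5) by (rule X1_Omega)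
        show "good T ?x" by (rule g)
        show "m \<omega> (Suc S) \<phi> = (1 - p) * m \<omega> S (P \<phi>) + p *
          (if H = 0 then emp ?x (T + S) \<phi>
           else m \<omega> S (lowI M) * ring_mean ?x (T + S) (lowI M) \<phi> + m \<omega> S (upI M) * ring_mean ?x (T + S) (upI M) \<phi>)"
          if "\<phi> \<in> fam" for S \<phi>
        proof -
          have "m \<omega> (Suc S) \<phi> = (1 - p) * m \<omega> S (P \<phi>) +
            p * (jump_mean (T + S) (lowI M) \<phi> \<omega> * m \<omega> S (lowI M) + jump_mean (T + S) (upI M) \<phi> \<omega> * m \<omega> S (upI M))"
            using elim(1) that pos by blast
          note step = this[unfolded one jump_mean_def]
          show ?thesis
          proof (cases "H = 0")
            case True
            show ?thesis using step unfolding if_P[OF True] by (simp add: algebra_simps)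
          next
            case False
            show ?thesis using step unfolding one if_not_P[OF False] by (simp add: algebra_simps)
          qed
        qed
        show "m \<omega> S \<phi> \<le> m \<omega> S \<psi> + e"
          if "\<phi> \<in> fam \<union> P ` fam" "\<psi> \<in> fam \<union> P ` fam" "e \<in> {0, H, exp (- H)}" "\<And>x. x \<in> Omega \<Longrightarrow> \<phi> x \<le> \<psi> x + e" for S \<phi> \<psi> e
          using elim(2) that by blast
        show "m \<omega> S (\<lambda>x. \<phi> x - \<psi> x) = m \<omega> S \<phi> - m \<omega> S \<psi>" if "\<phi> \<in> fam" "\<psi> \<in> fam" for S \<phi> \<psi>
          using elim(3) that by blast
        show "m \<omega> S (\<lambda>_. a) = a" if "a \<in> {0, 1, 1 / 2, - 1 / 2}" for S a
          using elim(4) that by blast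
      qed
    qed
  qed
qed

end

section \<open>The equi-energy sampler\<close>

text \<open>A circle of length 1 has diameter 1 / 2.\<close>

lemma circle_lipschitz_bound:
  assumes lip: "\<And>x y. \<bar>f x - f y\<bar> \<le> \<bar>x - y\<bar>" and per: "\<And>x. f (x + 1) = f (x :: real)"
  shows "\<bar>f x - f y\<bar> \<le> 1 / 2"
proof -
  have fr: "f (frac z) = f z" for z by (rule periodic_frac) (rule per)
  have *: "\<bar>f a - f b\<bar> \<le> 1 / 2" if "a \<le> b" "b \<le> a + 1" for a b
  proof (cases "b - a \<le> 1 / 2")
    case True
    then show ?thesis using lip[of a b] that by linarith
  next
    case False
    then show ?thesis using lip[of "a + 1" b] per[of a] that by linarith
  qed
  have "\<bar>f (frac x) - f (frac y)\<bar> \<le> 1 / 2"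
    using *[of "frac x" "frac y"] *[of "frac y" "frac x"] frac_lt_1[of x] frac_lt_1[of y] frac_ge_0[of x] frac_ge_0[of y]
    by (cases "frac x \<le> frac y") linarith+
  then show ?thesis by (simp add: fr)
qed

lemma target_dens_eq: "target_dens M H y = 2 / (1 + exp H) * (lowI M y + exp H * upI M y)"
  by (simp add: target_dens_def lowI_def upI_def upper_def)

lemma integral_target:
  assumes "bmeas g"
  shows "(LINT y|target M H. g y) = 2 / (1 + exp H) * (lam (\<lambda>y. lowI M y * g y) + exp H * lam (\<lambda>y. upI M y * g y))"
proof -
  have [measurable]: "g \<in> borel_measurable circ_leb" using assms by (auto intro: circ_leb_measurable)
  have i: "integrable circ_leb (\<lambda>y. lowI M y * g y)" "integrable circ_leb (\<lambda>y. exp H * (upI M y * g y))"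
    using assms by (auto intro!: bmeas_integrable_circ bmeas_mult)
  have "(LINT y|target M H. g y) = lam (\<lambda>y. target_dens M H y *\<^sub>R g y)"
    unfolding target_def
  proof (rule integral_density)
    show "AE y in circ_leb. 0 \<le> target_dens M H y" by (simp add: target_dens_def add_nonneg_nonneg)
  qed measurable
  also have "\<dots> = lam (\<lambda>y. 2 / (1 + exp H) * (lowI M y * g y + exp H * (upI M y * g y)))"
    by (rule Bochner_Integration.integral_cong[OF refl])
       (simp only: target_dens_eq real_scaleR_def distrib_right distrib_left mult.assoc)
  also have "\<dots> = 2 / (1 + exp H) * (lam (\<lambda>y. lowI M y * g y) + lam (\<lambda>y. exp H * (upI M y * g y)))"
    using i by simp
  finally show ?thesis by simp
qed

theorem theorem3:
  fixes P :: "'a measure"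
    and M T :: nat
    and H c p_ee \<epsilon> A1 A2 x :: real
    and Q :: "real measure"
    and q f :: "real \<Rightarrow> real"
    and k :: enat
    and X1 X0 :: "nat \<Rightarrow> 'a \<Rightarrow> real"
  assumes M: "M > 1"
    and H: "H \<ge> 0"
    and c: "0 < c" "c < 1 / (4 * real M)"
    and p_ee: "0 < p_ee" "p_ee < 1"
    and q_cont: "continuous_map (Metric_space.mtopology Omega circ_dist) euclideanreal q"
    and q_nonneg: "\<And>y. y \<in> Omega \<Longrightarrow> 0 \<le> q y"
    and Q_prob: "prob_space Q"
    and Q_dens: "Q = density circ_leb (\<lambda>y. ennreal (q y))"
    and q_L2: "sqrt (LINT y|circ_leb. (q y)\<^sup>2) \<le> 2"
    and f_Lipschitz: "\<And>y z. y \<in> Omega \<Longrightarrow> z \<in> Omega \<Longrightarrow> \<bar>f y - f z\<bar> \<le> circ_dist y z"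
    and f_mean: "(LINT y|target M H. f y) = 0"
    and k: "k \<ge> 1"
    and eps: "0 < \<epsilon>" "\<epsilon> < min (1 / 512) (c * real M / 384)"
    and T: "real T > 110592 * (1 / c\<^sup>2) * (1 / \<epsilon> + 1)\<^sup>2 * ln (4608 * (1 / \<epsilon> + 1)\<^sup>2)"
    and x: "x \<in> Omega"
    and sampler: "equi_energy_sampler P M H c p_ee Q T x X1 X0"
    and A1: "A1 = min (p_ee * (1 - p_ee) * real M / 32) (p_ee / (2 * c))"
    and A2: "A2 = 16 * exp 1 * H / (A1 * c) * exp (- H)"
  shows "ereal (\<P>(\<omega> in P. \<forall>S::nat.
             ereal (real S) \<le> ereal (real T) * (1 + ereal_of_enat k * ereal (\<epsilon> / 2)) \<longrightarrow>
             real_cond_exp P (trajectory1 P X1) (\<lambda>\<omega>. f (X0 T \<omega>) * f (X0 (T + S) \<omega>)) \<omega>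
               \<le> 2 * exp (- A1 * c * real_of_int \<lfloor>real S / 4\<rfloor>) + 2 * \<epsilon> + A2))
         \<ge> 1 - ereal (\<epsilon> / 12) * min (ereal_of_enat k) (ereal (1 / (1 - \<epsilon> powr (\<epsilon> / 2))))"
proof -
  interpret st: stripes M c by unfold_locales (use M c in auto)
  interpret s: equi_energy_sampler P M H c p_ee Q T x X1 X0 by fact
  \<comment> \<open>The hypotheses constrain f on \<open>Omega\<close> only; g is its periodic
    extension to the line.\<close>
  define g where "g = (\<lambda>y. f (frac y))"
  have gf: "g y = f y" if "y \<in> Omega" for y using that by (simp add: g_def frac_id_Omega)
  have g_lip: "\<bar>g y - g z\<bar> \<le> \<bar>y - z\<bar>" for y z
    unfolding g_def by (rule order_trans[OF f_Lipschitz circ_dist_frac_le]) (rule frac_Omega)+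
  have g_per: "g (y + 1) = g y" for y by (simp add: g_def frac_1_eq)
  note g_osc = circle_lipschitz_bound[OF g_lip g_per]
  have g_bm: "bmeas g"
  proof (rule lipschitz_bmeas[where C=1 and B="\<bar>g 0\<bar> + 1 / 2"])
    show "\<bar>g y\<bar> \<le> \<bar>g 0\<bar> + 1 / 2" for y using g_osc[of y 0] by linarith
  qed (simp add: g_lip)
  have "(LINT y|target M H. f y) = (LINT y|target M H. g y)"
    by (rule Bochner_Integration.integral_cong) (simp_all add: target_def gf)
  then have I0: "2 / (1 + exp H) * (lam (\<lambda>y. lowI M y * g y) + exp H * lam (\<lambda>y. upI M y * g y)) = 0"
    using f_mean integral_target[OF g_bm] by simp
  have "1 + exp H > 0" by (simp add: add_pos_pos)
  then have g_mean: "lam (\<lambda>y. lowI M y * g y) + exp H * lam (\<lambda>y. upI M y * g y) = 0" using I0 by simp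
  \<comment> \<open>The functional \<open>?m\<close> below is (1 + exp H) / 2 times the mean under
    the target. A function of mean 0 and oscillation at most 1 / 2 is bounded by 1 / 2.\<close>
  have g_bound: "\<bar>g y\<bar> \<le> 1 / 2" for y
  proof -
    let ?m = "\<lambda>h. lam (\<lambda>y. lowI M y * h y) + exp H * lam (\<lambda>y. upI M y * h y)"
    have mono: "?m h \<le> ?m h'" if "bmeas h" "bmeas h'" "\<And>z. h z \<le> h' z" for h h'
      using that by (intro add_mono mult_left_mono integral_mono) (auto intro!: bmeas_integrable_circ bmeas_mult)
    have const: "?m (\<lambda>_. a) = (1 + exp H) / 2 * a" for a
      using st.lam_lowI st.lam_upI by (simp add: field_simps)
    have "g z \<le> g y + 1 / 2" "g y - 1 / 2 \<le> g z" for z using g_osc[of y z] by linarith+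
    then have "?m g \<le> ?m (\<lambda>_. g y + 1 / 2)" "?m (\<lambda>_. g y - 1 / 2) \<le> ?m g"
      by (intro mono g_bm bmeas_const; simp)+
    then have "0 \<le> (1 + exp H) / 2 * (g y + 1 / 2)" "(1 + exp H) / 2 * (g y - 1 / 2) \<le> 0"
      unfolding const g_mean by auto
    then show ?thesis using \<open>1 + exp H > 0\<close> by (simp add: zero_le_mult_iff mult_le_0_iff abs_le_iff)
  qed
  interpret e: ee_chain P M H c p_ee Q T x X1 X0 \<epsilon> g
    by unfold_locales (use M H c p_ee eps g_lip g_per g_bound g_mean T in auto)
  obtain E where E: "E \<in> s.events" "s.prob E \<ge> 1 - \<epsilon> / 12" "\<And>\<omega>. \<omega> \<in> E \<Longrightarrow> e.good T (\<lambda>s. X1 s \<omega>)"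
    using e.good_event by blast
  let ?c = "\<lambda>S \<omega>. real_cond_exp P (trajectory1 P X1) (\<lambda>\<omega>. f (X0 T \<omega>) * f (X0 (T + S) \<omega>)) \<omega>"
  let ?bd = "\<lambda>S. 2 * exp (- A1 * c * real_of_int \<lfloor>real S / 4\<rfloor>) + 2 * \<epsilon> + A2"
  \<comment> \<open>Level 0 starts at x almost surely, so the first factor of the correlation is the
    constant g x.\<close>
  have "AE \<omega> in P. ?c S \<omega> = g x * e.m \<omega> S g" for S
  proof -
    have [measurable]: "(\<lambda>\<omega>. g (X0 (T + S) \<omega>)) \<in> borel_measurable P" for S by (rule e.X0_bmeas_measurable[OF g_bm])
    have fg: "\<omega> \<in> space P \<Longrightarrow> f (X0 (T + S) \<omega>) = g (X0 (T + S) \<omega>)" for \<omega> S using e.X0_Omega by (simp add: gf)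
    have fm: "(\<lambda>\<omega>. f (X0 (T + S) \<omega>)) \<in> borel_measurable P" for S
      using fg by (subst measurable_cong[where g="\<lambda>\<omega>. g (X0 (T + S) \<omega>)"]) auto
    from fm[of 0] fm[of S] have [measurable]: "(\<lambda>\<omega>. f (X0 T \<omega>)) \<in> borel_measurable P" "(\<lambda>\<omega>. f (X0 (T + S) \<omega>)) \<in> borel_measurable P" by auto
    have "AE \<omega> in P. f (X0 T \<omega>) * f (X0 (T + S) \<omega>) = g x * g (X0 (T + S) \<omega>)"
      using s.X0_init AE_space by eventually_elim (use fg gf x in auto)
    then have "AE \<omega> in P. ?c S \<omega> = real_cond_exp P (trajectory1 P X1) (\<lambda>\<omega>. g x * g (X0 (T + S) \<omega>)) \<omega>"
      by (rule e.tr.real_cond_exp_cong) measurable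
    moreover have "AE \<omega> in P. real_cond_exp P (trajectory1 P X1) (\<lambda>\<omega>. g x * g (X0 (T + S) \<omega>)) \<omega> = g x * e.m \<omega> S g"
      unfolding e.m_def by (rule e.tr.real_cond_exp_cmult[OF e.X0_integrable[OF g_bm]])
    ultimately show ?thesis by eventually_elim simp
  qed
  then have "AE \<omega> in P. \<forall>S. ?c S \<omega> = g x * e.m \<omega> S g" unfolding AE_all_countable by blast
  with e.m_AE_run have "AE \<omega> in P. \<omega> \<in> E \<longrightarrow> (\<forall>S. ?c S \<omega> \<le> ?bd S)"
  proof eventually_elim
    case (elim \<omega>)
    show ?case
    proof (intro impI allI)
      fix S assume "\<omega> \<in> E"
      then interpret r: ee_run M c p_ee H \<epsilon> g T "\<lambda>s. X1 s \<omega>" "e.m \<omega>" using elim(1) E(3) by blast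
      show "?c S \<omega> \<le> ?bd S" using r.run_bound[OF A1 A2 g_bound, of x S] elim(2) by simp
    qed
  qed
  then have "s.prob E \<le> \<P>(\<omega> in P. \<forall>S::nat. ereal (real S) \<le> ereal (real T) * (1 + ereal_of_enat k * ereal (\<epsilon> / 2)) \<longrightarrow> ?c S \<omega> \<le> ?bd S)"
    using sets.sets_into_space[OF E(1)]
    by (intro s.finite_measure_mono_AE) (auto elim!: eventually_mono)
  \<comment> \<open>The good event fails with probability at most \<epsilon> / 12, and both entries
    of the minimum are at least 1: k by assumption, and the quotient because
    \<open>\<epsilon> powr (\<epsilon> / 2)\<close> lies strictly between 0 and 1.\<close>
  moreover have "1 - ereal (\<epsilon> / 12) * min (ereal_of_enat k) (ereal (1 / (1 - \<epsilon> powr (\<epsilon> / 2)))) \<le> ereal (1 - \<epsilon> / 12)"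
  proof -
    have "\<epsilon> powr (\<epsilon> / 2) < 1 powr (\<epsilon> / 2)" using eps by (intro powr_less_mono2) auto
    moreover have "0 < \<epsilon> powr (\<epsilon> / 2)" using eps by simp
    ultimately have "1 \<le> ereal (1 / (1 - \<epsilon> powr (\<epsilon> / 2)))" by (simp add: one_ereal_def)
    moreover have "1 \<le> ereal_of_enat k"
      using k by (metis ereal_of_enat_le_iff of_nat_1 ereal_of_enat_simps(1) one_enat_def one_ereal_def)
    ultimately have "1 \<le> min (ereal_of_enat k) (ereal (1 / (1 - \<epsilon> powr (\<epsilon> / 2))))" by simp
    then have "ereal (\<epsilon> / 12) * 1 \<le> ereal (\<epsilon> / 12) * min (ereal_of_enat k) (ereal (1 / (1 - \<epsilon> powr (\<epsilon> / 2))))"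
      using eps by (intro ereal_mult_left_mono) auto
    then have "1 - ereal (\<epsilon> / 12) * min (ereal_of_enat k) (ereal (1 / (1 - \<epsilon> powr (\<epsilon> / 2)))) \<le> 1 - ereal (\<epsilon> / 12)"
      by (intro ereal_minus_mono) auto
    then show ?thesis by (simp add: one_ereal_def)
  qed
  ultimately show ?thesis using E(2) by (meson ereal_less_eq(3) order_trans)
qed

end
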